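(* Consider the underdamped Langevin equation $$d\mathbf q=\mathbf p\,dt,\qquad d\mathbf p=-\tfrac12\boldsymbol\sigma\boldsymbol\sigma^T\mathbf p\,dt+\mathbf b(\mathbf q)\,dt+\tfrac{1}{\sqrt\beta}\boldsymbol\sigma\,d\mathbf B,\qquad \mathbf q,\mathbf p\in\mathbb R^d,$$ with $\beta>0$ and initial probability density function $\rho_0(\mathbf q,\mathbf p)>0$. Suppose that $\boldsymbol\sigma\in\mathbb R^{d\times d}$ is a constant nonsingular matrix, and that $\mathbf b:\mathbb R^d\to\mathbb R^d$ satisfies: (a) for any $n\in\mathbb Z^+$ there exists $K_n>0$ such that $|\mathbf b(\mathbf x)-\mathbf b(\mathbf y)|\le K_n|\mathbf x-\mathbf y|$ whenever $|\mathbf x|,|\mathbf y|\le n$; (b) there exists $C>0$ such that $\mathbf x^T\mathbf b(\mathbf x)\le C(1+|\mathbf x|^2)$ for all $\mathbf x\in\mathbb R^d$. Then the following are equivalent: (i) (Reversibility) the stochastic process $(\mathbf q_t,\mathbf p_t)_{t\ge0}$ is reversible. (ii) (Symmetry) $\rho_0(\mathbf q,\mathbf p)=\rho_0(\mathbf q,-\mathbf p)$ and, for arbitrary $\varphi_1(\mathbf q),\varphi_2(\mathbf p),\psi_1(\mathbf q),\psi_2(\mathbf p)\in C_0^\infty(\mathbb R^d)$, $$\iint\varphi_1(\mathbf q)\varphi_2(\mathbf p)\,\mathcal L\big(\psi_1(\mathbf q)\psi_2(\mathbf p)\big)\rho_0(\mathbf q,\mathbf p)\,d\mathbf q\,d\mathbf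 p=\iint\mathcal L\big(\varphi_1(\mathbf q)\widetilde\varphi_2(\mathbf p)\big)\psi_1(\mathbf q)\widetilde\psi_2(\mathbf p)\rho_0(\mathbf q,\mathbf p)\,d\mathbf q\,d\mathbf p,$$ where $\widetilde\varphi_2(\mathbf p)=\varphi_2(-\mathbf p)$ and $\widetilde\psi_2(\mathbf p)=\psi_2(-\mathbf p)$. (iii) (Potential condition) there exists $U:\mathbb R^d\to\mathbb R$ such that $-\nabla_{\mathbf q}U(\mathbf q)=\mathbf b(\mathbf q)$ and $\rho_0(\mathbf q,\mathbf p)=\frac1Ze^{-\beta H(\mathbf q,\mathbf p)}$, $Z=\iint e^{-\beta H(\mathbf q,\mathbf p)}\,d\mathbf q\,d\mathbf p<\infty$, where $H(\mathbf q,\mathbf p):=\frac{|\mathbf p|^2}{2}+U(\mathbf q)$. (iv) (Evenness in the $\mathbf p$ variable) $\rho_0(\mathbf q,\mathbf p)=\rho_0(\mathbf q,-\mathbf p)$ and $\rho_0$ is stationary, i.e. it solves $\mathcal L^*\rho_0=0$. (v) (Separation of variables) $\rho_0(\mathbf q,\mathbf p)=U_1(\mathbf q)U_2(\mathbf p)$ with $U_1>0$ and $U_2>0$, and $\rho_0$ is stationary, i.e. it solves $\mathcal L^*\rho_0=0$.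
   Context: $\mathbf B$ is a $d$-dimensional standard Brownian motion. The generator is $$\mathcal Lf:=\mathbf p\cdot\nabla_{\mathbf q}f+\mathbf b\cdot\nabla_{\mathbf p}f-\tfrac12(\boldsymbol\sigma\boldsymbol\sigma^T\mathbf p)\cdot\nabla_{\mathbf p}f+\tfrac1{2\beta}(\boldsymbol\sigma\boldsymbol\sigma^T):\nabla^2_{\mathbf p}f,$$ and the Fokker–Planck operator is $$\mathcal L^*\rho:=-\mathbf p\cdot\nabla_{\mathbf q}\rho-\mathbf b\cdot\nabla_{\mathbf p}\rho+\tfrac12\nabla_{\mathbf p}\cdot\big(\rho\boldsymbol\sigma\boldsymbol\sigma^T\mathbf p+\tfrac1\beta\boldsymbol\sigma\boldsymbol\sigma^T\nabla_{\mathbf p}\rho\big).$$ A process $\{X_t,t\ge0\}$ is stationary if its finite-dimensional distributions are invariant under time shifts. Position $\mathbf q$ is an even variable and momentum $\mathbf p$ an odd variable: for $T>0$, the time-reversed process is $(\mathbf q^*_t,\mathbf p^*_t):=(\mathbf q_{T-t},-\mathbf p_{T-t})$, $0\le t\le T$. The process is reversible if it is stationary and for every $T>0$ the time-reversed process has the same finite-dimensional distributions as $(\mathbf q_t,\mathbf p_t)_{0\le t\le T}$. *)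

theory Defs
  imports "HOL-Probability.Probability"
begin

definition dir_deriv :: "'a::real_normed_vector \<Rightarrow> ('a \<Rightarrow> real) \<Rightarrow> 'a \<Rightarrow> real" where
  "dir_deriv v f x = deriv (\<lambda>s. f (x + s *\<^sub>R v)) 0"

primrec cont_diff :: "nat \<Rightarrow> ('a::euclidean_space \<Rightarrow> real) \<Rightarrow> bool" where
  "cont_diff 0 f \<longleftrightarrow> continuous_on UNIV f"
| "cont_diff (Suc k) f \<longleftrightarrow>
     (\<forall>x. f differentiable (at x)) \<and> (\<forall>v. cont_diff k (dir_deriv v f))"

definition test_function :: "('a::euclidean_space \<Rightarrow> real) \<Rightarrow> bool" where
  "test_function f \<longleftrightarrow> (\<forall>k. cont_diff k f) \<and> compact (closure {x. f x \<noteq> 0})"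

text \<open>The phase space consists of pairs (position, momentum).\<close>

type_synonym 'n phase = "(real ^ 'n) \<times> (real ^ 'n)"

definition pd_q :: "'n \<Rightarrow> ('n::finite phase \<Rightarrow> real) \<Rightarrow> 'n phase \<Rightarrow> real" where
  "pd_q i f = dir_deriv (axis i 1, 0) f"

definition pd_p :: "'n \<Rightarrow> ('n::finite phase \<Rightarrow> real) \<Rightarrow> 'n phase \<Rightarrow> real" where
  "pd_p i f = dir_deriv (0, axis i 1) f"

definition grad_q :: "('n::finite phase \<Rightarrow> real) \<Rightarrow> 'n phase \<Rightarrow> real ^ 'n" where
  "grad_q f x = (\<chi> i. pd_q i f x)"

definition grad_p :: "('n::finite phase \<Rightarrow> real) \<Rightarrow> 'n phase \<Rightarrow> real ^ 'n" where
  "grad_p f x = (\<chi> i. pd_p i f x)"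

definition hess_p :: "('n::finite phase \<Rightarrow> real) \<Rightarrow> 'n phase \<Rightarrow> real ^ 'n ^ 'n" where
  "hess_p f x = (\<chi> i j. pd_p i (pd_p j f) x)"

text \<open>In the last summand the inner product of two matrices is the Frobenius product.\<close>

definition generator ::
    "real \<Rightarrow> real ^ 'n ^ 'n \<Rightarrow> (real ^ 'n \<Rightarrow> real ^ 'n) \<Rightarrow>
     ('n::finite phase \<Rightarrow> real) \<Rightarrow> 'n phase \<Rightarrow> real" where
  "generator \<beta> \<sigma> b f = (\<lambda>(q, p).
     p \<bullet> grad_q f (q, p) + b q \<bullet> grad_p f (q, p)
     - 1/2 * (((\<sigma> ** transpose \<sigma>) *v p) \<bullet> grad_p f (q, p))
     + 1/(2*\<beta>) * ((\<sigma> ** transpose \<sigma>) \<bullet> hess_p f (q, p)))"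

text \<open>
  An initial density is merely measurable, so the stationary Fokker--Planck equation is
  read in the sense of distributions.  Distributions are represented by their action on test
  functions.  Multiplication by a function and differentiation are defined by duality, on
  arbitrary arguments: the drift is only locally Lipschitz, hence a test function multiplied by a
  component of it need not be smooth, but it does have all derivatives in the momentum
  variable, and those are the only ones taken of it.
\<close>

type_synonym 'n distrib = "('n phase \<Rightarrow> real) \<Rightarrow> real"

definition dist_of :: "('n::finite phase \<Rightarrow> real) \<Rightarrow> 'n distrib" where
  "dist_of \<rho> \<phi> = (LINT x|lborel. \<rho> x * \<phi> x)"

definition dist_mult :: "('n::finite phase \<Rightarrow> real) \<Rightarrow> 'n distrib \<Rightarrow> 'n distrib" where
  "dist_mult a T \<phi> = T (\<lambda>x. a x * \<phi> x)"

definition dist_pd_q :: "'n \<Rightarrow> 'n::finite distrib \<Rightarrow> 'n distrib" where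
  "dist_pd_q i T \<phi> = - T (pd_q i \<phi>)"

definition dist_pd_p :: "'n \<Rightarrow> 'n::finite distrib \<Rightarrow> 'n distrib" where
  "dist_pd_p i T \<phi> = - T (pd_p i \<phi>)"

definition fokker_planck ::
    "real \<Rightarrow> real ^ 'n ^ 'n \<Rightarrow> (real ^ 'n \<Rightarrow> real ^ 'n) \<Rightarrow> 'n::finite distrib \<Rightarrow> 'n distrib" where
  "fokker_planck \<beta> \<sigma> b T = (let A = \<sigma> ** transpose \<sigma> in (\<lambda>\<phi>.
     - (\<Sum>i\<in>UNIV. dist_mult (\<lambda>(q, p). p $ i) (dist_pd_q i T) \<phi>)
     - (\<Sum>i\<in>UNIV. dist_mult (\<lambda>(q, p). b q $ i) (dist_pd_p i T) \<phi>)
     + 1/2 * (\<Sum>i\<in>UNIV. dist_pd_p i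
         (\<lambda>\<eta>. dist_mult (\<lambda>(q, p). (A *v p) $ i) T \<eta>
              + 1/\<beta> * (\<Sum>j\<in>UNIV. A $ i $ j * dist_pd_p j T \<eta>)) \<phi>)))"

definition stationary_density ::
    "real \<Rightarrow> real ^ 'n ^ 'n \<Rightarrow> (real ^ 'n \<Rightarrow> real ^ 'n) \<Rightarrow> ('n::finite phase \<Rightarrow> real) \<Rightarrow> bool" where
  "stationary_density \<beta> \<sigma> b \<rho> \<longleftrightarrow>
     (\<forall>\<phi>. test_function \<phi> \<longrightarrow> fokker_planck \<beta> \<sigma> b (dist_of \<rho>) \<phi> = 0)"

text \<open>Processes and filtrations are indexed by all reals; only nonnegative times matter.\<close>

locale brownian_motion = prob_space M for M :: "'w measure" +
  fixes F :: "real \<Rightarrow> 'w measure" and B :: "real \<Rightarrow> 'w \<Rightarrow> real ^ 'n::finite"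
  assumes subalgebra: "0 \<le> t \<Longrightarrow> subalgebra M (F t)"
    and filtration_mono: "0 \<le> s \<Longrightarrow> s \<le> t \<Longrightarrow> subalgebra (F t) (F s)"
    and B_adapted: "0 \<le> t \<Longrightarrow> B t \<in> borel_measurable (F t)"
    and B_zero: "AE \<omega> in M. B 0 \<omega> = 0"
    and B_continuous: "AE \<omega> in M. continuous_on {0..} (\<lambda>t. B t \<omega>)"
    and B_indep: "0 \<le> s \<Longrightarrow> s \<le> t \<Longrightarrow>
          indep_set (sets (F s)) (sets (vimage_algebra (space M) (\<lambda>\<omega>. B t \<omega> - B s \<omega>) borel))"
    and B_normal: "0 \<le> s \<Longrightarrow> s < t \<Longrightarrow>
          distributed M lborel (\<lambda>\<omega>. B t \<omega> - B s \<omega>)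
            (\<lambda>x. ennreal (\<Prod>i\<in>UNIV. normal_density 0 (sqrt (t - s)) (x $ i)))"

text \<open>
  The noise coefficient is constant, so the stochastic integral of it over [0,t] is
  the matrix applied to the Brownian motion at time t.  No initial law is prescribed here.
\<close>

locale langevin_solution = brownian_motion M F B
  for M :: "'w measure" and F :: "real \<Rightarrow> 'w measure" and B :: "real \<Rightarrow> 'w \<Rightarrow> real ^ 'n::finite" +
  fixes \<beta> :: real and \<sigma> :: "real ^ 'n ^ 'n" and b :: "real ^ 'n \<Rightarrow> real ^ 'n"
    and q p :: "real \<Rightarrow> 'w \<Rightarrow> real ^ 'n"
  assumes q_adapted: "0 \<le> t \<Longrightarrow> q t \<in> borel_measurable (F t)"
    and p_adapted: "0 \<le> t \<Longrightarrow> p t \<in> borel_measurable (F t)"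
    and q_continuous: "AE \<omega> in M. continuous_on {0..} (\<lambda>t. q t \<omega>)"
    and p_continuous: "AE \<omega> in M. continuous_on {0..} (\<lambda>t. p t \<omega>)"
    and q_equation: "AE \<omega> in M. \<forall>t\<ge>0. q t \<omega> = q 0 \<omega> + integral {0..t} (\<lambda>s. p s \<omega>)"
    and p_equation: "AE \<omega> in M. \<forall>t\<ge>0. p t \<omega> = p 0 \<omega>
          + integral {0..t} (\<lambda>s. - (1/2) *\<^sub>R ((\<sigma> ** transpose \<sigma>) *v p s \<omega>) + b (q s \<omega>))
          + (1 / sqrt \<beta>) *\<^sub>R (\<sigma> *v B t \<omega>)"

definition same_fdd ::
    "'w measure \<Rightarrow> real set \<Rightarrow> (real \<Rightarrow> 'w \<Rightarrow> 's::topological_space) \<Rightarrow> (real \<Rightarrow> 'w \<Rightarrow> 's) \<Rightarrow> bool" where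
  "same_fdd M J X Y \<longleftrightarrow> (\<forall>I. finite I \<longrightarrow> I \<subseteq> J \<longrightarrow>
     distr M (Pi\<^sub>M I (\<lambda>_. borel)) (\<lambda>\<omega>. \<lambda>t\<in>I. X t \<omega>) =
     distr M (Pi\<^sub>M I (\<lambda>_. borel)) (\<lambda>\<omega>. \<lambda>t\<in>I. Y t \<omega>))"

definition stationary_process ::
    "'w measure \<Rightarrow> (real \<Rightarrow> 'w \<Rightarrow> 's::topological_space) \<Rightarrow> bool" where
  "stationary_process M X \<longleftrightarrow> (\<forall>h\<ge>0. same_fdd M {0..} (\<lambda>t. X (t + h)) X)"

definition time_reversal ::
    "real \<Rightarrow> (real \<Rightarrow> 'w \<Rightarrow> 'n::finite phase) \<Rightarrow> real \<Rightarrow> 'w \<Rightarrow> 'n phase" where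
  "time_reversal T X t \<omega> = (fst (X (T - t) \<omega>), - snd (X (T - t) \<omega>))"

definition reversible_process ::
    "'w measure \<Rightarrow> (real \<Rightarrow> 'w \<Rightarrow> 'n::finite phase) \<Rightarrow> bool" where
  "reversible_process M X \<longleftrightarrow>
     stationary_process M X \<and> (\<forall>T>0. same_fdd M {0..T} (time_reversal T X) X)"

text \<open>
  A probability density is determined only up to null sets, so identities between densities
  are required almost everywhere with respect to Lebesgue measure.
\<close>

definition even_in_p :: "('n::finite phase \<Rightarrow> real) \<Rightarrow> bool" where
  "even_in_p \<rho> \<longleftrightarrow> (AE (q, p) in lborel. \<rho> (q, p) = \<rho> (q, - p))"

definition symmetry_condition ::
    "real \<Rightarrow> real ^ 'n ^ 'n \<Rightarrow> (real ^ 'n \<Rightarrow> real ^ 'n) \<Rightarrow> ('n::finite phase \<Rightarrow> real) \<Rightarrow> bool" where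
  "symmetry_condition \<beta> \<sigma> b \<rho> \<longleftrightarrow> even_in_p \<rho> \<and>
     (\<forall>\<phi>1 \<phi>2 \<psi>1 \<psi>2. test_function \<phi>1 \<longrightarrow> test_function \<phi>2 \<longrightarrow>
        test_function \<psi>1 \<longrightarrow> test_function \<psi>2 \<longrightarrow>
        (LINT (q, p)|lborel. \<phi>1 q * \<phi>2 p
           * generator \<beta> \<sigma> b (\<lambda>(q', p'). \<psi>1 q' * \<psi>2 p') (q, p) * \<rho> (q, p)) =
        (LINT (q, p)|lborel. generator \<beta> \<sigma> b (\<lambda>(q', p'). \<phi>1 q' * \<phi>2 (- p')) (q, p)
           * \<psi>1 q * \<psi>2 (- p) * \<rho> (q, p)))"

definition hamiltonian :: "(real ^ 'n \<Rightarrow> real) \<Rightarrow> 'n::finite phase \<Rightarrow> real" where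
  "hamiltonian U = (\<lambda>(q, p). (norm p)\<^sup>2 / 2 + U q)"

definition potential_condition ::
    "real \<Rightarrow> (real ^ 'n \<Rightarrow> real ^ 'n) \<Rightarrow> ('n::finite phase \<Rightarrow> real) \<Rightarrow> bool" where
  "potential_condition \<beta> b \<rho> \<longleftrightarrow> (\<exists>U.
     (\<forall>q. GDERIV U q :> - b q) \<and>
     integrable lborel (\<lambda>x. exp (- \<beta> * hamiltonian U x)) \<and>
     (AE x in lborel. \<rho> x =
        1 / (LINT y|lborel. exp (- \<beta> * hamiltonian U y)) * exp (- \<beta> * hamiltonian U x)))"

definition separable_density :: "('n::finite phase \<Rightarrow> real) \<Rightarrow> bool" where
  "separable_density \<rho> \<longleftrightarrow> (\<exists>U1 U2. (\<forall>q. U1 q > 0) \<and> (\<forall>p. U2 p > 0) \<and>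
     (AE (q, p) in lborel. \<rho> (q, p) = U1 q * U2 p))"

end

theory Submission imports Defs begin

text \<open>For an even stationary density the parts of the generator that are even and odd under reversal of
the momentum annihilate it separately. The Ornstein--Uhlenbeck part forces a Gaussian in the momentum: the
cosine transform, divided by its Gaussian value, is constant along a contracting linear flow and hence
constant. The transport part then says weakly that the position density \<open>c\<close> satisfies
\<open>\<nabla>c = \<beta> c b\<close>, which makes \<open>ln c / \<beta>\<close> a potential. Testing the symmetry condition against a
function that is one on the support of the other one gives stationarity.

No stochastic calculus is used, since the noise is additive: a path solves an integral equation driven by the
Brownian path and is the limit of a symmetric splitting scheme. With Gibbs initial density, a step
of that scheme is reversible up to a factor which on bounded sets tends to one even after
multiplication over the whole path; this gives reversibility. Conversely the expansion of
\<open>E (g (X 0) (f (X t) - f (X 0)))\<close> for small \<open>t\<close> turns reversibility into the symmetry condition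
and into stationarity.\<close>

text \<open>The density is only positive and integrable and the drift only locally Lipschitz, so
  every identity is weak and \<open>b\<close> is never differentiated: weak equations are integrated
  along lines, which yields continuous representatives. No moments are assumed either; the cutoffs
  \<open>radial_bump\<close> produce the second moment on which the cosine transform relies.
  Separation of variables is reduced to evenness: comparing the equation at different positions
  shows that the momentum factor has a linear logarithmic gradient, for otherwise some translation
  would multiply the position factor by a constant, which no integrable density survives. For the
  process, the obstacle is that \<open>b\<close> and \<open>U\<close> are controlled on bounded sets
  only. Hence the scheme is reversed just as an inequality between path functionals cut off to a
  ball; Fatou's lemma removes the cutoff, and the same inequality for the reversed functional turns
  it into equality. The small-time expansion has to discard large Brownian excursions: their
  probability is of order \<open>t^2\<close>, negligible after division by \<open>t\<close>.\<close>

abbreviation dd :: "'a::real_normed_vector => ('a => real) => 'a => real" where "dd == dir_deriv"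

abbreviation Borel :: "('a::topological_space => 'b::topological_space) set" where "Borel == borel_measurable borel"

abbreviation nnl :: "('a::euclidean_space => ennreal) => ennreal" (binder "NN " 10) where "nnl f == nn_integral lborel f"

abbreviation seq_lim :: "(nat => 'a::topological_space) => 'a => bool" (infix "---->" 60) where "X ----> l == (X \<longlongrightarrow> l) sequentially"

notation scaleR (infixr "*R" 75)

lemmas borel_contI = borel_measurable_continuous_onI
lemmas meas_comp = measurable_compose
lemmas lint_cong = Bochner_Integration.integral_cong
lemmas lint_sum = Bochner_Integration.integral_sum
lemmas lint_add = Bochner_Integration.integral_add
lemmas lint_diff = Bochner_Integration.integral_diff
lemmas int_bound = Bochner_Integration.integrable_bound
lemmas int_sum = Bochner_Integration.integrable_sum
lemmas int_dct = integral_dominated_convergence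
lemmas borel_intI = borel_measurable_integrable
lemmas cont_comp = continuous_on_compose2
lemmas cont_at_on = continuous_at_imp_continuous_on

section \<open>Directional derivatives and test functions\<close>

lemma dd_eq: assumes "(f has_derivative f') (at x)" shows "dd v f x = f' v"
proof -
 have 1: "((%s::real. x + s *R v) has_derivative (%s. s *R v)) (at 0)" by (auto intro!: derivative_eq_intros)
 have "((%s. f (x + s *R v)) has_derivative (%s. f' (s *R v))) (at 0)" using has_derivative_compose[OF 1, of f f'] assms by simp
 moreover have "(%s. f' (s *R v)) = (*) (f' v)" using linear_scale[OF has_derivative_linear[OF assms]] by (auto simp: mult.commute)
 ultimately show ?thesis unfolding dir_deriv_def by (intro DERIV_imp_deriv) (simp add: has_field_derivative_def)
qed

lemma differentiable_has_dd: assumes "f differentiable (at x)" shows "(f has_derivative (%v. dd v f x)) (at x)"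
proof -
 obtain f' where f': "(f has_derivative f') (at x)" using assms unfolding differentiable_def by auto
 hence "(%v. dd v f x) = f'" using dd_eq by blast
 thus ?thesis using f' by simp
qed

text \<open>Smoothness is separated from compact support because squared norms, linear functions and
  cosines enter the calculus without being test functions.\<close>

definition smooth :: "('a::euclidean_space => real) => bool" where
 "smooth f \<longleftrightarrow> (\<forall>k. cont_diff k f)"

lemma smooth_differentiable: "smooth f ==> f differentiable (at x)" unfolding smooth_def by (metis cont_diff.simps(2))

lemma smooth_dd: "smooth f ==> smooth (dd v f)" unfolding smooth_def by (metis cont_diff.simps(2))

lemma smooth_has_derivative: "smooth f ==> (f has_derivative (%v. dd v f x)) (at x)" by (simp add: differentiable_has_dd smooth_differentiable)

lemma smooth_cont: "smooth f ==> continuous_on S f" unfolding smooth_def using cont_diff.simps(1) continuous_on_subset by blast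

lemma smooth_DERIV_line: fixes f :: "'a::euclidean_space => real" assumes "smooth f"
 shows "((%s. f (x + s *R v)) has_real_derivative dd v f (x + s *R v)) (at s)"
proof -
 have 1: "((%s::real. x + s *R v) has_derivative (%s. s *R v)) (at s)" by (auto intro!: derivative_eq_intros)
 have "((%s. f (x + s *R v)) has_derivative (%r. dd (r *R v) f (x + s *R v))) (at s)"
  using has_derivative_compose[OF 1 smooth_has_derivative[OF assms]] by simp
 moreover have "(%r. dd (r *R v) f (x + s *R v)) = (*) (dd v f (x + s *R v))"
  using linear_scale[OF has_derivative_linear[OF smooth_has_derivative[OF assms]]] by (auto simp: mult.commute)
 ultimately show ?thesis by (simp add: has_field_derivative_def)
qed

lemma dd_add_dir: assumes "smooth f" shows "dd (v + w) f x = dd v f x + dd w f x"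
 using linear_add[OF has_derivative_linear[OF smooth_has_derivative[OF assms]]] by simp

lemma dd_scaleR_dir: assumes "smooth f" shows "dd (c *R v) f x = c * dd v f x"
 using linear_scale[OF has_derivative_linear[OF smooth_has_derivative[OF assms]]] by simp

lemma dd_sum_dir: assumes "smooth f" shows "dd (\<Sum>i\<in>I. v i) f x = (\<Sum>i\<in>I. dd (v i) f x)"
 using linear_sum[OF has_derivative_linear[OF smooth_has_derivative[OF assms]]] by simp

lemma cont_diff_Suc_imp: "cont_diff (Suc k) f ==> cont_diff k f"
proof (induction k arbitrary: f)
 case 0
 thus ?case by (auto intro!: cont_at_on differentiable_imp_continuous_within)
next
 case (Suc k) thus ?case by (metis cont_diff.simps(2))
qed

lemma dd_const [simp]: "dd v (%x. c) = (%x. 0)" by (simp add: dir_deriv_def fun_eq_iff)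

lemma cont_diff_const: "cont_diff k (%x. c)" by (induction k arbitrary: c) auto

lemma dd_add: assumes "!!x. f differentiable (at x)" "!!x. g differentiable (at x)" shows "dd v (%x. f x + g x) = (%x. dd v f x + dd v g x)"
proof
 fix x
 show "dd v (%x. f x + g x) x = dd v f x + dd v g x" by (rule dd_eq) (intro has_derivative_add differentiable_has_dd assms)
qed

lemma cont_diff_add: "cont_diff k f ==> cont_diff k g ==> cont_diff k (%x. f x + g x)"
proof (induction k arbitrary: f g)
 case 0 thus ?case by (auto intro: continuous_intros)
next
 case (Suc k)
 have d: "!!x. f differentiable (at x)" "!!x. g differentiable (at x)" using Suc.prems by auto
 show ?case using Suc dd_add[OF d] d by auto
qed

lemma dd_mult: assumes "!!x. f differentiable (at x)" "!!x. g differentiable (at x)"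
 shows "dd v (%x. f x * g x) = (%x. f x * dd v g x + dd v f x * g x)"
proof
 fix x
 show "dd v (%x. f x * g x) x = f x * dd v g x + dd v f x * g x" by (rule dd_eq) (intro has_derivative_mult differentiable_has_dd assms)
qed

lemma cont_diff_mult: "cont_diff k f ==> cont_diff k g ==> cont_diff k (%x. f x * g x)"
proof (induction k arbitrary: f g)
 case 0 thus ?case by (auto intro: continuous_intros)
next
 case (Suc k)
 have d: "!!x. f differentiable (at x)" "!!x. g differentiable (at x)" using Suc.prems by auto
 have "cont_diff k f" "cont_diff k g" using Suc.prems cont_diff_Suc_imp by blast+
 thus ?case using Suc dd_mult[OF d] d by (auto intro: cont_diff_add)
qed

lemma dd_affine: assumes "bounded_linear L" "!!x. f differentiable (at x)" shows "dd v (%x. f (L x + a)) = (%x. dd (L v) f (L x + a))"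
proof
 fix x
 have "((%x. L x + a) has_derivative L) (at x)" using assms(1) by (auto intro!: derivative_eq_intros bounded_linear_imp_has_derivative)
 from has_derivative_compose[OF this differentiable_has_dd[OF assms(2)]]
 show "dd v (%x. f (L x + a)) x = dd (L v) f (L x + a)" by (rule dd_eq)
qed

lemma cont_diff_affine: assumes "bounded_linear L" shows "cont_diff k f ==> cont_diff k (%x. f (L x + a))"
proof (induction k arbitrary: f)
 case 0
 have "continuous_on UNIV (%x. L x + a)" by (intro continuous_on_add linear_continuous_on assms continuous_on_const)
 thus ?case using 0 cont_comp[of UNIV f UNIV "%x. L x + a"] by simp
next
 case (Suc k)
 have d: "!!x. f differentiable (at x)" using Suc.prems by auto
 have "((%x. L x + a) has_derivative L) (at x)" for x using assms(1) by (auto intro!: derivative_eq_intros bounded_linear_imp_has_derivative)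
 from has_derivative_compose[OF this differentiable_has_dd[OF d]]
 have "(%x. f (L x + a)) differentiable (at x)" for x unfolding differentiable_def by blast
 thus ?case using Suc dd_affine[OF assms d] by auto
qed

lemma cont_diff_bounded_linear: assumes "bounded_linear f" shows "cont_diff k f"
proof (cases k)
 case 0 thus ?thesis using assms by (simp add: linear_continuous_on)
next
 case (Suc j)
 have d: "(f has_derivative f) (at x)" for x by (rule bounded_linear_imp_has_derivative[OF assms])
 have "dd v f = (%x. f v)" for v by (rule ext) (rule dd_eq[OF d])
 thus ?thesis using Suc d by (auto simp: differentiable_def cont_diff_const)
qed

lemma smooth_const: "smooth (%x. c)" by (simp add: smooth_def cont_diff_const)
lemma smooth_add: "smooth f ==> smooth g ==> smooth (%x. f x + g x)" by (simp add: smooth_def cont_diff_add)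
lemma smooth_mult: "smooth f ==> smooth g ==> smooth (%x. f x * g x)" by (simp add: smooth_def cont_diff_mult)
lemma smooth_bounded_linear: "bounded_linear f ==> smooth f" by (simp add: smooth_def cont_diff_bounded_linear)
lemma smooth_affine: "bounded_linear L ==> smooth f ==> smooth (%x. f (L x + a))" by (simp add: smooth_def cont_diff_affine)
lemma smooth_cmult: "smooth f ==> smooth (%x. c * f x)" by (intro smooth_mult smooth_const)
lemma smooth_diff: "smooth f ==> smooth g ==> smooth (%x. f x - g x)" using smooth_add[of f "%x. (-1) * g x"] smooth_cmult[of g "-1"] by simp
lemma smooth_sum: "(!!i. i : I ==> smooth (f i)) ==> smooth (%x. \<Sum>i\<in>I. f i x)"
 by (induction I rule: infinite_finite_induct) (auto intro: smooth_const smooth_add)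
lemma smooth_prod: "(!!i. i : I ==> smooth (f i)) ==> smooth (%x. \<Prod>i\<in>I. f i x)"
 by (induction I rule: infinite_finite_induct) (auto intro: smooth_const smooth_mult)

lemma smooth_norm_power2: "smooth (%x::'a::euclidean_space. (norm x)^2)"
proof -
 have "(%x::'a. (norm x)^2) = (%x. \<Sum>b\<in>Basis. (x \<bullet> b) * (x \<bullet> b))" by (metis euclidean_inner power2_norm_eq_inner)
 thus ?thesis by (simp only:) (intro smooth_sum smooth_mult smooth_bounded_linear bounded_linear_inner_left)
qed

section \<open>Flat functions at the origin\<close>

definition flat_exp :: "real poly => real => real" where
 "flat_exp P x = (if x > 0 then poly P (1/x) * exp (- (1/x)) else 0)"

lemma poly_times_exp_neg_tendsto_0: "((%y::real. poly P y * exp (- y)) \<longlongrightarrow> 0) at_top"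
proof -
 have "((%y::real. \<Sum>i\<le>degree P. coeff P i * (y ^ i / exp y)) \<longlongrightarrow> (\<Sum>i\<le>degree P. coeff P i * 0)) at_top"
  by (intro tendsto_sum tendsto_mult tendsto_const tendsto_power_div_exp_0)
 moreover have "(%y::real. poly P y * exp (- y)) = (%y. \<Sum>i\<le>degree P. coeff P i * (y ^ i / exp y))"
  by (simp add: poly_altdef sum_distrib_right exp_minus divide_inverse mult.assoc)
 ultimately show ?thesis by simp
qed

lemma flat_exp_tendsto_0: "(flat_exp P \<longlongrightarrow> 0) (at_right 0)"
proof -
 have "((%x. poly P (inverse x) * exp (- inverse x)) \<longlongrightarrow> 0) (at_right 0)"
  by (rule filterlim_compose[OF poly_times_exp_neg_tendsto_0 filterlim_inverse_at_top_right])
 thus ?thesis by (rule Lim_transform_eventually)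
    (auto simp: eventually_at_filter flat_exp_def inverse_eq_divide)
qed

text \<open>Differentiating \<open>P(1/x) exp(-1/x)\<close> replaces \<open>P\<close> by
  \<open>X^2 (P - P')\<close>, so the family is closed under derivatives and smoothness becomes an
  induction over all \<open>P\<close> at once. \<open>P = 1\<close> is the classical flat
  function.\<close>

lemma flat_exp_DERIV:
 "(flat_exp P has_real_derivative flat_exp (monom 1 2 * (P - pderiv P)) x) (at x)"
proof (cases "x > 0")
 case True
 have "((%x. poly P (1/x) * exp (- (1/x))) has_real_derivative
   poly P (1/x) * (exp (- (1/x)) * (1/x^2)) + poly (pderiv P) (1/x) * (- 1/x^2) * exp (- (1/x))) (at x)"
  using True by (auto intro!: derivative_eq_intros DERIV_chain2[OF poly_DERIV] simp: power2_eq_square)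
 also have "poly P (1/x) * (exp (- (1/x)) * (1/x^2)) + poly (pderiv P) (1/x) * (- 1/x^2) * exp (- (1/x)) = flat_exp (monom 1 2 * (P - pderiv P)) x"
  using True by (simp add: flat_exp_def poly_monom field_simps)
 finally show ?thesis by (rule has_field_derivative_transform_within_open[where S="{0<..}"])
    (use True in \<open>auto simp: flat_exp_def\<close>)
next
 case False
 show ?thesis
 proof (cases "x < 0")
  case True
  have "((%x. 0) has_real_derivative 0) (at x)" by simp
  moreover have "flat_exp (monom 1 2 * (P - pderiv P)) x = 0" using True by (simp add: flat_exp_def)
  ultimately show ?thesis by (auto intro: has_field_derivative_transform_within_open[where S="{..<0}" and f="%x. 0"]
     simp: True flat_exp_def)
 next
  case False
  hence [simp]: "x = 0" using \<open>\<not> x > 0\<close> by simp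
  \<comment> \<open>For \<open>h > 0\<close> the quotient \<open>flat_exp P h / h\<close> is
    \<open>flat_exp (monom 1 1 * P) h\<close>: the factor \<open>1/h\<close> is absorbed into the
    polynomial.\<close>
  have "(flat_exp (monom 1 1 * P) \<longlongrightarrow> 0) (at_right 0)" by (rule flat_exp_tendsto_0)
  hence "((%h. flat_exp P h / h) \<longlongrightarrow> 0) (at_right 0)" by (rule Lim_transform_eventually)
     (auto simp: eventually_at_filter flat_exp_def poly_monom)
  moreover have "((%h. flat_exp P h / h) \<longlongrightarrow> 0) (at_left 0)" by (rule Lim_transform_eventually[of "%x. 0"])
     (auto simp: eventually_at_filter flat_exp_def)
  ultimately have "((%h. flat_exp P h / h) \<longlongrightarrow> 0) (at 0)" by (rule filterlim_split_at[rotated])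
  thus ?thesis by (simp add: DERIV_def flat_exp_def)
 qed
qed

lemma cont_diff_flat_exp_compose: assumes "smooth u" shows "cont_diff k (%x. flat_exp P (u x))"
proof (induction k arbitrary: P)
 case 0
 have "continuous_on UNIV (flat_exp P)" using flat_exp_DERIV DERIV_isCont cont_at_on by blast
 thus ?case using smooth_cont[OF assms] by (auto intro: cont_comp)
next
 case (Suc k)
 have *: "((%x. flat_exp P (u x)) has_derivative
   (%v. flat_exp (monom 1 2 * (P - pderiv P)) (u x) * dd v u x)) (at x)" for x
  using has_derivative_compose[OF smooth_has_derivative[OF assms] flat_exp_DERIV[unfolded has_field_derivative_def]] by (simp add: mult.commute)
 have "dd v (%x. flat_exp P (u x)) = (%x. flat_exp (monom 1 2 * (P - pderiv P)) (u x) * dd v u x)" for v using dd_eq[OF *] by blast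
 moreover have "cont_diff k (dd v u)" for v using assms smooth_dd smooth_def by blast
 ultimately show ?case using * Suc by (auto simp: differentiable_def intro!: cont_diff_mult)
qed

lemma smooth_flat_exp_compose: "smooth u ==> smooth (%x. flat_exp P (u x))" by (simp add: smooth_def cont_diff_flat_exp_compose)


section \<open>Calculus of test functions\<close>

lemma tf_I: assumes "smooth f" "compact K" "!!x. x \<notin> K ==> f x = 0" shows "test_function f"
proof -
 have "closure {x. f x \<noteq> 0} \<subseteq> K" using assms(2,3) by (intro closure_minimal) (auto intro: compact_imp_closed)
 hence "compact (closure {x. f x \<noteq> 0})" using assms(2) by (metis closed_closure compact_Int_closed inf.absorb_iff2)
 thus ?thesis using assms(1) by (simp add: test_function_def smooth_def)
qed

lemma tf_smooth: "test_function f ==> smooth f" by (simp add: test_function_def smooth_def)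

lemma tf_support: assumes "test_function f" obtains K where "compact K" "!!x. x \<notin> K ==> f x = 0"
 by (metis (mono_tags, lifting) assms closure_subset mem_Collect_eq subsetD test_function_def)

lemma tf_support_cball: fixes f :: "'a::euclidean_space => real" assumes "test_function f" obtains R where "R > 0" "!!x. norm x > R ==> f x = 0"
proof -
 obtain K where K: "compact K" "!!x. x \<notin> K ==> f x = 0" using tf_support[OF assms] by blast
 obtain R where "R > 0" "!!x. x : K ==> norm x <= R" using bounded_pos compact_imp_bounded[OF K(1)] by metis
 thus ?thesis using that[of R] K(2) by fastforce
qed

lemma dd_outside_closed: assumes "closed K" "!!x. x \<notin> K ==> f x = 0" "x \<notin> K" shows "dd v f x = 0"
proof (rule dd_eq)
 show "(f has_derivative (%_. 0)) (at x)" by (rule has_derivative_transform_within_open[of "%_. 0" _ _ _ "- K"]) (use assms in auto)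
qed

lemma tf_dd: assumes "test_function f" shows "test_function (dd v f)"
proof -
 obtain K where K: "compact K" "!!x. x \<notin> K ==> f x = 0" using tf_support[OF assms] by blast
 show ?thesis by (rule tf_I[OF smooth_dd[OF tf_smooth[OF assms]] K(1)])
    (rule dd_outside_closed[OF compact_imp_closed[OF K(1)] K(2)])
qed

lemma tf_mult_smooth: assumes "test_function f" "smooth g" shows "test_function (%x. f x * g x)"
proof -
 obtain K where K: "compact K" "!!x. x \<notin> K ==> f x = 0" using tf_support[OF assms(1)] by blast
 show ?thesis by (rule tf_I[OF smooth_mult[OF tf_smooth[OF assms(1)] assms(2)] K(1)]) (simp add: K)
qed

lemma tf_cmult: "test_function f ==> test_function (%x. c * f x)" using tf_mult_smooth[of f "%x. c"] by (simp add: smooth_const mult.commute)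

lemma tf_add: assumes "test_function f" "test_function g" shows "test_function (%x. f x + g x)"
proof -
 obtain K where K: "compact K" "!!x. x \<notin> K ==> f x = 0" using tf_support[OF assms(1)] by blast
 obtain L where L: "compact L" "!!x. x \<notin> L ==> g x = 0" using tf_support[OF assms(2)] by blast
 show ?thesis by (rule tf_I[OF smooth_add compact_Un[OF K(1) L(1)]])
    (use assms K L in \<open>auto intro: tf_smooth\<close>)
qed

lemma tf_uminus_arg: fixes f :: "'a::euclidean_space => real" assumes "test_function f" shows "test_function (%x. f (- x))"
proof -
 obtain K where K: "compact K" "!!x. x \<notin> K ==> f x = 0" using tf_support[OF assms(1)] by blast
 show ?thesis
 proof (rule tf_I)
  show "smooth (%x. f (- x))" using smooth_affine[of uminus f 0] tf_smooth[OF assms] by (simp add: bounded_linear_minus[OF bounded_linear_ident])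
  show "compact (uminus ` K)" by (intro compact_continuous_image continuous_intros K)
  show "x \<notin> uminus ` K ==> f (- x) = 0" for x by (metis K(2) imageI minus_minus)
 qed
qed

lemma smooth_fst: "smooth f ==> smooth (%x. f (fst x))" using smooth_affine[OF bounded_linear_fst, of f 0] by simp

lemma smooth_snd: "smooth f ==> smooth (%x. f (snd x))" using smooth_affine[OF bounded_linear_snd, of f 0] by simp

lemma tf_tensor: fixes f :: "'a::euclidean_space => real" and g :: "'b::euclidean_space => real" assumes "test_function f" "test_function g"
 shows "test_function (%x. f (fst x) * g (snd x))"
proof -
 obtain K where K: "compact K" "!!x. x \<notin> K ==> f x = 0" using tf_support[OF assms(1)] by blast
 obtain L where L: "compact L" "!!x. x \<notin> L ==> g x = 0" using tf_support[OF assms(2)] by blast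
 show ?thesis by (rule tf_I[OF smooth_mult[OF smooth_fst smooth_snd] compact_Times[OF K(1) L(1)]])
    (use assms K L in \<open>auto intro: tf_smooth simp: mem_Times_iff\<close>)
qed

lemma compact_support_bounded: fixes f :: "'a::euclidean_space => real" assumes "continuous_on UNIV f" "compact K" "!!x. x \<notin> K ==> f x = 0"
 obtains B where "B > 0" "!!x. \<bar>f x\<bar> <= B"
proof -
 have "bounded (f ` K)" using assms by (intro compact_imp_bounded compact_continuous_image) (auto intro: continuous_on_subset)
 then obtain B where "B > 0" "\<forall>x\<in>K. \<bar>f x\<bar> <= B" unfolding bounded_pos by auto
 thus ?thesis using that[of B] assms(3) by (metis abs_zero less_imp_le)
qed

lemma tf_bounded: assumes "test_function f" obtains B where "B > 0" "!!x. \<bar>f x\<bar> <= B"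
 by (metis assms compact_support_bounded smooth_cont tf_smooth tf_support)

text \<open>Products over coordinates are chosen because boxes generate the Borel sets, are stable
  under intersection, and split into a position box and a momentum box. No normalization is
  involved: the factors \<open>exp (- 1 / (k c))\<close> tend to one by themselves as
  \<open>k\<close> grows.\<close>

definition box_bump :: "'a::euclidean_space => 'a => nat => 'a => real" where
 "box_bump a b k x = (\<Prod>i\<in>Basis. flat_exp 1 (real k * ((x \<bullet> i - a \<bullet> i) * (b \<bullet> i - x \<bullet> i))))"

lemma flat_exp_1_bounds: "0 <= flat_exp 1 x" "flat_exp 1 x <= 1" by (auto simp: flat_exp_def)

lemma box_bump_bounds: "0 <= box_bump a b k x" "box_bump a b k x <= 1"
 unfolding box_bump_def by (auto intro!: prod_nonneg prod_le_1 flat_exp_1_bounds)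

text \<open>Some coordinate lies outside its interval and makes the quadratic argument nonpositive.
  With a reversed interval both linear factors could be negative, hence the condition on
  \<open>a\<close> and \<open>b\<close>.\<close>

lemma box_bump_outside: "x \<notin> box a b ==> \<forall>i\<in>Basis. a \<bullet> i < b \<bullet> i ==> box_bump a b k x = 0"
proof -
 assume x: "x \<notin> box a b" and ab: "\<forall>i\<in>Basis. a \<bullet> i < b \<bullet> i"
 then obtain i where i: "i : Basis" "\<not> (a \<bullet> i < x \<bullet> i \<and> x \<bullet> i < b \<bullet> i)" by (auto simp: mem_box)
 hence "(x \<bullet> i - a \<bullet> i) * (b \<bullet> i - x \<bullet> i) <= 0" using ab by (smt (verit, best) mult_nonneg_nonpos mult_nonpos_nonneg)
 hence "flat_exp 1 (real k * ((x \<bullet> i - a \<bullet> i) * (b \<bullet> i - x \<bullet> i))) = 0"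
  by (auto simp: flat_exp_def zero_less_mult_iff mult_le_0_iff dest: mult_nonneg_nonpos)
 thus "box_bump a b k x = 0" using i(1) by (auto simp: box_bump_def)
qed

lemma box_bump_test_function: assumes "\<forall>i\<in>Basis. a \<bullet> i < b \<bullet> i" shows "test_function (box_bump a b k)"
proof (rule tf_I[OF _ compact_cbox[of a b]])
 have "smooth (%x::'a. x \<bullet> i)" for i by (intro smooth_bounded_linear bounded_linear_inner_left)
 thus "smooth (box_bump a b k)" unfolding box_bump_def[abs_def]
  by (intro smooth_prod smooth_flat_exp_compose smooth_cmult smooth_mult smooth_diff smooth_const)
 show "x \<notin> cbox a b ==> box_bump a b k x = 0" for x using box_bump_outside assms box_subset_cbox by blast
qed

lemma box_bump_tendsto: assumes "\<forall>i\<in>Basis. a \<bullet> i < b \<bullet> i" shows "(%k. box_bump a b k x) ----> indicator (box a b) x"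
proof (cases "x : box a b")
 case False
 thus ?thesis using box_bump_outside[OF False assms] by simp
next
 case True
 have "(%k. flat_exp 1 (real k * ((x \<bullet> i - a \<bullet> i) * (b \<bullet> i - x \<bullet> i)))) ----> 1" if "i : Basis" for i
 proof -
  define c where "c = (x \<bullet> i - a \<bullet> i) * (b \<bullet> i - x \<bullet> i)"
  have c: "c > 0" using True that by (auto simp: c_def mem_box)
  have "(%k. exp (- (inverse c * inverse (real k)))) ----> exp (- (inverse c * 0))" by (intro tendsto_intros lim_inverse_n)
  hence "(%k. flat_exp 1 (real k * c)) ----> exp (- (inverse c * 0))"
  proof (rule Lim_transform_eventually)
   show "\<forall>\<^sub>F k in sequentially. exp (- (inverse c * inverse (real k))) = flat_exp 1 (real k * c)"
    using eventually_gt_at_top[of 0] by eventually_elim (use c in \<open>auto simp: flat_exp_def field_simps\<close>)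
  qed
  thus ?thesis by (simp add: c_def)
 qed
 hence "(%k. box_bump a b k x) ----> (\<Prod>i\<in>(Basis::'a set). 1)" unfolding box_bump_def by (rule tendsto_prod)
 thus ?thesis using True by simp
qed

section \<open>Integration by parts and weak gradients\<close>

lemma borel_measurable_translate [measurable]: fixes f :: "'a::euclidean_space => 'b::topological_space" shows "f : Borel ==> (%x. f (x + v)): Borel"
 by (rule meas_comp[of "%x. x + v" borel borel f]) simp_all

lemma lborel_distr_add: "distr lborel borel (%x. x + v) = (lborel :: 'a::euclidean_space measure)"
 using lborel_distr_plus[of v] by (simp add: add.commute[of _ v])

lemma integral_translate: fixes f :: "'a::euclidean_space => real" assumes [measurable]: "f : Borel" shows "(LBINT x. f (x + v)) = (LBINT x. f x)"
proof -
 have "(LINT x|distr lborel borel (%x. x + v). f x) = (LBINT x. f (x + v))" by (rule integral_distr) simp_all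
 thus ?thesis by (simp add: lborel_distr_add)
qed

lemma int_translate: fixes f :: "'a::euclidean_space => real" assumes "integrable lborel f" shows "integrable lborel (%x. f (x + v))"
proof -
 have "integrable (distr lborel borel (%x. x + v)) f" using assms by (simp add: lborel_distr_add)
 thus ?thesis using assms by (subst (asm) integrable_distr_eq) auto
qed

lemma AE_translate: assumes "AE x in (lborel :: 'a::euclidean_space measure). P x" shows "AE x in lborel. P (x + v)"
proof -
 obtain N where N: "{x : space lborel. \<not> P x} \<subseteq> N" "N : null_sets lborel" using assms by (auto simp: eventually_ae_filter)
 have "AE x in distr lborel borel (%x. x + v). x \<notin> N" unfolding lborel_distr_add using N(2) by (rule AE_not_in)
 hence "AE x in lborel. x + v \<notin> N" using N(2) by (subst (asm) AE_distr_iff) auto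
 thus ?thesis using N(1) by auto
qed

lemma lborel_distr_uminus_euclidean: "distr lborel borel uminus = (lborel :: 'a::euclidean_space measure)"
 using lborel_affine[of "-1" "0::'a"] by (simp add: density_1)

lemma integral_uminus_arg: fixes f :: "'a::euclidean_space => real" assumes [measurable]: "f : Borel" shows "(LBINT x. f (- x)) = (LBINT x. f x)"
proof -
 have "(LINT x|distr lborel borel uminus. f x) = (LBINT x. f (- x))" by (rule integral_distr) simp_all
 thus ?thesis by (simp add: lborel_distr_uminus_euclidean)
qed

lemma int_mult_bounded: fixes f g :: "'a => real" assumes "integrable M f" "g : borel_measurable M" "!!x. \<bar>g x\<bar> <= B"
 shows "integrable M (%x. f x * g x)"
proof (rule int_bound)
 show "integrable M (%x. B * f x)" using assms(1) by simp
 have "0 <= B" using assms(3) abs_ge_zero order_trans by blast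
 hence "norm (f x * g x) <= norm (B * f x)" for x using mult_right_mono[OF assms(3)[of x], of "\<bar>f x\<bar>"] by (simp add: abs_mult mult.commute)
 thus "AE x in M. norm (f x * g x) <= norm (B * f x)" by simp
qed (use assms in auto)

lemma int_mult_test: fixes f h :: "'a::euclidean_space => real" assumes "integrable lborel f" "test_function h"
 shows "integrable lborel (%x. f x * h x)"
proof -
 obtain B where "!!x. \<bar>h x\<bar> <= B" using tf_bounded[OF assms(2)] by blast
 moreover have "h : borel_measurable lborel" using borel_contI[OF smooth_cont[OF tf_smooth[OF assms(2)]]] by simp
 ultimately show ?thesis using int_mult_bounded assms(1) by blast
qed

lemma tf_measurable: "test_function h ==> h : Borel" by (intro borel_contI smooth_cont tf_smooth)

lemma int_continuous_compact_support: fixes F :: "'a::euclidean_space => real"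
 assumes "continuous_on UNIV F" "compact K" "!!x. x \<notin> K ==> F x = 0" shows "integrable lborel F"
proof -
 have "integrable lborel (%x. indicator K x *R F x)" by (rule borel_integrable_compact) (use assms in \<open>auto intro: continuous_on_subset\<close>)
 moreover have "(%x. indicator K x *R F x) = F" using assms(3) by (fastforce simp: indicator_def)
 ultimately show ?thesis by simp
qed

text \<open>Only the derivative along one fixed direction is needed, so that drifts which are merely
 Lipschitz can occur as factors in the remaining directions.\<close>

lemma integral_dd_eq_0: fixes F G :: "'a::euclidean_space => real"
 assumes F: "continuous_on UNIV F" and K: "compact K" "!!x. x \<notin> K ==> F x = 0"
  and D: "!!x. ((%s. F (x + s *R v)) has_real_derivative G x) (at 0)" and G: "continuous_on UNIV G" shows "(LBINT x. G x) = 0"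
proof -
 have Dx: "((%s. F (x + s *R v)) has_real_derivative G (x + s *R v)) (at s)" for x s
 proof -
  have "((%r. F ((x + s *R v) + (r - s) *R v)) has_real_derivative G (x + s *R v) * 1) (at s)"
   by (rule DERIV_chain2[where f="%r. F ((x + s *R v) + r *R v)" and g="%r. r - s"])
     (use D[of "x + s *R v"] in \<open>auto intro!: derivative_eq_intros\<close>)
  moreover have "(x + s *R v) + (r - s) *R v = x + r *R v" for r by (simp add: algebra_simps)
  ultimately show ?thesis by simp
 qed
 have G0: "G x = 0" if "x \<notin> K" for x
 proof -
  have "open ((%s. x + s *R v) -` (- K))" by (intro open_vimage open_Compl compact_imp_closed[OF K(1)] continuous_intros)
  hence "((%s. F (x + s *R v)) has_real_derivative 0) (at 0)" using that K by (intro has_field_derivative_transform_within_open[OF DERIV_const]) auto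
  thus ?thesis using D[of x] DERIV_unique by blast
 qed
 obtain B where B: "B > 0" "!!x. \<bar>G x\<bar> <= B" using compact_support_bounded[OF G K(1) G0] by blast
 \<comment> \<open>\<open>K'\<close> is swept out by shifting \<open>K\<close> back along
   \<open>v\<close>; outside it every difference quotient with step at most one vanishes, so it
   carries the dominating function.\<close>
 define K' where "K' = (%(x, s). x - s *R v) ` (K \<times> {0..1})"
 have K': "compact K'" unfolding K'_def
  by (intro compact_continuous_image compact_Times K compact_Icc) (auto simp: split_beta intro!: continuous_intros)
 define Q where "Q n x = real (Suc n) * (F (x + inverse (real (Suc n)) *R v) - F x)" for n x
 have [measurable]: "F : Borel" "G : Borel" using F G by (auto intro: borel_contI)
 have Fi: "integrable lborel F" by (rule int_continuous_compact_support[OF F K])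
 have "(%n. LBINT x. Q n x) ----> (LBINT x. G x)"
 proof (rule int_dct)
  show "integrable lborel (%x. indicator K' x *R B)" by (rule borel_integrable_compact[OF K']) simp
  show "AE x in lborel. (%n. Q n x) ----> G x"
  proof (rule AE_I2)
   fix x
   have "((%h. (F (x + h *R v) - F x) / h) \<longlongrightarrow> G x) (at 0)" using D[of x] by (simp add: DERIV_def)
   moreover have "filterlim (%n. inverse (real (Suc n))) (at 0) sequentially" by (intro filterlim_atI LIMSEQ_inverse_real_of_nat) auto
   ultimately have "(%n. (F (x + inverse (real (Suc n)) *R v) - F x) / inverse (real (Suc n))) ----> G x" by (rule filterlim_compose)
   thus "(%n. Q n x) ----> G x" by (simp add: Q_def field_simps)
  qed
  show "AE x in lborel. norm (Q n x) <= indicator K' x *R B" for n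
  proof (rule AE_I2)
   fix x
   define h where "h = inverse (real (Suc n))"
   have h: "0 < h" "h <= 1" by (auto simp: h_def field_simps)
   obtain z where z: "0 < z" "z < h" "F (x + h *R v) - F (x + 0 *R v) = (h - 0) * G (x + z *R v)"
    using MVT2[OF h(1), of "%s. F (x + s *R v)" "%s. G (x + s *R v)"] Dx by blast
   hence Q: "Q n x = G (x + z *R v)" using h by (simp add: Q_def h_def[symmetric]) (simp add: h_def field_simps)
   have "x : K'" if "x + z *R v : K" unfolding K'_def using that z h by (force intro!: image_eqI[of _ _ "(x + z *R v, z)"])
   thus "norm (Q n x) <= indicator K' x *R B" using B G0[of "x + z *R v"] Q by (auto simp: indicator_def)
  qed
 qed (auto simp: Q_def[abs_def])
 moreover have "(LBINT x. Q n x) = 0" for n unfolding Q_def using Fi int_translate[OF Fi] by (simp add: integral_translate)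
 ultimately show ?thesis by (simp add: LIMSEQ_const_iff)
qed

text \<open>Dominated convergence turns the bumps into indicators of boxes; the positive and
  negative parts of \<open>f\<close> then define measures that agree on a generating family.
  Integrability is asked on boxes only, since \<open>f\<close> will contain merely continuous
  factors.\<close>

lemma AE_eq_0_box_bump: fixes f :: "'a::euclidean_space => real" assumes [measurable]: "f : Borel"
  and int: "!!a b. integrable lborel (%x. indicator (box a b) x * f x)"
  and zero: "!!a b k. \<forall>i\<in>Basis. a \<bullet> i < b \<bullet> i ==> (LBINT x. f x * box_bump a b k x) = 0" shows "AE x in lborel. f x = 0"
proof -
 have box0: "(LBINT x. indicator (box a b) x * f x) = 0" for a b :: 'a
 proof (cases "\<forall>i\<in>Basis. a \<bullet> i < b \<bullet> i")
  case False
  hence "box a b = {}" by (auto simp: box_eq_empty not_less)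
  thus ?thesis by simp
 next
  case True
  have [measurable]: "box_bump a b k : Borel" for k using tf_measurable[OF box_bump_test_function[OF True]] .
  have "(%k. LBINT x. f x * box_bump a b k x) ----> (LBINT x. indicator (box a b) x * f x)"
  proof (rule int_dct)
   show "integrable lborel (%x. \<bar>indicator (box a b) x * f x\<bar>)" using int by (rule integrable_abs)
   show "AE x in lborel. (%k. f x * box_bump a b k x) ----> indicator (box a b) x * f x"
    using tendsto_mult[OF tendsto_const box_bump_tendsto[OF True]] by (simp add: mult.commute)
   show "AE x in lborel. norm (f x * box_bump a b k x) <= \<bar>indicator (box a b) x * f x\<bar>" for k
    using box_bump_outside[OF _ True] box_bump_bounds[of a b k] by (auto simp: indicator_def abs_mult intro!: mult_left_le)
  qed auto
  thus ?thesis using zero[OF True] by (simp add: LIMSEQ_const_iff)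
 qed
 \<comment> \<open>\<open>ennreal\<close> sends negative reals to zero, so \<open>fp\<close> and
   \<open>fn\<close> are the positive and negative parts of \<open>f\<close>.\<close>
 define fp where "fp x = ennreal (f x)" for x
 define fn where "fn x = ennreal (- f x)" for x
 have [measurable]: "fp : Borel" "fn : Borel" unfolding fp_def[abs_def] fn_def[abs_def] by auto
 have eq: "emeasure (density lborel fp) (box a b) = emeasure (density lborel fn) (box a b)
   \<and> emeasure (density lborel fp) (box a b) < \<infinity>" for a b :: 'a
 proof -
  have 1: "emeasure (density lborel fp) (box a b) = (NN x. ennreal (indicator (box a b) x * f x))"
   by (subst emeasure_density) (auto simp: fp_def indicator_def intro!: nn_integral_cong)
  have 2: "emeasure (density lborel fn) (box a b) = (NN x. ennreal (- (indicator (box a b) x * f x)))"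
   by (subst emeasure_density) (auto simp: fn_def indicator_def intro!: nn_integral_cong)
  have i: "integrable lborel (%x. indicator (box a b) x * f x)" by (rule int)
  have f: "(NN x. ennreal (indicator (box a b) x * f x)) < \<infinity>"
    "(NN x. ennreal (- (indicator (box a b) x * f x))) < \<infinity>" using i unfolding real_integrable_def by (auto simp: less_top)
  have "0 = enn2real (NN x. ennreal (indicator (box a b) x * f x))
    - enn2real (NN x. ennreal (- (indicator (box a b) x * f x)))" using real_lebesgue_integral_def[OF i] box0 by simp
  moreover have "x = y" if "x < \<infinity>" "y < \<infinity>" "0 = enn2real x - enn2real y" for x y using that by (cases x; cases y) auto
  ultimately show ?thesis unfolding 1 2 using f by blast
 qed
 have "density lborel fp = density lborel fn"
 proof (rule measure_eqI_generator_eq[where E="range (%(a, b). box a b :: 'a set)" and \<Omega>=UNIV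
    and A="%n. box (- (real n *R One)) (real n *R One)"])
  show "Int_stable (range (%(a, b). box a b :: 'a set))" by (auto simp: Int_stable_def box_Int_box)
  show "sets (density lborel fp) = sigma_sets UNIV (range (%(a, b). box a b :: 'a set))"
   "sets (density lborel fn) = sigma_sets UNIV (range (%(a, b). box a b :: 'a set))" by (simp_all add: borel_eq_box)
  show "(\<Union>n. box (- (real n *R One)) (real n *R One)) = (UNIV :: 'a set)" using UN_box_eq_UNIV by (simp add: )
  show "X : range (%(a, b). box a b) ==> emeasure (density lborel fp) X = emeasure (density lborel fn) X" for X :: "'a set" using eq by auto
  show "emeasure (density lborel fp) (box (- (real n *R One)) (real n *R One)) \<noteq> \<infinity>" for n using eq less_irrefl by metis
 qed auto
 hence "AE x in lborel. fp x = fn x" by (subst (asm) sigma_finite_measure.density_unique_iff[OF sigma_finite_lborel]) auto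
 thus ?thesis
 proof eventually_elim
  case (elim x)
  show ?case
  proof (cases "f x \<ge> 0")
   case True thus ?thesis using elim by (simp add: fp_def fn_def ennreal_neg)
  next
   case False thus ?thesis using elim by (simp add: fp_def fn_def ennreal_neg)
  qed
 qed
qed

section \<open>Fubini, null sets and translations for Lebesgue measure\<close>

lemma borel_fst:
 "fst : borel_measurable (borel :: ('a::euclidean_space \<times> 'b::euclidean_space) measure)" by (intro borel_contI continuous_intros)

lemma borel_snd:
 "snd : borel_measurable (borel :: ('a::euclidean_space \<times> 'b::euclidean_space) measure)" by (intro borel_contI continuous_intros)

lemma lborel_fubini: fixes f :: "'a::euclidean_space \<times> 'b::euclidean_space => real" assumes "integrable lborel f"
 shows "(LBINT x. LBINT y. f (x, y)) = (LBINT z. f z)" and "(LBINT y. LBINT x. f (x, y)) = (LBINT z. f z)"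
  and "AE x in lborel. integrable lborel (%y. f (x, y))" and "AE y in lborel. integrable lborel (%x. f (x, y))"
  and "integrable lborel (%x. LBINT y. f (x, y))" and "integrable lborel (%y. LBINT x. f (x, y))"
proof -
 have f: "integrable (lborel \<Otimes>\<^sub>M lborel) f" using assms by (simp add: lborel_prod)
 show 1: "(LBINT x. LBINT y. f (x, y)) = (LBINT z. f z)" using lborel_pair.integral_fst'[OF f] by (simp add: lborel_prod)
 show "(LBINT y. LBINT x. f (x, y)) = (LBINT z. f z)" using lborel_pair.Fubini_integral[of "%x y. f (x, y)"] f 1 by simp
 show "AE x in lborel. integrable lborel (%y. f (x, y))" by (rule lborel_pair.AE_integrable_fst'[OF f])
 show "integrable lborel (%x. LBINT y. f (x, y))" by (rule lborel_pair.integrable_fst'[OF f])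
 have g: "integrable (lborel \<Otimes>\<^sub>M lborel) (%(y, x). f (x, y))" by (rule lborel_pair.integrable_product_swap[OF f])
 show "AE y in lborel. integrable lborel (%x. f (x, y))" using lborel_pair.AE_integrable_fst'[OF g] by simp
 show "integrable lborel (%y. LBINT x. f (x, y))" using lborel_pair.integrable_fst'[OF g] by simp
qed

lemma nn_lborel_fst: fixes f :: "'a::euclidean_space \<times> 'b::euclidean_space => ennreal" assumes "f : Borel"
 shows "(NN x. (NN y. f (x, y))) = (NN z. f z)" and "(NN y. (NN x. f (x, y))) = (NN z. f z)"
proof -
 have f: "f : borel_measurable (lborel \<Otimes>\<^sub>M lborel)" using assms by (simp add: lborel_prod)
 show "(NN x. (NN y. f (x, y))) = (NN z. f z)" using lborel.nn_integral_fst[OF f] by (simp add: lborel_prod)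
 show "(NN y. (NN x. f (x, y))) = (NN z. f z)" using lborel_pair.nn_integral_snd[OF f] by (simp add: lborel_prod)
qed

lemma int_lborel_prodI: fixes f :: "'a::euclidean_space \<times> 'b::euclidean_space => real" assumes [measurable]: "f : Borel"
  and fin: "(NN y. (NN x. ennreal \<bar>f (x, y)\<bar>)) < \<infinity>" shows "integrable lborel f"
proof -
 have "(NN z. ennreal \<bar>f z\<bar>) < \<infinity>" using nn_lborel_fst(2)[of "%z. ennreal \<bar>f z\<bar>"] fin by simp
 thus ?thesis by (intro integrableI_bounded) simp_all
qed

lemma int_tensor: fixes f :: "'a::euclidean_space => real" and g :: "'b::euclidean_space => real"
 assumes f: "integrable lborel f" and g: "integrable lborel g" shows "integrable lborel (%z. f (fst z) * g (snd z))"
proof (rule int_lborel_prodI)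
 have [measurable]: "f : Borel" "g : Borel" using borel_intI[OF f] borel_intI[OF g] by simp_all
 show "(%z. f (fst z) * g (snd z)): Borel" unfolding borel_prod[symmetric] by measurable
 have "(NN y. (NN x. ennreal \<bar>f x * g y\<bar>)) = (NN y. (NN x. ennreal \<bar>f x\<bar>) * ennreal \<bar>g y\<bar>)"
  by (intro nn_integral_cong) (simp add: abs_mult ennreal_mult nn_integral_multc)
 also have "... = (NN x. ennreal \<bar>f x\<bar>) * (NN y. ennreal \<bar>g y\<bar>)" by (rule nn_integral_cmult) measurable
 also have "... < \<infinity>" using f g by (auto simp: integrable_iff_bounded ennreal_mult_less_top)
 finally show "(NN y. (NN x. ennreal \<bar>f (fst (x, y)) * g (snd (x, y))\<bar>)) < \<infinity>" by simp
qed

lemma AE_lborel_prod_iff: fixes P :: "'a::euclidean_space \<times> 'b::euclidean_space => bool" assumes "{z. P z} : sets borel"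
 shows "(AE x in lborel. AE y in lborel. P (x, y)) \<longleftrightarrow> (AE z in lborel. P z)"
  and "(AE y in lborel. AE x in lborel. P (x, y)) \<longleftrightarrow> (AE z in lborel. P z)"
proof -
 have s: "{z : space (lborel \<Otimes>\<^sub>M lborel). P (fst z, snd z)} : sets (lborel \<Otimes>\<^sub>M lborel)"
  unfolding lborel_prod using assms by simp
 show 1: "(AE x in lborel. AE y in lborel. P (x, y)) \<longleftrightarrow> (AE z in lborel. P z)"
  using lborel_pair.AE_pair_iff[of "%x y. P (x, y)", OF s] unfolding lborel_prod prod.collapse .
 show "(AE y in lborel. AE x in lborel. P (x, y)) \<longleftrightarrow> (AE z in lborel. P z)"
  using lborel_pair.AE_commute[of "%x y. P (x, y)", OF s] 1 by simp
qed

lemma AE_lborel_swap: fixes P :: "'a::euclidean_space => 'b::euclidean_space => bool"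
 assumes "{z. P (fst z) (snd z)} : sets borel" and "AE y in lborel. AE x in lborel. P x y" shows "AE x in lborel. AE y in lborel. P x y"
 using AE_lborel_prod_iff[OF assms(1)] assms(2) by simp

lemma nn_translate: fixes f :: "'a::euclidean_space => ennreal" assumes [measurable]: "f : Borel" shows "(NN x. f (x + v)) = (NN x. f x)"
proof -
 have "(\<integral>\<^sup>+x. f x \<partial>distr lborel borel (%x. x + v)) = (NN x. f (x + v))" by (rule nn_integral_distr) simp_all
 thus ?thesis by (simp add: lborel_distr_add)
qed

lemma AE_lborel_obtain: assumes "AE x in (lborel :: 'a::euclidean_space measure). P x" obtains x where "P x"
proof -
 have "\<not> (AE x in (lborel :: 'a measure). False)"
 proof
  assume "AE x in (lborel :: 'a measure). False"
  hence "emeasure (lborel :: 'a measure) UNIV = 0" using AE_iff_measurable[of UNIV lborel "%x::'a. False"] by auto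
  thus False by simp
 qed
 thus ?thesis using assms that by (metis (mono_tags, lifting) eventually_mono)
qed

text \<open>The set of disagreement is open, and a nonempty open set is not negligible. This is how
  almost-everywhere identities become pointwise ones.\<close>

lemma AE_lborel_continuous_eq: fixes f g :: "'a::euclidean_space => real"
 assumes "AE x in lborel. f x = g x" "continuous_on UNIV f" "continuous_on UNIV g" shows "f x = g x"
proof (rule ccontr)
 assume ne: "f x \<noteq> g x"
 have o: "open {x. f x \<noteq> g x}" using assms(2,3) by (intro open_Collect_neq)
 hence "{x. f x \<noteq> g x} : null_sets lborel" using assms(1) AE_iff_null[of lborel "%x. f x = g x"] by (simp add: borel_open)
 hence "negligible {x. f x \<noteq> g x}" using null_sets_completionI negligible_iff_null_sets by blast
 thus False using open_not_negligible[OF o] ne by blast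
qed

section \<open>Weak gradient equations along lines\<close>

lemma linear_ode_solution: fixes G a :: "real => real" assumes G: "continuous_on {0..1} G" and a: "continuous_on {0..1} a"
  and eq: "!!s. s : {0..1} ==> G s = G 0 + integral {0..s} (%u. G u * a u)" shows "G 1 = G 0 * exp (integral {0..1} a)"
proof -
 define I where "I s = integral {0..s} a" for s
 have DI: "(I has_real_derivative a s) (at s within {0..1})" if "s : {0..1}" for s unfolding I_def using integral_has_real_derivative[OF a that] .
 have DG: "(G has_real_derivative G s * a s) (at s within {0..1})" if "s : {0..1}" for s
 proof -
  have "((%s. G 0 + integral {0..s} (%u. G u * a u)) has_real_derivative 0 + G s * a s) (at s within {0..1})"
   by (intro DERIV_add DERIV_const integral_has_real_derivative continuous_intros G a that)
  hence "((%s. G 0 + integral {0..s} (%u. G u * a u)) has_derivative (*) (G s * a s)) (at s within {0..1})" by (simp add: has_field_derivative_def)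
  hence "(G has_derivative (*) (G s * a s)) (at s within {0..1})"
   using has_derivative_transform[of s "{0..1}" G "%s. G 0 + integral {0..s} (%u. G u * a u)"] that eq by blast
  thus ?thesis by (simp add: has_field_derivative_def)
 qed
 have "((%s. G s * exp (- I s)) has_real_derivative 0) (at s within {0..1})" if "s : {0..1}" for s
  using DG[OF that] DI[OF that] by (auto intro!: derivative_eq_intros)
 hence "\<exists>c. \<forall>s\<in>{0..1}. G s * exp (- I s) = c" by (intro has_field_derivative_zero_constant) auto
 hence "G 1 * exp (- I 1) = G 0 * exp (- I 0)" by auto
 thus ?thesis by (simp add: I_def exp_minus field_simps)
qed


lemma tf_translate: fixes h :: "'a::euclidean_space => real" assumes "test_function h"
 shows "test_function (%x. h (x + a))" "dd w (%x. h (x + a)) = (%x. dd w h (x + a))"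
proof -
 have b: "bounded_linear (%x::'a. x)" by (rule bounded_linear_ident)
 obtain K where K: "compact K" "!!x. x \<notin> K ==> h x = 0" using tf_support[OF assms] by blast
 show "test_function (%x. h (x + a))"
 proof (rule tf_I[OF smooth_affine[where L="%x. x" and a=a and f=h, OF b tf_smooth[OF assms]]])
  show "compact ((%x. x - a) ` K)" by (intro compact_continuous_image continuous_intros K)
  show "x \<notin> (%x. x - a) ` K ==> h (x + a) = 0" for x by (metis K(2) add_diff_cancel imageI)
 qed
 show "dd w (%x. h (x + a)) = (%x. dd w h (x + a))"
  using dd_affine[where L="%x. x" and f=h and v=w and a=a, OF b] smooth_differentiable[OF tf_smooth[OF assms]] by simp
qed

context fixes c :: "'a::euclidean_space => real" and g :: "'a => 'a" and v :: 'a assumes ci: "integrable lborel c" and g: "continuous_on UNIV g"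
  and weak: "!!h. test_function h ==>
   (LBINT x. c x * dd v h x) = - (LBINT x. c x * (g x \<bullet> v) * h x)"
begin

lemma weak_c_measurable [measurable]: "c : Borel" using borel_intI[OF ci] by simp

lemma weak_g_measurable [measurable]: "g : Borel" by (rule borel_contI[OF g])

definition "wm q = c q * (g q \<bullet> v)"

lemma wm_measurable [measurable]: "wm : Borel" unfolding wm_def[abs_def] by measurable

lemma wm_line_measurable [measurable]: "(%z. wm (fst z + snd z *R v)): Borel" unfolding borel_prod[symmetric] by measurable

lemma indicator_snd_measurable:
 "(%z. indicator {a..b::real} (snd z) :: real): borel_measurable (borel :: ('a \<times> real) measure)" unfolding borel_prod[symmetric] by measurable

lemma cball_borel [measurable]: "cball (x::'b::metric_space) r : sets borel" by (intro borel_closed closed_cball)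

lemma wm_slab_measurable:
 "(%z. indicator (cball 0 r) (fst z) * indicator {0..1::real} (snd z) * wm (fst z + snd z *R v)): Borel" unfolding borel_prod[symmetric] by measurable

text \<open>For \<open>x\<close> in a ball and \<open>u\<close> in the unit interval the points
  \<open>x + u *R v\<close> stay in a larger ball, on which the continuous \<open>g\<close> is
  bounded; the rest is translation invariance for \<open>c\<close>. This joint integrability
  licenses the later exchanges of integrals.\<close>

lemma wm_slab_integrable:
 "integrable lborel (%z. indicator (cball 0 r) (fst z) * indicator {0..1::real} (snd z) * wm (fst z + snd z *R v))"
proof (rule int_lborel_prodI)
 let ?K = "cball (0::'a) (r + norm v)"
 have "bounded ((%q. g q \<bullet> v) ` ?K)"
  by (intro compact_imp_bounded compact_continuous_image continuous_intros compact_cball continuous_on_subset[OF g]) auto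
 then obtain B where B: "B > 0" "!!q. q : ?K ==> \<bar>g q \<bullet> v\<bar> <= B" unfolding bounded_pos by auto
 have "(NN x. ennreal \<bar>indicator (cball 0 r) x * indicator {0..1} y * wm (x + y *R v)\<bar>)
   <= indicator {0..1} y * (NN x. ennreal (B * \<bar>c x\<bar>))" for y :: real
 proof -
  have "(NN x. ennreal \<bar>indicator (cball 0 r) x * indicator {0..1} y * wm (x + y *R v)\<bar>)
   <= (NN x. indicator {0..1} y * ennreal (B * \<bar>c (x + y *R v)\<bar>))"
  proof (intro nn_integral_mono)
   fix x
   have "\<bar>g (x + y *R v) \<bullet> v\<bar> * \<bar>c (x + y *R v)\<bar> <= B * \<bar>c (x + y *R v)\<bar>" if "norm x <= r" "0 <= y" "y <= 1"
   proof -
    have "norm (x + y *R v) <= norm x + \<bar>y\<bar> * norm v" by (metis norm_scaleR norm_triangle_ineq)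
    also have "\<bar>y\<bar> * norm v <= norm v" using that by (simp add: mult_left_le_one_le)
    finally show ?thesis using that B(2) by (intro mult_right_mono) auto
   qed
   thus "ennreal \<bar>indicator (cball 0 r) x * indicator {0..1} y * wm (x + y *R v)\<bar>
     <= indicator {0..1} y * ennreal (B * \<bar>c (x + y *R v)\<bar>)" by (auto simp: indicator_def wm_def abs_mult mult.commute intro!: ennreal_leI)
  qed
  also have "... = indicator {0..1} y * (NN x. ennreal (B * \<bar>c (x + y *R v)\<bar>))" by (rule nn_integral_cmult) measurable
  also have "(NN x. ennreal (B * \<bar>c (x + y *R v)\<bar>)) = (NN x. ennreal (B * \<bar>c x\<bar>))" by (rule nn_translate) measurable
  finally show ?thesis .
 qed
 hence "(NN y. (NN x. ennreal \<bar>indicator (cball 0 r) x * indicator {0..1} y * wm (x + y *R v)\<bar>))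
   <= (NN y. indicator {0..1::real} y * (NN x. ennreal (B * \<bar>c x\<bar>)))" by (rule nn_integral_mono)
 also have "... = (NN x. ennreal (B * \<bar>c x\<bar>))" by (subst nn_integral_multc) auto
 also have "... < \<infinity>"
 proof -
  have "integrable lborel (%x. B * \<bar>c x\<bar>)" using ci by simp
  thus ?thesis unfolding integrable_iff_bounded using B by (simp add: abs_mult)
 qed
 finally show "(NN y. (NN x. ennreal \<bar>indicator (cball 0 r) (fst (x, y)) * indicator {0..1::real} (snd (x, y))
   * wm (fst (x, y) + snd (x, y) *R v)\<bar>)) < \<infinity>" by simp
qed (rule wm_slab_measurable)

text \<open>The increment that \<open>c\<close> should have on the segment from \<open>q\<close> to
  \<open>q + s *R v\<close>. On the null set of lines where the integrand is not integrable, the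
  integral is zero by convention.\<close>

definition "wM q s = (LBINT u. indicator {0..s} u * wm (q + u *R v))"

lemma wm_slab_integrable': assumes "s : {0..1}"
 shows "integrable lborel (%z. indicator (cball 0 r) (fst z) * (indicator {0..s} (snd z) * wm (fst z + snd z *R v)))"
proof -
 have "(%z::'a \<times> real. indicator {0..s} (snd z) :: real): borel_measurable lborel" using indicator_snd_measurable by simp
 from int_mult_bounded[OF wm_slab_integrable this, of 1 r]
 show ?thesis by (rule Bochner_Integration.integrable_cong[THEN iffD1, rotated -1])
    (use assms in \<open>auto simp: indicator_def\<close>)
qed

text \<open>The weak equation is tested with the translates of \<open>h\<close> by
  \<open>u *R v\<close>, for \<open>u\<close> between 0 and \<open>s\<close>, and integrated over
  \<open>u\<close>. On one side the fundamental theorem of calculus produces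
  \<open>h (q - s *R v) - h q\<close>; on the other a shift of the variable moves the translation
  onto \<open>wm\<close>.\<close>

lemma weak_line_difference_test: assumes s: "s : {0..1}" and t: "test_function h" shows "(LBINT q. (c (q + s *R v) - c q - wM q s) * h q) = 0"
proof -
 note [measurable] = tf_measurable[OF t] tf_measurable[OF tf_dd[OF t, of v]]
 obtain B where B: "!!x. \<bar>dd v h x\<bar> <= B" using tf_bounded[OF tf_dd[OF t]] by blast
 obtain R where R: "R > 0" "!!x. norm x > R ==> h x = 0" using tf_support_cball[OF t] by blast
 define F where "F z = c (fst z) * (- dd v h (fst z + (- snd z) *R v) * indicator {0..s} (snd z))" for z
 have [measurable]: "F : Borel" unfolding F_def[abs_def] borel_prod[symmetric] by measurable
 have F0: "\<bar>F z\<bar> <= \<bar>c (fst z)\<bar> * (B * indicator {0..1} (snd z))" for z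
  unfolding F_def abs_mult using s B[of "fst z + (- snd z) *R v"] by (intro mult_left_mono) (auto simp: indicator_def)
 have Fi: "integrable lborel F"
 proof (rule int_bound)
  show "integrable lborel (%z. \<bar>c (fst z)\<bar> * (B * indicator {0..1::real} (snd z)))" by (rule int_tensor) (use ci in simp_all)
  show "AE z in lborel. norm (F z) <= norm (\<bar>c (fst z)\<bar> * (B * indicator {0..1::real} (snd z)))"
   using F0 by (intro AE_I2) (metis abs_ge_self order_trans real_norm_def)
 qed simp
 have cont: "continuous_on UNIV (%u. - dd v h (q + (- u) *R v))" for q by (intro continuous_on_minus cont_comp[OF
    smooth_cont[OF smooth_dd[OF tf_smooth[OF t]], of UNIV]] continuous_intros) auto
 have inner: "(LBINT u. F (q, u)) = c q * (h (q - s *R v) - h q)" for q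
 proof -
  have "(LBINT u. (- dd v h (q + (- u) *R v)) * indicator {0..s} u) = h (q + (- s) *R v) - h (q + (- 0) *R v)"
  proof (rule integral_FTC_Icc_real)
   show "0 <= s" using s by simp
   show "DERIV (%u. h (q + (- u) *R v)) u :> - dd v h (q + (- u) *R v)" for u
   proof -
    have "((%u. h (q + (- u) *R v)) has_real_derivative dd v h (q + (- u) *R v) * (- 1)) (at u)"
     by (rule DERIV_chain2[where f="%s. h (q + s *R v)" and g=uminus,
       OF smooth_DERIV_line[OF tf_smooth[OF t]] DERIV_minus[OF DERIV_ident]])
    thus ?thesis by simp
   qed
   show "isCont (%u. - dd v h (q + (- u) *R v)) u" for u using cont by (simp add: continuous_on_eq_continuous_at)
  qed
  thus ?thesis unfolding F_def fst_conv snd_conv integral_mult_right_zero by simp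
 qed
 have slice: "(LBINT q. F (q, u)) = indicator {0..s} u * (LBINT q. wm (q + u *R v) * h q)" for u
 proof -
  have "(LBINT q. F (q, u)) = - indicator {0..s} u * (LBINT q. c q * dd v h (q + (- u) *R v))"
   by (subst integral_mult_right_zero[symmetric]) (simp add: F_def ac_simps)
  also have "(LBINT q. c q * dd v h (q + (- u) *R v)) = - (LBINT q. wm q * h (q + (- u) *R v))" using weak[OF tf_translate(1)[OF t, of "(- u) *R v"]]
   unfolding tf_translate(2)[OF t] wm_def .
  also have "(LBINT q. wm q * h (q + (- u) *R v)) = (LBINT q. wm (q + u *R v) * h q)"
   using integral_translate[of "%q. wm q * h (q + (- u) *R v)" "u *R v"] by simp
  finally show ?thesis by simp
 qed
 define G where "G z = (indicator (cball 0 R) (fst z) * (indicator {0..s} (snd z) * wm (fst z + snd z *R v))) * h (fst z)" for z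
 have Gi: "integrable lborel G"
 proof -
  obtain C where "!!x. \<bar>h x\<bar> <= C" using tf_bounded[OF t] by blast
  moreover have "(%z::'a \<times> real. h (fst z)): borel_measurable lborel" using meas_comp[OF borel_fst tf_measurable[OF t]] by simp
  ultimately show ?thesis unfolding G_def using int_mult_bounded[OF wm_slab_integrable'[OF s]] by blast
 qed
 have hR: "indicator (cball 0 R) q * h q = h q" for q using R by (auto simp: indicator_def not_le)
 have Gq: "(LBINT u. G (q, u)) = wM q s * h q" for q
 proof -
  have "(LBINT u. G (q, u)) = (LBINT u. (indicator {0..s} u * wm (q + u *R v)) * (indicator (cball 0 R) q * h q))" by (simp add: G_def ac_simps)
  thus ?thesis by (simp add: hR wM_def)
 qed
 have Gu: "(LBINT q. G (q, u)) = indicator {0..s} u * (LBINT q. wm (q + u *R v) * h q)" for u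
 proof -
  have "(LBINT q. G (q, u)) = (LBINT q. indicator {0..s} u * (wm (q + u *R v) * (indicator (cball 0 R) q * h q)))" by (simp add: G_def ac_simps)
  thus ?thesis by (simp add: hR)
 qed
 have "(LBINT q. c q * (h (q - s *R v) - h q)) = (LBINT q. wM q s * h q)"
  using lborel_fubini(1,2)[OF Fi] lborel_fubini(1,2)[OF Gi] unfolding inner slice Gq Gu by simp
 moreover have "(LBINT q. c q * h (q - s *R v)) = (LBINT q. c (q + s *R v) * h q)"
  using integral_translate[of "%q. c q * h (q - s *R v)" "s *R v"] by simp
 moreover have i1: "integrable lborel (%q. c q * h (q - s *R v))" using int_mult_test[OF ci tf_translate(1)[OF t, of "- (s *R v)"]] by simp
 moreover have i2: "integrable lborel (%q. c q * h q)" by (rule int_mult_test[OF ci t])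
 moreover have i3: "integrable lborel (%q. c (q + s *R v) * h q)" by (rule int_mult_test[OF int_translate[OF ci] t])
 moreover have i4: "integrable lborel (%q. wM q s * h q)" using lborel_fubini(5)[OF Gi] by (simp add: Gq)
 ultimately show ?thesis by (simp add: algebra_simps)
qed

lemma weak_line_difference_AE: assumes s: "s : {0..1}" shows "AE q in lborel. c (q + s *R v) = c q + wM q s"
proof -
 have [measurable]: "(%q. wM q s): Borel" unfolding wM_def[abs_def] by (rule lborel.borel_measurable_lebesgue_integral)
    (simp add: split_beta' borel_prod lborel_prod cong: measurable_cong_sets)
 have "AE q in lborel. c (q + s *R v) - c q - wM q s = 0"
 proof (rule AE_eq_0_box_bump)
  show "(LBINT x. (c (x + s *R v) - c x - wM x s) * box_bump a b k x) = 0" if "\<forall>i\<in>Basis. a \<bullet> i < b \<bullet> i" for a b k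
   by (rule weak_line_difference_test[OF s box_bump_test_function[OF that]])
  fix a b :: 'a
  obtain r where r: "box a b \<subseteq> cball 0 r" using bounded_subset_ballD[OF bounded_box[of a b], of 0] ball_subset_cball by (meson subset_trans)
  have "integrable lborel (%q. indicator (cball 0 r) q * wM q s)" using lborel_fubini(5)[OF wm_slab_integrable'[OF s, of r]] by (simp add: wM_def)
  hence "integrable lborel (%q. (indicator (cball 0 r) q * wM q s) * indicator (box a b) q)"
   by (rule int_mult_bounded[where B=1]) (auto simp: indicator_def)
  moreover have "(%q. (indicator (cball 0 r) q * wM q s) * indicator (box a b) q) = (%q. indicator (box a b) q * wM q s)"
   using r by (auto simp: indicator_def fun_eq_iff)
  ultimately have "integrable lborel (%q. indicator (box a b) q * wM q s)" by simp
  moreover have "integrable lborel (%q. (c (q + s *R v) - c q) * indicator (box a b) q)" by (rule int_mult_bounded[where B=1])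
     (use ci int_translate[OF ci] in \<open>auto simp: indicator_def\<close>)
  ultimately have "integrable lborel (%q. (c (q + s *R v) - c q) * indicator (box a b) q - indicator (box a b) q * wM q s)"
   by (rule Bochner_Integration.integrable_diff[rotated])
  thus "integrable lborel (%x. indicator (box a b) x * (c (x + s *R v) - c x - wM x s))" by (simp add: algebra_simps)
 qed measurable
 thus ?thesis by eventually_elim simp
qed

text \<open>The exceptional set of \<open>weak_line_difference_AE\<close> depends on
  \<open>s\<close>. Fubini exchanges the quantifiers: on almost every line the identity holds for
  almost all \<open>s\<close>, and there \<open>c\<close> agrees with the solution of a linear
  differential equation.\<close>

lemma weak_line_exp_AE:
 "AE q in lborel. c (q + v) = c q * exp (integral {0..1} (%u. g (q + u *R v) \<bullet> v))"
proof -
 have wMm: "(%z. wM (fst z) (snd z)): borel_measurable (borel :: ('a \<times> real) measure)"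
 proof -
  have "(%z :: 'a \<times> real. LBINT u. (if 0 <= u \<and> u <= snd z then 1 else 0) * wm (fst z + u *R v)): borel_measurable (borel \<Otimes>\<^sub>M borel)"
   by measurable
  moreover have "wM (fst z) (snd z) = (LBINT u. (if 0 <= u \<and> u <= snd z then 1 else 0) * wm (fst z + u *R v))" for z
   unfolding wM_def by (intro lint_cong) (auto simp: indicator_def)
  ultimately show ?thesis unfolding borel_prod[symmetric] by simp
 qed
 have cm: "(%z. c (fst z + snd z *R v)): borel_measurable (borel :: ('a \<times> real) measure)"
  "(%z. c (fst z)): borel_measurable (borel :: ('a \<times> real) measure)" unfolding borel_prod[symmetric] by measurable
 have "AE s in lborel. AE q in lborel. s : {0..1} \<longrightarrow> c (q + s *R v) = c q + wM q s"
 proof (rule AE_I2)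
  fix s :: real
  show "AE q in lborel. s : {0..1} \<longrightarrow> c (q + s *R v) = c q + wM q s" using weak_line_difference_AE[of s] by (cases "s : {0..1}") auto
 qed
 moreover have "{z. snd z : {0..1} \<longrightarrow> c (fst z + snd z *R v) = c (fst z) + wM (fst z) (snd z)} : sets (borel :: ('a \<times> real) measure)"
 proof -
  have "(%z. c (fst z) + wM (fst z) (snd z)): borel_measurable (borel :: ('a \<times> real) measure)" by (intro borel_measurable_add cm wMm)
  hence A: "{z : space borel. c (fst z + snd z *R v) = c (fst z) + wM (fst z) (snd z)} : sets (borel :: ('a \<times> real) measure)"
   using cm(1) by (intro borel_measurable_eq)
  have o: "open (- (snd -` {0..1}) :: ('a \<times> real) set)" by (intro open_Compl closed_vimage continuous_intros closed_atLeastAtMost)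
  have "{z. snd z : {0..1} \<longrightarrow> c (fst z + snd z *R v) = c (fst z) + wM (fst z) (snd z)}
   = - (snd -` {0..1}) \<union> {z : space borel. c (fst z + snd z *R v) = c (fst z) + wM (fst z) (snd z)}" by auto
  thus ?thesis using sets.Un[OF borel_open[OF o] A] by (simp only:)
 qed
 ultimately have ae1: "AE q in lborel. AE s in lborel. s : {0..1} \<longrightarrow> c (q + s *R v) = c q + wM q s"
  by (rule AE_lborel_swap[where P="%q s. s : {0..1} \<longrightarrow> c (q + s *R v) = c q + wM q s", rotated])
 have "AE q in lborel. \<forall>n::nat. integrable lborel (%u. indicator (cball 0 (real n)) q * indicator {0..1} u * wm (q + u *R v))"
  using lborel_fubini(3)[OF wm_slab_integrable] by (simp add: AE_all_countable)
 \<comment> \<open>Almost all \<open>s\<close> need not include the endpoint, so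
   \<open>s = 1\<close> is added with a null set of its own.\<close>
 moreover have "AE q in lborel. c (q + 1 *R v) = c q + wM q 1" by (rule weak_line_difference_AE) simp
 ultimately show ?thesis using ae1
 proof eventually_elim
  case (elim q)
  define a where "a u = g (q + u *R v) \<bullet> v" for u
  have ac: "continuous_on S a" for S unfolding a_def[abs_def] by (intro continuous_intros cont_comp[OF g]) auto
  obtain n where "norm q <= real n" using real_arch_simple by blast
  with elim(1) have int: "integrable lborel (%u. indicator {0..1} u * wm (q + u *R v))" by (auto dest!: spec[of _ n])
  \<comment> \<open>\<open>G\<close> is the continuous representative of \<open>c\<close> on the
    line; agreement for almost all \<open>s\<close> is enough inside the integral equation.\<close>
  define G where "G s = c q + wM q s" for s
  have si: "set_integrable lborel {0..s} (%u. wm (q + u *R v))" if "s : {0..1}" for s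
  proof -
   have "integrable lborel (%u. (indicator {0..1} u * wm (q + u *R v)) * indicator {0..s} u)"
    by (rule int_mult_bounded[OF int, where B=1]) (auto simp: indicator_def)
   also have "(%u. (indicator {0..1} u * wm (q + u *R v)) * indicator {0..s} u) = (%u. indicator {0..s} u *R wm (q + u *R v))"
    using that by (auto simp: indicator_def fun_eq_iff)
   finally show ?thesis by (simp add: set_integrable_def)
  qed
  have wMi: "wM q s = integral {0..s} (%u. wm (q + u *R v))" if "s : {0..1}" for s
   using set_borel_integral_eq_integral(2)[OF si[OF that]] by (simp add: wM_def set_lebesgue_integral_def)
  have Gc: "continuous_on {0..1} G"
  proof -
   have "continuous_on {0..1} (%s. c q + integral {0..s} (%u. wm (q + u *R v)))"
    by (intro continuous_intros indefinite_integral_continuous_1 set_borel_integral_eq_integral(1)[OF si]) simp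
   also have "?this \<longleftrightarrow> continuous_on {0..1} G" by (rule continuous_on_cong[OF refl]) (simp add: G_def wMi)
   finally show ?thesis .
  qed
  have Geq: "G s = G 0 + integral {0..s} (%u. G u * a u)" if s: "s : {0..1}" for s
  proof -
   have "set_integrable lborel {0..s} (%u. G u * a u)" unfolding set_integrable_def
    using s by (intro borel_integrable_compact continuous_intros ac continuous_on_subset[OF Gc]) auto
   hence "integral {0..s} (%u. G u * a u) = (LBINT u. indicator {0..s} u * (G u * a u))"
    using set_borel_integral_eq_integral(2)[of "{0..s}" "%u. G u * a u"] by (simp add: set_lebesgue_integral_def)
   also have "... = (LBINT u. indicator {0..s} u * wm (q + u *R v))"
   proof (rule integral_cong_AE)
    show "(%u. indicator {0..s} u * (G u * a u)): borel_measurable lborel"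
     using \<open>set_integrable lborel {0..s} (%u. G u * a u)\<close> unfolding set_integrable_def by (auto dest: borel_intI)
    show "AE u in lborel. indicator {0..s} u * (G u * a u) = indicator {0..s} u * wm (q + u *R v)"
     using elim(3) by eventually_elim (use s in \<open>auto simp: indicator_def G_def wm_def a_def\<close>)
   qed measurable
   also have "... = wM q s" by (simp add: wM_def)
   finally have "integral {0..s} (%u. G u * a u) = wM q s" .
   moreover have "wM q 0 = 0" using wMi[of 0] by simp
   ultimately show ?thesis by (simp add: G_def)
  qed
  have "G 1 = G 0 * exp (integral {0..1} a)" by (rule linear_ode_solution[OF Gc ac Geq])
  moreover have "wM q 0 = 0" using wMi[of 0] by simp
  ultimately show ?case using elim(2) by (simp add: G_def a_def[abs_def])
 qed
qed

end


declare weak_c_measurable [measurable del] weak_g_measurable [measurable del]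
 wm_measurable [measurable del] wm_line_measurable [measurable del]

lemma continuous_on_line_integral: fixes g :: "'a::euclidean_space => 'a" assumes g: "continuous_on UNIV g"
 shows "continuous_on UNIV (%z. integral {0..1} (%u. g (fst z + u *R snd z) \<bullet> snd z))"
proof -
 have "continuous_on (UNIV \<times> cbox 0 1) (%(z, u). g (fst z + u *R snd z) \<bullet> snd z)" unfolding split_beta'
  by (intro continuous_on_inner cont_comp[OF g] continuous_intros) auto
 from integral_continuous_on_param[OF this] show ?thesis by simp
qed

text \<open>The null set of the line identity depends on \<open>v\<close>; exchanging quantifiers
  provides one base point \<open>q0\<close> that serves almost all \<open>v\<close> and defines
  \<open>V\<close>. The increment formula for \<open>V\<close> holds at first for almost all
  \<open>x\<close>, then for all by continuity, and it makes \<open>g\<close> conservative without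
  any derivative of \<open>g\<close>.\<close>

lemma weak_gradient_potential: fixes c :: "'a::euclidean_space => real" and g :: "'a => 'a"
 assumes ci: "integrable lborel c" and pos: "AE x in lborel. 0 < c x" and g: "continuous_on UNIV g" and weak: "!!h v. test_function h ==>
   (LBINT x. c x * dd v h x) = - (LBINT x. c x * (g x \<bullet> v) * h x)" obtains V where "continuous_on UNIV V"
  "!!x v. V (x + v) = V x + integral {0..1} (%u. g (x + u *R v) \<bullet> v)"
  "AE x in lborel. c x = exp (V x)"
proof -
 define L where "L q v = integral {0..1} (%u. g (q + u *R v) \<bullet> v)" for q v
 have Lc: "continuous_on UNIV (%z. L (fst z) (snd z))" using continuous_on_line_integral[OF g] by (simp add: L_def)
 have [measurable]: "c : Borel" using borel_intI[OF ci] by simp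
 have line: "AE q in lborel. c (q + v) = c q * exp (L q v)" for v unfolding L_def by (rule weak_line_exp_AE[OF ci g weak])
 have [measurable]: "(%z. L (fst z) (snd z)): borel_measurable (borel \<Otimes>\<^sub>M borel)" unfolding borel_prod by (rule borel_contI[OF Lc])
 have "{z : space (borel \<Otimes>\<^sub>M borel). c (fst z + snd z) = c (fst z) * exp (L (fst z) (snd z))} : sets (borel \<Otimes>\<^sub>M borel)"
  by measurable
 hence "{z. c (fst z + snd z) = c (fst z) * exp (L (fst z) (snd z))} : sets borel" unfolding borel_prod by simp
 hence "AE q in lborel. AE v in lborel. c (q + v) = c q * exp (L q v)"
  by (rule AE_lborel_swap[where P="%q v. c (q + v) = c q * exp (L q v)"]) (simp add: line)
 with pos have "AE q in lborel. 0 < c q \<and> (AE v in lborel. c (q + v) = c q * exp (L q v))" by eventually_elim simp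
 then obtain q0 where q0: "0 < c q0" "AE v in lborel. c (q0 + v) = c q0 * exp (L q0 v)" by (rule AE_lborel_obtain) blast
 define V where "V x = ln (c q0) + L q0 (x - q0)" for x
 have Vc: "continuous_on UNIV V" unfolding V_def by (intro continuous_intros cont_comp[OF Lc, of _ "%x. (q0, x - q0)", simplified])
 have Vc': "continuous_on UNIV (%x. V (x + v))" for v by (rule cont_comp[OF Vc]) (auto intro!: continuous_intros)
 have Lc': "continuous_on UNIV (%q. L q v)" for v by (rule cont_comp[OF Lc, of _ "%q. (q, v)", simplified]) (auto intro!: continuous_intros)
 have cV: "AE x in lborel. c x = exp (V x)"
  using AE_translate[OF q0(2), of "- q0"] by eventually_elim (use q0(1) in \<open>simp add: V_def exp_add\<close>)
 have VL: "V (x + v) = V x + L x v" for x v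
 proof (rule AE_lborel_continuous_eq[where f="%x. V (x + v)" and g="%x. V x + L x v"])
  show "AE x in lborel. V (x + v) = V x + L x v" using line[of v] cV AE_translate[OF cV, of v]
  proof eventually_elim
   case (elim x)
   hence "exp (V (x + v)) = exp (V x + L x v)" by (simp add: exp_add)
   thus ?case by (simp only: exp_inj_iff)
  qed
 qed (intro continuous_on_add Vc Vc' Lc')+
 show ?thesis by (rule that[OF Vc _ cV]) (use VL in \<open>simp add: L_def\<close>)
qed

text \<open>Path independence is contained in the hypothesis on \<open>V\<close>, so
  differentiability rests only on \<open>g\<close> varying little along a short segment from
  \<open>x\<close>.\<close>

lemma line_integral_potential_GDERIV: fixes V :: "'a::euclidean_space => real" assumes g: "continuous_on UNIV g"
  and V: "!!x v. V (x + v) = V x + integral {0..1} (%u. g (x + u *R v) \<bullet> v)" shows "GDERIV V x :> g x"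
proof -
 have gl: "(%u. g (x + u *R v) \<bullet> v) integrable_on {0..1}" for v
  by (intro integrable_continuous_interval continuous_intros cont_comp[OF g]) auto
 have "\<exists>d>0. \<forall>y. norm (y - x) < d \<longrightarrow> \<bar>V y - V x - (y - x) \<bullet> g x\<bar> <= e * norm (y - x)" if e: "e > 0" for e
 proof -
  obtain d where d: "d > 0" "!!y. dist y x < d ==> dist (g y) (g x) < e" using g e unfolding continuous_on_iff by (metis UNIV_I)
  have "\<bar>V y - V x - (y - x) \<bullet> g x\<bar> <= e * norm (y - x)" if y: "norm (y - x) < d" for y
  proof -
   define v where "v = y - x"
   have "V y - V x = integral {0..1} (%u. g (x + u *R v) \<bullet> v)" using V[of x v] by (simp add: v_def)
   hence "V y - V x - v \<bullet> g x = integral {0..1} (%u. g (x + u *R v) \<bullet> v) - integral {0..1::real} (%u. g x \<bullet> v)"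
    by (simp add: inner_commute)
   also have "... = integral {0..1} (%u. g (x + u *R v) \<bullet> v - g x \<bullet> v)" by (rule integral_diff[symmetric]) (auto intro: gl)
   also have "norm ... <= (e * norm v) * (1 - 0)"
   proof (rule integral_bound)
    show "continuous_on {0..1} (%u. g (x + u *R v) \<bullet> v - g x \<bullet> v)" by (intro continuous_intros cont_comp[OF g]) auto
    fix u :: real assume u: "u : {0..1}"
    have "dist (x + u *R v) x < d" using u y mult_left_le_one_le[of "norm v" u] by (simp add: dist_norm v_def)
    hence "norm (g (x + u *R v) - g x) <= e" using d(2) by (fastforce simp: dist_norm)
    hence "norm (g (x + u *R v) - g x) * norm v <= e * norm v" by (intro mult_right_mono) auto
    thus "norm (g (x + u *R v) \<bullet> v - g x \<bullet> v) <= e * norm v"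
     using Cauchy_Schwarz_ineq2[of "g (x + u *R v) - g x" v] by (simp add: inner_diff_left)
   qed simp
   finally show ?thesis by (simp add: v_def)
  qed
  thus ?thesis using d(1) by blast
 qed
 thus ?thesis unfolding gderiv_def has_derivative_at_alt by (simp add: bounded_linear_inner_left)
qed

interpretation lborel_product: product_sigma_finite "%_::'i. lborel :: real measure" ..

lemma lborel_eq_PiM: "lborel = distr (\<Pi>\<^sub>M b\<in>(Basis::'a::euclidean_space set). (lborel :: real measure)) borel (%f. \<Sum>b\<in>Basis. f b *R b)"
 by (subst lborel_def) (simp add: lborel_eq_real)

lemma sum_Basis_measurable [measurable]:
 "(%f. \<Sum>b\<in>Basis. f b *R b): measurable (\<Pi>\<^sub>M b\<in>(Basis::'a::euclidean_space set). (lborel :: real measure)) (borel :: 'a measure)"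
 by measurable

text \<open>Stated over normed fields because the characteristic function of the Gaussian is
  computed with complex values.\<close>

lemma fixes f :: "'a::euclidean_space => real => 'c::{real_normed_field, banach, second_countable_topology}"
 assumes f: "!!b. b : Basis ==> integrable lborel (f b)"
 shows integrable_prod_Basis: "integrable lborel (%x. \<Prod>b\<in>Basis. f b (x \<bullet> b))"
  and integral_prod_Basis: "(LBINT x. (\<Prod>b\<in>Basis. f b (x \<bullet> b))) = (\<Prod>b\<in>Basis. LBINT t. f b t)"
proof -
 have [measurable]: "f b : Borel" if "b : Basis" for b using borel_intI[OF f[OF that]] by simp
 have m: "(%x. \<Prod>b\<in>Basis. f b (x \<bullet> b)): Borel" by measurable
 have eq: "(\<Prod>b\<in>Basis. f b ((\<Sum>b\<in>Basis. x b *R b) \<bullet> b)) = (\<Prod>b\<in>Basis. f b (x b))" for x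
  by (intro prod.cong refl) (simp add: inner_sum_left_Basis)
 have "integrable (\<Pi>\<^sub>M b\<in>(Basis::'a set). lborel) (%x. \<Prod>b\<in>Basis. f b (x b))"
  by (rule lborel_product.product_integrable_prod) (use f in auto)
 thus "integrable lborel (%x. \<Prod>b\<in>Basis. f b (x \<bullet> b))" by (subst lborel_eq_PiM, subst integrable_distr_eq[OF _ m]) (auto simp: eq)
 have "(LBINT x. (\<Prod>b\<in>Basis. f b (x \<bullet> b))) = integral\<^sup>L (\<Pi>\<^sub>M b\<in>(Basis::'a set). lborel) (%x. \<Prod>b\<in>Basis. f b (x b))"
  by (subst lborel_eq_PiM, subst integral_distr[OF _ m]) (auto simp: eq)
 also have "... = (\<Prod>b\<in>Basis. LBINT t. f b t)" by (rule lborel_product.product_integral_prod) (use f in auto)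
 finally show "(LBINT x. (\<Prod>b\<in>Basis. f b (x \<bullet> b))) = (\<Prod>b\<in>Basis. LBINT t. f b t)" .
qed

section \<open>Gaussian densities\<close>

text \<open>\<open>v\<close> is the deviation per coordinate, not the variance. The product form
  gives access to one-dimensional moments and matches the law prescribed for Brownian
  increments.\<close>

definition gauss :: "real => 'a::euclidean_space => real" where
 "gauss v x = (\<Prod>b\<in>Basis. normal_density 0 v (x \<bullet> b))"

lemma norm_power2_Basis: "(norm x)^2 = (\<Sum>b\<in>Basis. (x \<bullet> b)^2)" for x :: "'a::euclidean_space"
 unfolding power2_norm_eq_inner by (subst euclidean_inner) (simp add: power2_eq_square)

lemma gauss_eq: "gauss v (x::'a::euclidean_space) = (1 / sqrt (2 * pi * v^2)) ^ DIM('a) * exp (- (norm x)\<^sup>2 / (2 * v^2))"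
proof -
 have "gauss v x = (\<Prod>b\<in>(Basis::'a set). 1 / sqrt (2 * pi * v^2)) * (\<Prod>b\<in>Basis. exp (- (x \<bullet> b)\<^sup>2 / (2 * v^2)))"
  unfolding gauss_def normal_density_def by (subst prod.distrib) simp
 also have "(\<Prod>b\<in>Basis. exp (- (x \<bullet> b)\<^sup>2 / (2 * v^2))) = exp (\<Sum>b\<in>Basis. - (x \<bullet> b)\<^sup>2 / (2 * v^2))"
  by (simp add: exp_sum)
 also have "(\<Sum>b\<in>Basis. - (x \<bullet> b)\<^sup>2 / (2 * v^2)) = - (norm x)\<^sup>2 / (2 * v^2)"
  unfolding norm_power2_Basis by (simp only: sum_divide_distrib[symmetric] sum_negf)
 finally show ?thesis by simp
qed

lemma gauss_pos: "v > 0 ==> gauss v x > 0" by (simp add: gauss_def prod_pos normal_density_pos)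

lemma gauss_nonneg: "0 <= gauss v x" by (simp add: gauss_def prod_nonneg)

lemma gauss_measurable [measurable]: "gauss v : Borel" unfolding gauss_def[abs_def] by measurable

lemma gauss_uminus: "gauss v (- x) = gauss v x" by (simp add: gauss_eq)

lemma int_gauss: "v > 0 ==> integrable lborel (gauss v)" unfolding gauss_def[abs_def] by (rule integrable_prod_Basis) simp

lemma integral_gauss: "v > 0 ==> (LBINT x. gauss v x) = 1" unfolding gauss_def by (subst integral_prod_Basis) auto

lemma normal_density_char: assumes "v > 0" shows "integrable lborel (%x. complex_of_real (normal_density 0 v x) * iexp (t * x))"
  and "(LBINT x. complex_of_real (normal_density 0 v x) * iexp (t * x)) = complex_of_real (exp (- (v^2 * t^2) / 2))"
proof -
 show "integrable lborel (%x. complex_of_real (normal_density 0 v x) * iexp (t * x))"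
 proof (rule int_bound)
  show "integrable lborel (normal_density 0 v)" using assms by simp
  show "AE x in lborel. norm (complex_of_real (normal_density 0 v x) * iexp (t * x)) <= norm (normal_density 0 v x)" by (simp add: norm_mult)
 qed measurable
 have "(LBINT x. complex_of_real (normal_density 0 v x) * iexp (t * x))
   = \<bar>v\<bar> *R (LBINT x. complex_of_real (normal_density 0 v (0 + v * x)) * iexp (t * (0 + v * x)))"
  by (rule lborel_integral_real_affine) (use assms in simp)
 also have "... = (LBINT x. std_normal_density x *R iexp ((t * v) * x))"
 proof -
  have "v *R (complex_of_real (normal_density 0 v (v * x)) * iexp (t * (v * x))) = std_normal_density x *R iexp ((t * v) * x)" for x
  proof -
   have "v * normal_density 0 v (v * x) = std_normal_density x" using assms by (simp add: normal_density_def power_mult_distrib real_sqrt_mult)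
   thus ?thesis by (simp add: scaleR_conv_of_real mult.assoc[symmetric] flip: of_real_mult)
  qed
  thus ?thesis using assms by (simp flip: integral_scaleR_right)
 qed
 also have "... = char std_normal_distribution (t * v)" unfolding char_def by (subst integral_density) auto
 also have "... = complex_of_real (exp (- (v^2 * t^2) / 2))" by (simp add: char_std_normal_distribution power_mult_distrib mult.commute)
 finally show "(LBINT x. complex_of_real (normal_density 0 v x) * iexp (t * x)) = complex_of_real (exp (- (v^2 * t^2) / 2))" .
qed

text \<open>The phase \<open>h\<close> makes one real identity serve for cosine and sine, so that
  later arguments stay real.\<close>

lemma integral_gauss_cos: fixes y :: "'a::euclidean_space" assumes "v > 0"
 shows "(LBINT x. gauss v x * cos (y \<bullet> x + h)) = exp (- (v^2 * (norm y)^2) / 2) * cos h"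
proof -
 let ?f = "%b x. complex_of_real (normal_density 0 v x) * iexp ((y \<bullet> b) * x)"
 have eq: "(\<Prod>b\<in>Basis. ?f b (x \<bullet> b)) = complex_of_real (gauss v x) * iexp (y \<bullet> x)" for x :: 'a
 proof -
  have "(\<Prod>b\<in>Basis. ?f b (x \<bullet> b)) = complex_of_real (gauss v x) * exp (\<Sum>b\<in>Basis. \<i> * ((y \<bullet> b) * (x \<bullet> b)))"
   by (simp add: prod.distrib gauss_def exp_sum)
  also have "(\<Sum>b\<in>Basis. \<i> * ((y \<bullet> b) * (x \<bullet> b))) = \<i> * complex_of_real (y \<bullet> x)"
   by (simp add: euclidean_inner[of y x] sum_distrib_left)
  finally show ?thesis .
 qed
 have i: "integrable lborel (%x::'a. complex_of_real (gauss v x) * iexp (y \<bullet> x))"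
  using integrable_prod_Basis[of ?f, OF normal_density_char(1)[OF assms]] unfolding eq .
 have "(LBINT x. complex_of_real (gauss v x) * iexp (y \<bullet> x)) = (\<Prod>b\<in>Basis. complex_of_real (exp (- (v^2 * (y \<bullet> b)^2) / 2)))"
  using integral_prod_Basis[of ?f, OF normal_density_char(1)[OF assms]] unfolding eq normal_density_char(2)[OF assms] .
 also have "... = complex_of_real (exp (\<Sum>b\<in>Basis. - (v^2 * (y \<bullet> b)^2) / 2))" by (simp add: exp_sum)
 also have "(\<Sum>b\<in>Basis. - (v^2 * (y \<bullet> b)^2) / 2) = - (v^2 * (norm y)^2) / 2"
  unfolding norm_power2_Basis by (simp only: sum_distrib_left sum_divide_distrib[symmetric] sum_negf)
 finally have I: "(LBINT x. complex_of_real (gauss v x) * iexp (y \<bullet> x)) = complex_of_real (exp (- (v^2 * (norm y)^2) / 2))" .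
 have i2: "integrable lborel (%x::'a. complex_of_real (gauss v x) * iexp (y \<bullet> x) * iexp h)" using i by simp
 have "(LBINT x. Re (complex_of_real (gauss v x) * iexp (y \<bullet> x) * iexp h)) = Re (complex_of_real (exp (- (v^2 * (norm y)^2) / 2)) * iexp h)"
  using integral_Re[OF i2] by (simp add: I)
 moreover have "Re (complex_of_real (gauss v x) * iexp (y \<bullet> x) * iexp h) = gauss v x * cos (y \<bullet> x + h)" for x
  by (simp add: cis_conv_exp[symmetric] cos_add cis.simps algebra_simps)
 ultimately show ?thesis by (simp add: cis_conv_exp[symmetric])
qed

lemma integral_gauss_scale: fixes f :: "'a::euclidean_space => real" assumes v: "v > 0" and [measurable]: "f : Borel"
 shows "(LBINT x. gauss v x * f x) = (LBINT x. gauss 1 x * f (v *R x))"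
proof -
 have "(LBINT x. gauss v x * f x) = (LINT x|density (distr lborel borel (%x. 0 + v *R x)) (%_. \<bar>v\<bar>^DIM('a)). gauss v x * f x)"
  using lborel_affine[of v "0::'a"] v by simp
 also have "... = (LINT x|distr lborel borel (%x. 0 + v *R x). \<bar>v\<bar>^DIM('a) *R (gauss v x * f x))" by (rule integral_density) auto
 also have "... = (LBINT x. \<bar>v\<bar>^DIM('a) *R (gauss v (0 + v *R x) * f (0 + v *R x)))" by (rule integral_distr) auto
 also have "... = (LBINT x. gauss 1 x * f (v *R x))"
 proof (intro lint_cong refl)
  fix x :: 'a
  have "v ^ DIM('a) * gauss v (v *R x) = gauss 1 x" using v by (simp add: gauss_eq power_mult_distrib real_sqrt_mult power_divide)
  thus "\<bar>v\<bar>^DIM('a) *R (gauss v (0 + v *R x) * f (0 + v *R x)) = gauss 1 x * f (v *R x)" using v by (simp add: mult.assoc[symmetric])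
 qed
 finally show ?thesis .
qed

lemma int_gauss_norm_power:
 "integrable lborel (%x::'a::euclidean_space. gauss 1 x * norm x ^ k)"
proof -
 have even: "integrable lborel (%x::'a. gauss 1 x * norm x ^ (2 * k))" for k
 proof (rule int_bound)
  show "integrable lborel (%x::'a. (4 ^ k * fact k * sqrt 2 ^ DIM('a)) * gauss (sqrt 2) x)" by (intro integrable_mult_right int_gauss) simp
  show "AE x::'a in lborel. norm (gauss 1 x * norm x ^ (2 * k)) <= norm ((4 ^ k * fact k * sqrt 2 ^ DIM('a)) * gauss (sqrt 2) x)"
  proof (rule AE_I2)
   fix x :: 'a
   \<comment> \<open>A quarter of the squared norm uses up half of the Gaussian exponent; what
     remains is the density with deviation \<open>sqrt 2\<close>.\<close>
   define y where "y = (norm x)^2 / 4"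
   have y: "0 <= y" by (simp add: y_def)
   have "y ^ k / fact k <= exp y" using exp_ge_one_minus_x_over_n_power_n sum_le_suminf[of "%n. inverse (fact n) * y ^ n" "{k}"] y summable_exp[of y]
    by (simp add: exp_def scaleR_conv_of_real field_simps)
   moreover have "norm x ^ (2 * k) = (4 * y) ^ k" by (simp only: y_def power_mult) simp
   ultimately have "norm x ^ (2 * k) <= 4 ^ k * fact k * exp y" by (simp add: power_mult_distrib field_simps)
   hence "gauss 1 x * norm x ^ (2 * k) <= gauss 1 x * (4 ^ k * fact k * exp y)" by (intro mult_left_mono gauss_nonneg)
   also have "... = 4 ^ k * fact k * (gauss 1 x * exp y)" by simp
   also have "gauss 1 x * exp y = sqrt 2 ^ DIM('a) * gauss (sqrt 2) x"
    by (simp add: gauss_eq y_def exp_add[symmetric] real_sqrt_mult power_divide power_mult_distrib field_simps)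
      (simp flip: power_mult_distrib)
   finally show "norm (gauss 1 x * norm x ^ (2 * k)) <= norm ((4 ^ k * fact k * sqrt 2 ^ DIM('a)) * gauss (sqrt 2) x)"
    by (simp add: gauss_nonneg mult.assoc abs_mult mult.left_commute)
  qed
 qed simp
 show ?thesis
 proof (rule int_bound)
  show "integrable lborel (%x::'a. gauss 1 x + gauss 1 x * norm x ^ (2 * k))" by (intro Bochner_Integration.integrable_add even int_gauss) simp
  show "AE x::'a in lborel. norm (gauss 1 x * norm x ^ k) <= norm (gauss 1 x + gauss 1 x * norm x ^ (2 * k))"
  proof (rule AE_I2)
   fix x :: 'a
   have "norm x ^ k <= 1 + norm x ^ (2 * k)"
   proof (cases "norm x ^ k <= 1")
    case False thus ?thesis by (simp add: mult.commute[of 2] power_mult power2_eq_square)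
      (metis False add_increasing le_cases mult_left_mono mult_1_right norm_ge_zero zero_le_one zero_le_power)
   qed (simp add: add_increasing2)
   hence "gauss 1 x * norm x ^ k <= gauss 1 x * (1 + norm x ^ (2 * k))" by (intro mult_left_mono gauss_nonneg)
   thus "norm (gauss 1 x * norm x ^ k) <= norm (gauss 1 x + gauss 1 x * norm x ^ (2 * k))" by (simp add: gauss_nonneg algebra_simps)
  qed
 qed simp
qed

lemma integral_gauss_second_moment: fixes i j :: "'a::euclidean_space" assumes "i : Basis" "j : Basis"
 shows "(LBINT x. gauss 1 x * ((x \<bullet> i) * (x \<bullet> j))) = (if i = j then 1 else 0)"
proof -
 let ?f = "%b t. std_normal_density t * ((if b = i then t else 1) * (if b = j then t else 1))"
 have m1: "integrable lborel (%t. std_normal_density t * t)" using integrable_std_normal_moment[of 1] by simp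
 have m2: "integrable lborel (%t. std_normal_density t * (t * t))" using integrable_std_normal_moment[of 2] by (simp add: power2_eq_square)
 have int: "integrable lborel (?f b)" for b by (cases "b = i"; cases "b = j") (use m1 m2 in simp_all)
 have e1: "(LBINT t. std_normal_density t * t) = 0" using integral_std_normal_moment_odd[of 0] by simp
 have e2: "(LBINT t. std_normal_density t * (t * t)) = 1" using integral_std_normal_moment_even[of 1] by (simp add: power2_eq_square)
 have "(\<Prod>b\<in>Basis. ?f b (x \<bullet> b)) = gauss 1 x * ((x \<bullet> i) * (x \<bullet> j))" for x :: 'a
  using assms by (simp add: prod.distrib gauss_def prod.delta)
 hence "(LBINT x. gauss 1 x * ((x \<bullet> i) * (x \<bullet> j))) = (\<Prod>b\<in>Basis. LBINT t. ?f b t)"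
  using integral_prod_Basis[of ?f] int by simp
 also have "... = (if i = j then 1 else 0)"
 proof (cases "i = j")
  case True
  hence "(LBINT t. ?f b t) = 1" for b by (cases "b = j") (simp_all add: e2)
  thus ?thesis using True by simp
 next
  case False
  hence "(LBINT t. ?f i t) = 0" using e1 by simp
  hence "(\<Prod>b\<in>Basis. LBINT t. ?f b t) = 0" using assms(1) by (intro prod_zero[OF finite_Basis] bexI[of _ i])
  thus ?thesis using False by simp
 qed
 finally show ?thesis .
qed


text \<open>A Gaussian bump around \<open>y\<close> is a Gaussian mixture of cosines, so the
  convolution of \<open>d\<close> with every Gaussian vanishes. Moving the convolution onto a bump
  function and letting the width \<open>w\<close> go to zero recovers the integral of
  \<open>d\<close> against that function.\<close>

lemma fourier_unique: fixes d :: "'a::euclidean_space => real"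
 assumes di: "integrable lborel d" and zero: "!!u g. (LBINT p. d p * cos (u \<bullet> p + g)) = 0" shows "AE p in lborel. d p = 0"
proof -
 have [measurable]: "d : Borel" using borel_intI[OF di] by simp
 have conv0: "(LBINT p. d p * gauss w (p - y)) = 0" if w: "w > 0" for w y
 proof -
  \<comment> \<open>The dual width: the transform of a Gaussian with deviation \<open>1 / w\<close>
    is a Gaussian profile with deviation \<open>w\<close>.\<close>
  define v where "v = 1 / w"
  have v: "v > 0" using w by (simp add: v_def)
  define G where "G z = (d (fst z) * gauss v (snd z)) * cos ((fst z - y) \<bullet> snd z)" for z :: "'a \<times> 'a"
  have "(%z::'a \<times> 'a. cos ((fst z - y) \<bullet> snd z)): Borel" unfolding borel_prod[symmetric] by measurable
  hence Gi: "integrable lborel G" unfolding G_def by (intro int_mult_bounded[where B=1] int_tensor di int_gauss v) simp_all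
  have "(LBINT p. d p * exp (- (v^2 * (norm (p - y))^2) / 2)) = (LBINT p. LBINT u. G (p, u))"
  proof (intro lint_cong refl)
   fix p
   have "(LBINT u. G (p, u)) = d p * (LBINT u. gauss v u * cos ((p - y) \<bullet> u + 0))"
    by (subst integral_mult_right_zero[symmetric]) (simp add: G_def mult.assoc)
   thus "d p * exp (- (v^2 * (norm (p - y))^2) / 2) = (LBINT u. G (p, u))" by (simp add: integral_gauss_cos[OF v, where h=0, simplified])
  qed
  also have "... = (LBINT u. LBINT p. G (p, u))" using lborel_fubini(1,2)[OF Gi] by simp
  also have "... = 0"
  proof -
   have "(LBINT p. G (p, u)) = 0" for u
   proof -
    have "(LBINT p. G (p, u)) = gauss v u * (LBINT p. d p * cos (u \<bullet> p + - (u \<bullet> y)))"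
    proof -
     have "G (p, u) = gauss v u * (d p * cos (u \<bullet> p + - (u \<bullet> y)))" for p
     proof -
      have "(p - y) \<bullet> u = u \<bullet> p + - (u \<bullet> y)" by (simp add: inner_diff_left inner_commute[of u])
      thus ?thesis by (simp only: G_def fst_conv snd_conv ac_simps)
     qed
     thus ?thesis by (simp only: integral_mult_right_zero)
    qed
    thus ?thesis by (simp only: zero mult_zero_right)
   qed
   thus ?thesis by simp
  qed
  finally have "(LBINT p. d p * exp (- (v^2 * (norm (p - y))^2) / 2)) = 0" .
  moreover have "d p * gauss w (p - y) = (1 / sqrt (2 * pi * w^2)) ^ DIM('a) * (d p * exp (- (v^2 * (norm (p - y))^2) / 2))" for p
   using w by (simp add: gauss_eq v_def power_divide)
  ultimately show ?thesis by (simp only: integral_mult_right_zero)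
 qed
 show ?thesis
 proof (rule AE_eq_0_box_bump)
  fix a b :: 'a and k :: nat
  show "integrable lborel (%x. indicator (box a b) x * d x)"
   using int_mult_bounded[OF di, of "indicator (box a b)" 1] by (simp add: mult.commute indicator_def)
  assume ab: "\<forall>i\<in>Basis. a \<bullet> i < b \<bullet> i"
  define h where "h = box_bump a b k"
  have t: "test_function h" unfolding h_def by (rule box_bump_test_function[OF ab])
  note [measurable] = tf_measurable[OF t]
  obtain B where B: "B > 0" "!!x. \<bar>h x\<bar> <= B" using tf_bounded[OF t] by blast
  have hi: "integrable lborel h" using tf_support[OF t] int_continuous_compact_support[OF smooth_cont[OF tf_smooth[OF t]]] by metis
  define I where "I w p = (LBINT z. gauss 1 z * h (w *R z + p))" for w p
  have I0: "(LBINT p. d p * I w p) = 0" if w: "w > 0" for w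
  proof -
   define G where "G z = (d (fst z) * h (snd z)) * gauss w (fst z - snd z)" for z :: "'a \<times> 'a"
   obtain C where C: "!!x. \<bar>gauss w (x::'a)\<bar> <= C"
   proof
    fix x :: 'a show "\<bar>gauss w x\<bar> <= (1 / sqrt (2 * pi * w^2)) ^ DIM('a) * 1" unfolding gauss_eq abs_mult by (intro mult_mono) auto
   qed
   have "(%z::'a \<times> 'a. gauss w (fst z - snd z)): Borel" unfolding borel_prod[symmetric] by measurable
   hence Gi: "integrable lborel G" unfolding G_def by (intro int_mult_bounded[where B=C] int_tensor di hi C) simp_all
   have "(LBINT p. d p * I w p) = (LBINT p. LBINT y. G (p, y))"
   proof (intro lint_cong refl)
    fix p
    have "(LBINT y. G (p, y)) = d p * (LBINT y. gauss w (p - y) * h y)" by (subst integral_mult_right_zero[symmetric]) (simp add: G_def ac_simps)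
    also have "(LBINT y. gauss w (p - y) * h y) = (LBINT z. gauss w z * h (z + p))"
     using integral_translate[of "%y. gauss w (p - y) * h y" p] by (simp add: gauss_uminus)
    also have "... = I w p" unfolding I_def by (rule integral_gauss_scale[OF w]) measurable
    finally show "d p * I w p = (LBINT y. G (p, y))" by simp
   qed
   also have "... = (LBINT y. LBINT p. G (p, y))" using lborel_fubini(1,2)[OF Gi] by simp
   also have "... = 0"
   proof -
    have "(LBINT p. G (p, y)) = h y * (LBINT p. d p * gauss w (p - y))" for y
     by (subst integral_mult_right_zero[symmetric]) (simp add: G_def ac_simps)
    thus ?thesis by (simp add: conv0[OF w])
   qed
   finally show ?thesis .
  qed
  have Ilim: "(%n. I (inverse (real (Suc n))) p) ----> h p" for p
  proof -
   have "(%n. LBINT z. gauss 1 z * h (inverse (real (Suc n)) *R z + p)) ----> (LINT z::'a|lborel. gauss 1 z * h p)"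
   proof (rule int_dct)
    show "integrable lborel (%z::'a. gauss 1 z * B)" by (intro integrable_mult_left int_gauss) simp
    show "AE z in lborel. norm (gauss 1 z * h (inverse (real (Suc n)) *R z + p)) <= gauss 1 z * B" for n
     by (rule AE_I2) (simp add: abs_mult gauss_nonneg mult_left_mono B)
    show "AE z in lborel. (%n. gauss 1 z * h (inverse (real (Suc n)) *R z + p)) ----> gauss 1 z * h p"
    proof (rule AE_I2)
     fix z :: 'a
     have "(%n. inverse (real (Suc n)) *R z + p) ----> 0 *R z + p" by (intro tendsto_intros LIMSEQ_inverse_real_of_nat)
     thus "(%n. gauss 1 z * h (inverse (real (Suc n)) *R z + p)) ----> gauss 1 z * h p"
      using continuous_on_tendsto_compose[OF smooth_cont[OF tf_smooth[OF t]], of _ p sequentially UNIV] by (intro tendsto_mult tendsto_const) auto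
    qed
   qed measurable
   thus ?thesis by (simp add: I_def integral_gauss)
  qed
  have Ib: "\<bar>I w p\<bar> <= B" for w p
  proof -
   have "\<bar>I w p\<bar> <= (LBINT z. \<bar>gauss 1 z * h (w *R z + p)\<bar>)" unfolding I_def by (rule integral_abs_bound)
   also have "... <= (LINT z::'a|lborel. gauss 1 z * B)"
   proof (rule integral_mono)
    show "integrable lborel (%z::'a. gauss 1 z * B)" by (intro integrable_mult_left int_gauss) simp
    show "integrable lborel (%z. \<bar>gauss 1 z * h (w *R z + p)\<bar>)" by (intro integrable_abs int_mult_bounded[where B=B] int_gauss B) simp_all
   qed (simp add: abs_mult gauss_nonneg mult_left_mono B)
   finally show ?thesis by (simp add: integral_gauss)
  qed
  have Im: "I w : Borel" for w unfolding I_def[abs_def] by measurable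
  have "(%n. LBINT p. d p * I (inverse (real (Suc n))) p) ----> (LBINT p. d p * h p)"
  proof (rule int_dct)
   show "integrable lborel (%p. \<bar>d p\<bar> * B)" using di by simp
   show "AE p in lborel. (%n. d p * I (inverse (real (Suc n))) p) ----> d p * h p" by (intro AE_I2 tendsto_mult tendsto_const Ilim)
   show "AE p in lborel. norm (d p * I (inverse (real (Suc n))) p) <= \<bar>d p\<bar> * B" for n
    by (rule AE_I2) (simp add: abs_mult mult_left_mono Ib)
  qed (use Im in auto)
  moreover have "(LBINT p. d p * I (inverse (real (Suc n))) p) = 0" for n by (rule I0) simp
  ultimately show "(LBINT x. d x * box_bump a b k x) = 0" by (simp add: LIMSEQ_const_iff h_def)
 qed simp
qed

section \<open>Smooth plateau functions\<close>

lemma dd_locally_const: assumes "open S" "x : S" "!!y. y : S ==> f y = c" shows "dd v f x = 0"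
proof (rule dd_eq)
 show "(f has_derivative (%_. 0)) (at x)" by (rule has_derivative_transform_within_open[OF has_derivative_const assms(1,2)]) (simp add: assms(3))
qed

text \<open>The radial profile of a plateau is known only as an antiderivative; smoothness of the
  composition is inherited from that of its first derivatives.\<close>

lemma smooth_antiderivative_compose: assumes H: "!!x. (H has_real_derivative h x) (at x)" and u: "smooth u" and hu: "smooth (%x. h (u x))"
 shows "smooth (%x. H (u x))"
proof -
 have *: "((%x. H (u x)) has_derivative (%v. h (u x) * dd v u x)) (at x)" for x
  using has_derivative_compose[OF smooth_has_derivative[OF u] H[unfolded has_field_derivative_def]] by simp
 have "dd v (%x. H (u x)) = (%x. h (u x) * dd v u x)" for v using dd_eq[OF *] by blast
 hence "cont_diff (Suc k) (%x. H (u x))" for k using * smooth_mult[OF hu smooth_dd[OF u]] by (auto simp: differentiable_def smooth_def)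
 thus ?thesis unfolding smooth_def by (metis cont_diff_Suc_imp)
qed

lemma plateau_function: assumes r: "0 < r" obtains w :: "'a::euclidean_space => real" where "test_function w" "!!x. norm x <= r ==> w x = 1"
  "!!x. \<bar>w x\<bar> <= 1" "!!x y. norm x = norm y ==> w x = w y"
proof -
 define h where "h x = flat_exp 1 x * flat_exp 1 (1 - x)" for x
 have hc: "isCont h x" for x unfolding h_def
  by (intro continuous_intros DERIV_isCont[OF flat_exp_DERIV] isCont_o2[OF _ DERIV_isCont[OF flat_exp_DERIV]])
 obtain F where F: "!!x. (F has_vector_derivative h x) (at x)" using einterval_antiderivative[of "-\<infinity>" "\<infinity>" h] hc by auto
 define H where "H x = F x - F 0" for x
 have H: "(H has_real_derivative h x) (at x)" for x
  unfolding H_def using F[of x] by (auto intro!: derivative_eq_intros simp: has_real_derivative_iff_has_vector_derivative)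
 have h: "0 <= h x" "h x = 0 \<longleftrightarrow> x <= 0 \<or> 1 <= x" for x by (auto simp: h_def flat_exp_def)
 have mono: "H x <= H y" if "x <= y" for x y by (rule DERIV_nonneg_imp_nondecreasing[OF that]) (use H h in blast)
 obtain z where z: "0 < z" "z < 1/2" "H (1/2) - H 0 = (1/2 - 0) * h z" using MVT2[of 0 "1/2" H h] H by auto
 have "0 < h z" using h[of z] z by linarith
 hence H12: "0 < H (1/2)" using z(3) by (simp add: H_def)
 have H1: "H x = H 1" if x: "1 <= x" for x
 proof (cases "x = 1")
  case False
  then obtain z where "1 < z" "H x - H 1 = (x - 1) * h z" using MVT2[of 1 x H h] H x by auto
  thus ?thesis using h(2)[of z] by simp
 qed simp
 have H0: "H x = 0" if x: "x <= 0" for x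
 proof (cases "x = 0")
  case False
  then obtain z where "z < 0" "H 0 - H x = (0 - x) * h z" using MVT2[of x 0 H h] H x by auto
  thus ?thesis using h(2)[of z] by (simp add: H_def)
 qed (simp add: H_def)
 have H1p: "0 < H 1" using H12 mono[of "1/2" 1] by simp
 \<comment> \<open>\<open>H\<close> rises from 0 to \<open>H 1\<close> on the unit interval. The
   argument is at least one for \<open>norm x <= r\<close> and nonpositive once
   \<open>(norm x)^2\<close> reaches \<open>2 * r^2\<close>. Dependence on the norm alone will make
   the plateau invariant under momentum reversal.\<close>
 define w where "w x = 1 / H 1 * H (2 - (norm x)^2 / r^2)" for x :: 'a
 show ?thesis
 proof (rule that)
  have u: "smooth (%x::'a. a + c * (norm x)^2)" for a c by (intro smooth_add smooth_const smooth_cmult smooth_norm_power2)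
  have "smooth (%x::'a. H (2 + (- 1 / r^2) * (norm x)^2))"
  proof (rule smooth_antiderivative_compose[OF H u])
   have "smooth (%x::'a. flat_exp 1 (2 + (- 1 / r^2) * (norm x)^2) * flat_exp 1 (- 1 + (1 / r^2) * (norm x)^2))"
    by (intro smooth_mult smooth_flat_exp_compose u)
   thus "smooth (%x::'a. h (2 + (- 1 / r^2) * (norm x)^2))" by (simp add: h_def)
  qed
  hence sm: "smooth w" unfolding w_def[abs_def] by (intro smooth_cmult) simp
  show "test_function w"
  proof (rule tf_I[OF sm compact_cball[of 0 "2 * r"]])
   fix x :: 'a assume "x \<notin> cball 0 (2 * r)"
   hence "(2 * r)^2 <= (norm x)^2" using r by (intro power_mono) auto
   moreover have "2 * r^2 <= (2 * r)^2" by (simp add: power_mult_distrib)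
   ultimately have "2 * r^2 <= (norm x)^2" by linarith
   hence "2 - (norm x)^2 / r^2 <= 0" using r by (simp add: field_simps)
   thus "w x = 0" by (simp add: w_def H0)
  qed
  show "w x = 1" if "norm x <= r" for x
  proof -
   have "(norm x)^2 <= r^2" using that by (intro power_mono) auto
   hence "1 <= 2 - (norm x)^2 / r^2" using r by (simp add: field_simps)
   from H1[OF this] show ?thesis using H1p by (simp add: w_def)
  qed
  show "\<bar>w x\<bar> <= 1" for x
   using mono[of 0 "2 - (norm x)^2 / r^2"] mono[of "2 - (norm x)^2 / r^2" 1] H0[of "2 - (norm x)^2 / r^2"] H1[of "2 - (norm x)^2 / r^2"] H0[of 0] H1p
   by (cases "2 - (norm x)^2 / r^2 <= 0"; cases "2 - (norm x)^2 / r^2 <= 1") (auto simp: w_def abs_mult)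
  show "w x = w y" if "norm x = norm y" for x y by (simp add: w_def that)
 qed
qed


section \<open>The Ornstein--Uhlenbeck operator\<close>

text \<open>The directions \<open>s k\<close> stand for the columns of the noise matrix. A sum over
  directional derivatives keeps matrices out of the analysis in the momentum variable.\<close>

definition ou :: "real => ('k::finite => 'a::euclidean_space) => ('a => real) => 'a => real" where
 "ou \<beta> s f p = 1/2 * (\<Sum>k\<in>UNIV. 1/\<beta> * dd (s k) (dd (s k) f) p - (s k \<bullet> p) * dd (s k) f p)"

text \<open>The last summand is the carre du champ; the factor two of the second-order Leibniz rule
  is cancelled by the prefactor one half.\<close>

lemma ou_mult: assumes f: "smooth f" and g: "smooth g" shows "ou \<beta> s (%x. f x * g x) p = f p * ou \<beta> s g p + g p * ou \<beta> s f p
  + 1/\<beta> * (\<Sum>k\<in>UNIV. dd (s k) f p * dd (s k) g p)"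
proof -
 have d: "dd v (%x. f x * g x) = (%x. f x * dd v g x + dd v f x * g x)" if "smooth f" "smooth g" for f g :: "'a => real" and v
  by (rule dd_mult) (use that in \<open>auto intro: smooth_differentiable\<close>)
 have d2: "dd v (dd v (%x. f x * g x)) p = f p * dd v (dd v g) p + 2 * (dd v f p * dd v g p) + dd v (dd v f) p * g p" for v unfolding d[OF f g]
  by (subst dd_add) (auto intro!: smooth_differentiable smooth_mult smooth_dd f g simp: d f g smooth_dd)
 show ?thesis unfolding ou_def d2 unfolding d[OF f g] by (simp add: sum_distrib_left sum.distrib[symmetric] algebra_simps)
qed

text \<open>First and, below, second derivative of \<open>flat_exp 1\<close>, named because the
  cutoff estimates bound them separately.\<close>

definition fe1 :: "real => real" where "fe1 = flat_exp (monom 1 2 * (1 - pderiv 1))"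
definition fe2 :: "real => real" where
 "fe2 = flat_exp (monom 1 2 * (monom 1 2 * (1 - pderiv 1) - pderiv (monom 1 2 * (1 - pderiv 1))))"

definition radial_bump :: "real => 'a::euclidean_space => real" where
 "radial_bump e p = flat_exp 1 (1 - e * (norm p)^2)"

lemma smooth_radial_bump: "smooth (radial_bump e)" unfolding radial_bump_def[abs_def]
 by (intro smooth_flat_exp_compose smooth_diff smooth_const smooth_cmult smooth_norm_power2)

lemma flat_exp_radial_derivative: fixes p :: "'a::euclidean_space" shows "((%p::'a. flat_exp P (1 - e * (norm p)^2)) has_derivative
  (%v. flat_exp (monom 1 2 * (P - pderiv P)) (1 - e * (norm p)^2) * (- 2 * e * (p \<bullet> v)))) (at p)"
proof -
 have "((%p::'a. 1 - e * (p \<bullet> p)) has_derivative (%v. - 2 * e * (p \<bullet> v))) (at p)"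
  by (auto intro!: derivative_eq_intros simp: inner_commute algebra_simps)
 from has_derivative_compose[OF this flat_exp_DERIV[unfolded has_field_derivative_def]]
 show ?thesis by (simp add: power2_norm_eq_inner)
qed

lemma dd_radial_bump:
 "dd v (radial_bump e) = (%p. fe1 (1 - e * (norm p)^2) * (- 2 * e * (p \<bullet> v)))" using dd_eq[OF flat_exp_radial_derivative[of 1 e]]
 by (auto simp: radial_bump_def[abs_def] fe1_def fun_eq_iff)

lemma dd2_radial_bump:
 "dd v (dd v (radial_bump e)) p =
   fe2 (1 - e * (norm p)^2) * (2 * e * (p \<bullet> v))^2 - fe1 (1 - e * (norm p)^2) * (2 * e * (v \<bullet> v))"
proof -
 have a: "((%p. - 2 * e * (p \<bullet> v)) has_derivative (%w. - 2 * e * (w \<bullet> v))) (at p)" by (auto intro!: derivative_eq_intros)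
 have b: "((%p. fe1 (1 - e * (norm p)^2)) has_derivative (%v. fe2 (1 - e * (norm p)^2) * (- 2 * e * (p \<bullet> v)))) (at p)"
  unfolding fe1_def fe2_def by (rule flat_exp_radial_derivative)
 show ?thesis unfolding dd_radial_bump by (subst dd_eq[OF has_derivative_mult[OF b a]]) (simp add: power2_eq_square algebra_simps)
qed

lemma flat_exp_bounded: obtains M where "M > 0" "!!x. x <= 1 ==> \<bar>flat_exp P x\<bar> <= M"
proof -
 have c: "continuous_on UNIV (flat_exp P)" using flat_exp_DERIV DERIV_isCont cont_at_on by blast
 have "bounded (flat_exp P ` {0..1})" by (intro compact_imp_bounded compact_continuous_image continuous_on_subset[OF c]) auto
 then obtain M where M: "M > 0" "\<forall>x\<in>{0..1}. \<bar>flat_exp P x\<bar> <= M" unfolding bounded_pos by auto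
 have "\<bar>flat_exp P x\<bar> <= M" if "x <= 1" for x
 proof (cases "x \<ge> 0")
  case True thus ?thesis using M that by auto
 next
  case False thus ?thesis using M(1) by (simp add: flat_exp_def)
 qed
 thus ?thesis using that M(1) by blast
qed

lemma flat_exp_measurable [measurable]: "flat_exp P : Borel" by (intro borel_contI cont_at_on ballI DERIV_isCont[OF flat_exp_DERIV])

lemma fe_measurable [measurable]: "fe1 : Borel" "fe2 : Borel" by (simp_all add: fe1_def fe2_def)

lemma fe1_nonneg: "0 <= fe1 x" and fe1_1_pos: "0 < fe1 1" and fe1_nonpos: "x <= 0 ==> fe1 x = 0" and fe2_nonpos: "x <= 0 ==> fe2 x = 0"
 by (auto simp: fe1_def fe2_def flat_exp_def poly_monom pderiv_1)

lemma radial_bump_test_function: assumes "e > 0" shows "test_function (radial_bump e :: 'a::euclidean_space => real)"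
proof (rule tf_I[OF smooth_radial_bump, of "cball 0 (1 / sqrt e)"])
 fix p :: 'a assume "p \<notin> cball 0 (1 / sqrt e)"
 hence "(1 / sqrt e)^2 < (norm p)^2" using assms by (intro power_strict_mono) auto
 hence "1 < e * (norm p)^2" using assms by (simp add: power_divide field_simps)
 thus "radial_bump e p = 0" by (simp add: radial_bump_def flat_exp_def)
qed simp

lemma cont_diff_cos_affine: "cont_diff k (%p::'a::euclidean_space. c * cos (y \<bullet> p + h))"
proof (induction k arbitrary: c h)
 case 0 show ?case by (auto intro!: continuous_intros)
next
 case (Suc k)
 have d: "((%p::'a. c * cos (y \<bullet> p + h)) has_derivative (%v. (c * (y \<bullet> v)) * cos (y \<bullet> p + (h + pi / 2)))) (at p)" for p
 proof -
  have "cos (y \<bullet> p + (h + pi / 2)) = - sin (y \<bullet> p + h)" by (simp add: add.assoc[symmetric] cos_add[of _ "pi / 2"])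
  thus ?thesis by (auto intro!: derivative_eq_intros)
 qed
 hence "dd v (%p::'a. c * cos (y \<bullet> p + h)) = (%p. (c * (y \<bullet> v)) * cos (y \<bullet> p + (h + pi / 2)))" for v using dd_eq by blast
 thus ?case using d Suc by (auto simp: differentiable_def)
qed

lemma smooth_cos_affine: "smooth (%p::'a::euclidean_space. cos (y \<bullet> p + h))" using cont_diff_cos_affine[of _ 1 y h] by (simp add: smooth_def)

lemma dd_cos_affine:
 "dd v (%p::'a::euclidean_space. cos (y \<bullet> p + h)) = (%p. - (y \<bullet> v) * sin (y \<bullet> p + h))"
 "dd v (%p::'a::euclidean_space. - (y \<bullet> v) * sin (y \<bullet> p + h)) = (%p. - (y \<bullet> v)\<^sup>2 * cos (y \<bullet> p + h))"
proof -
 have d: "((%p::'a. cos (y \<bullet> p + h)) has_derivative (%v. - (y \<bullet> v) * sin (y \<bullet> p + h))) (at p)" for p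
  by (auto intro!: derivative_eq_intros)
 show "dd v (%p::'a::euclidean_space. cos (y \<bullet> p + h)) = (%p. - (y \<bullet> v) * sin (y \<bullet> p + h))" using dd_eq[OF d] by blast
 have d2: "((%p::'a. - (y \<bullet> v) * sin (y \<bullet> p + h)) has_derivative (%w. - (y \<bullet> v) * ((y \<bullet> w) * cos (y \<bullet> p + h)))) (at p)" for p
  by (auto intro!: derivative_eq_intros)
 show "dd v (%p::'a::euclidean_space. - (y \<bullet> v) * sin (y \<bullet> p + h)) = (%p. - (y \<bullet> v)\<^sup>2 * cos (y \<bullet> p + h))"
  using dd_eq[OF d2, of v] by (auto simp: fun_eq_iff power2_eq_square)
qed

lemma cos_second_order: "\<bar>cos (a + x) - cos a + x * sin a\<bar> <= x^2" for a x :: real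
proof -
 have sin_lip: "\<bar>sin u - sin a\<bar> <= \<bar>u - a\<bar>" for u
 proof -
  have "norm (sin u - sin a) <= 1 * norm (u - a)" by (rule field_differentiable_bound[of UNIV sin cos]) auto
  thus ?thesis by simp
 qed
 have "norm ((cos (a + x) + (a + x) * sin a) - (cos a + a * sin a)) <= \<bar>x\<bar> * norm ((a + x) - a)"
 proof (rule field_differentiable_bound[of "cball a \<bar>x\<bar>" "%u. cos u + u * sin a" "%u. sin a - sin u"])
  show "((%u. cos u + u * sin a) has_field_derivative sin a - sin u) (at u within cball a \<bar>x\<bar>)" for u by (auto intro!: derivative_eq_intros)
  show "norm (sin a - sin u) <= \<bar>x\<bar>" if "u : cball a \<bar>x\<bar>" for u using sin_lip[of u] that by (auto simp: dist_real_def)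
 qed (auto simp: dist_real_def)
 thus ?thesis by (simp add: algebra_simps power2_eq_square)
qed

text \<open>Moving from a maximum point of \<open>h - w |z|\<^sup>2\<close> along the contracting direction \<open>- L z\<close>
 increases that function, so the maximum over any ball sits at the origin.\<close>

lemma constant_along_contracting_field: fixes h :: "'a::euclidean_space => real" and L :: "'a => 'a" assumes cont: "continuous_on UNIV h"
  and D: "!!z. ((%t. h (z - t *R L z)) has_real_derivative 0) (at 0)" and L: "!!z. z \<noteq> 0 ==> z \<bullet> L z > 0" shows "h z = h 0"
proof -
 have upper: "h z <= h 0" if cont: "continuous_on UNIV h" and D: "!!z. ((%t. h (z - t *R L z)) has_real_derivative 0) (at 0)" for h :: "'a => real"
 proof -
  have le: "h z - w * (norm z)^2 <= h 0" if w: "w > 0" for w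
  proof -
   define k where "k x = h x - w * (norm x)^2" for x
   have "continuous_on (cball 0 (norm z)) k" unfolding k_def by (intro continuous_intros continuous_on_subset[OF cont]) auto
   then obtain x where x: "x : cball 0 (norm z)" "!!y. y : cball 0 (norm z) ==> k y <= k x"
    using continuous_attains_sup[of "cball 0 (norm z)" k] by auto
   have "x = 0"
   proof (rule ccontr)
    assume nz: "x \<noteq> 0"
    have nrm: "(norm (x - t *R L x))^2 = (norm x)^2 - 2 * t * (x \<bullet> L x) + t^2 * (norm (L x))^2" for t unfolding power2_norm_eq_inner
     by (simp add: inner_diff_left inner_diff_right inner_commute algebra_simps power2_eq_square)
    have "((%t. k (x - t *R L x)) has_real_derivative 2 * w * (x \<bullet> L x)) (at 0)"
     unfolding k_def nrm using D[of x] by (auto intro!: derivative_eq_intros)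
    from DERIV_pos_inc_right[OF this] L[OF nz] w
    obtain d where d: "d > 0" "!!t. 0 < t ==> t < d ==> k x < k (x - t *R L x)" by auto
    define N where "N = (norm (L x))^2 + 1"
    \<comment> \<open>Being below \<open>d\<close>, this \<open>t\<close> increases
      \<open>k\<close>; and the point stays in the ball because \<open>t * (norm (L x))^2\<close> is
      at most twice \<open>x \<bullet> L x\<close>.\<close>
    define t where "t = min (d / 2) ((x \<bullet> L x) / N)"
    have N: "N > 0" by (simp add: N_def add_nonneg_pos)
    have t: "0 < t" "t < d" using d(1) L[OF nz] N by (auto simp: t_def)
    have "t * N <= x \<bullet> L x" using N by (simp add: t_def min_le_iff_disj field_simps)
       (metis min.cobounded2 N pos_le_divide_eq mult.commute)
    moreover have "t * (norm (L x))^2 <= t * N" using t by (simp add: N_def)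
    ultimately have "t * (norm (L x))^2 <= 2 * (x \<bullet> L x)" using L[OF nz] by linarith
    hence "t * (t * (norm (L x))^2) <= t * (2 * (x \<bullet> L x))" using t by (intro mult_left_mono) auto
    hence "(norm (x - t *R L x))^2 <= (norm x)^2" unfolding nrm by (simp add: power2_eq_square algebra_simps)
    hence "norm (x - t *R L x) <= norm x" by (rule power2_le_imp_le) simp
    hence "k (x - t *R L x) <= k x" using x by auto
    thus False using d(2)[OF t] by simp
   qed
   thus ?thesis using x(2)[of z] by (simp add: k_def)
  qed
  show ?thesis
  proof (rule ccontr)
   assume "\<not> h z <= h 0"
   hence g: "h z - h 0 > 0" by simp
   \<comment> \<open>With this \<open>w\<close> the quadratic penalty at \<open>z\<close> is at most
     half of the supposed gap.\<close>
   define w where "w = (h z - h 0) / (2 * ((norm z)^2 + 1))"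
   have p: "(norm z)^2 + 1 > 0" by (simp add: add_nonneg_pos)
   hence "w > 0" using g by (simp add: w_def)
   hence "h z - h 0 <= w * (norm z)^2" using le by fastforce
   also have "... <= w * ((norm z)^2 + 1)" using \<open>w > 0\<close> by simp
   also have "... = (h z - h 0) / 2" using p by (simp add: w_def field_simps)
   finally show False using g by simp
  qed
 qed
 have "- h z <= - h 0" by (rule upper) (use cont D in \<open>auto intro!: continuous_intros derivative_eq_intros\<close>)
 with upper[OF cont D] show ?thesis by simp
qed


context fixes s :: "'k::finite => 'a::euclidean_space" and \<beta> :: real
 assumes \<beta>: "0 < \<beta>" and span: "!!x. x \<noteq> 0 ==> \<exists>k. s k \<bullet> x \<noteq> 0"
begin

text \<open>With \<open>A\<close> the sum of the rank-one matrices of the vectors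
  \<open>s k\<close>, this and the next two are the quadratic form of \<open>A\<close>, the map
  \<open>A\<close> itself and its trace; \<open>span\<close> makes \<open>A\<close> positive
  definite.\<close>

definition "ou_Q x = (\<Sum>k\<in>UNIV. (s k \<bullet> x)^2)"
definition "ou_L x = (\<Sum>k\<in>UNIV. (s k \<bullet> x) *R s k)"
definition "ou_T = (\<Sum>k\<in>UNIV. s k \<bullet> s k)"

lemma ou_Q_nonneg: "0 <= ou_Q x" by (simp add: ou_Q_def sum_nonneg)
lemma ou_T_nonneg: "0 <= ou_T" by (simp add: ou_T_def sum_nonneg)

lemma ou_Q_pos: "x \<noteq> 0 ==> 0 < ou_Q x"
proof -
 assume "x \<noteq> 0"
 then obtain k where "s k \<bullet> x \<noteq> 0" using span by blast
 thus ?thesis unfolding ou_Q_def by (intro sum_pos2[of _ k]) auto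
qed

lemma inner_ou_L: "x \<bullet> ou_L x = ou_Q x" by (simp add: ou_L_def ou_Q_def inner_sum_right power2_eq_square inner_commute)

lemma ou_Q_le: "ou_Q x <= ou_T * (norm x)^2" unfolding ou_Q_def ou_T_def sum_distrib_right power2_norm_eq_inner
 by (intro sum_mono Cauchy_Schwarz_ineq)

lemma ou_Q_continuous: "continuous_on S ou_Q" unfolding ou_Q_def[abs_def] by (intro continuous_intros)

lemma ou_Q_measurable [measurable]: "ou_Q : Borel" by (intro borel_contI ou_Q_continuous)

lemma ou_Q_lower: obtains l where "l > 0" "!!x. l * (norm x)^2 <= ou_Q x"
proof -
 obtain b :: 'a where "b : Basis" using nonempty_Basis by blast
 hence "sphere (0::'a) 1 \<noteq> {}" by (auto intro!: exI[of _ b])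
 then obtain x0 where x0: "x0 : sphere 0 1" "!!x. x : sphere 0 1 ==> ou_Q x0 <= ou_Q x"
  using continuous_attains_inf[OF compact_sphere, of 0 1 ou_Q] ou_Q_continuous by blast
 have "ou_Q x0 * (norm x)^2 <= ou_Q x" for x
 proof (cases "x = 0")
  case True thus ?thesis by (simp add: ou_Q_def)
 next
  case False
  have "ou_Q ((1 / norm x) *R x) = ou_Q x / (norm x)^2" by (simp add: ou_Q_def power_divide sum_divide_distrib)
  moreover have "ou_Q x0 <= ou_Q ((1 / norm x) *R x)" using False by (intro x0) simp
  ultimately show ?thesis using False by (simp add: pos_le_divide_eq)
 qed
 moreover have "ou_Q x0 > 0" using x0(1) by (intro ou_Q_pos) auto
 ultimately show ?thesis using that by blast
qed

lemma ou_radial_bump: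
 "ou \<beta> s (radial_bump e) p = e * (fe1 (1 - e * (norm p)^2) * ou_Q p
   - fe1 (1 - e * (norm p)^2) * (ou_T / \<beta>) + 2 / \<beta> * (e * (fe2 (1 - e * (norm p)^2) * ou_Q p)))"
 unfolding ou_def dd2_radial_bump unfolding dd_radial_bump ou_Q_def ou_T_def
 by (simp add: sum_distrib_left sum_distrib_right sum_divide_distrib sum.distrib[symmetric] sum_subtractf[symmetric]
   power2_eq_square inner_commute algebra_simps)

text \<open>The factor \<open>F\<close> vanishes unless \<open>e * (norm p)^2 <= 1\<close>, and
  there \<open>e * ou_Q p\<close> is at most the trace: a bound independent of
  \<open>e\<close>.\<close>

lemma radial_ou_Q_bound: assumes "!!x. x <= 1 ==> \<bar>F x\<bar> <= M" "!!x. x <= 0 ==> F x = 0" "0 <= e"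
 shows "\<bar>e * (F (1 - e * (norm p)^2) * ou_Q p)\<bar> <= M * ou_T"
proof -
 have M: "0 <= M" using assms(1)[of 0] by simp
 show ?thesis
 proof (cases "e * (norm p)^2 <= 1")
  case True
  have "e * ou_Q p <= e * (ou_T * (norm p)^2)" using ou_Q_le assms(3) by (intro mult_left_mono)
  also have "... = ou_T * (e * (norm p)^2)" by simp
  also have "... <= ou_T * 1" using True ou_T_nonneg by (intro mult_left_mono)
  finally have "e * ou_Q p <= ou_T" by simp
  moreover have "\<bar>F (1 - e * (norm p)^2)\<bar> <= M" by (rule assms(1)) (use assms(3) in simp)
  ultimately have "\<bar>F (1 - e * (norm p)^2)\<bar> * (e * ou_Q p) <= M * ou_T" using M assms(3) ou_Q_nonneg by (intro mult_mono) auto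
  thus ?thesis using assms(3) ou_Q_nonneg by (simp add: abs_mult mult_ac)
 next
  case False
  hence "F (1 - e * (norm p)^2) = 0" by (intro assms(2)) simp
  thus ?thesis using M ou_T_nonneg by simp
 qed
qed

context fixes f :: "'a => real" assumes fi: "integrable lborel f" and f0: "!!p. 0 <= f p"
  and weak: "!!h. test_function h ==> (LBINT p. f p * ou \<beta> s h p) = 0"
begin

text \<open>Tested with the cutoff \<open>radial_bump e\<close>, the equation balances
  \<open>fe1\<close> times \<open>ou_Q\<close> against terms bounded uniformly in \<open>e\<close>,
  once a common factor \<open>e\<close> is divided out. As \<open>e\<close> tends to zero, Fatou's
  lemma bounds the integral of \<open>f\<close> times \<open>ou_Q\<close>, which dominates the
  squared norm.\<close>

lemma ou_second_moment: "integrable lborel (%p. f p * (norm p)^2)"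
proof -
 have [measurable]: "f : Borel" using borel_intI[OF fi] by simp
 obtain M1 where M1: "M1 > 0" "!!x. x <= 1 ==> \<bar>fe1 x\<bar> <= M1" using flat_exp_bounded unfolding fe1_def by blast
 obtain M2 where M2: "M2 > 0" "!!x. x <= 1 ==> \<bar>fe2 x\<bar> <= M2" using flat_exp_bounded unfolding fe2_def by blast
 define K where "K = M1 * ou_T / \<beta> + 2 / \<beta> * (M2 * ou_T)"
 have K: "0 <= K" using M1 M2 \<beta> ou_T_nonneg by (simp add: K_def)
 define e where "e n = inverse (real (Suc n))" for n
 have e: "e n > 0" for n by (simp add: e_def)
 define u where "u n p = f p * (fe1 (1 - e n * (norm p)^2) * ou_Q p)" for n p
 define w where "w n p = fe1 (1 - e n * (norm p)^2) * (ou_T / \<beta>) - 2 / \<beta> * (e n * (fe2 (1 - e n * (norm p)^2) * ou_Q p))" for n p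
 have u0: "0 <= u n p" for n p by (simp add: u_def f0 fe1_nonneg ou_Q_nonneg)
 have bound: "(NN p. ennreal (u n p)) <= ennreal (K * (LBINT p. f p))" for n
 proof -
  have wb: "\<bar>w n p\<bar> <= K" for p
  proof -
   have "\<bar>fe1 (1 - e n * (norm p)^2)\<bar> * (ou_T / \<beta>) <= M1 * (ou_T / \<beta>)"
    using M1(2)[of "1 - e n * (norm p)^2"] e[of n] \<beta> ou_T_nonneg by (intro mult_right_mono) auto
   moreover have "2 / \<beta> * \<bar>e n * (fe2 (1 - e n * (norm p)^2) * ou_Q p)\<bar> <= 2 / \<beta> * (M2 * ou_T)"
    using radial_ou_Q_bound[where F=fe2, OF M2(2) fe2_nonpos] e[of n] \<beta> by (intro mult_left_mono) auto
   ultimately show ?thesis unfolding w_def K_def using \<beta> ou_T_nonneg by (intro order.trans[OF abs_triangle_ineq4]) (simp add: abs_mult)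
  qed
  have wi: "integrable lborel (%p. f p * w n p)" by (rule int_mult_bounded[OF fi _ wb]) (unfold w_def, measurable)
  have zero: "(LBINT p. f p * ou \<beta> s (radial_bump (e n)) p) = 0" by (rule weak[OF radial_bump_test_function[OF e]])
  have ui: "integrable lborel (u n)" unfolding u_def
  proof (rule int_mult_bounded[OF fi])
   show "\<bar>fe1 (1 - e n * (norm p)^2) * ou_Q p\<bar> <= M1 * ou_T / e n" for p
    using radial_ou_Q_bound[where F=fe1, OF M1(2) fe1_nonpos, of "e n" p] e[of n] by (simp add: abs_mult field_simps)
  qed measurable
  have "f p * ou \<beta> s (radial_bump (e n)) p = e n * (u n p - f p * w n p)" for p by (simp add: ou_radial_bump u_def w_def algebra_simps)
  hence "e n * ((LBINT p. u n p) - (LBINT p. f p * w n p)) = 0" using zero ui wi by simp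
  hence "(LBINT p. u n p) = (LBINT p. f p * w n p)" using e[of n] by simp
  also have "... <= (LBINT p. K * f p)"
  proof (rule integral_mono[OF wi])
   show "f p * w n p <= K * f p" for p using mult_left_mono[OF order.trans[OF abs_ge_self wb], of "f p" p] f0 by (simp add: mult.commute)
  qed (use fi in simp)
  finally have "(LBINT p. u n p) <= K * (LBINT p. f p)" by simp
  thus ?thesis using u0 by (subst nn_integral_eq_integral[OF ui]) (auto intro: ennreal_leI)
 qed
 have lim: "(%n. ennreal (u n p)) ----> ennreal (f p * (fe1 1 * ou_Q p))" for p
 proof -
  have "isCont fe1 1" unfolding fe1_def by (rule DERIV_isCont[OF flat_exp_DERIV])
  moreover have "(%n. 1 - e n * (norm p)^2) ----> 1 - 0 * (norm p)^2" unfolding e_def by (intro tendsto_intros LIMSEQ_inverse_real_of_nat)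
  ultimately have "(%n. fe1 (1 - e n * (norm p)^2)) ----> fe1 1" using isCont_tendsto_compose[of 1 fe1 "%n. 1 - e n * (norm p)^2"] by simp
  thus ?thesis unfolding u_def by (intro tendsto_intros)
 qed
 have "(NN p. ennreal (f p * (fe1 1 * ou_Q p))) = (NN p. liminf (%n. ennreal (u n p)))" by (intro nn_integral_cong lim_imp_Liminf[symmetric] lim) simp
 also have "... <= liminf (%n. (NN p. ennreal (u n p)))" by (rule nn_integral_liminf) (unfold u_def, measurable)
 also have "... <= ennreal (K * (LBINT p. f p))" by (intro Liminf_le always_eventually) (use bound in auto)
 finally have "(NN p. ennreal (f p * (fe1 1 * ou_Q p))) < \<infinity>" using ennreal_less_top le_less_trans by (metis infinity_ennreal_def)
 hence Qi: "integrable lborel (%p. f p * (fe1 1 * ou_Q p))" by (intro integrableI_nonneg) (auto simp: f0 fe1_nonneg ou_Q_nonneg)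
 obtain l where l: "l > 0" "!!x. l * (norm x)^2 <= ou_Q x" using ou_Q_lower by blast
 show ?thesis
 proof (rule int_bound)
  show "integrable lborel (%p. 1 / (fe1 1 * l) * (f p * (fe1 1 * ou_Q p)))" by (rule integrable_mult_right[OF Qi])
  show "AE p in lborel. norm (f p * (norm p)^2) <= norm (1 / (fe1 1 * l) * (f p * (fe1 1 * ou_Q p)))"
  proof (rule AE_I2)
   fix p :: 'a
   have "(norm p)^2 <= ou_Q p / l" using l by (simp add: field_simps)
   hence "f p * (norm p)^2 <= f p * (ou_Q p / l)" by (intro mult_left_mono f0)
   also have "... = 1 / (fe1 1 * l) * (f p * (fe1 1 * ou_Q p))" using fe1_1_pos by (simp add: field_simps)
   finally have "f p * (norm p)^2 <= 1 / (fe1 1 * l) * (f p * (fe1 1 * ou_Q p))" .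
   moreover have "0 <= f p * (norm p)^2" using f0 by simp
   ultimately show "norm (f p * (norm p)^2) <= norm (1 / (fe1 1 * l) * (f p * (fe1 1 * ou_Q p)))" by simp
  qed
 qed measurable
qed

lemma ou_moment: "k <= 2 ==> integrable lborel (%p. f p * norm p ^ k)"
proof (rule int_bound)
 have [measurable]: "f : Borel" using borel_intI[OF fi] by simp
 assume k: "k <= 2"
 show "integrable lborel (%p. f p + f p * (norm p)^2)" using fi ou_second_moment by simp
 show "AE p in lborel. norm (f p * norm p ^ k) <= norm (f p + f p * (norm p)^2)"
 proof (rule AE_I2)
  fix p :: 'a
  have "norm p ^ k <= 1 + (norm p)^2"
  proof (cases "norm p <= 1")
   case True thus ?thesis by (simp add: power_le_one add_increasing2)
  next
   case False hence "norm p ^ k <= (norm p)^2" using k by (intro power_increasing) auto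
   thus ?thesis by simp
  qed
  hence "f p * norm p ^ k <= f p * (1 + (norm p)^2)" by (intro mult_left_mono f0)
  thus "norm (f p * norm p ^ k) <= norm (f p + f p * (norm p)^2)" using f0[of p] by (simp add: algebra_simps)
 qed
 show "(%p. f p * norm p ^ k): borel_measurable lborel" by measurable
qed

text \<open>Cutoffs at scale \<open>1 / e n\<close> multiply \<open>h\<close>. The drift meets the
  cutoff only as \<open>e n *R p\<close> paired with the gradient of \<open>y\<close> at that same
  point, which is bounded uniformly in \<open>n\<close>, so a multiple of \<open>f\<close> dominates
  the error terms. At a fixed \<open>p\<close> they vanish as soon as
  \<open>e n * norm p < 1\<close>.\<close>

lemma ou_weak_extension: assumes h: "smooth h" and M: "!!p. \<bar>h p\<bar> <= M" "!!k p. \<bar>dd (s k) h p\<bar> <= M"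
  and int: "integrable lborel (%p. f p * ou \<beta> s h p)" shows "(LBINT p. f p * ou \<beta> s h p) = 0"
proof -
 obtain y :: "'a => real" where y: "test_function y" "!!x. norm x <= 1 ==> y x = 1" "!!x. \<bar>y x\<bar> <= 1"
  using plateau_function[of 1] by (metis zero_less_one)
 note sm = tf_smooth[OF y(1)]
 have one: "dd v y x = 0" if "x : ball 0 1" for x v by (rule dd_locally_const[OF open_ball that, of _ 1]) (simp add: y(2))
 have two: "dd v (dd v y) x = 0" if "x : ball 0 1" for x v by (rule dd_locally_const[OF open_ball that]) (rule one)
 have "\<exists>B. \<forall>x. \<bar>dd (s k) y x\<bar> <= B" for k using tf_bounded[OF tf_dd[OF y(1)]] by metis
 then obtain B1 where B1: "!!k x. \<bar>dd (s k) y x\<bar> <= B1 k" by metis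
 define T1 where "T1 x = 1/2 * (\<Sum>k\<in>UNIV. 1/\<beta> * dd (s k) (dd (s k) y) x)" for x
 define T2 where "T2 x = 1/2 * (\<Sum>k\<in>UNIV. (s k \<bullet> x) * dd (s k) y x)" for x
 have cs: "continuous_on UNIV (dd v y)" "continuous_on UNIV (dd v (dd v y))" for v by (intro smooth_cont smooth_dd sm)+
 obtain K where K: "compact K" "!!x. x \<notin> K ==> y x = 0" using tf_support[OF y(1)] by blast
 note out = dd_outside_closed[OF compact_imp_closed[OF K(1)]]
 have c1: "continuous_on UNIV T1" "continuous_on UNIV T2" unfolding T1_def T2_def by (intro continuous_intros cs)+
 obtain A1 where A1: "!!x. \<bar>T1 x\<bar> <= A1" by (rule compact_support_bounded[OF c1(1) K(1)]) (simp add: T1_def out[OF out[OF K(2)]], blast)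
 obtain A2 where A2: "!!x. \<bar>T2 x\<bar> <= A2" by (rule compact_support_bounded[OF c1(2) K(1)]) (simp add: T2_def out[OF K(2)], blast)
 define e where "e n = inverse (real (Suc n))" for n
 have e: "0 < e n" "e n <= 1" for n by (auto simp: e_def field_simps)
 define yn where "yn n p = y (e n *R p)" for n p
 have D: "dd v (%p. g (e n *R p)) = (%p. e n * dd v g (e n *R p))" if "smooth g" for g v n
  using dd_affine[OF bounded_linear_scaleR_right smooth_differentiable[OF that], of v "e n" 0] dd_scaleR_dir[OF that] by simp
 have Dn: "dd v (yn n) = (%p. e n * dd v y (e n *R p))" for v n unfolding yn_def using D[OF sm] .
 have DDn: "dd v (dd v (yn n)) = (%p. e n * (e n * dd v (dd v y) (e n *R p)))" for v n
  unfolding Dn using D[OF smooth_cmult[OF smooth_dd[OF sm], of "e n" v]]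
   dd_mult[of "%_. e n" "dd v y" v] smooth_differentiable[OF smooth_dd[OF sm]] by (simp add: mult_ac)
 have ouy: "ou \<beta> s (yn n) p = (e n)^2 * T1 (e n *R p) - T2 (e n *R p)" for n p
  unfolding ou_def DDn T1_def T2_def unfolding Dn by (simp add: sum_subtractf sum_distrib_left power2_eq_square algebra_simps)
 have ynt: "test_function (yn n)" for n
 proof (rule tf_I)
  show "smooth (yn n)" unfolding yn_def using smooth_affine[OF bounded_linear_scaleR_right sm, of "e n" 0] by simp
  show "compact ((%x. (1 / e n) *R x) ` K)" by (intro compact_scaling K)
  show "yn n x = 0" if "x \<notin> (%x. (1 / e n) *R x) ` K" for x unfolding yn_def using that e(1)[of n] by (intro K(2)) (auto intro: rev_image_eqI)
 qed
 define R where "R n p = h p * ou \<beta> s (yn n) p + 1/\<beta> * (\<Sum>k\<in>UNIV. dd (s k) (yn n) p * dd (s k) h p)" for n p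
 have eq: "ou \<beta> s (%p. yn n p * h p) p = yn n p * ou \<beta> s h p + R n p" for n p unfolding ou_mult[OF tf_smooth[OF ynt] h] R_def by simp
 define C where "C = M * (A1 + A2) + 1/\<beta> * (\<Sum>k\<in>UNIV. B1 k * M)"
 have RC: "\<bar>R n p\<bar> <= C" for n p
 proof -
  have "(e n)^2 * \<bar>T1 (e n *R p)\<bar> <= 1 * A1" using e[of n] by (intro mult_mono A1) (auto simp: power_le_one)
  hence "\<bar>(e n)^2 * T1 (e n *R p)\<bar> <= A1" by (simp add: abs_mult)
  hence "\<bar>ou \<beta> s (yn n) p\<bar> <= A1 + A2" unfolding ouy using A2[of "e n *R p"] by linarith
  hence a: "\<bar>h p * ou \<beta> s (yn n) p\<bar> <= M * (A1 + A2)"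
   unfolding abs_mult using M(1) order.trans[OF abs_ge_zero M(1)] by (intro mult_mono) auto
  have "\<bar>dd (s k) (yn n) p\<bar> <= B1 k" for k
  proof -
   have "\<bar>e n\<bar> * \<bar>dd (s k) y (e n *R p)\<bar> <= 1 * B1 k" using e[of n] by (intro mult_mono B1) auto
   thus ?thesis unfolding Dn abs_mult by simp
  qed
  hence "\<bar>\<Sum>k\<in>UNIV. dd (s k) (yn n) p * dd (s k) h p\<bar> <= (\<Sum>k\<in>UNIV. B1 k * M)"
   by (intro order.trans[OF sum_abs] sum_mono) (auto simp: abs_mult intro!: mult_mono M order.trans[OF abs_ge_zero B1])
  hence "\<bar>1/\<beta> * (\<Sum>k\<in>UNIV. dd (s k) (yn n) p * dd (s k) h p)\<bar> <= 1/\<beta> * (\<Sum>k\<in>UNIV. B1 k * M)"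
   unfolding abs_mult using \<beta> by (intro mult_mono) auto
  with a show ?thesis unfolding R_def C_def by linarith
 qed
 have "(%n. LBINT p. f p * ou \<beta> s (%p. yn n p * h p) p) ----> (LBINT p. f p * ou \<beta> s h p)"
 proof (rule int_dct[where w="%p. \<bar>f p * ou \<beta> s h p\<bar> + C * \<bar>f p\<bar>"])
  show "integrable lborel (%p. \<bar>f p * ou \<beta> s h p\<bar> + C * \<bar>f p\<bar>)" using int fi by simp
  show "(%p. f p * ou \<beta> s h p): borel_measurable lborel" using int by (rule borel_intI)
  have sm_ou: "smooth (ou \<beta> s g)" if "smooth g" for g
   unfolding ou_def[abs_def] by (intro smooth_cmult smooth_sum smooth_diff smooth_mult smooth_dd that smooth_bounded_linear bounded_linear_inner_right)
  have "ou \<beta> s (%p. yn n p * h p): Borel" for n by (intro borel_contI smooth_cont sm_ou smooth_mult h tf_smooth[OF ynt])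
  thus "(%p. f p * ou \<beta> s (%p. yn n p * h p) p): borel_measurable lborel" for n using borel_intI[OF fi] by simp
  show "AE p in lborel. norm (f p * ou \<beta> s (%p. yn n p * h p) p) <= \<bar>f p * ou \<beta> s h p\<bar> + C * \<bar>f p\<bar>" for n
  proof (rule AE_I2)
   fix p :: 'a
   have "\<bar>yn n p\<bar> * \<bar>f p * ou \<beta> s h p\<bar> <= 1 * \<bar>f p * ou \<beta> s h p\<bar>" unfolding yn_def by (intro mult_right_mono y) auto
   moreover have "\<bar>f p\<bar> * \<bar>R n p\<bar> <= \<bar>f p\<bar> * C" by (intro mult_left_mono RC) auto
   moreover have "\<bar>f p * (yn n p * ou \<beta> s h p + R n p)\<bar> <= \<bar>yn n p\<bar> * \<bar>f p * ou \<beta> s h p\<bar> + \<bar>f p\<bar> * \<bar>R n p\<bar>"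
    unfolding distrib_left by (rule order.trans[OF abs_triangle_ineq]) (simp add: abs_mult mult_ac)
   ultimately show "norm (f p * ou \<beta> s (%p. yn n p * h p) p) <= \<bar>f p * ou \<beta> s h p\<bar> + C * \<bar>f p\<bar>"
    unfolding eq by (simp add: mult.commute)
  qed
  show "AE p in lborel. (%n. f p * ou \<beta> s (%p. yn n p * h p) p) ----> f p * ou \<beta> s h p"
  proof (rule AE_I2)
   fix p :: 'a
   have "(%n. e n * norm p) ----> 0 * norm p" unfolding e_def by (intro tendsto_mult LIMSEQ_inverse_real_of_nat tendsto_const)
   hence "\<forall>\<^sub>F n in sequentially. e n * norm p < 1" by (rule order_tendstoD(2)) simp
   hence "\<forall>\<^sub>F n in sequentially. f p * ou \<beta> s (%p. yn n p * h p) p = f p * ou \<beta> s h p"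
   proof eventually_elim
    case (elim n)
    hence "e n *R p : ball 0 1" using e(1)[of n] by simp
    note z = one[OF this] two[OF this] y(2)[of "e n *R p"] this
    show ?case unfolding eq R_def ouy Dn T1_def T2_def using z by (simp add: yn_def)
   qed
   thus "(%n. f p * ou \<beta> s (%p. yn n p * h p) p) ----> f p * ou \<beta> s h p" by (rule tendsto_eventually)
  qed
 qed
 moreover have "(LBINT p. f p * ou \<beta> s (%p. yn n p * h p) p) = 0" for n by (rule weak[OF tf_mult_smooth[OF ynt h]])
 ultimately show ?thesis by (simp add: LIMSEQ_const_iff)
qed

text \<open>A cosine is inserted into the weak equation: the drift term is the derivative of the
  transform of \<open>f\<close> in direction \<open>- ou_L y\<close>, and the second-order term is a
  multiple of the transform itself. The result is a differential equation for the transform.\<close>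

lemma ou_cos_identity:
 "(LBINT p. f p * ((ou_L y \<bullet> p) * sin (y \<bullet> p + h))) = ou_Q y / \<beta> * (LBINT p. f p * cos (y \<bullet> p + h))"
proof -
 have [measurable]: "f : Borel" using borel_intI[OF fi] by simp
 define T where "T p = cos (y \<bullet> p + h)" for p
 have Ts: "smooth T" unfolding T_def[abs_def] by (rule smooth_cos_affine)
 have DT: "dd v T = (%p. - (y \<bullet> v) * sin (y \<bullet> p + h))" for v unfolding T_def[abs_def] by (rule dd_cos_affine)
 have ouT: "ou \<beta> s T p = 1/2 * ((ou_L y \<bullet> p) * sin (y \<bullet> p + h) - ou_Q y / \<beta> * T p)" for p
 proof -
  have L: "ou_L y \<bullet> p = (\<Sum>k\<in>UNIV. (y \<bullet> s k) * (s k \<bullet> p))" by (simp add: ou_L_def inner_sum_left inner_commute[of y])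
  have Q: "ou_Q y = (\<Sum>k\<in>UNIV. (y \<bullet> s k)^2)" by (simp add: ou_Q_def inner_commute[of y])
  show ?thesis unfolding ou_def DT dd_cos_affine(2) L Q T_def sum_distrib_right sum_divide_distrib sum_subtractf[symmetric]
   by (intro arg_cong[where f="(*) (1/2)"] sum.cong refl) (simp add: algebra_simps)
 qed
 let ?I = "%p. f p * ((ou_L y \<bullet> p) * sin (y \<bullet> p + h))"
 have i1: "integrable lborel ?I"
 proof (rule int_bound[OF integrable_mult_right[OF ou_moment[of 1], of "norm (ou_L y)"]])
  show "AE p in lborel. norm (?I p) <= norm (norm (ou_L y) * (f p * norm p ^ 1))"
  proof (rule AE_I2)
   fix p :: 'a
   have "\<bar>ou_L y \<bullet> p\<bar> * \<bar>sin (y \<bullet> p + h)\<bar> <= (norm (ou_L y) * norm p) * 1" by (intro mult_mono Cauchy_Schwarz_ineq2) auto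
   from mult_left_mono[OF this f0[of p]] show "norm (?I p) <= norm (norm (ou_L y) * (f p * norm p ^ 1))"
    using f0[of p] by (simp add: abs_mult mult_ac)
  qed
 qed simp_all
 have i2: "integrable lborel (%p. f p * T p)" by (rule int_mult_bounded[OF fi, where B=1]) (auto simp: T_def)
 have e: "f p * ou \<beta> s T p = 1/2 * (?I p - ou_Q y / \<beta> * (f p * T p))" for p by (simp add: ouT algebra_simps)
 have "(LBINT p. f p * ou \<beta> s T p) = 0"
 proof (rule ou_weak_extension[OF Ts])
  define M where "M = 1 + (\<Sum>k\<in>UNIV. \<bar>y \<bullet> s k\<bar>)"
  have M: "1 <= M" "\<bar>y \<bullet> s k\<bar> <= M" for k
   using member_le_sum[of k UNIV "%k. \<bar>y \<bullet> s k\<bar>"] by (simp_all add: M_def sum_nonneg)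
  show "\<bar>T p\<bar> <= M" for p unfolding T_def by (rule order.trans[OF abs_cos_le_one M(1)])
  show "\<bar>dd (s k) T p\<bar> <= M" for k p using mult_mono[OF M(2)[of k] abs_sin_le_one[of "y \<bullet> p + h"]] M(1) by (simp add: DT abs_mult)
  show "integrable lborel (%p. f p * ou \<beta> s T p)" unfolding e using i1 i2 by simp
 qed
 thus ?thesis unfolding e using i1 i2 by (simp add: T_def)
qed

text \<open>Only the derivative of the transform along the field \<open>- ou_L z\<close> is known.
  Divided by the Gaussian, the transform has derivative zero there, and
  \<open>constant_along_contracting_field\<close> evaluates the quotient at the origin. The second
  moment supplies the quadratic Taylor error.\<close>

lemma ou_fourier:
 "(LBINT p. f p * cos (z \<bullet> p + k)) = cos k * (LBINT p. f p) * exp (- (norm z)\<^sup>2 / (2 * \<beta>))"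
proof -
 have [measurable]: "f : Borel" using borel_intI[OF fi] by simp
 define F where "F z = (LBINT p. f p * cos (z \<bullet> p + k))" for z
 define h where "h z = F z * exp ((norm z)^2 / (2 * \<beta>))" for z
 have Fi: "integrable lborel (%p. f p * cos (z \<bullet> p + k))" for z by (rule int_mult_bounded[OF fi, where B=1]) auto
 have si: "integrable lborel (%p. f p * ((w \<bullet> p) * sin (z \<bullet> p + k)))" for w z
 proof (rule int_bound)
  show "integrable lborel (%p. norm w * (f p * norm p ^ 1))" by (intro integrable_mult_right ou_moment) simp
  show "AE p in lborel. norm (f p * ((w \<bullet> p) * sin (z \<bullet> p + k))) <= norm (norm w * (f p * norm p ^ 1))"
  proof (rule AE_I2)
   fix p :: 'a
   have "\<bar>w \<bullet> p\<bar> * \<bar>sin (z \<bullet> p + k)\<bar> <= (norm w * norm p) * 1" by (intro mult_mono Cauchy_Schwarz_ineq2) auto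
   hence "f p * (\<bar>w \<bullet> p\<bar> * \<bar>sin (z \<bullet> p + k)\<bar>) <= f p * (norm w * norm p)" by (intro mult_left_mono f0) simp
   thus "norm (f p * ((w \<bullet> p) * sin (z \<bullet> p + k))) <= norm (norm w * (f p * norm p ^ 1))"
    using f0[of p] by (simp add: abs_mult mult_ac)
  qed
 qed measurable
 define S where "S = (LBINT p. f p * (norm p)^2)"
 have taylor: "\<bar>F (z + w) - F z + (LBINT p. f p * ((w \<bullet> p) * sin (z \<bullet> p + k)))\<bar> <= S * (norm w)^2" for z w
 proof -
  define g where "g p = f p * (cos ((z + w) \<bullet> p + k) - cos (z \<bullet> p + k) + (w \<bullet> p) * sin (z \<bullet> p + k))" for p
  have g: "g = (%p. f p * cos ((z + w) \<bullet> p + k) - f p * cos (z \<bullet> p + k) + f p * ((w \<bullet> p) * sin (z \<bullet> p + k)))"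
   by (simp add: g_def fun_eq_iff algebra_simps)
  have gi: "integrable lborel g" unfolding g by (intro Bochner_Integration.integrable_add Bochner_Integration.integrable_diff Fi si)
  have "F (z + w) - F z + (LBINT p. f p * ((w \<bullet> p) * sin (z \<bullet> p + k))) = (LBINT p. g p)" unfolding g F_def using Fi si by simp
  also have "\<bar>...\<bar> <= (LBINT p. \<bar>g p\<bar>)" by (rule integral_abs_bound)
  also have "... <= (LBINT p. (norm w)^2 * (f p * (norm p)^2))"
  proof (rule integral_mono)
   fix p
   have "\<bar>cos ((z + w) \<bullet> p + k) - cos (z \<bullet> p + k) + (w \<bullet> p) * sin (z \<bullet> p + k)\<bar> <= (w \<bullet> p)^2"
    using cos_second_order[of "z \<bullet> p + k" "w \<bullet> p"] by (simp add: inner_add_left ac_simps)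
   also have "... <= (norm w)^2 * (norm p)^2" using Cauchy_Schwarz_ineq[of w p] by (simp add: power2_norm_eq_inner)
   finally show "\<bar>g p\<bar> <= (norm w)^2 * (f p * (norm p)^2)" using f0[of p] by (simp add: g_def abs_mult mult.left_commute mult_left_mono)
  qed (use gi ou_second_moment in auto)
  finally show ?thesis by (simp add: S_def mult.commute)
 qed
 have D: "((%t. F (z - t *R ou_L z)) has_real_derivative ou_Q z / \<beta> * F z) (at 0)" for z
 proof -
  define m where "m = ou_Q z / \<beta> * F z"
  have m: "m = (LBINT p. f p * ((ou_L z \<bullet> p) * sin (z \<bullet> p + k)))" unfolding m_def F_def by (rule ou_cos_identity[symmetric])
  have q: "\<bar>F (z - t *R ou_L z) - F z - t * m\<bar> <= S * (norm (ou_L z))^2 * t^2" for t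
  proof -
   have e1: "(LBINT p. f p * (((- t) *R ou_L z \<bullet> p) * sin (z \<bullet> p + k))) = (LBINT p. - t * (f p * ((ou_L z \<bullet> p) * sin (z \<bullet> p + k))))"
    by (intro lint_cong) auto
   have e2: "(LBINT p. - t * (f p * ((ou_L z \<bullet> p) * sin (z \<bullet> p + k)))) = - t * m" unfolding m by (rule integral_mult_right_zero)
   show ?thesis using taylor[of z "(- t) *R ou_L z"] unfolding trans[OF e1 e2] by (simp add: power_mult_distrib mult_ac)
  qed
  have "((%t. (F (z - t *R ou_L z) - F z) / t - m) \<longlongrightarrow> 0) (at 0)"
  proof (rule Lim_null_comparison)
   show "\<forall>\<^sub>F t in at 0. norm ((F (z - t *R ou_L z) - F z) / t - m) <= S * (norm (ou_L z))^2 * \<bar>t\<bar>"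
    unfolding eventually_at_filter
   proof (intro always_eventually allI impI)
    fix t :: real assume t: "t \<noteq> 0"
    have "(F (z - t *R ou_L z) - F z) / t - m = (F (z - t *R ou_L z) - F z - t * m) / t" using t by (simp add: field_simps)
    also have "norm ... <= S * (norm (ou_L z))^2 * t^2 / \<bar>t\<bar>" using q[of t] by (simp add: divide_right_mono)
    also have "... = S * (norm (ou_L z))^2 * \<bar>t\<bar>" using t by (simp add: power2_eq_square field_simps abs_if)
    finally show "norm ((F (z - t *R ou_L z) - F z) / t - m) <= S * (norm (ou_L z))^2 * \<bar>t\<bar>" .
   qed
   show "((%t. S * (norm (ou_L z))^2 * \<bar>t\<bar>) \<longlongrightarrow> 0) (at (0::real))" by (auto intro!: tendsto_eq_intros)
  qed
  hence "((%t. (F (z - t *R ou_L z) - F z) / t) \<longlongrightarrow> m) (at 0)" by (simp add: LIM_zero_iff)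
  thus ?thesis by (simp add: DERIV_def m_def)
 qed
 have Fc: "continuous_on UNIV F"
 proof -
  have "isCont F z" for z
  proof -
   define M where "M = (LBINT p. f p * norm p ^ 1)"
   have "norm (F x - F y) <= M * norm (x - y)" for x y
   proof -
    have "F x - F y = (LBINT p. f p * cos (x \<bullet> p + k) - f p * cos (y \<bullet> p + k))" unfolding F_def using Fi by simp
    also have "\<bar>...\<bar> <= (LBINT p. \<bar>f p * cos (x \<bullet> p + k) - f p * cos (y \<bullet> p + k)\<bar>)" by (rule integral_abs_bound)
    also have "... <= (LBINT p. norm (x - y) * (f p * norm p ^ 1))"
    proof (rule integral_mono)
     fix p
     have "norm (cos (x \<bullet> p + k) - cos (y \<bullet> p + k)) <= 1 * norm ((x \<bullet> p + k) - (y \<bullet> p + k))"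
      by (rule field_differentiable_bound[of UNIV cos "%x. - sin x"]) (auto intro!: derivative_eq_intros)
     also have "... <= norm (x - y) * norm p" using Cauchy_Schwarz_ineq2[of "x - y" p] by (simp add: inner_diff_left)
     finally have "f p * \<bar>cos (x \<bullet> p + k) - cos (y \<bullet> p + k)\<bar> <= f p * (norm (x - y) * norm p)"
      by (intro mult_left_mono f0) simp
     thus "\<bar>f p * cos (x \<bullet> p + k) - f p * cos (y \<bullet> p + k)\<bar> <= norm (x - y) * (f p * norm p ^ 1)"
      using f0[of p] by (simp add: right_diff_distrib[symmetric] abs_mult mult_ac)
     show "integrable lborel (%p. norm (x - y) * (f p * norm p ^ 1))" by (intro integrable_mult_right ou_moment) simp
    qed (use Fi in auto)
    also have "... = M * norm (x - y)" by (simp add: M_def mult.commute)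
    finally show ?thesis by simp
   qed
   hence "\<forall>\<^sub>F y in at z. norm (F y - F z) <= M * norm (y - z)" by (intro always_eventually allI)
   moreover have "((%y. M * norm (y - z)) \<longlongrightarrow> 0) (at z)" by (auto intro!: tendsto_eq_intros)
   ultimately have "((%y. F y - F z) \<longlongrightarrow> 0) (at z)" by (rule Lim_null_comparison)
   thus ?thesis by (simp add: isCont_def LIM_zero_iff)
  qed
  thus ?thesis by (simp add: cont_at_on)
 qed
 have "h z = h 0"
 proof (rule constant_along_contracting_field[where L=ou_L])
  show "continuous_on UNIV h" unfolding h_def using \<beta> by (intro continuous_intros Fc) auto
  show "x \<noteq> 0 ==> 0 < x \<bullet> ou_L x" for x by (simp add: inner_ou_L ou_Q_pos)
  fix z
  have n: "(norm (z - t *R ou_L z))^2 = (norm z)^2 - 2 * t * ou_Q z + t^2 * (norm (ou_L z))^2" for t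
   unfolding power2_norm_eq_inner inner_ou_L[symmetric] by (simp add: inner_diff_left inner_diff_right inner_commute power2_eq_square algebra_simps)
  have E: "((%t. exp (((norm z)^2 - 2 * t * ou_Q z + t^2 * (norm (ou_L z))^2) / (2 * \<beta>))) has_real_derivative
    exp ((norm z)^2 / (2 * \<beta>)) * (- ou_Q z / \<beta>)) (at 0)" using \<beta> by (auto intro!: derivative_eq_intros simp: field_simps)
  show "((%t. h (z - t *R ou_L z)) has_real_derivative 0) (at 0)" unfolding h_def n by (rule DERIV_cong[OF DERIV_mult[OF D E]]) simp
 qed
 hence "F z * exp ((norm z)^2 / (2 * \<beta>)) = cos k * (LBINT p. f p)" by (simp add: h_def F_def)
 thus ?thesis unfolding F_def[symmetric] by (simp add: exp_minus field_simps)
qed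

text \<open>The mass of \<open>f\<close> stays as a factor because \<open>f\<close> will be the
  density integrated over positions against a bump, hence not normalized.\<close>

lemma ou_liouville: "AE p in lborel. f p = (LBINT p. f p) * gauss (1 / sqrt \<beta>) p"
proof -
 define m where "m = (LBINT p. f p)"
 have v: "1 / sqrt \<beta> > 0" using \<beta> by simp
 have gi: "integrable lborel (gauss (1 / sqrt \<beta>) :: 'a => real)" by (rule int_gauss[OF v])
 have [measurable]: "f : Borel" using borel_intI[OF fi] by simp
 have "AE p in lborel. f p - m * gauss (1 / sqrt \<beta>) p = 0"
 proof (rule fourier_unique)
  show "integrable lborel (%p. f p - m * gauss (1 / sqrt \<beta>) p)" using fi gi by simp
  fix y :: 'a and h
  have i1: "integrable lborel (%p. f p * cos (y \<bullet> p + h))" by (rule int_mult_bounded[OF fi, where B=1]) auto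
  have i2: "integrable lborel (%p. gauss (1 / sqrt \<beta>) p * cos (y \<bullet> p + h))" by (rule int_mult_bounded[OF gi, where B=1]) auto
  have "(LBINT p. (f p - m * gauss (1 / sqrt \<beta>) p) * cos (y \<bullet> p + h))
    = (LBINT p. f p * cos (y \<bullet> p + h)) - m * (LBINT p. gauss (1 / sqrt \<beta>) p * cos (y \<bullet> p + h))"
   using i1 i2 by (simp add: left_diff_distrib mult.assoc)
  also have "... = 0" unfolding ou_fourier integral_gauss_cos[OF v] using \<beta> by (simp add: m_def power_divide mult_ac)
  finally show "(LBINT p. (f p - m * gauss (1 / sqrt \<beta>) p) * cos (y \<bullet> p + h)) = 0" .
 qed
 thus ?thesis by (simp add: m_def)
qed

end
end

section \<open>The generator on phase space\<close>

lemma dd_pair_smooth: assumes "smooth (f :: 'n::finite phase => real)"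
 shows "u \<bullet> grad_q f x = dd (u, 0) f x" "u \<bullet> grad_p f x = dd (0, u) f x"
proof -
 have sc: "dd (c *R v, 0) f x = c * dd (v, 0) f x" "dd (0, c *R v) f x = c * dd (0, v) f x" for c and v :: "real^'n"
  using dd_scaleR_dir[OF assms, of c "(v, 0)" x] dd_scaleR_dir[OF assms, of c "(0, v)" x] by simp_all
 have u: "u = (\<Sum>i\<in>UNIV. u $ i *R axis i 1)" by (simp add: vec_eq_iff axis_def if_distrib cong: if_cong)
 have "(u, 0::real^'n) = (\<Sum>i\<in>UNIV. u $ i *R (axis i 1, 0))" by (subst (1) u) (simp add: prod_eq_iff fst_sum snd_sum)
 thus "u \<bullet> grad_q f x = dd (u, 0) f x" by (simp add: dd_sum_dir[OF assms] sc grad_q_def pd_q_def inner_vec_def)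
 have "(0::real^'n, u) = (\<Sum>i\<in>UNIV. u $ i *R (0, axis i 1))" by (subst (1) u) (simp add: prod_eq_iff fst_sum snd_sum)
 thus "u \<bullet> grad_p f x = dd (0, u) f x" by (simp add: dd_sum_dir[OF assms] sc grad_p_def pd_p_def inner_vec_def)
qed

lemma diffusion_matrix_mult: fixes \<sigma> :: "real ^ 'n ^ 'n"
 shows "(\<sigma> ** transpose \<sigma>) *v p = (\<Sum>k\<in>UNIV. (column k \<sigma> \<bullet> p) *R column k \<sigma>)"
proof -
 have "((\<sigma> ** transpose \<sigma>) *v p) $ i = (\<Sum>k\<in>UNIV. (column k \<sigma> \<bullet> p) * \<sigma> $ i $ k)" for i
 proof -
  have "((\<sigma> ** transpose \<sigma>) *v p) $ i = (\<Sum>j\<in>UNIV. \<Sum>k\<in>UNIV. \<sigma> $ i $ k * \<sigma> $ j $ k * p $ j)"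
   by (simp add: matrix_vector_mult_def matrix_matrix_mult_def transpose_def sum_distrib_right)
  also have "... = (\<Sum>k\<in>UNIV. \<Sum>j\<in>UNIV. \<sigma> $ i $ k * \<sigma> $ j $ k * p $ j)" by (rule sum.swap)
  also have "... = (\<Sum>k\<in>UNIV. (column k \<sigma> \<bullet> p) * \<sigma> $ i $ k)"
   by (simp add: column_def inner_vec_def sum_distrib_right sum_distrib_left mult_ac)
  finally show ?thesis .
 qed
 thus ?thesis by (simp add: vec_eq_iff column_def)
qed

lemma dd_sum_fun: assumes "!!i. i : I ==> smooth (f i)" "finite I"
 shows "dd v (%x. \<Sum>i\<in>I. c i * f i x) x = (\<Sum>i\<in>I. c i * dd v (f i) x)"
proof (rule dd_eq)
 show "((%x. \<Sum>i\<in>I. c i * f i x) has_derivative (%v. \<Sum>i\<in>I. c i * dd v (f i) x)) (at x)"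
  by (intro has_derivative_sum has_derivative_mult_right smooth_has_derivative assms)
qed

lemma diffusion_hess: fixes \<sigma> :: "real ^ 'n ^ 'n" and f :: "'n::finite phase => real" assumes f: "smooth f"
 shows "(\<sigma> ** transpose \<sigma>) \<bullet> hess_p f x = (\<Sum>k\<in>UNIV. dd (0, column k \<sigma>) (dd (0, column k \<sigma>) f) x)"
proof -
 have c: "dd (0, column k \<sigma>) g x = (\<Sum>i\<in>UNIV. \<sigma> $ i $ k * dd (0, axis i 1) g x)" if "smooth g" for g :: "'n phase => real" and k x
  using dd_pair_smooth(2)[OF that, of "column k \<sigma>" x] by (simp add: grad_p_def pd_p_def inner_vec_def column_def)
 have cc: "dd (0, column k \<sigma>) (dd (0, column k \<sigma>) f) x
   = (\<Sum>i\<in>UNIV. \<sigma> $ i $ k * (\<Sum>j\<in>UNIV. \<sigma> $ j $ k * dd (0, axis i 1) (dd (0, axis j 1) f) x))" for k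
 proof -
  have "dd (0, column k \<sigma>) f = (%x. \<Sum>j\<in>UNIV. \<sigma> $ j $ k * dd (0, axis j 1) f x)" using c[OF f] by blast
  hence "dd (0, axis i 1) (dd (0, column k \<sigma>) f) x = (\<Sum>j\<in>UNIV. \<sigma> $ j $ k * dd (0, axis i 1) (dd (0, axis j 1) f) x)" for i
   by (simp add: dd_sum_fun smooth_dd f)
  thus ?thesis using c[OF smooth_dd[OF f]] by simp
 qed
 have "(\<sigma> ** transpose \<sigma>) \<bullet> hess_p f x = (\<Sum>i\<in>UNIV. \<Sum>j\<in>UNIV. \<Sum>k\<in>UNIV. \<sigma> $ i $ k * (\<sigma> $ j $ k * dd (0, axis i 1) (dd (0, axis j 1) f) x))"
  by (simp add: inner_vec_def matrix_matrix_mult_def transpose_def hess_p_def pd_p_def sum_distrib_right mult.assoc)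
 also have "... = (\<Sum>i\<in>UNIV. \<Sum>k\<in>UNIV. \<Sum>j\<in>UNIV. \<sigma> $ i $ k * (\<sigma> $ j $ k * dd (0, axis i 1) (dd (0, axis j 1) f) x))"
  by (intro sum.cong refl sum.swap)
 also have "... = (\<Sum>k\<in>UNIV. \<Sum>i\<in>UNIV. \<Sum>j\<in>UNIV. \<sigma> $ i $ k * (\<sigma> $ j $ k * dd (0, axis i 1) (dd (0, axis j 1) f) x))"
  by (rule sum.swap)
 also have "... = (\<Sum>k\<in>UNIV. dd (0, column k \<sigma>) (dd (0, column k \<sigma>) f) x)" unfolding cc by (simp add: sum_distrib_left)
 finally show ?thesis .
qed

text \<open>The phase-space analogue of \<open>ou\<close>: the part of the generator that is symmetric
 under reversal of the momentum.\<close>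

definition diffusion :: "real => real ^ 'n ^ 'n => ('n::finite phase => real) => 'n phase => real" where
 "diffusion \<beta> \<sigma> f x = 1/2 * (\<Sum>k\<in>UNIV. 1/\<beta> * dd (0, column k \<sigma>) (dd (0, column k \<sigma>) f) x
   - (column k \<sigma> \<bullet> snd x) * dd (0, column k \<sigma>) f x)"

lemma generator_eq: fixes f :: "'n::finite phase => real" assumes f: "smooth f"
 shows "generator \<beta> \<sigma> b f x = dd (snd x, b (fst x)) f x + diffusion \<beta> \<sigma> f x"
proof -
 obtain q p where x: "x = (q, p)" by (cases x)
 have 1: "p \<bullet> grad_q f x + b q \<bullet> grad_p f x = dd (p, b q) f x"
  using dd_add_dir[OF f, of "(p, 0)" "(0, b q)" x] by (simp add: dd_pair_smooth[OF f])
 have 2: "((\<sigma> ** transpose \<sigma>) *v p) \<bullet> grad_p f x = (\<Sum>k\<in>UNIV. (column k \<sigma> \<bullet> p) * dd (0, column k \<sigma>) f x)"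
 proof -
  have "dd (0, c *R v) f x = c * dd (0, v) f x" for c and v :: "real^'n" using dd_scaleR_dir[OF f, of c "(0, v)" x] by simp
  thus ?thesis unfolding diffusion_matrix_mult inner_sum_left by (simp add: dd_pair_smooth[OF f])
 qed
 show ?thesis unfolding generator_def x prod.case fst_conv snd_conv 1[unfolded x] 2[unfolded x] diffusion_hess[OF f] diffusion_def
  by (simp add: sum_subtractf sum_distrib_left[symmetric] right_diff_distrib sum_divide_distrib[symmetric])
qed

definition tensor :: "('a => real) => ('b => real) => 'a \<times> 'b => real" where
 "tensor f g x = f (fst x) * g (snd x)"

lemma tensor_case: "(%(q, p). f q * g p) = tensor f g" by (auto simp: tensor_def fun_eq_iff)

lemma tf_tensor': "test_function f ==> test_function g ==> test_function (tensor f g)" unfolding tensor_def[abs_def] by (rule tf_tensor)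

lemma smooth_tensor: "smooth f ==> smooth g ==> smooth (tensor f g)" unfolding tensor_def[abs_def] by (intro smooth_mult smooth_fst smooth_snd)

lemma dd_tensor: assumes f: "smooth f" and g: "smooth g" shows "dd (u, v) (tensor f g) x = dd u f (fst x) * g (snd x) + f (fst x) * dd v g (snd x)"
proof -
 have "((%x. f (fst x)) has_derivative (%w. dd (fst w) f (fst x))) (at x)"
  by (rule has_derivative_compose[OF has_derivative_fst[OF has_derivative_ident] smooth_has_derivative[OF f]])
 moreover have "((%x. g (snd x)) has_derivative (%w. dd (snd w) g (snd x))) (at x)"
  by (rule has_derivative_compose[OF has_derivative_snd[OF has_derivative_ident] smooth_has_derivative[OF g]])
 ultimately have "((%x. f (fst x) * g (snd x)) has_derivative
   (%w. f (fst x) * dd (snd w) g (snd x) + dd (fst w) f (fst x) * g (snd x))) (at x)" by (rule has_derivative_mult)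
 from dd_eq[OF this] show ?thesis by (simp add: tensor_def[abs_def])
qed

lemma dd_zero [simp]: "dd 0 f = (%x. 0)" by (simp add: dir_deriv_def fun_eq_iff)

lemma dd_tensor_snd: assumes f: "smooth f" and g: "smooth g" shows "dd (0, v) (tensor f g) = tensor f (dd v g)"
 using dd_tensor[OF f g, of 0 v] by (auto simp: fun_eq_iff tensor_def)

lemma diffusion_tensor: assumes "smooth f" "smooth g"
 shows "diffusion \<beta> \<sigma> (tensor f g) x = f (fst x) * ou \<beta> (%k. column k \<sigma>) g (snd x)" unfolding diffusion_def ou_def
 by (simp add: dd_tensor_snd assms smooth_dd tensor_def sum_distrib_left algebra_simps)

definition transport :: "(real ^ 'n => real ^ 'n) => ('n::finite phase => real) => 'n phase => real" where
 "transport b f x = dd (snd x, b (fst x)) f x"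

lemma generator_split:
 "smooth f ==> generator \<beta> \<sigma> b f x = transport b f x + diffusion \<beta> \<sigma> f x" by (simp add: generator_eq transport_def)

definition flip :: "'a \<times> 'b::uminus => 'a \<times> 'b" where "flip x = (fst x, - snd x)"

lemma flip_flip [simp]: "flip (flip x) = (x :: 'a \<times> 'b::group_add)" by (simp add: flip_def)

lemma fst_flip [simp]: "fst (flip x) = fst x" and snd_flip [simp]: "snd (flip x) = - snd x" by (simp_all add: flip_def)

lemma flip_bounded_linear: "bounded_linear (flip :: 'a::real_normed_vector \<times> 'b::real_normed_vector => 'a \<times> 'b)"
 unfolding flip_def[abs_def] by (intro bounded_linear_Pair bounded_linear_fst bounded_linear_minus bounded_linear_snd)

lemma smooth_flip: "smooth f ==> smooth (%x. f (flip x))" using smooth_affine[OF flip_bounded_linear, of f 0] by simp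

lemma dd_flip: "smooth f ==> dd v (%x. f (flip x)) x = dd (flip v) f (flip x)"
 using dd_affine[OF flip_bounded_linear, of f v 0] by (simp add: smooth_differentiable)

lemma dd_minus_dir: "smooth f ==> dd (- v) f x = - dd v f x" using dd_scaleR_dir[of f "-1" v x] by simp

text \<open>At the reversed point the transport direction is \<open>(- p, b q)\<close>, and
  \<open>flip\<close> sends it to \<open>- (p, b q)\<close>; hence the sign.\<close>

lemma transport_part_flip: assumes f: "smooth (f :: 'n::finite phase => real)" shows "transport b (%x. f (flip x)) (flip x) = - transport b f x"
proof -
 have "flip (snd (flip x), b (fst (flip x))) = - (snd x, b (fst x))" by (simp add: flip_def)
 thus ?thesis unfolding transport_def dd_flip[OF f] by (simp only: flip_flip dd_minus_dir[OF f])
qed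

lemma diffusion_part_flip: assumes f: "smooth (f :: 'n::finite phase => real)"
 shows "diffusion \<beta> \<sigma> (%x. f (flip x)) (flip x) = diffusion \<beta> \<sigma> f x"
proof -
 have fl: "dd (flip (0, v)) g y = - dd (0, v) g y" if "smooth g" for g :: "'n phase => real" and v y
  using dd_minus_dir[OF that, of "(0, v)" y] by (simp add: flip_def)
 have 1: "dd (0, v) (%x. f (flip x)) = (%x. (- 1) * dd (0, v) f (flip x))" for v by (simp add: fun_eq_iff dd_flip[OF f] fl[OF f])
 have 2: "dd (0, v) (dd (0, v) (%x. f (flip x))) y = dd (0, v) (dd (0, v) f) (flip y)" for v y
 proof -
  have "dd (0, v) (%x. (- 1) * dd (0, v) f (flip x)) y = (- 1) * dd (0, v) (%x. dd (0, v) f (flip x)) y"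
   using dd_sum_fun[of "{()}" "%_. %x. dd (0, v) f (flip x)" "(0, v)" "%_. -1" y]
    smooth_flip[OF smooth_dd[OF f]] by simp
  thus ?thesis unfolding 1 by (simp add: dd_flip smooth_dd f fl)
 qed
 show ?thesis unfolding diffusion_def 2 unfolding 1 by simp
qed

section \<open>Momentum reversal and integration on phase space\<close>

lemma lborel_distr_flip:
 "distr lborel borel flip = (lborel :: ('a::euclidean_space \<times> 'b::euclidean_space) measure)"
proof (rule measure_eqI)
 have fm: "flip : borel_measurable (borel :: ('a \<times> 'b) measure)" by (intro borel_contI linear_continuous_on flip_bounded_linear)
 fix A :: "('a \<times> 'b) set" assume "A : sets (distr lborel borel flip)"
 hence A: "A : sets borel" by simp
 have m1: "(%z. indicator A (flip z) :: ennreal): Borel" using meas_comp[OF fm borel_measurable_indicator[OF A]] .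
 have "emeasure (distr lborel borel flip) A = (NN z. indicator A (flip z))" using A fm by (subst nn_integral_distr[symmetric]) auto
 also have "... = (NN x. (NN y. indicator A (x, - y)))" by (subst nn_lborel_fst(1)[OF m1, symmetric]) (simp add: flip_def)
 also have "... = (NN x. (NN y. indicator A (x, y)))"
 proof -
  have "(NN y. indicator A (x, - y)) = (NN y. indicator A (x, y))" for x :: 'a
  proof -
   have "(%y. indicator A (x, y) :: ennreal): Borel" using meas_comp[OF borel_contI borel_measurable_indicator[OF A], of "%y. (x, y)"]
    by (simp add: continuous_on_Pair)
   hence "(\<integral>\<^sup>+y. indicator A (x, y) \<partial>distr lborel borel uminus) = (NN y. indicator A (x, - y))"
    by (intro nn_integral_distr) auto
   thus ?thesis by (simp add: lborel_distr_uminus_euclidean)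
  qed
  thus ?thesis by simp
 qed
 also have "... = (NN z. indicator A z)" using A by (intro nn_lborel_fst(1)) simp
 also have "... = emeasure lborel A" using A by simp
 finally show "emeasure (distr lborel borel flip) A = emeasure lborel A" .
qed simp

lemma flip_measurable [measurable]:
 "flip : borel_measurable (borel :: ('a::euclidean_space \<times> 'b::euclidean_space) measure)"
 by (intro borel_contI linear_continuous_on flip_bounded_linear)

lemma integral_flip: fixes f :: "'a::euclidean_space \<times> 'b::euclidean_space => real" assumes [measurable]: "f : Borel"
 shows "(LBINT x. f (flip x)) = (LBINT x. f x)"
proof -
 have "(LINT x|distr lborel borel flip. f x) = (LBINT x. f (flip x))" by (rule integral_distr) simp_all
 thus ?thesis by (simp add: lborel_distr_flip)
qed

lemma box_bump_prod: "box_bump a b k x = box_bump (fst a) (fst b) k (fst x) * box_bump (snd a) (snd b) k (snd x)"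
proof -
 have inj: "inj_on (%u::'a. (u, 0::'b)) Basis" "inj_on (%u::'b. (0::'a, u)) Basis" by (auto intro!: inj_onI)
 have disj: "(%u::'a. (u, 0::'b)) ` Basis \<inter> (%u::'b. (0::'a, u)) ` Basis = {}" by auto
 show ?thesis unfolding box_bump_def Basis_prod_def
  by (subst prod.union_disjoint[OF _ _ disj]) (auto simp: prod.reindex[OF inj(1)] prod.reindex[OF inj(2)] inner_prod_def)
qed

lemma even_in_p_flip: "even_in_p \<rho> \<longleftrightarrow> (AE x in lborel. \<rho> x = \<rho> (flip x))"
 unfolding even_in_p_def flip_def by (simp add: case_prod_unfold)

lemma integral_even_flip: fixes \<rho> F :: "'n::finite phase => real" assumes "even_in_p \<rho>" and [measurable]: "\<rho> : Borel" "F : Borel"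
 shows "(LBINT x. \<rho> x * F (flip x)) = (LBINT x. \<rho> x * F x)"
proof -
 have "(LBINT x. \<rho> x * F (flip x)) = (LBINT x. \<rho> (flip x) * F (flip x))"
  by (rule integral_cong_AE) (use assms(1) in \<open>auto simp: even_in_p_flip\<close>)
 also have "... = (LBINT x. \<rho> x * F x)" by (rule integral_flip) measurable
 finally show ?thesis .
qed

lemma int_mult_supp: fixes \<rho> F :: "'a::euclidean_space => real"
 assumes "integrable lborel \<rho>" "continuous_on UNIV F" "compact K" "!!x. x \<notin> K ==> F x = 0" shows "integrable lborel (%x. \<rho> x * F x)"
proof -
 obtain B where "!!x. \<bar>F x\<bar> <= B" using compact_support_bounded[OF assms(2-4)] by blast
 moreover have "F : borel_measurable lborel" using borel_contI[OF assms(2)] by simp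
 ultimately show ?thesis using int_mult_bounded assms(1) by blast
qed

lemma integral_tensor: fixes f :: "'a::euclidean_space => real" and g :: "'b::euclidean_space => real"
 assumes "integrable lborel f" "integrable lborel g" shows "(LBINT z. f (fst z) * g (snd z)) = (LBINT x. f x) * (LBINT y. g y)"
 using lborel_fubini(1)[OF int_tensor[OF assms]] by simp

lemma integral_pos_lborel: fixes f :: "'a::euclidean_space => real" assumes "integrable lborel f" "!!x. f x > 0" shows "(LBINT x. f x) > 0"
proof -
 have "0 <= (LBINT x. f x)" using assms(2) by (intro integral_nonneg_AE) (simp add: less_imp_le)
 moreover have "(LBINT x. f x) \<noteq> 0"
 proof
  assume "(LBINT x. f x) = 0"
  hence "AE x in lborel. f x = 0" using integral_nonneg_eq_0_iff_AE[OF assms(1)] assms(2) by (simp add: less_imp_le)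
  then obtain x where "f x = 0" by (rule AE_lborel_obtain)
  thus False using assms(2)[of x] by simp
 qed
 ultimately show ?thesis by simp
qed

lemma AE_eq_0_test: fixes f :: "'a::euclidean_space => real"
 assumes f: "integrable lborel f" and zero: "!!h. test_function h ==> (LBINT x. f x * h x) = 0" shows "AE x in lborel. f x = 0"
proof (rule AE_eq_0_box_bump)
 show "f : Borel" using borel_intI[OF f] by simp
 show "integrable lborel (%x. indicator (box a b) x * f x)" for a b
  using int_mult_bounded[OF f, of "indicator (box a b)" 1] by (simp add: mult.commute indicator_def)
qed (intro zero box_bump_test_function)

text \<open>The product of \<open>c\<close> with a merely continuous \<open>h\<close> may fail to be
  integrable on the whole space, but it is integrable on boxes, which is all that the box bumps
  see.\<close>

lemma AE_eq_0_if_test_integrals_eq_0': fixes c h :: "'a::euclidean_space => real" assumes c: "integrable lborel c" and h: "continuous_on UNIV h"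
  and zero: "!!g. test_function g ==> (LBINT x. c x * (h x * g x)) = 0" shows "AE x in lborel. c x * h x = 0"
proof (rule AE_eq_0_box_bump)
 have hm: "h : Borel" using h by (rule borel_contI)
 show m: "(%x. c x * h x): Borel" using borel_intI[OF c] hm by simp
 fix a b :: 'a
 have "bounded (h ` cbox a b)" by (intro compact_imp_bounded compact_continuous_image continuous_on_subset[OF h] compact_cbox) auto
 then obtain B where B: "B > 0" "\<forall>x\<in>cbox a b. \<bar>h x\<bar> <= B" unfolding bounded_pos by auto
 have "integrable lborel (%x. c x * (indicator (box a b) x * h x))" by (rule int_mult_bounded[OF c, where B=B])
    (use hm B box_subset_cbox[of a b] in \<open>auto simp: indicator_def\<close>)
 thus "integrable lborel (%x. indicator (box a b) x * (c x * h x))" by (simp add: mult_ac)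
next
 fix a b :: 'a and k assume "\<forall>i\<in>Basis. a \<bullet> i < b \<bullet> i"
 thus "(LBINT x. c x * h x * box_bump a b k x) = 0" using zero[OF box_bump_test_function] by (simp add: mult.assoc)
qed

lemma shows AE_lborel_fst: "AE x in (lborel :: 'a::euclidean_space measure). P x ==>
   AE z in (lborel :: ('a \<times> 'b::euclidean_space) measure). P (fst z)"
  and AE_lborel_snd: "AE y in (lborel :: 'b measure). Q y ==> AE z in (lborel :: ('a \<times> 'b) measure). Q (snd z)"
proof -
 assume "AE x in (lborel :: 'a measure). P x"
 then obtain N where N: "{x : space lborel. \<not> P x} \<subseteq> N" "N : null_sets (lborel :: 'a measure)" by (auto simp: eventually_ae_filter)
 have m: "{z :: 'a \<times> 'b. fst z \<notin> N} : sets borel"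
  using measurable_sets[OF borel_fst, of "- N"] N(2) borel_comp[of N] by (simp add: vimage_def null_sets_def)
 have "AE x in lborel. AE y in (lborel :: 'b measure). fst (x, y) \<notin> N" using AE_not_in[OF N(2)] by eventually_elim simp
 hence "AE z in (lborel :: ('a \<times> 'b) measure). fst z \<notin> N" by (rule AE_lborel_prod_iff(1)[OF m, THEN iffD1])
 thus "AE z in (lborel :: ('a \<times> 'b) measure). P (fst z)" by eventually_elim (use N(1) in auto)
next
 assume "AE y in (lborel :: 'b measure). Q y"
 then obtain N where N: "{x : space lborel. \<not> Q x} \<subseteq> N" "N : null_sets (lborel :: 'b measure)" by (auto simp: eventually_ae_filter)
 have m: "{z :: 'a \<times> 'b. snd z \<notin> N} : sets borel"
  using measurable_sets[OF borel_snd, of "- N"] N(2) borel_comp[of N] by (simp add: vimage_def null_sets_def)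
 have "AE x in (lborel :: 'a measure). AE y in (lborel :: 'b measure). snd (x, y) \<notin> N" using AE_not_in[OF N(2)] by simp
 hence "AE z in (lborel :: ('a \<times> 'b) measure). snd z \<notin> N" by (rule AE_lborel_prod_iff(1)[OF m, THEN iffD1])
 thus "AE z in (lborel :: ('a \<times> 'b) measure). Q (snd z)" by eventually_elim (use N(1) in auto)
qed

lemma gauss_DERIV_line: fixes p h :: "'a::euclidean_space" assumes "v > 0"
 shows "((%s. gauss v (p + s *R h)) has_real_derivative - (p \<bullet> h) / v^2 * gauss v p) (at 0)"
proof -
 have e: "gauss v (p + s *R h) = (1 / sqrt (2 * pi * v^2)) ^ DIM('a) * exp (- ((p \<bullet> p) + 2 * s * (p \<bullet> h) + s^2 * (h \<bullet> h)) / (2 * v^2))" for s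
  unfolding gauss_eq power2_norm_eq_inner by (simp add: inner_add_left inner_add_right inner_commute algebra_simps power2_eq_square)
 have "((%s. exp (- ((p \<bullet> p) + 2 * s * (p \<bullet> h) + s^2 * (h \<bullet> h)) / (2 * v^2))) has_real_derivative
   exp (- (p \<bullet> p) / (2 * v^2)) * (- (p \<bullet> h) / v^2)) (at 0)" using assms by (auto intro!: derivative_eq_intros simp: field_simps)
 from DERIV_cmult[OF this, of "(1 / sqrt (2 * pi * v^2)) ^ DIM('a)"]
 show ?thesis unfolding e by (simp add: gauss_eq power2_norm_eq_inner mult_ac)
qed

lemma gauss_continuous: "continuous_on S (gauss v)" unfolding gauss_eq[abs_def] by (cases "v = 0") (auto intro!: continuous_intros)

lemma gauss_integration_by_parts: fixes g :: "'a::euclidean_space => real" assumes v: "v > 0" and t: "test_function g"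
 shows "(LBINT p. gauss v p * dd h g p) = 1 / v^2 * (LBINT p. gauss v p * ((p \<bullet> h) * g p))"
proof -
 obtain K where K: "compact K" "!!x. x \<notin> K ==> g x = 0" using tf_support[OF t] by blast
 have pc: "continuous_on UNIV g" by (rule smooth_cont[OF tf_smooth[OF t]])
 have i1: "integrable lborel (%p. gauss v p * dd h g p)" by (rule int_mult_test[OF int_gauss[OF v] tf_dd[OF t]])
 have c2: "continuous_on UNIV (%p. (p \<bullet> h) * g p)" by (intro continuous_on_mult continuous_on_inner continuous_on_id continuous_on_const pc)
 have i2: "integrable lborel (%p. gauss v p * ((p \<bullet> h) * g p))" by (rule int_mult_supp[OF int_gauss[OF v] c2 K(1)]) (simp add: K(2))
 have "(LBINT p. gauss v p * dd h g p - 1 / v^2 * (gauss v p * ((p \<bullet> h) * g p))) = 0"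
 proof (rule integral_dd_eq_0[where F="%p. gauss v p * g p" and v=h and K=K])
  show "continuous_on UNIV (%p. gauss v p * g p)" by (intro continuous_on_mult gauss_continuous pc)
  show "continuous_on UNIV (%p. gauss v p * dd h g p - 1 / v^2 * (gauss v p * ((p \<bullet> h) * g p)))"
   by (intro continuous_on_diff continuous_on_mult gauss_continuous c2 continuous_on_const
     smooth_cont[OF smooth_dd[OF tf_smooth[OF t]]])
  fix p
  have "((%s. g (p + s *R h)) has_real_derivative dd h g p) (at 0)" using smooth_DERIV_line[OF tf_smooth[OF t], of p h 0] by simp
  from DERIV_mult[OF gauss_DERIV_line[OF v] this]
  show "((%s. gauss v (p + s *R h) * g (p + s *R h)) has_real_derivative
    gauss v p * dd h g p - 1 / v^2 * (gauss v p * ((p \<bullet> h) * g p))) (at 0)" by (rule DERIV_cong) (simp add: field_simps)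
 qed (use K in auto)
 thus ?thesis using i1 i2 by (simp only: lint_diff integrable_mult_right integral_mult_right_zero)
qed

lemma invertible_columns_span: fixes \<sigma> :: "real ^ 'n ^ 'n" assumes "invertible \<sigma>" "x \<noteq> 0"
 shows "\<exists>k. column k \<sigma> \<bullet> x \<noteq> 0"
proof (rule ccontr)
 assume "\<not> ?thesis"
 hence orth: "x \<bullet> (\<sigma> *v y) = 0" for y by (simp add: matrix_mult_sum inner_sum_right inner_commute scalar_mult_eq_scaleR)
 obtain B where "\<sigma> ** B = mat 1" using assms(1) unfolding invertible_def by blast
 hence "\<sigma> *v (B *v x) = x" by (simp add: matrix_vector_mul_assoc)
 hence "x \<bullet> x = 0" using orth[of "B *v x"] by simp
 thus False using assms(2) by simp
qed

lemma transport_part_sum: assumes f: "smooth (f :: 'n::finite phase => real)"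
 shows "transport b f x = (\<Sum>i\<in>UNIV. snd x $ i * dd (axis i 1, 0) f x) + (\<Sum>i\<in>UNIV. b (fst x) $ i * dd (0, axis i 1) f x)"
proof -
 have "transport b f x = dd (snd x, 0) f x + dd (0, b (fst x)) f x"
  using dd_add_dir[OF f, of "(snd x, 0)" "(0, b (fst x))" x] by (simp add: transport_def)
 also have "... = snd x \<bullet> grad_q f x + b (fst x) \<bullet> grad_p f x" by (simp add: dd_pair_smooth[OF f])
 finally show ?thesis by (simp add: inner_vec_def grad_q_def grad_p_def pd_q_def pd_p_def)
qed

lemma transport_continuous: assumes f: "smooth (f :: 'n::finite phase => real)" and b: "continuous_on UNIV b"
 shows "continuous_on UNIV (transport b f)"
proof -
 have "continuous_on UNIV (%x. b (fst x))" by (rule cont_comp[OF b]) (auto intro!: continuous_intros)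
 thus ?thesis unfolding transport_part_sum[OF f, abs_def]
  by (intro continuous_on_add continuous_on_sum continuous_on_mult smooth_cont[OF smooth_dd[OF f]]
   continuous_on_component continuous_on_snd continuous_on_id)
qed

lemma diffusion_smooth: assumes f: "smooth f" shows "smooth (diffusion \<beta> \<sigma> f)"
proof -
 have "smooth (%x. v \<bullet> snd x)" for v :: "real^'a" by (intro smooth_bounded_linear bounded_linear_inner_right_comp bounded_linear_snd)
 thus ?thesis unfolding diffusion_def[abs_def]
  by (intro smooth_cmult smooth_sum smooth_diff smooth_mult smooth_dd[OF smooth_dd[OF f]] smooth_dd[OF f])
qed

lemma fixes f :: "'n::finite phase => real" assumes K: "closed K" "!!x. x \<notin> K ==> f x = 0" and x: "x \<notin> K"
 shows transport_part_outside: "transport b f x = 0" and diffusion_part_outside: "diffusion \<beta> \<sigma> f x = 0"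
proof -
 have z: "y \<notin> K ==> dd v f y = 0" for v y by (rule dd_outside_closed[OF K])
 have zz: "dd w (dd v f) x = 0" for v w by (rule dd_outside_closed[OF K(1) z x])
 show "transport b f x = 0" "diffusion \<beta> \<sigma> f x = 0" using z[OF x] zz by (simp_all add: transport_def diffusion_def)
qed

lemma fixes f \<rho> :: "'n::finite phase => real" assumes t: "test_function f" and \<rho>: "integrable lborel \<rho>"
 shows integrable_transport_part: "continuous_on UNIV b ==> integrable lborel (%x. \<rho> x * transport b f x)"
  and integrable_diffusion_part: "integrable lborel (%x. \<rho> x * diffusion \<beta> \<sigma> f x)"
proof -
 obtain K where K: "compact K" "!!x. x \<notin> K ==> f x = 0" using tf_support[OF t] by blast
 show "integrable lborel (%x. \<rho> x * transport b f x)" if "continuous_on UNIV b"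
  by (rule int_mult_supp[OF \<rho> transport_continuous[OF tf_smooth[OF t] that] K(1)
     transport_part_outside[OF compact_imp_closed[OF K(1)] K(2)]])
 show "integrable lborel (%x. \<rho> x * diffusion \<beta> \<sigma> f x)"
  by (rule int_mult_supp[OF \<rho> smooth_cont[OF diffusion_smooth[OF tf_smooth[OF t]]] K(1)
     diffusion_part_outside[OF compact_imp_closed[OF K(1)] K(2)]])
qed

lemma ou_test_function: fixes g :: "'a::euclidean_space => real" assumes t: "test_function g" shows "test_function (ou \<beta> s g)"
proof -
 obtain K where K: "compact K" "!!x. x \<notin> K ==> g x = 0" using tf_support[OF t] by blast
 have z: "y \<notin> K ==> dd v g y = 0" for v y by (rule dd_outside_closed[OF compact_imp_closed[OF K(1)] K(2)])
 have zz: "y \<notin> K ==> dd w (dd v g) y = 0" for v w y by (rule dd_outside_closed[OF compact_imp_closed[OF K(1)] z])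
 show ?thesis
 proof (rule tf_I[OF _ K(1)])
  have sg: "smooth g" by (rule tf_smooth[OF t])
  have "smooth (%x. v \<bullet> x)" for v :: 'a by (intro smooth_bounded_linear bounded_linear_inner_right)
  thus "smooth (ou \<beta> s g)" unfolding ou_def[abs_def]
   by (intro smooth_cmult smooth_sum smooth_diff smooth_mult smooth_dd[OF smooth_dd[OF sg]] smooth_dd[OF sg])
 qed (simp add: ou_def z zz)
qed

text \<open>Only product test functions are demanded: this is what the symmetry condition can
  deliver, and distributional stationarity implies it too, so one notion feeds all routes to the
  potential condition.\<close>

definition weakly_stationary ::
  "real => real ^ 'n ^ 'n => (real ^ 'n => real ^ 'n) => ('n::finite phase => real) => bool" where
 "weakly_stationary \<beta> \<sigma> b \<rho> \<longleftrightarrow> (\<forall>h1 h2. test_function h1 \<longrightarrow> test_function h2 \<longrightarrow>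
   (LBINT x. \<rho> x * generator \<beta> \<sigma> b (tensor h1 h2) x) = 0)"

section \<open>Weakly stationary densities\<close>

text \<open>No process is involved: the routes to the potential condition from symmetry, from
  evenness and from separability are statements about the density alone.\<close>

locale langevin_density = fixes \<beta> :: real and \<sigma> :: "real ^ 'n::finite ^ 'n" and b :: "real ^ 'n => real ^ 'n"
  and \<rho> :: "'n phase => real" assumes beta: "0 < \<beta>" and nonsingular: "invertible \<sigma>" and b_cont: "continuous_on UNIV b"
  and rho_pos: "!!x. 0 < \<rho> x" and rho_int: "integrable lborel \<rho>" and rho_1: "(LBINT x. \<rho> x) = 1"
begin

lemma rho_measurable [measurable]: "\<rho> : Borel" using borel_intI[OF rho_int] by simp

text \<open>Replacing \<open>h2\<close> by its reflection changes the sign of the transport integral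
  and preserves the diffusion integral, since \<open>\<rho>\<close> is even. So the sum and the
  difference of the two integrals both vanish.\<close>

lemma weak_even_split: assumes even: "even_in_p \<rho>" and weak: "weakly_stationary \<beta> \<sigma> b \<rho>"
  and t1: "test_function h1" and t2: "test_function h2" shows "(LBINT x. \<rho> x * transport b (tensor h1 h2) x) = 0"
  and "(LBINT x. \<rho> x * diffusion \<beta> \<sigma> (tensor h1 h2) x) = 0"
proof -
 define f where "f = tensor h1 h2"
 define g where "g = tensor h1 (%p. h2 (- p))"
 have tf: "test_function f" "test_function g" unfolding f_def g_def by (intro tf_tensor' tf_uminus_arg t1 t2)+
 have gf: "g = (%x. f (flip x))" by (simp add: g_def f_def tensor_def fun_eq_iff)
 note sm = tf_smooth[OF tf(1)] tf_smooth[OF tf(2)]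
 have iT: "integrable lborel (%x. \<rho> x * transport b f x)" by (rule integrable_transport_part[OF tf(1) rho_int b_cont])
 have iD: "integrable lborel (%x. \<rho> x * diffusion \<beta> \<sigma> f x)" by (rule integrable_diffusion_part[OF tf(1) rho_int])
 have "0 = (LBINT x. \<rho> x * generator \<beta> \<sigma> b f x)" using weak t1 t2 by (simp add: weakly_stationary_def f_def)
 also have "... = (LBINT x. \<rho> x * transport b f x) + (LBINT x. \<rho> x * diffusion \<beta> \<sigma> f x)"
  unfolding generator_split[OF sm(1)] using iT iD by (simp add: distrib_left)
 finally have 1: "(LBINT x. \<rho> x * transport b f x) + (LBINT x. \<rho> x * diffusion \<beta> \<sigma> f x) = 0" by simp
 have gm: "generator \<beta> \<sigma> b g : Borel" unfolding generator_split[OF sm(2), abs_def]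
  by (intro borel_contI continuous_on_add transport_continuous sm b_cont
    smooth_cont[OF diffusion_smooth])
 have "0 = (LBINT x. \<rho> x * generator \<beta> \<sigma> b g x)" using weak t1 tf_uminus_arg[OF t2] by (simp add: weakly_stationary_def g_def)
 also have "... = (LBINT x. \<rho> x * generator \<beta> \<sigma> b g (flip x))" by (rule integral_even_flip[OF even _ gm, symmetric]) measurable
 also have "... = (LBINT x. - (\<rho> x * transport b f x) + \<rho> x * diffusion \<beta> \<sigma> f x)"
  unfolding gf generator_split[OF smooth_flip[OF sm(1)]] transport_part_flip[OF sm(1)] diffusion_part_flip[OF sm(1)] by (simp add: right_diff_distrib)
 also have "... = - (LBINT x. \<rho> x * transport b f x) + (LBINT x. \<rho> x * diffusion \<beta> \<sigma> f x)" using iT iD by simp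
 finally have 2: "- (LBINT x. \<rho> x * transport b f x) + (LBINT x. \<rho> x * diffusion \<beta> \<sigma> f x) = 0" by simp
 from 1 2 show "(LBINT x. \<rho> x * transport b (tensor h1 h2) x) = 0" and "(LBINT x. \<rho> x * diffusion \<beta> \<sigma> (tensor h1 h2) x) = 0"
  unfolding f_def by linarith+
qed

definition "marginal q = (LBINT p. \<rho> (q, p))"

lemma marginal_integrable: "integrable lborel marginal" unfolding marginal_def[abs_def] by (rule lborel_fubini(5)[OF rho_int])

lemma marginal_pos: "AE q in lborel. 0 < marginal q" using lborel_fubini(3)[OF rho_int] unfolding marginal_def
 by eventually_elim (intro integral_pos_lborel rho_pos)

text \<open>Integrating \<open>\<rho>\<close> against a position bump \<open>h1\<close> leaves a
  function \<open>f\<close> of the momentum that is annihilated by \<open>ou\<close>, because the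
  diffusion does not act on positions; \<open>ou_liouville\<close> makes it a multiple of the
  Gaussian. The bump has to be nonnegative for \<open>f\<close> to be so, which box bumps
  provide.\<close>

lemma weak_even_product: assumes even: "even_in_p \<rho>" and weak: "weakly_stationary \<beta> \<sigma> b \<rho>"
 shows "AE x in lborel. \<rho> x = tensor marginal (gauss (1 / sqrt \<beta>)) x"
proof -
 have v: "1 / sqrt \<beta> > 0" using beta by simp
 note gi = int_gauss[OF v]
 have ti: "integrable lborel (tensor marginal (gauss (1 / sqrt \<beta>)) :: 'n phase => real)"
  unfolding tensor_def[abs_def] by (rule int_tensor[OF marginal_integrable gi])
 have "AE x in lborel. \<rho> x - tensor marginal (gauss (1 / sqrt \<beta>)) x = 0"
 proof (rule AE_eq_0_box_bump)
  have di: "integrable lborel (%x. \<rho> x - tensor marginal (gauss (1 / sqrt \<beta>)) x)" using rho_int ti by simp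
  show "(%x. \<rho> x - tensor marginal (gauss (1 / sqrt \<beta>)) x): Borel" using borel_intI[OF di] by simp
  show "integrable lborel (%x. indicator (box a b) x * (\<rho> x - tensor marginal (gauss (1 / sqrt \<beta>)) x))" for a b
   using int_mult_bounded[OF di, of "indicator (box a b)" 1] by (simp add: mult.commute indicator_def)
  fix a b :: "'n phase" and k assume ab: "\<forall>i\<in>Basis. a \<bullet> i < b \<bullet> i"
  have ab1: "\<forall>i\<in>Basis. fst a \<bullet> i < fst b \<bullet> i" and ab2: "\<forall>i\<in>Basis. snd a \<bullet> i < snd b \<bullet> i"
   using ab by (auto simp: Basis_prod_def ball_Un inner_prod_def)
  define h1 where "h1 = box_bump (fst a) (fst b) k"
  define h2 where "h2 = box_bump (snd a) (snd b) k"
  have t1: "test_function h1" and t2: "test_function h2" unfolding h1_def h2_def by (intro box_bump_test_function ab1 ab2)+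
  have h1_nonneg: "0 <= h1 q" for q by (simp add: h1_def box_bump_bounds)
  have h1b: "\<bar>h1 q\<bar> <= 1" for q using box_bump_bounds[of "fst a" "fst b" k q] by (simp add: h1_def)
  note [measurable] = tf_measurable[OF t1] tf_measurable[OF t2]
  define f where "f p = (LBINT q. \<rho> (q, p) * h1 q)" for p
  have i1: "integrable lborel (%z. \<rho> z * h1 (fst z))" by (rule int_mult_bounded[OF rho_int _ h1b])
     (use meas_comp[OF borel_fst tf_measurable[OF t1]] in simp)
  have fi: "integrable lborel f" using lborel_fubini(6)[OF i1] by (simp add: f_def[abs_def])
  have f0: "0 <= f p" for p unfolding f_def using rho_pos h1_nonneg by (intro integral_nonneg_AE) (simp add: less_imp_le)
  have f_test: "(LBINT p. f p * g p) = (LBINT z. \<rho> z * tensor h1 g z)" if g: "test_function g" for g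
  proof -
   have "integrable lborel (%z. \<rho> z * tensor h1 g z)" by (rule int_mult_test[OF rho_int tf_tensor'[OF t1 g]])
   hence "(LBINT z. \<rho> z * tensor h1 g z) = (LBINT p. LBINT q. \<rho> (q, p) * tensor h1 g (q, p))" by (rule lborel_fubini(2)[symmetric])
   also have "... = (LBINT p. f p * g p)"
   proof (intro lint_cong refl)
    fix p
    have "(LBINT q. \<rho> (q, p) * tensor h1 g (q, p)) = (LBINT q. (\<rho> (q, p) * h1 q) * g p)" by (simp add: tensor_def mult.assoc)
    thus "(LBINT q. \<rho> (q, p) * tensor h1 g (q, p)) = f p * g p" by (simp add: f_def)
   qed
   finally show ?thesis by simp
  qed
  have ou0: "(LBINT p. f p * ou \<beta> (%k. column k \<sigma>) g p) = 0" if g: "test_function g" for g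
  proof -
   have "tensor h1 (ou \<beta> (%k. column k \<sigma>) g) = diffusion \<beta> \<sigma> (tensor h1 g)"
    using diffusion_tensor[OF tf_smooth[OF t1] tf_smooth[OF g]] by (simp add: tensor_def fun_eq_iff)
   thus ?thesis unfolding f_test[OF ou_test_function[OF g]] using weak_even_split(2)[OF even weak t1 g] by simp
  qed
  have fg: "AE p in lborel. f p = (LBINT p. f p) * gauss (1 / sqrt \<beta>) p"
   by (rule ou_liouville[OF beta invertible_columns_span[OF nonsingular] fi f0 ou0])
  have fm: "(LBINT p. f p) = (LBINT q. marginal q * h1 q)" using lborel_fubini(1,2)[OF i1] by (simp add: f_def marginal_def)
  have "(LBINT x. \<rho> x * tensor h1 h2 x) = (LBINT p. f p * h2 p)" by (rule f_test[OF t2, symmetric])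
  also have "... = (LBINT p. (LBINT p. f p) * (gauss (1 / sqrt \<beta>) p * h2 p))"
  proof (rule integral_cong_AE)
   show "AE p in lborel. f p * h2 p = (LBINT p. f p) * (gauss (1 / sqrt \<beta>) p * h2 p)" using fg by eventually_elim simp
   show "(%p. f p * h2 p): borel_measurable lborel" using borel_intI[OF fi] by simp
  qed measurable
  also have "... = (LBINT q. marginal q * h1 q) * (LBINT p. gauss (1 / sqrt \<beta>) p * h2 p)" by (simp add: fm)
  also have "... = (LBINT x. (marginal (fst x) * h1 (fst x)) * (gauss (1 / sqrt \<beta>) (snd x) * h2 (snd x)))"
   by (rule integral_tensor[symmetric, OF int_mult_test[OF marginal_integrable t1] int_mult_test[OF gi t2]])
  also have "... = (LBINT x. tensor marginal (gauss (1 / sqrt \<beta>)) x * tensor h1 h2 x)" by (simp add: tensor_def mult_ac)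
  finally have "(LBINT x. \<rho> x * tensor h1 h2 x) = (LBINT x. tensor marginal (gauss (1 / sqrt \<beta>)) x * tensor h1 h2 x)" .
  moreover have "box_bump a b k = tensor h1 h2" by (simp add: fun_eq_iff tensor_def h1_def h2_def box_bump_prod[of a b])
  moreover have "integrable lborel (%x. \<rho> x * tensor h1 h2 x)" "integrable lborel (%x. tensor marginal (gauss (1 / sqrt \<beta>)) x * tensor h1 h2 x)"
   by (intro int_mult_test rho_int ti tf_tensor' t1 t2)+
  ultimately show "(LBINT x. (\<rho> x - tensor marginal (gauss (1 / sqrt \<beta>)) x) * box_bump a b k x) = 0" by (simp add: left_diff_distrib)
 qed
 thus ?thesis by simp
qed

lemma tensor_transport_integral: fixes c :: "real ^ 'n => real" and e :: "real ^ 'n => real"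
 assumes c: "integrable lborel c" and e: "integrable lborel e" and t1: "test_function h1" and t2: "test_function h2"
 shows "(LBINT x. tensor c e x * transport b (tensor h1 h2) x)
  = (\<Sum>i\<in>UNIV. (LBINT q. c q * dd (axis i 1) h1 q) * (LBINT p. e p * (p $ i * h2 p)))
  + (\<Sum>i\<in>UNIV. (LBINT q. c q * (b q $ i * h1 q)) * (LBINT p. e p * dd (axis i 1) h2 p))"
proof -
 obtain K1 where K1: "compact K1" "!!x. x \<notin> K1 ==> h1 x = 0" using tf_support[OF t1] by blast
 obtain K2 where K2: "compact K2" "!!x. x \<notin> K2 ==> h2 x = 0" using tf_support[OF t2] by blast
 have c1: "continuous_on UNIV h1" and c2: "continuous_on UNIV h2" by (intro smooth_cont tf_smooth t1 t2)+
 have ip: "integrable lborel (%p. e p * (p $ i * h2 p))" for i by (rule int_mult_supp[OF e _ K2(1)])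
    (auto simp: K2(2) intro!: continuous_on_mult continuous_on_component continuous_on_id c2)
 have ib: "integrable lborel (%q. c q * (b q $ i * h1 q))" for i by (rule int_mult_supp[OF c _ K1(1)])
    (auto simp: K1(2) intro!: continuous_on_mult continuous_on_component b_cont c1)
 have id1: "integrable lborel (%q. c q * dd v h1 q)" for v by (rule int_mult_test[OF c tf_dd[OF t1]])
 have id2: "integrable lborel (%p. e p * dd v h2 p)" for v by (rule int_mult_test[OF e tf_dd[OF t2]])
 note sm = tf_smooth[OF t1] tf_smooth[OF t2]
 have eq: "tensor c e x * transport b (tensor h1 h2) x
  = (\<Sum>i\<in>UNIV. (c (fst x) * dd (axis i 1) h1 (fst x)) * (e (snd x) * (snd x $ i * h2 (snd x))))
  + (\<Sum>i\<in>UNIV. (c (fst x) * (b (fst x) $ i * h1 (fst x))) * (e (snd x) * dd (axis i 1) h2 (snd x)))" for x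
  unfolding transport_part_sum[OF smooth_tensor[OF sm]] dd_tensor[OF sm] distrib_left sum_distrib_left
  by (intro arg_cong2[where f="(+)"] sum.cong refl) (simp_all add: tensor_def mult_ac)
 note A = int_tensor[OF id1 ip] integral_tensor[OF id1 ip]
 note B = int_tensor[OF ib id2] integral_tensor[OF ib id2]
 show ?thesis unfolding eq by (simp only: lint_add[OF int_sum[OF A(1)] int_sum[OF B(1)]]
    lint_sum[OF A(1)] lint_sum[OF B(1)] A(2) B(2))
qed

text \<open>A continuous function that vanishes almost everywhere vanishes, so \<open>p = w\<close>
  may be inserted.\<close>

lemma inner_zero_if_AE: fixes w :: "'c::euclidean_space" assumes e: "!!p. e p > 0" and 0: "AE p in lborel. e p * (w \<bullet> p) = (0::real)"
 shows "w = 0"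
proof -
 have "AE p in lborel. w \<bullet> p = 0" using 0 by eventually_elim (use e in \<open>simp add: less_le\<close>)
 hence "w \<bullet> w = 0" by (rule AE_lborel_continuous_eq) (intro continuous_intros)+
 thus ?thesis by simp
qed

lemma weak_even_imp_potential: assumes even: "even_in_p \<rho>" and weak: "weakly_stationary \<beta> \<sigma> b \<rho>"
 shows "potential_condition \<beta> b \<rho>"
proof -
 define \<gamma> :: "real ^ 'n => real" where "\<gamma> = gauss (1 / sqrt \<beta>)"
 have v: "1 / sqrt \<beta> > 0" using beta by simp
 have v2: "(1 / sqrt \<beta>)^2 = 1 / \<beta>" using beta by (simp add: power_divide)
 have gi: "integrable lborel \<gamma>" unfolding \<gamma>_def by (rule int_gauss[OF v])
 have gpos: "\<gamma> p > 0" for p unfolding \<gamma>_def by (rule gauss_pos[OF v])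
 have prod: "AE x in lborel. \<rho> x = tensor marginal \<gamma> x" unfolding \<gamma>_def by (rule weak_even_product[OF even weak])
 have mm: "marginal : Borel" using borel_intI[OF marginal_integrable] by simp
 have gm: "\<gamma> : Borel" unfolding \<gamma>_def by measurable
 have tm: "tensor marginal \<gamma> : Borel" unfolding tensor_def[abs_def]
  by (intro borel_measurable_times meas_comp[OF borel_fst mm] meas_comp[OF borel_snd gm])
 have weak_marginal: "(LBINT q. marginal q * dd v k q) = - (LBINT q. marginal q * (\<beta> *R b q \<bullet> v) * k q)"
  if t1: "test_function k" for k v
 proof -
  obtain K1 where K1: "compact K1" "!!x. x \<notin> K1 ==> k x = 0" using tf_support[OF t1] by blast
  have c1: "continuous_on UNIV k" by (intro smooth_cont tf_smooth t1)
  have ib: "integrable lborel (%q. marginal q * (b q $ i * k q))" for i by (rule int_mult_supp[OF marginal_integrable _ K1(1)])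
     (auto simp: K1(2) intro!: continuous_on_mult continuous_on_component b_cont c1)
  \<comment> \<open>After Gaussian integration by parts, where \<open>1 / v^2\<close> is \<beta>,
    both sums of the transport term carry the moment of \<open>p $ i\<close>; \<open>w\<close>
    collects its coefficients.\<close>
  define w :: "real ^ 'n" where "w = (\<chi> i. (LBINT q. marginal q * dd (axis i 1) k q) + \<beta> * (LBINT q. marginal q * (b q $ i * k q)))"
  have "AE p in lborel. \<gamma> p * (w \<bullet> p) = 0"
  proof (rule AE_eq_0_if_test_integrals_eq_0'[OF gi])
   show "continuous_on UNIV (%p. w \<bullet> p)" by (intro continuous_intros)
   fix k2 :: "real ^ 'n => real" assume t2: "test_function k2"
   obtain K2 where K2: "compact K2" "!!x. x \<notin> K2 ==> k2 x = 0" using tf_support[OF t2] by blast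
   have ip: "integrable lborel (%p. \<gamma> p * (p $ i * k2 p))" for i by (rule int_mult_supp[OF gi _ K2(1)])
      (auto simp: K2(2) intro!: continuous_on_mult continuous_on_component continuous_on_id smooth_cont[OF tf_smooth[OF t2]])
   have "0 = (LBINT x. \<rho> x * transport b (tensor k k2) x)" using weak_even_split(1)[OF even weak t1 t2] by simp
   also have "... = (LBINT x. tensor marginal \<gamma> x * transport b (tensor k k2) x)"
   proof (rule integral_cong_AE)
    have "transport b (tensor k k2): Borel" by (intro borel_contI transport_continuous b_cont tf_smooth tf_tensor' t1 t2)
    thus "(%x. \<rho> x * transport b (tensor k k2) x): borel_measurable lborel"
     "(%x. tensor marginal \<gamma> x * transport b (tensor k k2) x): borel_measurable lborel" using tm rho_measurable by simp_all
   qed (use prod in auto)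
   also have "... = (\<Sum>i\<in>UNIV. (LBINT q. marginal q * dd (axis i 1) k q) * (LBINT p. \<gamma> p * (p $ i * k2 p)))
     + (\<Sum>i\<in>UNIV. (LBINT q. marginal q * (b q $ i * k q)) * (LBINT p. \<gamma> p * dd (axis i 1) k2 p))"
    by (rule tensor_transport_integral[OF marginal_integrable gi t1 t2])
   also have "... = (\<Sum>i\<in>UNIV. w $ i * (LBINT p. \<gamma> p * (p $ i * k2 p)))" unfolding \<gamma>_def gauss_integration_by_parts[OF v t2] v2
    by (simp add: w_def inner_axis sum.distrib[symmetric] algebra_simps)
   also have "... = (LBINT p. (\<Sum>i\<in>UNIV. w $ i * (\<gamma> p * (p $ i * k2 p))))" using ip by (subst lint_sum) auto
   also have "... = (LBINT p. \<gamma> p * ((w \<bullet> p) * k2 p))" by (intro lint_cong refl)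
      (simp add: inner_vec_def sum_distrib_left sum_distrib_right mult_ac)
   finally show "(LBINT p. \<gamma> p * ((w \<bullet> p) * k2 p)) = 0" by simp
  qed
  hence "w = 0" by (rule inner_zero_if_AE[OF gpos])
  hence wi: "(LBINT q. marginal q * dd (axis i 1) k q) = - \<beta> * (LBINT q. marginal q * (b q $ i * k q))" for i
  proof -
   have "w $ i = 0" using \<open>w = 0\<close> by simp
   thus ?thesis by (simp add: w_def eq_neg_iff_add_eq_0)
  qed
  have vs: "v = (\<Sum>i\<in>UNIV. v $ i *R axis i 1)" by (simp add: vec_eq_iff axis_def if_distrib cong: if_cong)
  have dv: "dd v k q = (\<Sum>i\<in>UNIV. v $ i * dd (axis i 1) k q)" for q
   by (subst vs) (simp only: dd_sum_dir[OF tf_smooth[OF t1]] dd_scaleR_dir[OF tf_smooth[OF t1]])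
  have "(LBINT q. marginal q * dd v k q) = (LBINT q. (\<Sum>i\<in>UNIV. v $ i * (marginal q * dd (axis i 1) k q)))"
   unfolding dv by (intro lint_cong refl) (simp add: sum_distrib_left mult_ac)
  also have "... = (\<Sum>i\<in>UNIV. v $ i * (LBINT q. marginal q * dd (axis i 1) k q))" using int_mult_test[OF marginal_integrable tf_dd[OF t1]]
   by (subst lint_sum) auto
  also have "... = - (\<Sum>i\<in>UNIV. (\<beta> * v $ i) * (LBINT q. marginal q * (b q $ i * k q)))" by (simp add: wi sum_negf mult_ac)
  also have "(\<Sum>i\<in>UNIV. (\<beta> * v $ i) * (LBINT q. marginal q * (b q $ i * k q)))
    = (LBINT q. (\<Sum>i\<in>UNIV. (\<beta> * v $ i) * (marginal q * (b q $ i * k q))))" using ib by (subst lint_sum) auto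
  also have "... = (LBINT q. marginal q * (\<beta> *R b q \<bullet> v) * k q)" by (intro lint_cong refl)
     (simp add: inner_vec_def sum_distrib_left sum_distrib_right mult_ac)
  finally show ?thesis .
 qed
 have gc: "continuous_on UNIV (%q. \<beta> *R b q)" by (intro continuous_on_scaleR continuous_on_const b_cont)
 obtain V where V: "!!x v. V (x + v) = V x + integral {0..1} (%u. \<beta> *R b (x + u *R v) \<bullet> v)"
  "AE x in lborel. marginal x = exp (V x)" by (rule weak_gradient_potential[where c=marginal and g="%q. \<beta> *R b q",
     OF marginal_integrable marginal_pos gc weak_marginal]) blast+
 have GV: "GDERIV V x :> \<beta> *R b x" for x by (rule line_integral_potential_GDERIV[OF gc V(1)])
 define U where "U q = - (1 / \<beta>) * V q" for q
 have GU: "GDERIV U q :> - b q" for q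
 proof -
  have "(V has_derivative (%h. h \<bullet> (\<beta> *R b q))) (at q)" using GV[of q] by (simp add: gderiv_def)
  hence "((%q. - (1 / \<beta>) * V q) has_derivative (%h. - (1 / \<beta>) * (h \<bullet> (\<beta> *R b q)))) (at q)"
   by (rule has_derivative_mult_right)
  moreover have "(%h. - (1 / \<beta>) * (h \<bullet> (\<beta> *R b q))) = (%h. h \<bullet> - b q)" using beta by (simp add: fun_eq_iff)
  ultimately show ?thesis unfolding gderiv_def U_def by simp
 qed
 define E where "E x = exp (- \<beta> * hamiltonian U x)" for x
 \<comment> \<open>The normalization constant of the momentum Gaussian. As \<open>U\<close> absorbs
   the normalization of the position factor, comparing total masses identifies \<open>G\<close> with
   the reciprocal of the partition function.\<close>
 define G where "G = (1 / sqrt (2 * pi * (1 / \<beta>))) ^ CARD('n)"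
 have G: "G > 0" using beta by (simp add: G_def)
 have Um: "U : Borel" by (intro borel_contI cont_at_on ballI has_derivative_continuous[OF GU[unfolded gderiv_def]])
 have Em: "E : Borel"
 proof -
  have "(%x::'n phase. U (fst x)): Borel" by (rule meas_comp[OF borel_fst Um])
  moreover have "(%x::'n phase. norm (snd x)): Borel" by (rule meas_comp[OF borel_snd]) measurable
  ultimately show ?thesis unfolding E_def[abs_def] hamiltonian_def case_prod_unfold by measurable
 qed
 have "AE x in lborel. marginal (fst x) = exp (V (fst x))" by (rule AE_lborel_fst[OF V(2)])
 with prod have rE: "AE x in lborel. \<rho> x = G * E x"
 proof eventually_elim
  case (elim x)
  have "V (fst x) = - \<beta> * U (fst x)" using beta by (simp add: U_def)
  hence "\<rho> x = G * (exp (- \<beta> * U (fst x)) * exp (- (norm (snd x))\<^sup>2 / (2 * (1 / \<beta>))))"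
   using elim unfolding tensor_def \<gamma>_def gauss_eq v2 G_def by simp
  thus ?case by (simp add: E_def hamiltonian_def case_prod_unfold exp_add[symmetric] algebra_simps)
 qed
 have GEi: "integrable lborel (%x. G * E x)" using rho_int by (rule integrable_cong_AE_imp) (use rE Em in auto)
 hence Ei: "integrable lborel E" using G by simp
 have "1 = (LBINT x. G * E x)" unfolding rho_1[symmetric] by (rule integral_cong_AE) (use rE Em in auto)
 hence one: "1 = G * (LBINT x. E x)" by simp
 hence "G = 1 / (LBINT x. E x)" using G by (metis less_irrefl mult_zero_right nonzero_eq_divide_eq zero_neq_one)
 hence "AE x in lborel. \<rho> x = 1 / (LBINT x. E x) * E x" using rE by simp
 thus ?thesis unfolding potential_condition_def using GU Ei unfolding E_def[abs_def] by blast
qed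

end

text \<open>A Leibniz rule that never differentiates the coefficient. It applies to
  \<open>p $ i\<close> in position directions and to the possibly nondifferentiable
  \<open>b q $ i\<close> in momentum directions.\<close>

lemma dd_mult_constant_along: assumes f: "smooth f" and a: "!!s. a (x + s *R v) = a x" shows "dd v (%y. a y * f y) x = a x * dd v f x"
 unfolding dir_deriv_def[of v "%y. a y * f y"] a using DERIV_cmult[OF smooth_DERIV_line[OF f, of x v 0], of "a x"] by (intro DERIV_imp_deriv) simp

lemma diffusion_matrix_symmetric: "(\<sigma> ** transpose \<sigma>) $ i $ j = (\<sigma> ** transpose \<sigma>) $ j $ (i::'n::finite)"
 for \<sigma> :: "real ^ 'n ^ 'n" by (simp add: matrix_matrix_mult_def transpose_def mult.commute)

section \<open>Stationarity and symmetry as integral identities for the generator\<close>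

context langevin_density
begin

text \<open>Unfolding the dualities moves every operation onto \<open>h\<close>; products with
  coefficients are differentiated only along directions in which the coefficients are constant, or
  have the derivatives already on \<open>h\<close>.\<close>

lemma fokker_planck_eq: assumes t: "test_function h"
 shows "fokker_planck \<beta> \<sigma> b (dist_of \<rho>) h = (LBINT x. \<rho> x * generator \<beta> \<sigma> b h x)"
proof -
 let ?A = "\<sigma> ** transpose \<sigma>"
 note sm = tf_smooth[OF t]
 obtain K where K: "compact K" "!!x. x \<notin> K ==> h x = 0" using tf_support[OF t] by blast
 have z: "y \<notin> K ==> dd v h y = 0" for v y by (rule dd_outside_closed[OF compact_imp_closed[OF K(1)] K(2)])
 have p1: "pd_q i (%x. (case x of (q, p) => p $ i) * h x) = (%x. snd x $ i * pd_q i h x)" for i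
  unfolding pd_q_def case_prod_unfold by (intro ext dd_mult_constant_along[OF sm]) simp
 have p2: "pd_p i (%x. (case x of (q, p) => b q $ i) * h x) = (%x. b (fst x) $ i * pd_p i h x)" for i
  unfolding pd_p_def case_prod_unfold by (intro ext dd_mult_constant_along[OF sm]) simp
 have i1: "integrable lborel (%x. \<rho> x * (snd x $ i * pd_q i h x))" for i unfolding pd_q_def by (rule int_mult_supp[OF rho_int _ K(1)])
    (auto simp: z intro!: continuous_on_mult continuous_on_component continuous_on_snd continuous_on_id smooth_cont[OF smooth_dd[OF sm]])
 have bc: "continuous_on UNIV (%x::'n phase. b (fst x))" by (rule cont_comp[OF b_cont]) (auto intro!: continuous_intros)
 have i2: "integrable lborel (%x. \<rho> x * (b (fst x) $ i * pd_p i h x))" for i unfolding pd_p_def by (rule int_mult_supp[OF rho_int _ K(1)])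
    (auto simp: z intro!: continuous_on_mult continuous_on_component bc smooth_cont[OF smooth_dd[OF sm]])
 have "continuous_on UNIV (%x::'n phase. ?A *v snd x)"
  by (intro linear_continuous_on_compose[OF _ matrix_vector_mul_linear] continuous_on_snd continuous_on_id)
 hence i3: "integrable lborel (%x. \<rho> x * ((?A *v snd x) $ i * pd_p i h x))" for i unfolding pd_p_def by (intro int_mult_supp[OF rho_int _ K(1)])
    (auto simp: z intro!: continuous_on_mult continuous_on_component smooth_cont[OF smooth_dd[OF sm]])
 have i4: "integrable lborel (%x. \<rho> x * pd_p i (pd_p j h) x)" for i j unfolding pd_p_def by (intro int_mult_test[OF rho_int] tf_dd t)
 have "generator \<beta> \<sigma> b h x = (\<Sum>i\<in>UNIV. snd x $ i * pd_q i h x) + (\<Sum>i\<in>UNIV. b (fst x) $ i * pd_p i h x)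
   - 1/2 * (\<Sum>i\<in>UNIV. (?A *v snd x) $ i * pd_p i h x) + 1/(2*\<beta>) * (\<Sum>i\<in>UNIV. \<Sum>j\<in>UNIV. ?A $ i $ j * pd_p i (pd_p j h) x)" for x
  unfolding generator_def case_prod_unfold by (simp add: inner_vec_def grad_q_def grad_p_def hess_p_def)
 hence "(LBINT x. \<rho> x * generator \<beta> \<sigma> b h x) = (LBINT x.
   ((\<Sum>i\<in>UNIV. \<rho> x * (snd x $ i * pd_q i h x)) + (\<Sum>i\<in>UNIV. \<rho> x * (b (fst x) $ i * pd_p i h x))
   - 1/2 * (\<Sum>i\<in>UNIV. \<rho> x * ((?A *v snd x) $ i * pd_p i h x)) + 1/(2*\<beta>) * (\<Sum>i\<in>UNIV. \<Sum>j\<in>UNIV. ?A $ i $ j * (\<rho> x * pd_p i (pd_p j h) x))))"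
  by (simp only: sum_distrib_left distrib_left right_diff_distrib mult_ac)
 also have "... = (\<Sum>i\<in>UNIV. LBINT x. \<rho> x * (snd x $ i * pd_q i h x)) + (\<Sum>i\<in>UNIV. LBINT x. \<rho> x * (b (fst x) $ i * pd_p i h x))
   - 1/2 * (\<Sum>i\<in>UNIV. LBINT x. \<rho> x * ((?A *v snd x) $ i * pd_p i h x))
   + 1/(2*\<beta>) * (\<Sum>i\<in>UNIV. \<Sum>j\<in>UNIV. ?A $ i $ j * (LBINT x. \<rho> x * pd_p i (pd_p j h) x))" using i1 i2 i3 i4
  by (simp add: lint_sum int_sum)
 \<comment> \<open>The distributional form differentiates in the opposite order. Symmetry of the
   matrix allows the indices to be renamed, so partial derivatives need not be commuted.\<close>
 also have "(\<Sum>i\<in>UNIV. \<Sum>j\<in>UNIV. ?A $ i $ j * (LBINT x. \<rho> x * pd_p i (pd_p j h) x))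
   = (\<Sum>i\<in>UNIV. \<Sum>j\<in>UNIV. ?A $ i $ j * (LBINT x. \<rho> x * pd_p j (pd_p i h) x))"
  by (subst sum.swap) (simp add: diffusion_matrix_symmetric[of \<sigma>])
 finally show ?thesis unfolding fokker_planck_def Let_def dist_pd_q_def dist_pd_p_def dist_mult_def dist_of_def p1 p2 unfolding case_prod_unfold
  by (simp add: sum_negf sum.distrib sum_subtractf sum_distrib_left[symmetric] sum_divide_distrib[symmetric] algebra_simps)
qed

lemma stationary_density_iff:
 "stationary_density \<beta> \<sigma> b \<rho> \<longleftrightarrow> (\<forall>h. test_function h \<longrightarrow> (LBINT x. \<rho> x * generator \<beta> \<sigma> b h x) = 0)"
 by (auto simp: stationary_density_def fokker_planck_eq)

lemma stationary_imp_weakly: "stationary_density \<beta> \<sigma> b \<rho> ==> weakly_stationary \<beta> \<sigma> b \<rho>"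
 unfolding stationary_density_iff weakly_stationary_def using tf_tensor' by blast

lemma symmetry_condition_eq:
 "symmetry_condition \<beta> \<sigma> b \<rho> \<longleftrightarrow> even_in_p \<rho> \<and>
   (\<forall>g1 g2 h1 h2. test_function g1 \<longrightarrow> test_function g2 \<longrightarrow> test_function h1 \<longrightarrow> test_function h2 \<longrightarrow>
    (LBINT x. \<rho> x * (tensor g1 g2 x * generator \<beta> \<sigma> b (tensor h1 h2) x)) =
    (LBINT x. \<rho> x * (generator \<beta> \<sigma> b (%x. tensor g1 g2 (flip x)) x * tensor h1 h2 (flip x))))"
proof -
 have 1: "tensor f (%p. g (- p)) = (%x. tensor f g (flip x))" for f g :: "real^'n => real" by (auto simp: tensor_def fun_eq_iff)
 show ?thesis unfolding symmetry_condition_def tensor_case 1 by (simp add: case_prod_unfold tensor_def mult_ac)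
qed

lemma generator_locally_const: assumes f: "smooth f" and S: "open S" "x : S" "!!y. y : S ==> f y = c" shows "generator \<beta> \<sigma> b f x = 0"
proof -
 have 1: "dd v f y = 0" if "y : S" for v y by (rule dd_locally_const[OF S(1) that S(3)])
 have "dd v (dd v f) x = 0" for v by (rule dd_locally_const[OF S(1,2) 1])
 thus ?thesis by (simp add: generator_eq[OF f] diffusion_def 1 S(2))
qed

lemma norm_flip: "norm (flip x) = norm (x :: 'n phase)" by (simp add: norm_prod_def)

text \<open>The margin between \<open>r\<close> and \<open>r + 1\<close> leaves no boundary case: in
  the open ball of radius \<open>r + 1\<close> the function \<open>g\<close> is locally constant and
  its generator vanishes, and outside it \<open>f\<close> and its reflection vanish.\<close>

lemma duality_imp_zero_integral: assumes f: "test_function f" and r: "!!x. r < norm x ==> f x = 0"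
  and g: "test_function g" "!!x. norm x <= r + 1 ==> g x = 1" "!!x. g (flip x) = g x"
  and dual: "(LBINT x. \<rho> x * (g x * generator \<beta> \<sigma> b f x)) = (LBINT x. \<rho> x * (generator \<beta> \<sigma> b (%x. g (flip x)) x * f (flip x)))"
 shows "(LBINT x. \<rho> x * generator \<beta> \<sigma> b f x) = 0"
proof -
 have 1: "g x * generator \<beta> \<sigma> b f x = generator \<beta> \<sigma> b f x" for x
 proof (cases "norm x <= r + 1")
  case False
  have "open {x :: 'n phase. r < norm x}" by (intro open_Collect_less continuous_intros)
  from generator_locally_const[OF tf_smooth[OF f] this, of x 0] False r show ?thesis by simp
 qed (simp add: g(2))
 have 2: "generator \<beta> \<sigma> b g x * f (flip x) = 0" for x
 proof (cases "norm x < r + 1")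
  case True
  have "x : ball 0 (r + 1)" using True by simp
  hence "generator \<beta> \<sigma> b g x = 0" by (rule generator_locally_const[OF tf_smooth[OF g(1)] open_ball]) (simp add: g(2))
  thus ?thesis by simp
 qed (simp add: r norm_flip)
 show ?thesis using dual unfolding g(3) 1 2 by simp
qed

text \<open>The symmetry condition admits only products, so the plateau is
  \<open>tensor z z\<close>; it equals one on the whole ball because both components of a point have
  norm at most that of the point.\<close>

lemma symmetry_imp_weakly: assumes s: "symmetry_condition \<beta> \<sigma> b \<rho>" shows "weakly_stationary \<beta> \<sigma> b \<rho>"
 unfolding weakly_stationary_def
proof (intro allI impI)
 fix h1 h2 :: "real ^ 'n => real" assume t: "test_function h1" "test_function h2"
 have tf: "test_function (tensor h1 h2)" by (rule tf_tensor'[OF t])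
 obtain r where r: "0 < r" "!!x. r < norm x ==> tensor h1 h2 x = 0" using tf_support_cball[OF tf] by blast
 obtain z :: "real ^ 'n => real" where z: "test_function z" "!!x. norm x <= r + 1 ==> z x = 1" "!!x y. norm x = norm y ==> z x = z y"
  using plateau_function[of "r + 1"] r(1) by (metis add_pos_pos zero_less_one)
 show "(LBINT x. \<rho> x * generator \<beta> \<sigma> b (tensor h1 h2) x) = 0"
 proof (rule duality_imp_zero_integral[OF tf r(2) tf_tensor'[OF z(1,1)]])
  show "tensor z z x = 1" if "norm x <= r + 1" for x
   using that norm_fst_le[of "fst x" "snd x"] norm_snd_le[of "snd x" "fst x"] by (simp add: tensor_def z(2))
  show "tensor z z (flip x) = tensor z z x" for x using z(3)[of "- snd x" "snd x"] by (simp add: tensor_def)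
 qed (use s z(1) t in \<open>simp_all add: symmetry_condition_eq\<close>)
qed

end

text \<open>\<open>\<rho>\<close> is prescribed only up to null sets; \<open>R\<close> is its
  continuous Gibbs version, for which pointwise estimates and exact evenness are available.\<close>

locale gibbs_density = langevin_density \<beta> \<sigma> b \<rho>
 for \<beta> :: real and \<sigma> :: "real ^ 'n::finite ^ 'n" and b :: "real ^ 'n => real ^ 'n" and \<rho> :: "'n phase => real" +
 fixes U :: "real ^ 'n => real" and R :: "'n phase => real" and Z :: real
 assumes GU: "!!q. GDERIV U q :> - b q" and R_def: "!!x. R x = 1 / Z * exp (- \<beta> * hamiltonian U x)"
  and Z_pos: "0 < Z" and R_int: "integrable lborel R" and rho_R: "AE x in lborel. \<rho> x = R x"
begin

lemma R_continuous: "continuous_on UNIV R"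
proof -
 have "continuous_on UNIV U" using GU has_derivative_continuous cont_at_on unfolding gderiv_def by blast
 hence "continuous_on UNIV (%x :: 'n phase. U (fst x))" by (rule cont_comp) (auto intro: continuous_intros)
 thus ?thesis unfolding R_def[abs_def] hamiltonian_def case_prod_unfold by (intro continuous_intros) auto
qed

lemma R_measurable [measurable]: "R : Borel" by (rule borel_contI[OF R_continuous])

lemma R_flip: "R (flip x) = R x" by (simp add: R_def hamiltonian_def case_prod_unfold)

lemma gibbs_separable: "separable_density \<rho>" unfolding separable_density_def
proof (intro exI conjI allI)
 show "0 < 1 / Z * exp (- \<beta> * U q)" for q using Z_pos by simp
 show "0 < exp (- \<beta> * ((norm p)^2 / 2))" for p :: "real ^ 'n" by simp
 show "AE (q, p) in lborel. \<rho> (q, p) = 1 / Z * exp (- \<beta> * U q) * exp (- \<beta> * ((norm p)^2 / 2))" unfolding case_prod_unfold using rho_R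
  by eventually_elim (simp add: R_def hamiltonian_def case_prod_unfold exp_add[symmetric] algebra_simps)
qed

end

lemma (in langevin_density) potential_imp_gibbs: assumes "potential_condition \<beta> b \<rho>"
 obtains U R Z where "gibbs_density \<beta> \<sigma> b \<rho> U R Z"
proof -
 obtain U where U: "!!q. GDERIV U q :> - b q" "integrable lborel (%x. exp (- \<beta> * hamiltonian U x))"
  "AE x in lborel. \<rho> x = 1 / (LBINT y. exp (- \<beta> * hamiltonian U y)) * exp (- \<beta> * hamiltonian U x)"
  using assms unfolding potential_condition_def by blast
 have "gibbs_density \<beta> \<sigma> b \<rho> U (%x. 1 / (LBINT y. exp (- \<beta> * hamiltonian U y)) * exp (- \<beta> * hamiltonian U x))
   (LBINT y. exp (- \<beta> * hamiltonian U y))"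
 proof unfold_locales
  show "0 < (LBINT y. exp (- \<beta> * hamiltonian U y))" by (rule integral_pos_lborel[OF U(2)]) simp
 qed (use U in auto)
 thus ?thesis by (rule that)
qed

section \<open>Separable stationary densities\<close>

lemma AE_lborel_pair: assumes "AE z in (lborel :: ('a::euclidean_space \<times> 'b::euclidean_space) measure). P z"
 shows "AE x in lborel. AE y in lborel. P (x, y)"
proof -
 have "AE z in (lborel :: 'a measure) \<Otimes>\<^sub>M (lborel :: 'b measure). P z" unfolding lborel_prod by (rule assms)
 thus ?thesis by (rule lborel_pair.AE_pair)
qed

text \<open>\<open>U1\<close> and \<open>U2\<close> come without measurability. A slice of
  \<open>\<rho>\<close> at one good position replaces \<open>U2\<close>, and the marginal, which is
  then proportional to \<open>U1\<close> almost everywhere, replaces \<open>U1\<close>.\<close>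

lemma (in langevin_density) separable_factors: assumes "separable_density \<rho>"
 obtains c e where "integrable lborel c" "AE q in lborel. 0 < c q" "integrable lborel e" "!!p. 0 < e p"
  "AE x in lborel. \<rho> x = tensor c e x"
proof -
 obtain U1 U2 where U: "!!q. U1 q > 0" "!!p. U2 p > 0" and ae: "AE x in lborel. \<rho> x = U1 (fst x) * U2 (snd x)"
  using assms unfolding separable_density_def case_prod_unfold by auto
 have "AE q in lborel. AE p in lborel. \<rho> (q, p) = U1 q * U2 p" using AE_lborel_pair[OF ae] by simp
 with lborel_fubini(3)[OF rho_int] have "AE q in lborel. integrable lborel (%p. \<rho> (q, p)) \<and> (AE p in lborel. \<rho> (q, p) = U1 q * U2 p)"
  by eventually_elim simp
 then obtain q0 where q0: "integrable lborel (%p. \<rho> (q0, p))" "AE p in lborel. \<rho> (q0, p) = U1 q0 * U2 p" by (rule AE_lborel_obtain) blast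
 define e where "e p = \<rho> (q0, p)" for p
 have ei: "integrable lborel e" and epos: "!!p. 0 < e p" using q0(1) rho_pos by (auto simp: e_def[abs_def])
 define K where "K = (LBINT p. e p)"
 have K: "K > 0" unfolding K_def by (rule integral_pos_lborel[OF ei epos])
 have ae2: "AE x in lborel. \<rho> x = U1 (fst x) / U1 q0 * e (snd x)" using ae AE_lborel_snd[OF q0(2)]
 proof eventually_elim
  case (elim x)
  thus ?case using U(1)[of q0] by (simp add: e_def)
 qed
 hence "AE q in lborel. AE p in lborel. \<rho> (q, p) = U1 q / U1 q0 * e p" using AE_lborel_pair by fastforce
 with lborel_fubini(3)[OF rho_int] have "AE q in lborel. U1 q / U1 q0 = marginal q / K"
 proof eventually_elim
  case (elim q)
  have "marginal q = (LBINT p. U1 q / U1 q0 * e p)" unfolding marginal_def by (rule integral_cong_AE) (use elim ei in auto)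
  thus ?case using K by (simp add: K_def)
 qed
 from AE_lborel_fst[OF this] ae2 have "AE x in lborel. \<rho> x = tensor (%q. marginal q / K) e x" by eventually_elim (simp add: tensor_def)
 moreover have "integrable lborel (%q. marginal q / K)" using marginal_integrable by simp
 moreover have "AE q in lborel. 0 < marginal q / K" using marginal_pos by eventually_elim (use K in simp)
 ultimately show ?thesis using that ei epos by blast
qed

text \<open>Comparing total masses forces \<open>exp y = 1\<close>. The mass of a half space
  orthogonal to \<open>n\<close> is then unchanged under shifts by \<open>n\<close>, yet it must
  tend to the total mass in one direction and to zero in the other.\<close>

lemma no_translation_invariant_density: fixes c :: "'a::euclidean_space => real"
 assumes c: "integrable lborel c" and pos: "!!x. 0 < c x" and n: "n \<noteq> 0" and inv: "!!x. c (x + n) = exp y * c x" shows False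
proof -
 have [measurable]: "c : Borel" using borel_intI[OF c] by simp
 define I where "I = (LBINT x. c x)"
 have I: "I > 0" unfolding I_def by (rule integral_pos_lborel[OF c pos])
 have "I = (LBINT x. c (x + n))" unfolding I_def by (rule integral_translate[symmetric]) measurable
 also have "... = exp y * I" unfolding inv I_def by simp
 finally have "exp y = 1" using I by simp
 hence inv': "c (x + n) = c x" for x using inv by simp
 define J where "J t = (LBINT x. c x * indicator {x. n \<bullet> x <= t} x)" for t
 have hs [measurable]: "{x. n \<bullet> x <= t} : sets borel" for t by (intro borel_closed closed_halfspace_le)
 have step: "J (t + n \<bullet> n) = J t" for t
 proof -
  have "J (t + n \<bullet> n) = (LBINT x. c (x + n) * indicator {x. n \<bullet> x <= t + n \<bullet> n} (x + n))"
   unfolding J_def by (rule integral_translate[symmetric]) measurable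
  also have "... = J t" unfolding J_def by (simp add: inv' inner_add_right indicator_def)
  finally show ?thesis .
 qed
 have up: "J (real k * (n \<bullet> n)) = J 0" for k
 proof (induction k)
  case (Suc k)
  have "J (real (Suc k) * (n \<bullet> n)) = J (real k * (n \<bullet> n) + n \<bullet> n)" by (simp add: algebra_simps)
  thus ?case using step Suc by simp
 qed simp
 have down: "J (- (real k * (n \<bullet> n))) = J 0" for k
 proof (induction k)
  case (Suc k)
  have "J (- (real k * (n \<bullet> n))) = J (- (real (Suc k) * (n \<bullet> n)) + n \<bullet> n)" by (simp add: algebra_simps)
  also have "... = J (- (real (Suc k) * (n \<bullet> n)))" by (rule step)
  finally show ?case using Suc by simp
 qed simp
 have nn: "n \<bullet> n > 0" using n by simp
 have "(%k. J (real k * (n \<bullet> n))) ----> (LBINT x. c x)" unfolding J_def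
 proof (rule int_dct[where w=c])
  show "AE x in lborel. (%k. c x * indicator {x. n \<bullet> x <= real k * (n \<bullet> n)} x) ----> c x"
  proof (rule AE_I2)
   fix x
   obtain k0 where "(n \<bullet> x) / (n \<bullet> n) <= real k0" using real_arch_simple by blast
   hence k0: "n \<bullet> x <= real k0 * (n \<bullet> n)" using nn by (simp add: field_simps)
   have "\<forall>\<^sub>F k in sequentially. c x = c x * indicator {x. n \<bullet> x <= real k * (n \<bullet> n)} x"
    using eventually_ge_at_top[of k0]
   proof eventually_elim
    case (elim k)
    hence "real k0 * (n \<bullet> n) <= real k * (n \<bullet> n)" using nn by (intro mult_right_mono) auto
    thus ?case using k0 by (simp add: indicator_def)
   qed
   thus "(%k. c x * indicator {x. n \<bullet> x <= real k * (n \<bullet> n)} x) ----> c x" by (rule Lim_transform_eventually[OF tendsto_const])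
  qed
  show "AE x in lborel. norm (c x * indicator {x. n \<bullet> x <= real k * (n \<bullet> n)} x) <= c x" for k
   using pos by (intro AE_I2) (simp add: indicator_def less_imp_le)
 qed (use c in measurable)
 hence "J 0 = I" unfolding up I_def by (simp add: LIMSEQ_const_iff)
 moreover have "(%k. J (- (real k * (n \<bullet> n)))) ----> (LINT x::'a|lborel. 0)" unfolding J_def
 proof (rule int_dct[where w=c])
  show "AE x in lborel. (%k. c x * indicator {x. n \<bullet> x <= - (real k * (n \<bullet> n))} x) ----> 0"
  proof (rule AE_I2)
   fix x
   obtain k0 where "- (n \<bullet> x) / (n \<bullet> n) < real k0" using reals_Archimedean2 by blast
   hence k0: "- (n \<bullet> x) < real k0 * (n \<bullet> n)" using nn by (simp add: field_simps)
   have "\<forall>\<^sub>F k in sequentially. 0 = c x * indicator {x. n \<bullet> x <= - (real k * (n \<bullet> n))} x"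
    using eventually_ge_at_top[of k0]
   proof eventually_elim
    case (elim k)
    hence "real k0 * (n \<bullet> n) <= real k * (n \<bullet> n)" using nn by (intro mult_right_mono) auto
    thus ?case using k0 by (simp add: indicator_def)
   qed
   thus "(%k. c x * indicator {x. n \<bullet> x <= - (real k * (n \<bullet> n))} x) ----> 0" by (rule Lim_transform_eventually[OF tendsto_const])
  qed
  show "AE x in lborel. norm (c x * indicator {x. n \<bullet> x <= - (real k * (n \<bullet> n))} x) <= c x" for k
   using pos by (intro AE_I2) (simp add: indicator_def less_imp_le)
 qed (use c in measurable)
 hence "J 0 = 0" unfolding down by (simp add: LIMSEQ_const_iff)
 ultimately show False using I by simp
qed

text \<open>For a product density tested with products, stationarity relates moments of
  \<open>G1\<close> against \<open>c\<close> to moments of \<open>G2\<close> against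
  \<open>e\<close>. Solving for the gradient of \<open>c\<close> gives it a logarithmic gradient
  \<open>w\<close> that is affine in \<open>b\<close>; inserting this and subtracting the relation
  at two positions leaves \<open>(w q - w q') \<bullet> m G = (b q - b q') \<bullet> d G\<close>.
  Since the differences of \<open>w\<close> span, the weak gradient of \<open>e\<close> is
  \<open>e\<close> times a linear function, so \<open>ln e\<close> is quadratic and even.\<close>

lemma (in langevin_density) separable_stationary_even: assumes sep: "separable_density \<rho>" and weak: "weakly_stationary \<beta> \<sigma> b \<rho>"
 shows "even_in_p \<rho>"
proof -
 obtain c e where ci: "integrable lborel c" and cpos: "AE q in lborel. 0 < c q" and ei: "integrable lborel e"
  and epos: "!!p. 0 < e p" and prod: "AE x in lborel. \<rho> x = tensor c e x" by (rule separable_factors[OF sep]) blast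
 let ?s = "%k. column k \<sigma>"
 define m where "m G = (\<chi> i. LBINT p. e p * (p $ i * G p))" for G :: "real ^ 'n => real"
 define d where "d G = (\<chi> i. LBINT p. e p * dd (axis i 1) G p)" for G :: "real ^ 'n => real"
 define s where "s G = (LBINT p. e p * ou \<beta> ?s G p)" for G :: "real ^ 'n => real"
 define A where "A G = (\<chi> i. LBINT q. c q * dd (axis i 1) G q)" for G :: "real ^ 'n => real"
 define B where "B G = (\<chi> i. LBINT q. c q * (b q $ i * G q))" for G :: "real ^ 'n => real"
 define C where "C G = (LBINT q. c q * G q)" for G :: "real ^ 'n => real"
 have im: "integrable lborel (%p. h p * (g p * G p))" if h: "integrable lborel h" and t: "test_function G" and g: "continuous_on UNIV g"
  for h g G :: "real ^ 'n => real"
 proof -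
  obtain K where K: "compact K" "!!x. x \<notin> K ==> G x = 0" using tf_support[OF t] by blast
  show ?thesis by (rule int_mult_supp[OF h _ K(1)])
     (auto simp: K(2) intro!: continuous_on_mult g smooth_cont[OF tf_smooth[OF t]])
 qed
 have cc: "continuous_on UNIV (%p::real^'n. p $ i)" and bc: "continuous_on UNIV (%q. b q $ i)" for i
  by (intro continuous_on_component continuous_on_id b_cont)+
 have main: "A G1 \<bullet> m G2 + B G1 \<bullet> d G2 + C G1 * s G2 = 0" if t1: "test_function G1" and t2: "test_function G2" for G1 G2
 proof -
  note st = smooth_tensor[OF tf_smooth[OF t1] tf_smooth[OF t2]]
  have ti: "integrable lborel (tensor c e)" unfolding tensor_def[abs_def] by (rule int_tensor[OF ci ei])
  have tt: "test_function (tensor G1 G2)" by (rule tf_tensor'[OF t1 t2])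
  have gm: "generator \<beta> \<sigma> b (tensor G1 G2): Borel" unfolding generator_split[OF st, abs_def]
   by (intro borel_contI continuous_on_add transport_continuous st b_cont
    smooth_cont[OF diffusion_smooth])
  have "0 = (LBINT x. \<rho> x * generator \<beta> \<sigma> b (tensor G1 G2) x)" using weak t1 t2 by (simp add: weakly_stationary_def)
  also have "... = (LBINT x. tensor c e x * generator \<beta> \<sigma> b (tensor G1 G2) x)"
   by (rule integral_cong_AE) (use prod gm borel_intI[OF ti] in auto)
  also have "... = (LBINT x. tensor c e x * transport b (tensor G1 G2) x) + (LBINT x. tensor c e x * diffusion \<beta> \<sigma> (tensor G1 G2) x)"
   unfolding generator_split[OF st] distrib_left by (rule lint_add[OF integrable_transport_part[OF tt ti b_cont] integrable_diffusion_part[OF tt ti]])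
  also have "(LBINT x. tensor c e x * transport b (tensor G1 G2) x) = A G1 \<bullet> m G2 + B G1 \<bullet> d G2"
   unfolding tensor_transport_integral[OF ci ei t1 t2] by (simp add: A_def m_def B_def d_def inner_vec_def)
  also have "(LBINT x. tensor c e x * diffusion \<beta> \<sigma> (tensor G1 G2) x)
    = (LBINT x. (c (fst x) * G1 (fst x)) * (e (snd x) * ou \<beta> ?s G2 (snd x)))" unfolding diffusion_tensor[OF tf_smooth[OF t1] tf_smooth[OF t2]]
   by (intro lint_cong refl) (simp add: tensor_def mult_ac)
  also have "... = C G1 * s G2" unfolding C_def s_def
   by (rule integral_tensor[OF int_mult_test[OF ci t1] int_mult_test[OF ei ou_test_function[OF t2]]])
  finally show ?thesis by simp
 qed
 have m_inner: "n \<bullet> m G = (LBINT p. e p * ((n \<bullet> p) * G p))" if t: "test_function G" for n G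
 proof -
  have "n \<bullet> m G = (\<Sum>i\<in>UNIV. LBINT p. n $ i * (e p * (p $ i * G p)))" by (simp add: m_def inner_vec_def)
  also have "... = (LBINT p. (\<Sum>i\<in>UNIV. n $ i * (e p * (p $ i * G p))))" using im[OF ei t cc] by (intro lint_sum[symmetric]) simp
  also have "... = (LBINT p. e p * ((n \<bullet> p) * G p))"
   by (intro lint_cong refl) (simp add: inner_vec_def sum_distrib_left sum_distrib_right mult_ac)
  finally show ?thesis .
 qed
 \<comment> \<open>\<open>m\<close> is linear on test functions. A vector \<open>n\<close>
   orthogonal to its range would make \<open>n \<bullet> p\<close> vanish almost everywhere,
   \<open>e\<close> being positive.\<close>
 have m_surj: "\<exists>G. test_function G \<and> m G = v" for v
 proof -
  define S where "S = m ` Collect test_function"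
  have "subspace S" unfolding subspace_def
  proof (intro conjI ballI allI)
   have "m (%x. 0) = 0" by (simp add: m_def vec_eq_iff)
   moreover have "test_function (%x::real^'n. 0)" by (rule tf_I[OF smooth_const compact_empty]) simp
   ultimately show "0 : S" unfolding S_def by (intro image_eqI[of _ m "%x. 0"]) auto
  next
   fix x y assume "x : S" "y : S"
   then obtain G a where t: "test_function G" "test_function a" "x = m G" "y = m a" unfolding S_def by auto
   have "m (%p. G p + a p) = x + y" unfolding t m_def vec_eq_iff using im[OF ei t(1) cc] im[OF ei t(2) cc] by (simp add: distrib_left)
   thus "x + y : S" unfolding S_def using tf_add[OF t(1,2)] by (intro image_eqI[of _ m "%p. G p + a p"]) auto
  next
   fix r x assume "x : S"
   then obtain G where t: "test_function G" "x = m G" unfolding S_def by auto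
   have "m (%p. r * G p) $ i = r * (x $ i)" for i unfolding t m_def by (simp add: mult.left_commute[of _ r])
   hence "m (%p. r * G p) = r *R x" by (simp add: vec_eq_iff)
   thus "r *R x : S" unfolding S_def using tf_cmult[OF t(1)] by (intro image_eqI[of _ m "%p. r * G p"]) auto
  qed
  moreover have "span S = UNIV"
  proof (rule ccontr)
   assume "span S \<noteq> UNIV"
   then obtain n where n: "n \<noteq> 0" "\<forall>x\<in>span S. n \<bullet> x = 0" using span_not_UNIV_orthogonal by blast
   have "AE p in lborel. e p * (n \<bullet> p) = 0"
   proof (rule AE_eq_0_if_test_integrals_eq_0'[OF ei])
    show "continuous_on UNIV (%p. n \<bullet> p)" by (intro continuous_intros)
    fix G :: "real ^ 'n => real" assume t: "test_function G"
    have "n \<bullet> m G = 0" using n(2) t by (auto simp: S_def intro: span_base)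
    thus "(LBINT p. e p * ((n \<bullet> p) * G p)) = 0" unfolding m_inner[OF t] .
   qed
   from inner_zero_if_AE[OF epos this] n(1) show False by simp
  qed
  ultimately have "S = UNIV" using span_eq_iff[of S] by simp
  hence "v : S" by simp
  thus ?thesis unfolding S_def by auto
 qed
 have "\<forall>i. \<exists>G. test_function G \<and> m G = axis i 1" using m_surj by blast
 from choice[OF this] obtain G' where G': "!!i. test_function (G' i)" "!!i. m (G' i) = axis i 1" by blast
 \<comment> \<open>The \<open>G' i\<close> are dual to the axes under \<open>m\<close>; inserting
   them into the moment relation reads off the components of the weak gradient of
   \<open>c\<close>.\<close>
 define w where "w q = (\<chi> i. b q \<bullet> d (G' i) + s (G' i))" for q
 have wc: "continuous_on UNIV w" unfolding w_def by (intro continuous_intros b_cont)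
 have A_inner: "(LBINT q. c q * dd v G q) = A G \<bullet> v" if t: "test_function G" for v G
 proof -
  have vs: "v = (\<Sum>i\<in>UNIV. v $ i *R axis i 1)" by (simp add: vec_eq_iff axis_def if_distrib cong: if_cong)
  have dv: "dd v G q = (\<Sum>i\<in>UNIV. v $ i * dd (axis i 1) G q)" for q
   by (subst vs) (simp only: dd_sum_dir[OF tf_smooth[OF t]] dd_scaleR_dir[OF tf_smooth[OF t]])
  have "(LBINT q. c q * dd v G q) = (LBINT q. (\<Sum>i\<in>UNIV. v $ i * (c q * dd (axis i 1) G q)))"
   unfolding dv by (intro lint_cong refl) (simp add: sum_distrib_left mult_ac)
  also have "... = (\<Sum>i\<in>UNIV. LBINT q. v $ i * (c q * dd (axis i 1) G q))" using int_mult_test[OF ci tf_dd[OF t]] by (intro lint_sum) simp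
  also have "... = A G \<bullet> v" by (simp add: A_def inner_vec_def mult.commute)
  finally show ?thesis .
 qed
 have B_inner: "B G \<bullet> v + C G * r = (LBINT q. c q * ((b q \<bullet> v + r) * G q))" if t: "test_function G" for v r G
 proof -
  have i1: "integrable lborel (%q. c q * (b q $ i * G q) * v $ i)" for i using im[OF ci t bc] by simp
  have i2: "integrable lborel (%q. c q * G q * r)" using int_mult_test[OF ci t] by simp
  have "B G \<bullet> v + C G * r = (\<Sum>i\<in>UNIV. LBINT q. c q * (b q $ i * G q) * v $ i) + (LBINT q. c q * G q * r)"
   by (simp add: B_def C_def inner_vec_def)
  also have "... = (LBINT q. (\<Sum>i\<in>UNIV. c q * (b q $ i * G q) * v $ i) + c q * G q * r)"
   by (simp only: lint_add[OF int_sum[OF i1] i2] lint_sum[OF i1])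
  also have "... = (LBINT q. c q * ((b q \<bullet> v + r) * G q))"
   by (intro lint_cong refl) (simp add: inner_vec_def sum_distrib_left sum_distrib_right algebra_simps)
  finally show ?thesis .
 qed
 have weak_c: "(LBINT q. c q * dd v G q) = - (LBINT q. c q * (w q \<bullet> v) * G q)" if t: "test_function G" for G v
 proof -
  have "A G \<bullet> v = (\<Sum>i\<in>UNIV. v $ i * (A G \<bullet> m (G' i)))" unfolding G'(2) by (simp add: inner_vec_def axis_def if_distrib mult.commute cong: if_cong)
  also have "... = - (\<Sum>i\<in>UNIV. v $ i * (B G \<bullet> d (G' i) + C G * s (G' i)))"
  proof -
   have "A G \<bullet> m (G' i) = - (B G \<bullet> d (G' i) + C G * s (G' i))" for i using main[OF t G'(1)[of i]] by simp
   thus ?thesis by (simp only: mult_minus_right sum_negf)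
  qed
  also have "(\<Sum>i\<in>UNIV. v $ i * (B G \<bullet> d (G' i) + C G * s (G' i))) = B G \<bullet> (\<Sum>i\<in>UNIV. v $ i *R d (G' i)) + C G * (\<Sum>i\<in>UNIV. v $ i * s (G' i))"
   by (simp add: inner_sum_right sum_distrib_left sum.distrib algebra_simps)
  also have "... = (LBINT q. c q * ((b q \<bullet> (\<Sum>i\<in>UNIV. v $ i *R d (G' i)) + (\<Sum>i\<in>UNIV. v $ i * s (G' i))) * G q))"
   by (rule B_inner[OF t])
  also have "... = (LBINT q. c q * (w q \<bullet> v) * G q)" by (intro lint_cong refl)
     (simp add: w_def inner_vec_def[of "\<chi> i. _ i"] inner_sum_right sum.distrib[symmetric] algebra_simps)
  finally show ?thesis unfolding A_inner[OF t] .
 qed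
 obtain P1 where P1: "continuous_on UNIV P1" "!!x v. P1 (x + v) = P1 x + integral {0..1} (%u. w (x + u *R v) \<bullet> v)"
  "AE x in lborel. c x = exp (P1 x)" by (rule weak_gradient_potential[where c=c and g=w, OF ci cpos wc weak_c]) blast+
 have key: "w q \<bullet> m G = b q \<bullet> d G + s G" if t: "test_function G" for G q
 proof -
  define h where "h q = w q \<bullet> m G - (b q \<bullet> d G + s G)" for q
  have hc: "continuous_on UNIV h" unfolding h_def by (intro continuous_intros wc b_cont)
  have "AE q in lborel. c q * h q = 0"
  proof (rule AE_eq_0_if_test_integrals_eq_0'[OF ci hc])
   fix a :: "real ^ 'n => real" assume u: "test_function a"
   have i1: "integrable lborel (%q. c q * ((w q \<bullet> m G) * a q))" by (rule im[OF ci u]) (intro continuous_intros wc)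
   have i2: "integrable lborel (%q. c q * ((b q \<bullet> d G + s G) * a q))" by (rule im[OF ci u]) (intro continuous_intros b_cont)
   have "(LBINT q. c q * (h q * a q)) = (LBINT q. c q * ((w q \<bullet> m G) * a q) - c q * ((b q \<bullet> d G + s G) * a q))"
    by (intro lint_cong refl) (simp add: h_def algebra_simps)
   also have "... = (LBINT q. c q * ((w q \<bullet> m G) * a q)) - (LBINT q. c q * ((b q \<bullet> d G + s G) * a q))" by (rule lint_diff[OF i1 i2])
   also have "... = - (A a \<bullet> m G) - (B a \<bullet> d G + C a * s G)"
    unfolding B_inner[OF u] A_inner[OF u, symmetric] weak_c[OF u] by (simp add: mult.assoc)
   also have "... = 0" using main[OF u t] by simp
   finally show "(LBINT q. c q * (h q * a q)) = 0" .
  qed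
  with cpos have "AE q in lborel. h q = 0" by eventually_elim simp
  hence "h q = 0" by (rule AE_lborel_continuous_eq[OF _ hc]) (rule continuous_on_const)
  thus ?thesis by (simp add: h_def)
 qed
 have expint: "integrable lborel (%x. exp (P1 x))" using ci by (rule integrable_cong_AE_imp)
    (use P1(3) in \<open>auto intro!: borel_contI continuous_on_exp P1(1)\<close>)
 \<comment> \<open>Were \<open>n\<close> orthogonal to all differences,
   \<open>w q \<bullet> n\<close> would be constant in \<open>q\<close>, so translation by
   \<open>n\<close> would multiply the position density by a fixed factor.\<close>
 have span_w: "span (range (%(q, q'). w q - w q')) = UNIV"
 proof (rule ccontr)
  assume "\<not> ?thesis"
  then obtain n where n: "n \<noteq> 0" "\<forall>x\<in>span (range (%(q, q'). w q - w q')). n \<bullet> x = 0"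
   using span_not_UNIV_orthogonal by blast
  have "w q \<bullet> n = w 0 \<bullet> n" for q
  proof -
   have "w q - w 0 : span (range (%(q, q'). w q - w q'))" by (rule span_base) auto
   hence "n \<bullet> (w q - w 0) = 0" using n(2) by blast
   thus ?thesis by (simp add: inner_diff_right inner_commute[of n])
  qed
  hence "integral {0..1} (%u. w (x + u *R n) \<bullet> n) = integral {0..1::real} (%u. w 0 \<bullet> n)" for x
   by (intro Henstock_Kurzweil_Integration.integral_cong)
  hence "P1 (x + n) = P1 x + w 0 \<bullet> n" for x unfolding P1(2) by simp
  hence "exp (P1 (x + n)) = exp (w 0 \<bullet> n) * exp (P1 x)" for x by (simp add: exp_add)
  from no_translation_invariant_density[OF expint _ n(1) this] show False by simp
 qed
 \<comment> \<open>The vectors whose momentum moments are derivative moments form a subspace; it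
   contains the differences of \<open>w\<close>, with the differences of \<open>b\<close> as
   witnesses, and therefore everything.\<close>
 have "\<exists>l. \<forall>G. test_function G \<longrightarrow> x \<bullet> m G = l \<bullet> d G" for x
 proof -
  define T where "T = {x. \<exists>l. \<forall>G. test_function G \<longrightarrow> x \<bullet> m G = l \<bullet> d G}"
  have "subspace T" unfolding subspace_def
  proof (intro conjI ballI allI)
   show "0 : T" unfolding T_def by (auto intro!: exI[of _ 0])
  next
   fix x y assume "x : T" "y : T"
   then obtain l l' where "\<forall>G. test_function G \<longrightarrow> x \<bullet> m G = l \<bullet> d G" "\<forall>G. test_function G \<longrightarrow> y \<bullet> m G = l' \<bullet> d G"
    unfolding T_def by auto
   thus "x + y : T" unfolding T_def by (auto simp: inner_add_left intro!: exI[of _ "l + l'"])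
  next
   fix r x assume "x : T"
   then obtain l where "\<forall>G. test_function G \<longrightarrow> x \<bullet> m G = l \<bullet> d G" unfolding T_def by auto
   thus "r *R x : T" unfolding T_def by (auto intro!: exI[of _ "r *R l"])
  qed
  moreover have "range (%(q, q'). w q - w q') \<subseteq> T" unfolding T_def by (auto simp: inner_diff_left key intro!: exI[of _ "b _ - b _"])
  ultimately have "span (range (%(q, q'). w q - w q')) \<subseteq> T" by (rule span_minimal[rotated])
  thus ?thesis using span_w unfolding T_def by blast
 qed
 hence "\<forall>x. \<exists>l. \<forall>G. test_function G \<longrightarrow> x \<bullet> m G = l \<bullet> d G" by blast
 from choice[OF this] obtain l where l: "!!x G. test_function G ==> x \<bullet> m G = l x \<bullet> d G" by blast
 \<comment> \<open>Choice gives no linear dependence on \<open>x\<close>; extending the chosen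
   values on the axes linearly does. Injectivity of \<open>L\<close> comes from surjectivity of
   \<open>m\<close>.\<close>
 define L where "L x = (\<Sum>i\<in>UNIV. x $ i *R l (axis i 1))" for x
 have L: "x \<bullet> m G = L x \<bullet> d G" if t: "test_function G" for x G
 proof -
  have "L x \<bullet> d G = (\<Sum>i\<in>UNIV. x $ i * (axis i 1 \<bullet> m G))" unfolding L_def inner_sum_left l[OF t] by simp
  also have "... = (\<Sum>i\<in>UNIV. x $ i * (m G $ i))" by (simp add: inner_axis inner_commute[of "axis _ _"])
  finally show ?thesis by (simp add: inner_vec_def[of x])
 qed
 have Llin: "linear L" by (rule linearI) (simp_all add: L_def scaleR_left.add sum.distrib scaleR_sum_right scaleR_add_left)
 have "inj L"
 proof (subst linear_injective_0[OF Llin], intro allI impI)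
  fix x assume "L x = 0"
  hence z: "x \<bullet> m G = 0" if "test_function G" for G using L[OF that, of x] by simp
  obtain G where "test_function G" "m G = x" using m_surj by blast
  thus "x = 0" using z by fastforce
 qed
 hence "surj L" by (rule linear_injective_imp_surjective[OF Llin]) (rule refl)
 then obtain N where N': "linear N" "L \<circ> N = id" using linear_surjective_right_inverse[OF Llin] by blast
 have N: "linear N" "!!x. L (N x) = x" using N' by (auto simp: fun_eq_iff)
 define g where "g p = - adjoint N p" for p
 have adj: "adjoint N p \<bullet> v = p \<bullet> N v" for p v by (rule adjoint_clauses(2)[OF N(1)])
 have gc: "continuous_on UNIV g" unfolding g_def
  by (intro continuous_on_minus linear_continuous_on_compose[OF _ adjoint_linear[OF N(1)]] continuous_on_id)
 have weak_e: "(LBINT p. e p * dd v G p) = - (LBINT p. e p * (g p \<bullet> v) * G p)" if t: "test_function G" for G v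
 proof -
  have vs: "v = (\<Sum>i\<in>UNIV. v $ i *R axis i 1)" by (simp add: vec_eq_iff axis_def if_distrib cong: if_cong)
  have dv: "dd v G q = (\<Sum>i\<in>UNIV. v $ i * dd (axis i 1) G q)" for q
   by (subst vs) (simp only: dd_sum_dir[OF tf_smooth[OF t]] dd_scaleR_dir[OF tf_smooth[OF t]])
  have "(LBINT p. e p * dd v G p) = (LBINT p. (\<Sum>i\<in>UNIV. v $ i * (e p * dd (axis i 1) G p)))"
   unfolding dv by (intro lint_cong refl) (simp add: sum_distrib_left mult_ac)
  also have "... = (\<Sum>i\<in>UNIV. LBINT p. v $ i * (e p * dd (axis i 1) G p))" using int_mult_test[OF ei tf_dd[OF t]] by (intro lint_sum) simp
  also have "... = v \<bullet> d G" by (simp add: d_def inner_vec_def)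
  also have "... = N v \<bullet> m G" using L[OF t, of "N v"] N(2) by simp
  also have "... = (LBINT p. e p * ((N v \<bullet> p) * G p))" by (rule m_inner[OF t])
  also have "... = (LBINT p. - (e p * (g p \<bullet> v) * G p))" by (intro lint_cong refl) (simp add: g_def adj inner_commute[of _ "N v"])
  finally show ?thesis by simp
 qed
 obtain P2 where P2: "!!x v. P2 (x + v) = P2 x + integral {0..1} (%u. g (x + u *R v) \<bullet> v)" "AE x in lborel. e x = exp (P2 x)"
  by (rule weak_gradient_potential[where c=e and g=g, OF ei _ gc weak_e]) (use epos in auto)
 \<comment> \<open>\<open>g\<close> is odd, so the line integrals from the origin to
   \<open>p\<close> and to \<open>- p\<close> agree.\<close>
 have "P2 (- p) = P2 p" for p
 proof -
  have gm: "g (- x) = - g x" for x using linear_neg[OF adjoint_linear[OF N(1)]] by (simp add: g_def)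
  show ?thesis using P2(1)[of 0 p] P2(1)[of 0 "- p"] by (simp add: gm)
 qed
 hence ev: "exp (P2 (- p)) = exp (P2 p)" for p by simp
 from AE_lborel_snd[OF P2(2)] prod have R: "AE x in lborel. \<rho> x = c (fst x) * exp (P2 (snd x))" by eventually_elim (simp add: tensor_def)
 have "AE x in distr lborel borel (flip :: 'n phase => 'n phase). \<rho> x = c (fst x) * exp (P2 (snd x))" unfolding lborel_distr_flip by (rule R)
 hence "AE x in lborel. \<rho> (flip x) = c (fst (flip x)) * exp (P2 (snd (flip x)))" by (rule AE_distrD[rotated]) simp
 with R show ?thesis unfolding even_in_p_flip by eventually_elim (simp add: ev)
qed

section \<open>The splitting scheme\<close>

text \<open>Half a position move, one momentum kick with explicit friction, half a position move
  with the new momentum. Old and new state share the midpoint \<open>m\<close>, so exchanging them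
  and reversing both momenta gives a step of the same form.\<close>

definition split_step :: "('a::real_normed_vector => 'a) => ('a => 'a) => real => 'a \<times> 'a => 'a => 'a \<times> 'a" where
 "split_step G b h x y = (let m = fst x + (h/2) *R snd x; p' = snd x + h *R (b m - G (snd x)) + y in (m + (h/2) *R p', p'))"

primrec splitting_path :: "('a::real_normed_vector => 'a) => ('a => 'a) => real => (real => 'a) => 'a \<times> 'a => nat => 'a \<times> 'a" where
 "splitting_path G b h W x 0 = x"
| "splitting_path G b h W x (Suc k) = split_step G b h (splitting_path G b h W x k) (W (real (Suc k) * h) - W (real k * h))"

text \<open>The one-step estimate is available only while the error is at most one, since Lipschitz
  constants are local. The smallness condition at the last index keeps every earlier error in that
  range.\<close>

lemma discrete_gronwall_local: fixes e :: "nat => real" assumes h: "0 <= h" and L: "0 <= L" and d: "0 <= d" and e0: "e 0 = 0"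
  and step: "!!k. k < N ==> e k <= 1 ==> e (Suc k) <= (1 + h * L) * e k + h * d" and small: "exp (L * (h * real N)) * (h * real N) * d <= 1"
 shows "k <= N ==> e k <= exp (L * (h * real k)) * (h * real k) * d"
proof (induction k)
 case 0 thus ?case by (simp add: e0)
next
 case (Suc k)
 define a where "a = exp (L * (h * real k))"
 have kN: "real k <= real N" using Suc.prems by simp
 have "e k <= a * (h * real k) * d" using Suc by (simp add: a_def)
 also have "... <= exp (L * (h * real N)) * (h * real N) * d"
  unfolding a_def using h L d kN by (intro mult_right_mono mult_mono) (auto intro!: mult_left_mono)
 finally have "e k <= 1" using small by simp
 hence "e (Suc k) <= (1 + h * L) * e k + h * d" using step Suc.prems by simp
 also have "(1 + h * L) * e k <= exp (L * h) * (a * (h * real k) * d)"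
 proof (rule order.trans)
  show "(1 + h * L) * e k <= (1 + h * L) * (a * (h * real k) * d)" using \<open>e k <= a * (h * real k) * d\<close> h L by (intro mult_left_mono) auto
  show "(1 + h * L) * (a * (h * real k) * d) <= exp (L * h) * (a * (h * real k) * d)"
   using exp_ge_add_one_self[of "L * h"] h d by (intro mult_right_mono) (auto simp: a_def mult.commute)
 qed
 also have "h * d <= exp (L * h) * a * (h * d)"
 proof -
  have "1 * 1 <= exp (L * h) * a" unfolding a_def using h L by (intro mult_mono) auto
  hence "1 * (h * d) <= exp (L * h) * a * (h * d)" using h d by (intro mult_right_mono) auto
  thus ?thesis by simp
 qed
 finally have "e (Suc k) <= (exp (L * h) * a) * (h * real (Suc k)) * d" by (simp add: algebra_simps)
 also have "exp (L * h) * a = exp (L * (h * real (Suc k)))" by (simp add: a_def exp_add[symmetric] algebra_simps)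
 finally show ?case .
qed

lemma integral_const_approx: fixes f :: "real => 'a::euclidean_space"
 assumes "a <= c" "continuous_on {a..c} f" "!!s. s : {a..c} ==> norm (f s - v) <= B" shows "norm ((c - a) *R v - integral {a..c} f) <= (c - a) * B"
proof -
 have "norm (integral {a..c} (%s. f s - v)) <= B * (c - a)" by (rule integral_bound) (use assms in \<open>auto intro: continuous_on_diff\<close>)
 also have "integral {a..c} (%s. f s - v) = integral {a..c} f - (c - a) *R v"
  using assms(1,2) by (subst Henstock_Kurzweil_Integration.integral_diff) (auto intro: integrable_continuous_interval)
 finally show ?thesis by (simp add: norm_minus_commute mult.commute)
qed

text \<open>The estimate concerns one fixed continuous driving path. \<open>R\<close> bounds the
  exact path; while the error is at most one, the half-step point stays within radius
  \<open>R + 2\<close>, where a single Lipschitz constant applies.\<close>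

lemma splitting_path_converges: fixes q p W :: "real => 'a::euclidean_space"
 assumes T: "0 < T" and qc: "continuous_on {0..T} q" and pc: "continuous_on {0..T} p" and Wc: "continuous_on {0..T} W" and G: "bounded_linear G"
  and lip: "!!r. \<exists>K>0. \<forall>x y. norm x <= r \<longrightarrow> norm y <= r \<longrightarrow> norm (b x - b y) <= K * norm (x - y)"
  and qeq: "!!t. t : {0..T} ==> q t = q 0 + integral {0..t} p"
  and peq: "!!t. t : {0..T} ==> p t = p 0 + integral {0..t} (%s. b (q s) - G (p s)) + W t" and z: "0 < z"
 shows "\<forall>\<^sub>F N in sequentially. \<forall>k\<le>N. norm (splitting_path G b (T / real N) W (q 0, p 0) k - (q (real k * (T / real N)), p (real k * (T / real N)))) <= z"
proof -
 have "bounded ((%t. norm (q t) + norm (p t)) ` {0..T})" by (intro compact_imp_bounded compact_continuous_image continuous_intros qc pc) simp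
 then obtain R where R: "R > 0" "!!t. t : {0..T} ==> norm (q t) + norm (p t) <= R" unfolding bounded_pos by fastforce
 obtain g where g: "g > 0" "!!x. norm (G x) <= norm x * g" using bounded_linear.pos_bounded[OF G] by auto
 obtain K where K: "K > 0" "!!x y. norm x <= R + 2 ==> norm y <= R + 2 ==> norm (b x - b y) <= K * norm (x - y)" using lip[of "R + 2"] by auto
 have bcont: "continuous_on (cball 0 (R + 2)) b" unfolding continuous_on_iff
 proof (intro ballI allI impI)
  fix x :: 'a and e :: real assume x: "x : cball 0 (R + 2)" and e: "0 < e"
  show "\<exists>d>0. \<forall>x'\<in>cball 0 (R + 2). dist x' x < d \<longrightarrow> dist (b x') (b x) < e"
  proof (intro exI[of _ "e / K"] conjI ballI impI)
   fix y :: 'a assume y: "y : cball 0 (R + 2)" and d: "dist y x < e / K"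
   have "dist (b y) (b x) <= K * dist y x" using K(2)[of y x] x y by (simp add: dist_norm)
   also have "... < e" using d K(1) by (simp add: field_simps)
   finally show "dist (b y) (b x) < e" .
  qed (use e K in simp)
 qed
 have "bounded (b ` cball 0 (R + 2))" by (intro compact_imp_bounded compact_continuous_image bcont compact_cball)
 then obtain Cb where Cb: "Cb > 0" "!!x. norm x <= R + 2 ==> norm (b x) <= Cb" unfolding bounded_pos by fastforce
 define L where "L = 1 + g + K"
 have L: "L > 0" using g K by (simp add: L_def)
 \<comment> \<open>The local error per unit time that the Gronwall factor turns into
   \<open>min z 1\<close>. Half of it is given to the oscillation \<open>w\<close> of the paths,
   half to the step-size term \<open>h * D\<close>.\<close>
 define c where "c = min z 1 / (exp (L * T) * T)"
 have c: "c > 0" using z T by (simp add: c_def)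
 define w where "w = c / (2 * (L + 1/2))"
 have w: "w > 0" using c L by (simp add: w_def)
 obtain d1 where d1: "d1 > 0" "!!s t. s : {0..T} ==> t : {0..T} ==> dist s t < d1 ==> dist (q s) (q t) < w"
  using compact_uniformly_continuous[OF qc] w unfolding uniformly_continuous_on_def by (metis compact_Icc)
 obtain d2 where d2: "d2 > 0" "!!s t. s : {0..T} ==> t : {0..T} ==> dist s t < d2 ==> dist (p s) (p t) < w"
  using compact_uniformly_continuous[OF pc] w unfolding uniformly_continuous_on_def by (metis compact_Icc)
 obtain d3 where d3: "d3 > 0" "!!s t. s : {0..T} ==> t : {0..T} ==> dist s t < d3 ==> dist (W s) (W t) < w"
  using compact_uniformly_continuous[OF Wc] w unfolding uniformly_continuous_on_def by (metis compact_Icc)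
 \<comment> \<open>The errors of order \<open>h\<close> within a step: the displacement of the
   midpoint, felt through \<open>K\<close>, and the change of momentum by friction and
   force.\<close>
 define D where "D = K * (R + 1) / 2 + (g * (R + 1) + Cb) / 2"
 have D: "D > 0" using K R g Cb by (simp add: D_def add_pos_pos)
 \<comment> \<open>The last entry makes the half-step displacement \<open>(h/2) * (R + 1)\<close> at
   most one.\<close>
 define h0 where "h0 = min (min d1 d2) (min d3 (min (c / (2 * D)) (2 / (R + 1))))"
 have h0: "h0 > 0" using d1 d2 d3 c D R by (simp add: h0_def)
 obtain N0 where N0: "T / h0 < real N0" using reals_Archimedean2 by blast
 have "\<forall>k\<le>N. norm (splitting_path G b (T / real N) W (q 0, p 0) k - (q (real k * (T / real N)), p (real k * (T / real N)))) <= z"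
  if N: "N \<ge> max 1 N0" for N
 proof -
  define h where "h = T / real N"
  have N1: "real N > 0" using N by simp
  have h: "h > 0" using T N1 by (simp add: h_def)
  have "T / h0 < real N" using N0 N by (meson less_le_trans max.boundedE of_nat_le_iff)
  hence hh0: "h < h0" using h0 N1 by (simp add: h_def field_simps)
  have hN: "h * real N = T" using N1 by (simp add: h_def)
  define X where "X k = splitting_path G b h W (q 0, p 0) k" for k
  define e where "e k = norm (fst (X k) - q (real k * h)) + norm (snd (X k) - p (real k * h))" for k
  define u where "u = (L + 1/2) * w + h * D"
  have tk: "real k * h : {0..T}" if "k <= N" for k
  proof -
   have "real k * h <= real N * h" using that h by (intro mult_right_mono) auto
   thus ?thesis using h hN by (simp add: mult.commute)
  qed
  have step: "e (Suc k) <= (1 + h * L) * e k + h * u" if k: "k < N" and ek: "e k <= 1" for k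
  proof -
   define a where "a = real k * h"
   define c' where "c' = real (Suc k) * h"
   have ac: "a : {0..T}" "c' : {0..T}" using tk[of k] tk[of "Suc k"] k by (auto simp: a_def c'_def)
   have ca: "c' - a = h" by (simp add: a_def c'_def algebra_simps)
   have sub: "{a..c'} \<subseteq> {0..T}" using ac by auto
   have near: "dist s a < h0" if "s : {a..c'}" for s using that ca hh0 by (auto simp: dist_real_def)
   have wq: "norm (q s - q a) <= w" and wp: "norm (p s - p a) <= w" if "s : {a..c'}" for s
    using d1(2)[of s a] d2(2)[of s a] near[OF that] sub that ac(1) by (auto simp: dist_norm h0_def less_imp_le)
   have wW: "norm (W c' - W a) <= w" using d3(2)[of c' a] near[of c'] ac h ca by (auto simp: dist_norm h0_def less_imp_le)
   define Q where "Q = fst (X k)"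
   define P where "P = snd (X k)"
   define m where "m = Q + (h/2) *R P"
   define P' where "P' = P + h *R (b m - G P) + (W c' - W a)"
   have Xs: "X (Suc k) = (m + (h/2) *R P', P')" by (simp add: X_def split_step_def Let_def Q_def P_def m_def P'_def a_def c'_def)
   define x where "x = norm (Q - q a)"
   define y where "y = norm (P - p a)"
   have ek': "e k = x + y" by (simp add: e_def x_def y_def Q_def P_def a_def)
   have xy: "0 <= x" "0 <= y" "x + y <= 1" using ek ek' by (simp_all add: x_def y_def)
   have Rk: "norm (q a) + norm (p a) <= R" by (rule R(2)[OF ac(1)])
   have "norm Q <= norm (Q - q a) + norm (q a)" "norm P <= norm (P - p a) + norm (p a)" by (metis diff_add_cancel norm_triangle_ineq)+
   hence QP: "norm Q + norm P <= R + 1" using Rk xy by (simp add: x_def y_def)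
   have P: "norm P <= R + 1" using QP by (smt (verit) norm_ge_zero)
   have mQ: "norm (m - Q) <= (h/2) * (R + 1)" using P h by (simp add: m_def mult_left_mono)
   have "(h/2) * (R + 1) <= 1" using hh0 R(1) by (simp add: h0_def field_simps)
   moreover have "norm m <= norm Q + norm (m - Q)" by (metis add.commute diff_add_cancel norm_triangle_ineq)
   ultimately have mn: "norm m <= R + 2" using mQ QP norm_ge_zero[of P] by linarith
   have qn: "norm (q s) <= R + 2" if "s : {a..c'}" for s
   proof -
    have "s : {0..T}" using that sub by blast
    from R(2)[OF this] show ?thesis using norm_ge_zero[of "p s"] by linarith
   qed
   have bm: "norm (b m) <= Cb" by (rule Cb(2)[OF mn])
   have GP: "norm (G P) <= g * (R + 1)" using order.trans[OF g(2)[of P] mult_right_mono[OF P, of g]] g(1) by (simp add: mult.commute)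
   have PP: "norm (P' - P) <= h * (g * (R + 1) + Cb) + w"
   proof -
    have "norm (P' - P) <= norm (h *R (b m - G P)) + norm (W c' - W a)" unfolding P'_def by (metis add.assoc add_diff_cancel_left' norm_triangle_ineq)
    also have "norm (h *R (b m - G P)) <= h * (Cb + g * (R + 1))" using h bm GP norm_triangle_ineq4[of "b m" "G P"] by (simp add: mult_left_mono)
    finally show ?thesis using wW by (simp add: add.commute)
   qed
   have qint: "integral {a..c'} p = q c' - q a"
   proof -
    have "integral {0..a} p + integral {a..c'} p = integral {0..c'} p"
     using ac ca h sub by (intro Henstock_Kurzweil_Integration.integral_combine integrable_continuous_interval continuous_on_subset[OF pc]) auto
    thus ?thesis using qeq[OF ac(1)] qeq[OF ac(2)] by (metis add_diff_cancel_left add_diff_cancel_left')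
   qed
   have fc: "continuous_on {0..T} (%s. b (q s) - G (p s))"
   proof -
    have "norm (q s) <= R + 2" if "s : {0..T}" for s using R(2)[OF that] norm_ge_zero[of "p s"] by linarith
    thus ?thesis by (intro continuous_on_diff cont_comp[OF bcont qc] bounded_linear.continuous_on[OF G] pc) auto
   qed
   have pint: "integral {a..c'} (%s. b (q s) - G (p s)) = p c' - p a - (W c' - W a)"
   proof -
    have "integral {0..a} (%s. b (q s) - G (p s)) + integral {a..c'} (%s. b (q s) - G (p s)) = integral {0..c'} (%s. b (q s) - G (p s))"
     using ac ca h sub by (intro Henstock_Kurzweil_Integration.integral_combine integrable_continuous_interval continuous_on_subset[OF fc]) auto
    thus ?thesis using peq[OF ac(1)] peq[OF ac(2)] by (simp add: algebra_simps)
   qed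
   have I1: "norm (h *R P - integral {a..c'} p) <= h * (y + w)" unfolding ca[symmetric]
   proof (rule integral_const_approx)
    show "norm (p s - P) <= y + w" if "s : {a..c'}" for s
     using norm_triangle_ineq4[of "p s - p a" "P - p a"] wp[OF that] by (simp add: y_def algebra_simps)
   qed (use ca h in \<open>auto intro: continuous_on_subset[OF pc sub]\<close>)
   have I2: "norm (h *R (b m - G P) - integral {a..c'} (%s. b (q s) - G (p s))) <= h * (K * (x + (h/2) * (R + 1) + w) + g * (y + w))"
    unfolding ca[symmetric]
   proof (rule integral_const_approx)
    show "norm (b (q s) - G (p s) - (b m - G P)) <= K * (x + ((c' - a)/2) * (R + 1) + w) + g * (y + w)" if s: "s : {a..c'}" for s
    proof -
     have 1: "norm (q s - m) <= norm (q s - q a) + norm (q a - Q) + norm (Q - m)" by (smt (verit) norm_triangle_ineq diff_add_cancel add_diff_eq)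
     hence 1: "norm (q s - m) <= x + (h/2) * (R + 1) + w" using wq[OF s] mQ by (simp add: x_def norm_minus_commute)
     have 2: "norm (p s - P) <= y + w" using norm_triangle_ineq4[of "p s - p a" "P - p a"] wp[OF s] by (simp add: y_def algebra_simps)
     have "norm (b (q s) - b m) <= K * norm (q s - m)" by (rule K(2)[OF qn[OF s] mn])
     also have "... <= K * (x + (h/2) * (R + 1) + w)" using K(1) 1 by (intro mult_left_mono) auto
     finally have 3: "norm (b (q s) - b m) <= K * (x + (h/2) * (R + 1) + w)" .
     have "norm (G (p s) - G P) <= g * norm (p s - P)"
      using g(2)[of "p s - P"] linear_diff[OF bounded_linear.linear[OF G], of "p s" P] by (simp add: mult.commute)
     also have "... <= g * (y + w)" using g(1) 2 by (intro mult_left_mono) auto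
     finally have 4: "norm (G (p s) - G P) <= g * (y + w)" .
     have "norm (b (q s) - G (p s) - (b m - G P)) = norm ((b (q s) - b m) - (G (p s) - G P))" by (simp add: algebra_simps)
     also have "... <= norm (b (q s) - b m) + norm (G (p s) - G P)" by (rule norm_triangle_ineq4)
     finally show ?thesis using 3 4 by (simp add: ca)
    qed
   qed (use ca h in \<open>auto intro: continuous_on_subset[OF fc sub]\<close>)
   have E1: "norm (fst (X (Suc k)) - q c') <= x + h * (y + w) + (h/2) * (h * (g * (R + 1) + Cb) + w)"
   proof -
    have "fst (X (Suc k)) - q c' = (Q - q a) + (h *R P - integral {a..c'} p) + (h/2) *R (P' - P)"
     unfolding Xs qint m_def by (simp add: algebra_simps flip: scaleR_add_left)
    also have "norm ... <= norm (Q - q a) + norm (h *R P - integral {a..c'} p) + norm ((h/2) *R (P' - P))" by (smt (verit) norm_triangle_ineq)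
    also have "norm ((h/2) *R (P' - P)) <= (h/2) * (h * (g * (R + 1) + Cb) + w)" using h PP by (simp add: mult_left_mono)
    finally show ?thesis using I1 by (simp add: x_def)
   qed
   have E2: "norm (snd (X (Suc k)) - p c') <= y + h * (K * (x + (h/2) * (R + 1) + w) + g * (y + w))"
   proof -
    have "snd (X (Suc k)) - p c' = (P - p a) + (h *R (b m - G P) - integral {a..c'} (%s. b (q s) - G (p s)))"
     unfolding Xs pint P'_def by (simp add: algebra_simps)
    hence "norm (snd (X (Suc k)) - p c') <= norm (P - p a) + norm (h *R (b m - G P) - integral {a..c'} (%s. b (q s) - G (p s)))"
     by (metis norm_triangle_ineq)
    thus ?thesis using I2 by (simp add: y_def)
   qed
   have "e (Suc k) = norm (fst (X (Suc k)) - q c') + norm (snd (X (Suc k)) - p c')" by (simp only: e_def c'_def)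
   also have "... <= (x + h * (y + w) + (h/2) * (h * (g * (R + 1) + Cb) + w)) + (y + h * (K * (x + (h/2) * (R + 1) + w) + g * (y + w)))"
    using E1 E2 by (rule add_mono)
   \<comment> \<open>The subtracted term is nonnegative; it appears because one constant
     \<open>L\<close> serves both components of the error.\<close>
   also have "... = (1 + h * L) * (x + y) + h * u - h * (x + g * x + K * y)" by (simp add: L_def u_def D_def algebra_simps add_divide_distrib)
   also have "... <= (1 + h * L) * (x + y) + h * u" using h xy g K by simp
   finally show ?thesis unfolding ek' .
  qed
  have "h * D <= c / 2" using hh0 D by (simp add: h0_def field_simps)
  moreover have "(L + 1/2) * w = c / 2" using L by (simp add: w_def field_simps)
  ultimately have uc: "u <= c" by (simp add: u_def)
  have u0: "0 <= u" using L w h D by (simp add: u_def)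
  have bound: "exp (L * T) * T * u <= min z 1"
  proof -
   have "exp (L * T) * T * u <= exp (L * T) * T * c" using uc T by (intro mult_left_mono) auto
   also have "... = min z 1" using T by (simp add: c_def)
   finally show ?thesis .
  qed
  have "e k <= exp (L * (h * real k)) * (h * real k) * u" if "k <= N" for k
  proof (rule discrete_gronwall_local[where N=N and e=e])
   show "e 0 = 0" by (simp add: e_def X_def)
   show "exp (L * (h * real N)) * (h * real N) * u <= 1" unfolding hN using bound by simp
  qed (use h L u0 step that in auto)
  moreover have "exp (L * (h * real k)) * (h * real k) * u <= exp (L * T) * T * u" if "k <= N" for k
   using tk[OF that] h L u0 T by (intro mult_right_mono mult_mono) (auto simp: mult.commute)
  ultimately have ee: "e k <= z" if "k <= N" for k using bound that by fastforce
  show ?thesis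
  proof (intro allI impI)
   fix k assume "k <= N"
   have "norm (X k - (q (real k * h), p (real k * h))) <= e k"
    unfolding e_def by (metis norm_Pair_le prod.collapse fst_diff snd_diff fst_conv snd_conv)
   thus "norm (splitting_path G b (T / real N) W (q 0, p 0) k - (q (real k * (T / real N)), p (real k * (T / real N)))) <= z"
    using ee[OF \<open>k <= N\<close>] by (simp add: X_def h_def)
  qed
 qed
 thus ?thesis unfolding eventually_sequentially by blast
qed

section \<open>Changes of variables and the one-step kernel\<close>

lemma nn_uminus_arg: fixes f :: "'a::euclidean_space => ennreal" assumes [measurable]: "f : Borel" shows "(NN x. f (- x)) = (NN x. f x)"
proof -
 have "(\<integral>\<^sup>+x. f x \<partial>distr lborel borel uminus) = (NN x. f (- x))" by (rule nn_integral_distr) simp_all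
 thus ?thesis unfolding lborel_distr_uminus_euclidean by simp
qed

lemma nn_flip: fixes f :: "'a::euclidean_space \<times> 'b::euclidean_space => ennreal" assumes [measurable]: "f : Borel"
 shows "(NN x. f (flip x)) = (NN x. f x)"
proof -
 have "(\<integral>\<^sup>+x. f x \<partial>distr lborel borel flip) = (NN x. f (flip x))" by (rule nn_integral_distr) simp_all
 thus ?thesis unfolding lborel_distr_flip by simp
qed

lemma nn_lborel_swap: fixes f :: "'a::euclidean_space \<times> 'b::euclidean_space => ennreal" assumes "f : Borel"
 shows "(NN x. (NN y. f (x, y))) = (NN y. (NN x. f (x, y)))" by (simp only: nn_lborel_fst[OF assms])

lemma nn_gauss: "v > 0 ==> (NN x. ennreal (gauss v (x::'a::euclidean_space))) = 1"
 by (subst nn_integral_eq_integral) (simp_all add: int_gauss integral_gauss gauss_nonneg)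

text \<open>The factor is the inverse of the determinant; only its independence of \<open>F\<close> matters.\<close>

lemma nn_linear_scaling: fixes N L :: "'a::euclidean_space => 'a"
 assumes N: "bounded_linear N" and NL: "!!x. N (L x) = x" and [measurable]: "F : Borel"
 shows "(NN x. F (N x)) = (NN x. ennreal (gauss 1 (N x))) * (NN x. F x)"
proof -
 have Nm[measurable]: "N : Borel" by (intro borel_contI bounded_linear.continuous_on[OF N] continuous_on_id)
 have m: "(%z::'a \<times> 'a. F (N (fst z)) * ennreal (gauss 1 (snd z - N (fst z)))): Borel"
  "(%z::'a \<times> 'a. F (N (fst z) + snd z) * ennreal (gauss 1 (- N (fst z)))): Borel" unfolding borel_prod[symmetric] by measurable
 \<comment> \<open>A Gaussian of mass one is inserted and, with the integrals exchanged,
   \<open>y\<close> is shifted by \<open>L x\<close>; this decouples \<open>F\<close> from the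
   Jacobian factor.\<close>
 have "(NN y. F (N y)) = (NN y. F (N y) * (NN x. ennreal (gauss 1 (x + - N y))))" by (subst nn_translate) (simp_all add: nn_gauss)
 also have "... = (NN y. (NN x. F (N y) * ennreal (gauss 1 (x - N y))))" by (subst nn_integral_cmult) simp_all
 also have "... = (NN x. (NN y. F (N y) * ennreal (gauss 1 (x - N y))))" using nn_lborel_swap[OF m(1)] by simp
 also have "... = (NN x. (NN y. F (N y + x) * ennreal (gauss 1 (- N y))))"
 proof (rule nn_integral_cong)
  fix x :: 'a
  have "(NN y. F (N y) * ennreal (gauss 1 (x - N y))) = (NN y. F (N (y + L x)) * ennreal (gauss 1 (x - N (y + L x))))"
   by (rule nn_translate[symmetric]) measurable
  thus "(NN y. F (N y) * ennreal (gauss 1 (x - N y))) = (NN y. F (N y + x) * ennreal (gauss 1 (- N y)))"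
   by (simp add: linear_add[OF bounded_linear.linear[OF N]] NL)
 qed
 also have "... = (NN y. (NN x. F (N y + x) * ennreal (gauss 1 (- N y))))" using nn_lborel_swap[OF m(2)] by simp
 also have "... = (NN y. (NN x. F (x + N y)) * ennreal (gauss 1 (N y)))" by (subst nn_integral_multc) (simp_all add: gauss_uminus add.commute)
 also have "... = (NN x. ennreal (gauss 1 (N x))) * (NN x. F x)" by (subst nn_translate) (simp_all add: nn_integral_cmult mult.commute)
 finally show ?thesis .
qed

definition friction :: "real ^ 'n ^ 'n => real ^ 'n => real ^ 'n::finite" where
 "friction \<sigma> p = (1/2) *R ((\<sigma> ** transpose \<sigma>) *v p)"

definition noise :: "real => real ^ 'n ^ 'n => real ^ 'n => real ^ 'n::finite" where
 "noise \<beta> \<sigma> y = (1 / sqrt \<beta>) *R (\<sigma> *v y)"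

definition denoise :: "real => real ^ 'n ^ 'n => real ^ 'n => real ^ 'n::finite" where
 "denoise \<beta> \<sigma> z = sqrt \<beta> *R (matrix_inv \<sigma> *v z)"

text \<open>The Markov operator of one step; a Brownian increment over time \<open>h\<close> has
  deviation \<open>sqrt h\<close>. Values in \<open>ennreal\<close> keep the chain computations free
  of integrability conditions.\<close>

definition split_kernel :: "real => real ^ 'n ^ 'n => (real ^ 'n => real ^ 'n) => real => ('n::finite phase => ennreal) => 'n phase => ennreal" where
 "split_kernel \<beta> \<sigma> b h u x = (NN y. u (split_step (friction \<sigma>) b h x (noise \<beta> \<sigma> y)) * ennreal (gauss (sqrt h) y))"

lemma friction_linear: "bounded_linear (friction \<sigma>)"
 unfolding friction_def[abs_def] by (intro bounded_linear_scaleR_right[THEN bounded_linear_compose] matrix_vector_mul_bounded_linear)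

lemma noise_linear: "bounded_linear (noise \<beta> \<sigma>)"
 unfolding noise_def[abs_def] by (intro bounded_linear_scaleR_right[THEN bounded_linear_compose] matrix_vector_mul_bounded_linear)

lemma denoise_linear: "bounded_linear (denoise \<beta> \<sigma>)"
 unfolding denoise_def[abs_def] by (intro bounded_linear_scaleR_right[THEN bounded_linear_compose] matrix_vector_mul_bounded_linear)

lemma friction_measurable [measurable]: "friction \<sigma> : Borel" and noise_measurable [measurable]: "noise \<beta> \<sigma> : Borel"
 and denoise_measurable [measurable]: "denoise \<beta> \<sigma> : Borel"
 by (intro borel_contI linear_continuous_on friction_linear noise_linear denoise_linear)+

lemma matrix_inv_mult: assumes "invertible A" shows "A ** matrix_inv A = mat 1" "matrix_inv A ** A = mat 1"
 using someI_ex[OF assms[unfolded invertible_def]] by (simp_all add: matrix_inv_def)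

lemma denoise_noise: assumes "\<beta> > 0" "invertible \<sigma>"
 shows "denoise \<beta> \<sigma> (noise \<beta> \<sigma> x) = x" "noise \<beta> \<sigma> (denoise \<beta> \<sigma> x) = x"
 using assms by (simp_all add: denoise_def noise_def matrix_vector_mult_scaleR matrix_vector_mul_assoc matrix_inv_mult)

lemma split_step_measurable: fixes b :: "real ^ 'n::finite => real ^ 'n" assumes b: "continuous_on UNIV b"
 shows "(%z. split_step (friction \<sigma>) b h (fst z) (snd z)): borel_measurable (borel \<Otimes>\<^sub>M borel)"
proof -
 have [measurable]: "b : Borel" by (rule borel_contI[OF b])
 show ?thesis unfolding split_step_def Let_def borel_prod[symmetric] by measurable
qed

lemma split_kernel_measurable: fixes b :: "real ^ 'n::finite => real ^ 'n" assumes b: "continuous_on UNIV b" and [measurable]: "u : Borel"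
 shows "split_kernel \<beta> \<sigma> b h u : Borel"
proof -
 note [measurable] = meas_comp[OF _ split_step_measurable[OF b]]
 have "(%x. split_step (friction \<sigma>) b h (fst x) (noise \<beta> \<sigma> (snd x))): borel_measurable (borel \<Otimes>\<^sub>M lborel)"
  by (rule meas_comp[where g="%z. split_step (friction \<sigma>) b h (fst z) (snd z)" and f="%x. (fst x, noise \<beta> \<sigma> (snd x))", simplified, OF _ split_step_measurable[OF b]]) measurable
 hence [measurable]: "(%x. split_step (friction \<sigma>) b h (fst x) (noise \<beta> \<sigma> (snd x))): borel_measurable (borel \<Otimes>\<^sub>M lborel)" .
 show ?thesis unfolding split_kernel_def[abs_def] by (rule lborel.borel_measurable_nn_integral) (simp add: case_prod_unfold)
qed

text \<open>The conditional expectation of the product of all later observables along a chain with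
  transition operator \<open>Q\<close>. The index counts remaining steps, so \<open>h k\<close> is
  evaluated with \<open>k\<close> steps to go.\<close>

primrec chain_tail :: "(('a => ennreal) => 'a => ennreal) => (nat => 'a => ennreal) => nat => 'a => ennreal" where
 "chain_tail Q h 0 = (%_. 1)"
| "chain_tail Q h (Suc k) = Q (%x. h k x * chain_tail Q h k x)"

lemma chain_tail_measurable: assumes "!!u. u : borel_measurable M ==> Q u : borel_measurable M" "!!j. h j : borel_measurable M"
 shows "chain_tail Q h k : borel_measurable M" by (induction k) (simp_all add: assms borel_measurable_times_ennreal)

text \<open>The kernels are transposed one at a time by \<open>dual\<close>, each at the price of
  the factor \<open>c\<close>. Confining all observables to \<open>S\<close> is what makes a uniform
  \<open>c\<close> possible later.\<close>

lemma chain_reversal: fixes w :: "'a::euclidean_space \<times> 'b::euclidean_space => ennreal" and N :: nat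
 assumes Qm: "!!u. u : Borel ==> Q u : Borel" and w: "w : Borel" "!!x. w (flip x) = w x"
  and hm: "!!j. h j : Borel" and supp: "!!j x. x \<notin> S ==> h j x = 0" and S: "!!x. flip x : S \<longleftrightarrow> x : S"
  and dual: "!!u v. u : Borel ==> v : Borel ==>
   (!!x. x \<notin> S ==> u x = 0) ==> (!!x. x \<notin> S ==> v x = 0) ==>
   (NN x. w x * u x * Q v x) <= c * (NN x. w x * v (flip x) * Q (%y. u (flip y)) x)"
 defines "hr \<equiv> %j x. h (N - j) (flip x)"
 shows "(NN x. w x * (h N x * chain_tail Q h N x)) <= c ^ N * (NN x. w x * (hr N x * chain_tail Q hr N x))"
proof -
 note [measurable] = w(1) hm
 have [measurable]: "hr j : Borel" for j unfolding hr_def by measurable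
 have [measurable]: "chain_tail Q h k : Borel" "chain_tail Q hr k : Borel" for k by (rule chain_tail_measurable; simp add: Qm)+
 define C where "C j x = hr j x * chain_tail Q hr j x" for j x
 have Cm[measurable]: "C j : Borel" for j unfolding C_def by measurable
 \<comment> \<open>\<open>C j\<close>, seen through \<open>flip\<close>, is the reversed chain over
   the part already transposed; the other factor is the original chain over the rest.\<close>
 have main: "(NN x. w x * (h N x * chain_tail Q h N x)) <= c ^ j * (NN x. w x * (C j (flip x) * chain_tail Q h (N - j) x))" if "j <= N" for j
  using that
 proof (induction j)
  case 0
  thus ?case by (simp add: C_def hr_def)
 next
  case (Suc j)
  define k where "k = N - Suc j"
  have k: "N - j = Suc k" using Suc.prems by (simp add: k_def)
  define v where "v x = h k x * chain_tail Q h k x" for x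
  have vm[measurable]: "v : Borel" unfolding v_def by measurable
  have CS: "C (Suc j) (flip x) = h k x * Q (C j) (flip x)" for x by (simp add: C_def[abs_def]) (simp add: hr_def k_def)
  have QC[measurable]: "Q (C j): Borel" by (rule Qm[OF Cm])
  have "(NN x. w x * (C j (flip x) * chain_tail Q h (N - j) x)) = (NN x. w x * C j (flip x) * Q v x)" by (simp add: k v_def[abs_def] mult.assoc)
  also have "... <= c * (NN x. w x * v (flip x) * Q (%y. C j (flip (flip y))) x)"
  proof (rule dual)
   show "(%x. C j (flip x)): Borel" by measurable
   show "C j (flip x) = 0" if "x \<notin> S" for x using that by (simp add: C_def hr_def supp)
   show "v x = 0" if "x \<notin> S" for x using that by (simp add: v_def supp)
  qed (rule vm)
  also have "(NN x. w x * v (flip x) * Q (%y. C j (flip (flip y))) x) = (NN x. w (flip x) * v (flip (flip x)) * Q (C j) (flip x))"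
   by (subst nn_flip[of "%x. w x * v (flip x) * Q (C j) x"]) simp_all
  also have "... = (NN x. w x * (C (Suc j) (flip x) * chain_tail Q h (N - Suc j) x))" by (simp add: w(2) v_def CS k_def[symmetric] mult_ac)
  finally have "(NN x. w x * (C j (flip x) * chain_tail Q h (N - j) x)) <=
   c * (NN x. w x * (C (Suc j) (flip x) * chain_tail Q h (N - Suc j) x))" .
  from mult_left_mono[OF this, of "c ^ j"] order.trans[OF Suc.IH] Suc.prems
  show ?case by (simp add: mult.assoc power_Suc2 del: power_Suc)
 qed
 have "(NN x. w x * (C N (flip x) * chain_tail Q h (N - N) x)) = (NN x. w (flip x) * C N (flip x))" by (simp add: w(2))
 also have "... = (NN x. w x * C N x)" by (rule nn_flip[where f="%x. w x * C N x"]) simp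
 finally show ?thesis using main[of N] by (simp add: C_def)
qed

section \<open>Approximate detailed balance of one step\<close>

context gibbs_density
begin

lemma b_measurable [measurable]: "b : Borel" by (rule borel_contI[OF b_cont])

text \<open>Explicit friction puts the term
  \<open>- \<beta> * h / 8 * (norm (transpose \<sigma> *v p))^2\<close> into the Gaussian exponent
  of a step, and the reversed step has the same term at the other end. The exponential in the weight
  cancels it at both ends.\<close>

definition weight :: "real => 'n phase => real" where
 "weight h x = R x * exp (\<beta> * h / 8 * (norm (transpose \<sigma> *v snd x))^2)"

lemma R_nonneg: "0 <= R x" using Z_pos by (simp add: R_def)

lemma weight_nonneg: "0 <= weight h x" by (simp add: weight_def R_nonneg)

lemma weight_flip: "weight h (flip x) = weight h x"
 by (simp add: weight_def R_flip linear_neg[OF matrix_vector_mul_linear] del: transpose_matrix_vector)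

lemma weight_measurable [measurable]: "weight h : Borel"
proof -
 have "continuous_on UNIV (weight h)" unfolding weight_def[abs_def]
  by (intro continuous_intros R_continuous matrix_vector_mult_linear_continuous_on[THEN cont_comp]) auto
 thus ?thesis by (rule borel_contI)
qed

text \<open>The mixed terms of the two Gaussian exponents exchange the kinetic energies and leave
  the work of \<open>b m\<close> over the step. What survives is the error of the midpoint rule for
  \<open>U\<close>, whose gradient is \<open>- b\<close>.\<close>

lemma weight_ratio: fixes m p p' :: "real ^ 'n" assumes h: "0 < h"
 defines "x \<equiv> (m - (h/2) *R p, p)" and "x' \<equiv> (m + (h/2) *R p', p')"
 shows "weight h x * gauss (sqrt h) (denoise \<beta> \<sigma> (p' - (p + h *R (b m - friction \<sigma> p))))
  = exp (\<beta> * (U (fst x') - U (fst x) + b m \<bullet> (fst x' - fst x)))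
   * (weight h x' * gauss (sqrt h) (denoise \<beta> \<sigma> (- p - (- p' + h *R (b m - friction \<sigma> (- p'))))))"
proof -
 define S where "S w = transpose \<sigma> *v w" for w
 define r where "r = matrix_inv \<sigma> *v (p' - p - h *R b m)"
 have lin: "linear S" unfolding S_def[abs_def] by (rule matrix_vector_mul_linear)
 have fr: "matrix_inv \<sigma> *v friction \<sigma> w = (1/2) *R S w" for w
  by (simp add: friction_def S_def matrix_vector_mult_scaleR matrix_vector_mul_assoc matrix_mul_assoc matrix_inv_mult nonsingular del: transpose_matrix_vector)
 have d1: "denoise \<beta> \<sigma> (p' - (p + h *R (b m - friction \<sigma> p))) = sqrt \<beta> *R (r + (h/2) *R S p)"
 proof -
  have "p' - (p + h *R (b m - friction \<sigma> p)) = (p' - p - h *R b m) + h *R friction \<sigma> p" by (simp add: algebra_simps)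
  from arg_cong[OF this, of "(*v) (matrix_inv \<sigma>)"] show ?thesis by (simp add: denoise_def matrix_vector_right_distrib matrix_vector_mult_scaleR fr r_def)
 qed
 have d2: "denoise \<beta> \<sigma> (- p - (- p' + h *R (b m - friction \<sigma> (- p')))) = sqrt \<beta> *R (r - (h/2) *R S p')"
 proof -
  have "- p - (- p' + h *R (b m - friction \<sigma> (- p'))) = (p' - p - h *R b m) + h *R friction \<sigma> (- p')" by (simp add: algebra_simps)
  from arg_cong[OF this, of "(*v) (matrix_inv \<sigma>)"] show ?thesis by (simp add: denoise_def matrix_vector_right_distrib matrix_vector_mult_scaleR fr r_def linear_neg[OF lin])
 qed
 \<comment> \<open>The balance of noise and friction: \<open>S\<close> is the transpose of the
   matrix whose inverse defines \<open>r\<close>, so the mixed terms become free of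
   \<sigma>.\<close>
 have rS: "r \<bullet> S w = (p' - p - h *R b m) \<bullet> w" for w
 proof -
  have "r \<bullet> S w = (\<sigma> *v r) \<bullet> w" unfolding S_def by (metis dot_lmul_matrix inner_commute transpose_matrix_vector)
  thus ?thesis by (simp add: r_def matrix_vector_mul_assoc matrix_inv_mult nonsingular)
 qed
 have n1: "(norm (r + (h/2) *R S p))^2 = (norm r)^2 + h * ((p' - p - h *R b m) \<bullet> p) + h^2/4 * (norm (S p))^2"
  unfolding rS[symmetric] power2_norm_eq_inner by (simp add: inner_add_left inner_add_right inner_commute[of "S p" r] power2_eq_square field_simps)
 have n2: "(norm (r - (h/2) *R S p'))^2 = (norm r)^2 - h * ((p' - p - h *R b m) \<bullet> p') + h^2/4 * (norm (S p'))^2"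
  unfolding rS[symmetric] power2_norm_eq_inner by (simp add: inner_diff_left inner_diff_right inner_commute[of "S p'" r] power2_eq_square field_simps)
 have g: "gauss (sqrt h) (sqrt \<beta> *R w) = (1 / sqrt (2 * pi * h)) ^ CARD('n) * exp (- (\<beta> * (norm w)^2) / (2 * h))" for w :: "real ^ 'n"
  using h beta by (simp add: gauss_eq power_mult_distrib)
 have hh: "fst x' - fst x = (h/2) *R (p + p')" by (simp add: x_def x'_def algebra_simps)
 have key: "- \<beta> * ((norm p)^2 / 2 + U (fst x)) + \<beta> * h / 8 * (norm (S p))^2 + - (\<beta> * (norm (r + (h/2) *R S p))^2) / (2 * h)
   = \<beta> * (U (fst x') - U (fst x) + b m \<bullet> (fst x' - fst x))
   + (- \<beta> * ((norm p')^2 / 2 + U (fst x')) + \<beta> * h / 8 * (norm (S p'))^2 + - (\<beta> * (norm (r - (h/2) *R S p'))^2) / (2 * h))"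
  unfolding n1 n2 hh power2_norm_eq_inner[of p] power2_norm_eq_inner[of p']
  using h by (simp add: field_simps inner_simps inner_commute power2_eq_square)
 have comb: "(1 / Z * exp a1 * exp a2) * (C * exp a3) = exp e * ((1 / Z * exp b1 * exp b2) * (C * exp b3))"
  if "a1 + a2 + a3 = e + (b1 + b2 + b3)" for a1 a2 a3 b1 b2 b3 C e :: real
 proof -
  have "(1 / Z * exp a1 * exp a2) * (C * exp a3) = (C / Z) * exp (a1 + a2 + a3)" by (simp add: exp_add)
  thus ?thesis unfolding that by (simp add: exp_add)
 qed
 show ?thesis unfolding d1 d2 g weight_def R_def hamiltonian_def case_prod_unfold S_def[symmetric]
  by (rule comb) (use key in \<open>simp only: x_def x'_def fst_conv snd_conv\<close>)
qed

text \<open>In the coordinates midpoint, old momentum, new momentum the shift of the position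
  preserves volume, and passing from the noise to the new momentum costs the constant
  \<open>?J\<close>, the same for every pair of functions.\<close>

lemma split_kernel_coords: assumes [measurable]: "w : Borel" "v : Borel" shows "(NN x. w x * split_kernel \<beta> \<sigma> b h v x)
  = (NN u. ennreal (gauss 1 (noise \<beta> \<sigma> u))) * (NN m. (NN p. (NN p'. w (m - (h/2) *R p, p) * v (m + (h/2) *R p', p')
    * ennreal (gauss (sqrt h) (denoise \<beta> \<sigma> (p' - (p + h *R (b m - friction \<sigma> p))))))))"
  (is "_ = ?J * _")
proof -
 note [measurable] = split_kernel_measurable[OF b_cont assms(2)]
 have ker: "split_kernel \<beta> \<sigma> b h v (m - (h/2) *R p, p) = ?J * (NN p'. v (m + (h/2) *R p', p')
    * ennreal (gauss (sqrt h) (denoise \<beta> \<sigma> (p' - (p + h *R (b m - friction \<sigma> p))))))" for m p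
 proof -
  define a where "a = p + h *R (b m - friction \<sigma> p)"
  define F where "F y = v (m + (h/2) *R y, y) * ennreal (gauss (sqrt h) (denoise \<beta> \<sigma> (y - a)))" for y
  have [measurable]: "(%y. v (m + (h/2) *R y, y)): Borel" by (rule meas_comp[OF borel_measurable_Pair assms(2)]) measurable
  have Fm[measurable]: "F : Borel" unfolding F_def by measurable
  have "split_kernel \<beta> \<sigma> b h v (m - (h/2) *R p, p) = (NN u. F (noise \<beta> \<sigma> u + a))"
   by (simp add: split_kernel_def split_step_def Let_def F_def a_def denoise_noise beta nonsingular add_ac)
  also have "... = ?J * (NN y. F (y + a))"
   by (rule nn_linear_scaling[where F="%y. F (y + a)" and N="noise \<beta> \<sigma>" and L="denoise \<beta> \<sigma>", OF noise_linear]) (simp_all add: denoise_noise beta nonsingular)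
  also have "(NN y. F (y + a)) = (NN y. F y)" by (rule nn_translate) simp
  finally show ?thesis by (simp add: F_def a_def)
 qed
 define H where "H x = w x * split_kernel \<beta> \<sigma> b h v x" for x
 have Hm[measurable]: "H : Borel" unfolding H_def by measurable
 have m1: "(%z::'n phase. H (fst z - (h/2) *R snd z, snd z)): Borel"
  by (rule meas_comp[OF borel_measurable_Pair Hm]; unfold borel_prod[symmetric]; measurable)
 have m2: "(%q. H (q, p)): Borel" for p by (rule meas_comp[OF borel_measurable_Pair Hm]) (measurable)
 have "(NN x. H x) = (NN p. (NN q. H (q, p)))" by (rule nn_lborel_fst(2)[symmetric]) simp
 also have "... = (NN p. (NN m. H (m - (h/2) *R p, p)))"
 proof (rule nn_integral_cong)
  fix p
  show "(NN q. H (q, p)) = (NN m. H (m - (h/2) *R p, p))" using nn_translate[OF m2, of "- ((h/2) *R p)" p] by simp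
 qed
 also have "... = (NN m. (NN p. H (m - (h/2) *R p, p)))" using nn_lborel_swap[OF m1] by simp
 also have "... = (NN m. (NN p. ?J * (NN p'. w (m - (h/2) *R p, p) * v (m + (h/2) *R p', p')
    * ennreal (gauss (sqrt h) (denoise \<beta> \<sigma> (p' - (p + h *R (b m - friction \<sigma> p))))))))"
 proof (intro nn_integral_cong)
  fix m p
  have [measurable]: "(%p'. v (m + (h/2) *R p', p')): Borel" by (rule meas_comp[OF borel_measurable_Pair assms(2)]) measurable
  show "H (m - (h/2) *R p, p) = ?J * (NN p'. w (m - (h/2) *R p, p) * v (m + (h/2) *R p', p')
    * ennreal (gauss (sqrt h) (denoise \<beta> \<sigma> (p' - (p + h *R (b m - friction \<sigma> p))))))" unfolding H_def ker mult.assoc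
   by (subst nn_integral_cmult[where c="w (m - (h/2) *R p, p)"]) (simp_all add: mult.left_commute)
 qed
 also have "... = ?J * (NN m. (NN p. (NN p'. w (m - (h/2) *R p, p) * v (m + (h/2) *R p', p')
    * ennreal (gauss (sqrt h) (denoise \<beta> \<sigma> (p' - (p + h *R (b m - friction \<sigma> p))))))))"
 proof -
  let ?T = "%m p p'. w (m - (h/2) *R p, p) * v (m + (h/2) *R p', p')
    * ennreal (gauss (sqrt h) (denoise \<beta> \<sigma> (p' - (p + h *R (b m - friction \<sigma> p)))))"
  have [measurable]: "(%z. w (fst (fst z) - (h/2) *R snd (fst z), snd (fst z))): borel_measurable ((borel \<Otimes>\<^sub>M borel) \<Otimes>\<^sub>M lborel)"
   "(%z. v (fst (fst z) + (h/2) *R snd z, snd z)): borel_measurable ((borel \<Otimes>\<^sub>M borel) \<Otimes>\<^sub>M lborel)"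
   by (rule meas_comp[OF borel_measurable_Pair assms(1)] meas_comp[OF borel_measurable_Pair assms(2)]; measurable)+
  have "(%z. (NN p'. ?T (fst z) (snd z) p')): borel_measurable (borel \<Otimes>\<^sub>M borel)"
   by (rule lborel.borel_measurable_nn_integral) (simp add: case_prod_unfold)
  hence 1: "(%z. (NN p'. ?T (fst z) (snd z) p')): borel_measurable (borel \<Otimes>\<^sub>M lborel)" by (simp cong: measurable_cong_sets)
  have "(%p. (NN p'. ?T m p p')): borel_measurable lborel" for m using meas_comp[OF measurable_Pair1' 1, of m] by simp
  moreover have "(%m. (NN p. (NN p'. ?T m p p'))): Borel"
   by (rule lborel.borel_measurable_nn_integral) (use 1 in \<open>simp add: case_prod_unfold\<close>)
  ultimately show ?thesis by (subst nn_integral_cmult[symmetric], simp, subst nn_integral_cmult[symmetric]) simp_all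
 qed
 finally show ?thesis unfolding H_def .
qed

text \<open>With the midpoint fixed, time reversal replaces \<open>(p, p')\<close> by
  \<open>(- p', - p)\<close>, which preserves Lebesgue measure. The factor of
  \<open>weight_ratio\<close> is at most \<open>exp e\<close> wherever both functions are
  nonzero.\<close>

lemma splitting_kernel_duality: assumes h: "0 < h" and [measurable]: "u : Borel" "v : Borel"
  and defect: "!!m p p'. u (m - (h/2) *R p, p) \<noteq> 0 ==> v (m + (h/2) *R p', p') \<noteq> 0 ==>
   \<beta> * (U (m + (h/2) *R p') - U (m - (h/2) *R p) + b m \<bullet> ((h/2) *R (p + p'))) <= e"
 shows "(NN x. ennreal (weight h x) * u x * split_kernel \<beta> \<sigma> b h v x)
  <= ennreal (exp e) * (NN x. ennreal (weight h x) * v (flip x) * split_kernel \<beta> \<sigma> b h (%y. u (flip y)) x)"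
proof -
 let ?J = "(NN w. ennreal (gauss 1 (noise \<beta> \<sigma> w)))"
 let ?g = "%m p p'. gauss (sqrt h) (denoise \<beta> \<sigma> (p' - (p + h *R (b m - friction \<sigma> p))))"
 define H where "H m p p' = ennreal (exp e) * ennreal (weight h (m - (h/2) *R p, p)) * v (m - (h/2) *R p, - p)
  * u (m + (h/2) *R p', - p') * ennreal (?g m p p')" for m p p'
 have [measurable]: "(%y. u (flip y)): Borel" "(%y. v (flip y)): Borel" by simp_all
 have wm: "(%x. ennreal (weight h x)): Borel" by simp
 have Hm: "(%z. H m (fst z) (snd z)): Borel" for m
 proof -
  have [measurable]: "(%z::'n phase. ennreal (weight h (m - (h/2) *R fst z, fst z))): borel_measurable (borel \<Otimes>\<^sub>M borel)"
   "(%z::'n phase. v (m - (h/2) *R fst z, - fst z)): borel_measurable (borel \<Otimes>\<^sub>M borel)"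
   "(%z::'n phase. u (m + (h/2) *R snd z, - snd z)): borel_measurable (borel \<Otimes>\<^sub>M borel)"
   by (rule meas_comp[OF borel_measurable_Pair wm] meas_comp[OF borel_measurable_Pair assms(3)]
    meas_comp[OF borel_measurable_Pair assms(2)]; measurable)+
  show ?thesis unfolding H_def borel_prod[symmetric] by measurable
 qed
 have Hmc: "(%p. H m p p'): Borel" "(%p'. H m p p'): Borel" for m p p'
  using meas_comp[OF borel_measurable_Pair[OF measurable_ident_sets[OF refl] borel_measurable_const[of p']] Hm[of m]]
   meas_comp[OF borel_measurable_Pair[OF borel_measurable_const[of p] measurable_ident_sets[OF refl]] Hm[of m]] by simp_all
 have rev: "(NN p. (NN p'. H m p p')) = (NN p. (NN p'. H m (- p') (- p)))" for m
 proof -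
  have "(%z. H m (snd z) (fst z)): borel_measurable (borel \<Otimes>\<^sub>M borel)"
   using meas_comp[OF borel_measurable_Pair[OF measurable_snd measurable_fst] Hm[of m]] by simp
  hence Hs: "(%z. H m (snd z) (fst z)): borel_measurable (borel \<Otimes>\<^sub>M lborel)" by (simp cong: measurable_cong_sets)
  have Hm2: "(%p'. (NN p. H m p p')): Borel" by (rule lborel.borel_measurable_nn_integral) (use Hs in \<open>simp add: case_prod_unfold\<close>)
  have "(NN p. (NN p'. H m p p')) = (NN p'. (NN p. H m p p'))" using nn_lborel_swap[OF Hm] by simp
  also have "... = (NN p'. (NN p. H m p (- p')))" by (rule nn_uminus_arg[symmetric, OF Hm2])
  also have "... = (NN p'. (NN p. H m (- p) (- p')))" by (intro nn_integral_cong nn_uminus_arg[symmetric] Hmc)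
  finally show ?thesis .
 qed
 have "(NN x. ennreal (weight h x) * u x * split_kernel \<beta> \<sigma> b h v x)
  = ?J * (NN m. (NN p. (NN p'. ennreal (weight h (m - (h/2) *R p, p)) * u (m - (h/2) *R p, p) * v (m + (h/2) *R p', p') * ennreal (?g m p p'))))"
  by (rule split_kernel_coords) simp_all
 also have "... <= ?J * (NN m. (NN p. (NN p'. H m (- p') (- p))))"
 proof (intro mult_left_mono nn_integral_mono)
  fix m p p' :: "real ^ 'n"
  let ?x = "(m - (h/2) *R p, p)" and ?x' = "(m + (h/2) *R p', p')"
  have f: "weight h (m + (h/2) *R p', - p') = weight h ?x'" using weight_flip[of h ?x'] by (simp add: flip_def)
  show "ennreal (weight h ?x) * u ?x * v ?x' * ennreal (?g m p p') <= H m (- p') (- p)"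
  proof (cases "u ?x = 0 \<or> v ?x' = 0")
   case False
   have "weight h ?x * ?g m p p' = exp (\<beta> * (U (m + (h/2) *R p') - U (m - (h/2) *R p) + b m \<bullet> ((h/2) *R (p + p'))))
    * (weight h ?x' * ?g m (- p') (- p))" using weight_ratio[OF h, of m p p'] by (simp add: algebra_simps)
   also have "... <= exp e * (weight h ?x' * ?g m (- p') (- p))"
    using defect[of m p p'] False by (intro mult_right_mono) (simp_all add: weight_nonneg gauss_nonneg)
   finally have "ennreal (weight h ?x) * ennreal (?g m p p') <= ennreal (exp e) * (ennreal (weight h ?x') * ennreal (?g m (- p') (- p)))"
    by (simp add: weight_nonneg gauss_nonneg flip: ennreal_mult)
   from mult_left_mono[OF this, of "u ?x * v ?x'"] show ?thesis by (simp add: H_def f mult_ac)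
  qed auto
 qed simp
 also have "... = ?J * (NN m. (NN p. (NN p'. H m p p')))" by (simp only: rev)
 also have "... = (NN x. ennreal (exp e) * ennreal (weight h x) * v (flip x) * split_kernel \<beta> \<sigma> b h (%y. u (flip y)) x)"
 proof -
  have H': "H m p p' = ennreal (exp e) * ennreal (weight h (m - (h/2) *R p, p)) * v (flip (m - (h/2) *R p, p))
   * u (flip (m + (h/2) *R p', p')) * ennreal (?g m p p')" for m p p' by (simp add: H_def flip_def)
  have wv: "(%x. ennreal (exp e) * ennreal (weight h x) * v (flip x)): Borel" by measurable
  show ?thesis unfolding H' by (rule split_kernel_coords[OF wv, of "%y. u (flip y)", symmetric]) measurable
 qed
 also have "... = ennreal (exp e) * (NN x. ennreal (weight h x) * v (flip x) * split_kernel \<beta> \<sigma> b h (%y. u (flip y)) x)"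
 proof -
  have [measurable]: "split_kernel \<beta> \<sigma> b h (%y. u (flip y)): Borel" by (rule split_kernel_measurable[OF b_cont]) measurable
  show ?thesis unfolding mult.assoc by (rule nn_integral_cmult) measurable
 qed
 finally show ?thesis .
qed

text \<open>\<open>U\<close> has a gradient that is only locally Lipschitz, so the midpoint rule
  gains just one order. By the mean value theorem the increment of \<open>U\<close> is that of
  \<open>- b\<close> at a point within \<open>h * r\<close> of \<open>m\<close>, and the
  displacement is at most \<open>h * r\<close>: order \<open>h^2\<close> per step, thus order
  \<open>h\<close> over a fixed time.\<close>

lemma potential_midpoint_defect:
 assumes lip: "!!r. \<exists>K>0. \<forall>x y. norm x <= r \<longrightarrow> norm y <= r \<longrightarrow> norm (b x - b y) <= K * norm (x - y)" and r: "0 <= r"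
 obtains C where "0 <= C"
  "!!h m p p'. 0 < h ==> h <= 1 ==> norm (m - (h/2) *R p, p) <= r ==> norm (m + (h/2) *R p', p') <= r ==>
   \<beta> * (U (m + (h/2) *R p') - U (m - (h/2) *R p) + b m \<bullet> ((h/2) *R (p + p'))) <= C * h^2"
proof -
 \<comment> \<open>The midpoint may leave the ball of radius \<open>r\<close>, but half a step adds
   at most \<open>r / 2\<close> when \<open>h <= 1\<close>.\<close>
 obtain K where K: "K > 0" "!!x y. norm x <= 2 * r ==> norm y <= 2 * r ==> norm (b x - b y) <= K * norm (x - y)" using lip[of "2 * r"] by auto
 have "\<beta> * (U (m + (h/2) *R p') - U (m - (h/2) *R p) + b m \<bullet> ((h/2) *R (p + p'))) <= \<beta> * K * r^2 * h^2"
  if h: "0 < h" "h <= 1" and x: "norm (m - (h/2) *R p, p) <= r" and x': "norm (m + (h/2) *R p', p') <= r" for h m p p'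
 proof -
  define q where "q = m - (h/2) *R p"
  define d where "d = (h/2) *R (p + p')"
  have q': "m + (h/2) *R p' = q + d" by (simp add: q_def d_def algebra_simps)
  have "norm (m + (h/2) *R p') <= r" "norm (m - (h/2) *R p) <= r" "norm p <= r" "norm p' <= r"
   using norm_snd_le[of p "m - (h/2) *R p"] norm_snd_le[of p' "m + (h/2) *R p'"]
    norm_fst_le[of "m - (h/2) *R p" p] norm_fst_le[of "m + (h/2) *R p'" p'] x x' by simp_all
  hence pr: "norm p <= r" "norm p' <= r" "norm q <= r" "norm (q + d) <= r" unfolding q' by (simp_all add: q_def)
  have "((%s. U (q + s *R d)) has_derivative (%t. (t *R d) \<bullet> - b (q + s *R d))) (at s)" for s
   by (rule has_derivative_compose[OF _ GU[unfolded gderiv_def]]) (auto intro!: derivative_eq_intros)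
  hence "\<exists>s\<in>{0<..<1}. U (q + 1 *R d) - U (q + 0 *R d) = ((1 - 0) *R d) \<bullet> - b (q + s *R d)"
   using mvt_simple[of 0 1 "%s. U (q + s *R d)" "%s t. (t *R d) \<bullet> - b (q + s *R d)"] has_derivative_at_withinI by (metis zero_less_one)
  then obtain s where s: "0 < s" "s < 1" and Us: "U (q + d) - U q = - (b (q + s *R d) \<bullet> d)" by (auto simp: inner_commute)
  have hr: "(h/2) * norm p <= h/2 * r" "(h/2) * norm p' <= h/2 * r" using pr h by auto
  have dn: "norm d <= h * r" using norm_triangle_ineq[of p p'] pr h by (simp add: d_def)
  have sq: "norm (q + s *R d) <= 2 * r"
  proof -
   have "q + s *R d = (1 - s) *R q + s *R (q + d)" by (simp add: algebra_simps)
   hence "norm (q + s *R d) <= (1 - s) * norm q + s * norm (q + d)" using norm_triangle_ineq[of "(1 - s) *R q" "s *R (q + d)"] s by simp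
   also have "... <= (1 - s) * r + s * r" using s pr by (intro add_mono mult_left_mono) auto
   finally show ?thesis using r by (simp add: algebra_simps)
  qed
  have mq: "m = q + (h/2) *R p" by (simp add: q_def)
  have "h/2 * r <= 1 * r" using h r by (intro mult_right_mono) auto
  hence mn: "norm m <= 2 * r" using norm_triangle_ineq[of q "(h/2) *R p"] pr(3) hr(1) h(1) unfolding mq norm_scaleR by linarith
  have "m - (q + s *R d) = ((1 - s) * (h/2)) *R p - (s * (h/2)) *R p'"
   by (simp add: mq d_def algebra_simps) (simp add: diff_divide_distrib flip: scaleR_add_left)
  hence "norm (m - (q + s *R d)) <= (1 - s) * (h/2 * norm p) + s * (h/2 * norm p')"
   using norm_triangle_ineq4[of "((1 - s) * (h/2)) *R p" "(s * (h/2)) *R p'"] s h by simp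
  also have "... <= (1 - s) * (h/2 * r) + s * (h/2 * r)" using s h pr by (intro add_mono mult_left_mono) auto
  also have "... = h/2 * r" by (simp add: algebra_simps add_divide_distrib[symmetric])
  also have "... <= h * r" using h r by simp
  finally have dist: "norm (m - (q + s *R d)) <= h * r" .
  have "U (q + d) - U q + b m \<bullet> d = (b m - b (q + s *R d)) \<bullet> d" by (simp add: Us inner_diff_left)
  also have "... <= norm (b m - b (q + s *R d)) * norm d" by (rule norm_cauchy_schwarz)
  also have "... <= (K * (h * r)) * (h * r)" using order.trans[OF K(2)[OF mn sq] mult_left_mono[OF dist]] K(1) dn h r by (intro mult_mono) auto
  finally have "U (q + d) - U q + b m \<bullet> d <= K * (h * r) * (h * r)" .
  from mult_left_mono[OF this, of \<beta>] beta show ?thesis unfolding q' q_def[symmetric] d_def[symmetric] by (simp add: power2_eq_square mult_ac)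
 qed
 thus ?thesis using that[of "\<beta> * K * r^2"] K beta by auto
qed

text \<open>Each step contributes \<open>exp (C * h^2)\<close>. Passing from \<open>R\<close> to
  \<open>weight h\<close> is free because the weight is larger; returning to \<open>R\<close> on the
  ball costs one more factor \<open>exp (C * h)\<close>.\<close>

lemma splitting_chain_reversal:
 assumes lip: "!!r. \<exists>K>0. \<forall>x y. norm x <= r \<longrightarrow> norm y <= r \<longrightarrow> norm (b x - b y) <= K * norm (x - y)" and r: "0 <= r"
 obtains C where "0 <= C"
  "!!h N g. 0 < h ==> h <= 1 ==> (!!j. g j : Borel) ==> (!!j x. r < norm x ==> g j x = 0) ==>
   (NN x. ennreal (R x) * (g N x * chain_tail (split_kernel \<beta> \<sigma> b h) g N x)) <= ennreal (exp (C * h * (1 + h * real N))) *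
    (NN x. ennreal (R x) * (g 0 (flip x) * chain_tail (split_kernel \<beta> \<sigma> b h) (%j x. g (N - j) (flip x)) N x))"
proof -
 obtain C1 where C1: "0 <= C1"
  "!!h m p p'. 0 < h ==> h <= 1 ==> norm (m - (h/2) *R p, p) <= r ==> norm (m + (h/2) *R p', p') <= r ==>
   \<beta> * (U (m + (h/2) *R p') - U (m - (h/2) *R p) + b m \<bullet> ((h/2) *R (p + p'))) <= C1 * h^2"
  by (rule potential_midpoint_defect[OF lip r]) blast
 obtain c where c: "0 < c" "!!x. norm (transpose \<sigma> *v x) <= norm x * c"
  using bounded_linear.pos_bounded[OF matrix_vector_mul_bounded_linear[of "transpose \<sigma>"]] by blast
 \<comment> \<open>One constant for the midpoint defect and for the logarithm of
   \<open>weight h\<close> over \<open>R\<close> on the ball.\<close>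
 define C where "C = max C1 (\<beta> / 8 * (r * c)^2)"
 have C0: "0 <= C" using C1 by (simp add: C_def)
 have wR: "R x <= weight h x" if "0 < h" for h x
 proof -
  have "R x * 1 <= R x * exp (\<beta> * h / 8 * (norm (transpose \<sigma> *v snd x))^2)" using that beta R_nonneg by (intro mult_left_mono) auto
  thus ?thesis by (simp only: weight_def mult_1_right)
 qed
 have wR2: "weight h x <= exp (C * h) * R x" if "0 < h" "norm x <= r" for h x
 proof -
  have "norm (transpose \<sigma> *v snd x) <= r * c"
   using c(2)[of "snd x"] norm_snd_le[of "snd x" "fst x"] that(2) c(1) by (simp add: mult_right_mono order.trans)
  hence "(norm (transpose \<sigma> *v snd x))^2 <= (r * c)^2" by (intro power_mono) auto
  hence "\<beta> * h / 8 * (norm (transpose \<sigma> *v snd x))^2 <= \<beta> * h / 8 * (r * c)^2" using beta that(1) by (intro mult_left_mono) auto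
  also have "... <= C * h" using mult_right_mono[of "\<beta> / 8 * (r * c)^2" C h] that(1) by (simp add: C_def mult_ac)
  finally show ?thesis unfolding weight_def mult.commute[of "exp (C * h)"] by (intro mult_left_mono) (simp_all only: exp_le_cancel_iff R_nonneg)
 qed
 show ?thesis
 proof (rule that[OF C0])
  fix h :: real and N :: nat and g :: "nat => 'n phase => ennreal"
  assume h: "0 < h" "h <= 1" and g: "!!j. g j : Borel" "!!j x. r < norm x ==> g j x = 0"
  note [measurable] = g(1)
  let ?Q = "split_kernel \<beta> \<sigma> b h" and ?gr = "%j x. g (N - j) (flip x)"
  have nf: "norm (flip x) = norm x" for x :: "'n phase" by (simp add: norm_prod_def)
  have "(NN x. ennreal (R x) * (g N x * chain_tail ?Q g N x)) <= (NN x. ennreal (weight h x) * (g N x * chain_tail ?Q g N x))"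
   by (intro nn_integral_mono mult_right_mono ennreal_leI wR h) simp
  also have "... <= ennreal (exp (C * h^2)) ^ N * (NN x. ennreal (weight h x) * (?gr N x * chain_tail ?Q ?gr N x))"
  proof (rule chain_reversal[where S="cball 0 r"])
   show "?Q u : Borel" if "u : Borel" for u by (rule split_kernel_measurable[OF b_cont that])
   show "flip x : cball 0 r \<longleftrightarrow> x : cball 0 r" for x :: "'n phase" by (simp add: nf)
   fix u v :: "'n phase => ennreal"
   assume uv: "u : Borel" "v : Borel" "!!x. x \<notin> cball 0 r ==> u x = 0" "!!x. x \<notin> cball 0 r ==> v x = 0"
   show "(NN x. ennreal (weight h x) * u x * ?Q v x) <= ennreal (exp (C * h^2)) * (NN x. ennreal (weight h x) * v (flip x) * ?Q (%y. u (flip y)) x)"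
   proof (rule splitting_kernel_duality[OF h(1) uv(1,2)])
    fix m p p' :: "real ^ 'n"
    assume "u (m - (h/2) *R p, p) \<noteq> 0" "v (m + (h/2) *R p', p') \<noteq> 0"
    hence "norm (m - (h/2) *R p, p) <= r" "norm (m + (h/2) *R p', p') <= r" using uv(3,4) by (metis mem_cball_0)+
    from C1(2)[OF h this] mult_right_mono[of C1 C "h^2"]
    show "\<beta> * (U (m + (h/2) *R p') - U (m - (h/2) *R p) + b m \<bullet> ((h/2) *R (p + p'))) <= C * h^2" by (simp add: C_def)
   qed
  qed (use g in \<open>simp_all add: weight_flip\<close>)
  also have "(NN x. ennreal (weight h x) * (?gr N x * chain_tail ?Q ?gr N x))
   <= (NN x. ennreal (exp (C * h)) * (ennreal (R x) * (?gr N x * chain_tail ?Q ?gr N x)))"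
  proof (rule nn_integral_mono)
   fix x
   show "ennreal (weight h x) * (?gr N x * chain_tail ?Q ?gr N x) <= ennreal (exp (C * h)) * (ennreal (R x) * (?gr N x * chain_tail ?Q ?gr N x))"
   proof (cases "norm x <= r")
    case True
    have "ennreal (weight h x) <= ennreal (exp (C * h)) * ennreal (R x)" using wR2[OF h(1) True] R_nonneg by (simp flip: ennreal_mult)
    from mult_right_mono[OF this, of "?gr N x * chain_tail ?Q ?gr N x"] show ?thesis by (simp add: mult.assoc)
   next
    case False
    thus ?thesis by (simp add: g(2) nf)
   qed
  qed
  also have "... = ennreal (exp (C * h)) * (NN x. ennreal (R x) * (?gr N x * chain_tail ?Q ?gr N x))"
  proof (rule nn_integral_cmult)
   have rm[measurable]: "?gr j : Borel" for j by (rule meas_comp[OF flip_measurable g(1)])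
   have [measurable]: "chain_tail ?Q ?gr N : Borel" by (rule chain_tail_measurable[OF split_kernel_measurable[OF b_cont] rm])
   show "(%x. ennreal (R x) * (?gr N x * chain_tail ?Q ?gr N x)): borel_measurable lborel" by measurable
  qed
  finally have "(NN x. ennreal (R x) * (g N x * chain_tail ?Q g N x))
   <= (ennreal (exp (C * h^2)) ^ N * ennreal (exp (C * h))) * (NN x. ennreal (R x) * (g 0 (flip x) * chain_tail ?Q ?gr N x))"
   by (simp add: mult_left_mono mult.assoc)
  also have "ennreal (exp (C * h^2)) ^ N * ennreal (exp (C * h)) = ennreal (exp (C * h * (1 + h * real N)))"
  proof -
   have "exp (C * h^2) ^ N * exp (C * h) = exp (real N * (C * h^2) + C * h)" by (simp only: exp_of_nat_mult exp_add)
   thus ?thesis by (simp add: ennreal_power ennreal_mult[symmetric] algebra_simps power2_eq_square)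
  qed
  finally show "(NN x. ennreal (R x) * (g N x * chain_tail ?Q g N x))
   <= ennreal (exp (C * h * (1 + h * real N))) * (NN x. ennreal (R x) * (g 0 (flip x) * chain_tail ?Q ?gr N x))" .
 qed
qed

end

lemma gauss_vec: "gauss v (x :: real ^ 'n::finite) = (\<Prod>i\<in>UNIV. normal_density 0 v (x $ i))"
proof -
 have "gauss v x = (\<Prod>b\<in>(%i. axis i 1) ` UNIV. normal_density 0 v (x \<bullet> b))"
  unfolding gauss_def by (rule prod.cong) (auto simp: Basis_vec_def)
 also have "... = (\<Prod>i\<in>UNIV. normal_density 0 v (x \<bullet> axis i 1))"
  by (rule prod.reindex[unfolded comp_def]) (auto simp: inj_on_def axis_eq_axis)
 finally show ?thesis by (simp add: inner_axis)
qed

section \<open>The scheme driven by Brownian increments\<close>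

context brownian_motion
begin

lemma F_sets: "0 <= t ==> sets (F t) \<subseteq> sets M" "0 <= t ==> space (F t) = space M" using subalgebra by (auto simp: subalgebra_def)

lemma F_measurable_mono: "0 <= s ==> s <= t ==> f : measurable (F s) N ==> f : measurable (F t) N"
 using measurable_from_subalg[OF filtration_mono] by blast

lemma F_measurable: "0 <= s ==> f : measurable (F s) N ==> f : measurable M N" using measurable_from_subalg[OF subalgebra] by blast

lemma B_measurable: "0 <= t ==> B t : borel_measurable M" by (rule F_measurable[OF _ B_adapted])

text \<open>The identity of the sample space, viewed as a map into \<open>F s\<close>, is
  independent of the increment. Their joint law is therefore a product, and the increment can be
  integrated with the past frozen.\<close>

lemma nn_increment: assumes s: "0 <= s" and t: "s < t" and g: "g : borel_measurable (F s \<Otimes>\<^sub>M borel)"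
 shows "(\<integral>\<^sup>+w. g (w, B t w - B s w) \<partial>M) = (\<integral>\<^sup>+w. (NN y. g (w, y) * ennreal (gauss (sqrt (t - s)) y)) \<partial>M)"
proof -
 let ?D = "%w. B t w - B s w"
 have idm: "(%w. w): measurable M (F s)" using s F_sets[of s] by (intro measurableI) (auto dest: sets.sets_into_space)
 have D[measurable]: "?D : borel_measurable M" using B_measurable[of s] B_measurable[of t] s t by simp
 have Dd: "distr M borel ?D = density lborel (%x. ennreal (gauss (sqrt (t - s)) x))"
 proof -
  have "distr M lborel ?D = density lborel (%x. ennreal (gauss (sqrt (t - s)) x))"
   using distributed_distr_eq_density[OF B_normal[OF s t]] by (simp add: gauss_vec)
  moreover have "distr M lborel ?D = distr M borel ?D" by (rule distr_cong) simp_all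
  ultimately show ?thesis by simp
 qed
 interpret D: prob_space "distr M borel ?D" by (rule prob_space_distr) simp
 interpret I: prob_space "distr M (F s) (%w. w)" by (rule prob_space_distr) (rule idm)
 have "distr M (F s) (%w. w) \<Otimes>\<^sub>M distr M borel ?D = distr M (F s \<Otimes>\<^sub>M borel) (%w. (w, ?D w))"
 proof (rule pair_measure_eqI)
  fix A C assume A': "A : sets (distr M (F s) (%w. w))" and C': "C : sets (distr M borel ?D)"
  hence A: "A : sets (F s)" and C: "C : sets borel" by auto
  have AM: "A : sets M" "A \<subseteq> space M" using A F_sets(1)[OF s] sets.sets_into_space by auto
  have DC: "?D -` C \<inter> space M : sets M" using measurable_sets[OF D C] .
  have "prob (A \<inter> (?D -` C \<inter> space M)) = prob A * prob (?D -` C \<inter> space M)"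
   using B_indep[of s t] s t A C by (intro indep_setD) (auto simp: in_vimage_algebra)
  moreover have "(%w. (w, ?D w)) -` (A \<times> C) \<inter> space M = A \<inter> (?D -` C \<inter> space M)" using AM by auto
  moreover have "(%w. w) -` A \<inter> space M = A" using AM by auto
  ultimately show "emeasure (distr M (F s) (%w. w)) A * emeasure (distr M borel ?D) C = emeasure (distr M (F s \<Otimes>\<^sub>M borel) (%w. (w, ?D w))) (A \<times> C)"
   using A C AM DC idm D by (simp add: emeasure_distr measurable_Pair emeasure_eq_measure ennreal_mult[symmetric])
 qed (auto intro: D.sigma_finite_measure_axioms I.sigma_finite_measure_axioms cong: sets_pair_measure_cong)
 note pr = this[symmetric]
 have g': "g : borel_measurable (distr M (F s) (%w. w) \<Otimes>\<^sub>M distr M borel ?D)" using g by (simp cong: measurable_cong_sets)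
 have g2: "(%y. g (w, y)): Borel" if "w : space M" for w using meas_comp[OF measurable_Pair1' g] that F_sets(2)[OF s] by simp
 have gi: "(%w. \<integral>\<^sup>+y. g (w, y) \<partial>distr M borel ?D): borel_measurable (F s)"
  by (rule D.borel_measurable_nn_integral) (use g in \<open>simp add: case_prod_unfold cong: measurable_cong_sets\<close>)
 have "(\<integral>\<^sup>+w. g (w, ?D w) \<partial>M) = (\<integral>\<^sup>+z. g z \<partial>distr M (F s \<Otimes>\<^sub>M borel) (%w. (w, ?D w)))"
  by (rule nn_integral_distr[symmetric, OF measurable_Pair[OF idm D]]) (use g in simp)
 also have "... = (\<integral>\<^sup>+w. \<integral>\<^sup>+y. g (w, y) \<partial>distr M borel ?D \<partial>distr M (F s) (%w. w))"
  unfolding pr by (rule D.nn_integral_fst[OF g', symmetric])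
 also have "... = (\<integral>\<^sup>+w. \<integral>\<^sup>+y. g (w, y) \<partial>distr M borel ?D \<partial>M)" by (rule nn_integral_distr[OF idm]) (use gi in simp)
 also have "... = (\<integral>\<^sup>+w. (NN y. g (w, y) * ennreal (gauss (sqrt (t - s)) y)) \<partial>M)"
  unfolding Dd by (intro nn_integral_cong) (subst nn_integral_density, use g2 in \<open>simp_all add: mult.commute\<close>)
 finally show ?thesis .
qed

end

locale langevin_start = langevin_solution M F B \<beta> \<sigma> b q p + langevin_density \<beta> \<sigma> b \<rho>
 for M :: "'w measure" and F :: "real => 'w measure" and B :: "real => 'w => real ^ 'n::finite"
  and \<beta> :: real and \<sigma> :: "real ^ 'n ^ 'n" and b :: "real ^ 'n => real ^ 'n"
  and q p :: "real => 'w => real ^ 'n" and \<rho> :: "'n phase => real" +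
 assumes lip: "!!r. \<exists>K>0. \<forall>x y. norm x <= r \<longrightarrow> norm y <= r \<longrightarrow> norm (b x - b y) <= K * norm (x - y)"
  and init: "distributed M lborel (%w. (q 0 w, p 0 w)) (%x. ennreal (\<rho> x))"
begin

definition X :: "real => 'w => 'n phase" where "X t w = (q t w, p t w)"

lemma X_adapted: "0 <= t ==> X t : borel_measurable (F t)" unfolding X_def[abs_def] by (intro borel_measurable_Pair q_adapted p_adapted)

lemma X_measurable [measurable]: "0 <= t ==> X t : borel_measurable M" using F_measurable[OF _ X_adapted] .

lemma X0_distr: "distr M borel (X 0) = density lborel (%x. ennreal (\<rho> x))"
proof -
 have "distr M borel (X 0) = distr M lborel (%w. (q 0 w, p 0 w))" unfolding X_def[abs_def] by (rule distr_cong) simp_all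
 thus ?thesis using distributed_distr_eq_density[OF init] by simp
qed

lemma nn_X0: assumes [measurable]: "f : Borel" shows "(\<integral>\<^sup>+w. f (X 0 w) \<partial>M) = (NN x. ennreal (\<rho> x) * f x)"
proof -
 have "(\<integral>\<^sup>+w. f (X 0 w) \<partial>M) = (\<integral>\<^sup>+x. f x \<partial>distr M borel (X 0))" by (rule nn_integral_distr[symmetric]) simp_all
 thus ?thesis unfolding X0_distr by (simp add: nn_integral_density)
qed

definition scheme :: "real => nat => 'w => 'n phase" where
 "scheme h k w = splitting_path (friction \<sigma>) b h (%t. noise \<beta> \<sigma> (B t w)) (X 0 w) k"

lemma scheme_0 [simp]: "scheme h 0 w = X 0 w" by (simp add: scheme_def)

lemma scheme_Suc: "scheme h (Suc k) w = split_step (friction \<sigma>) b h (scheme h k w) (noise \<beta> \<sigma> (B (real (Suc k) * h) w - B (real k * h) w))"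
 by (simp add: scheme_def linear_diff[OF bounded_linear.linear[OF noise_linear]])

lemma scheme_adapted: "0 < h ==> scheme h k : borel_measurable (F (real k * h))"
proof (induction k)
 case 0
 have "scheme h 0 = X 0" by (simp add: fun_eq_iff)
 thus ?case using X_adapted[of 0] by simp
next
 case (Suc k)
 have le: "0 <= real k * h" "real k * h <= real (Suc k) * h" using Suc.prems by (auto intro: mult_right_mono)
 have "scheme h k : borel_measurable (F (real (Suc k) * h))" by (rule F_measurable_mono[OF le Suc.IH[OF Suc.prems]])
 moreover have "(%w. noise \<beta> \<sigma> (B (real (Suc k) * h) w - B (real k * h) w)): borel_measurable (F (real (Suc k) * h))"
  by (rule meas_comp[OF borel_measurable_diff[OF B_adapted F_measurable_mono[OF le B_adapted]] noise_measurable]) (use le in auto)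
 ultimately have "(%w. (scheme h k w, noise \<beta> \<sigma> (B (real (Suc k) * h) w - B (real k * h) w)))
  : measurable (F (real (Suc k) * h)) (borel \<Otimes>\<^sub>M borel)" by (rule measurable_Pair)
 from meas_comp[OF this split_step_measurable[OF b_cont]]
 show ?case unfolding scheme_Suc[abs_def] fst_conv snd_conv .
qed

text \<open>Starting from the last grid time, \<open>nn_increment\<close> replaces one Brownian
  increment after the other by an application of \<open>split_kernel\<close>. As
  \<open>chain_tail\<close> counts remaining steps, the observables appear with index
  \<open>N - j\<close>.\<close>

lemma nn_scheme: fixes g :: "nat => 'n phase => ennreal" assumes h: "0 < h" and g[measurable]: "!!j. g j : Borel"
 shows "(\<integral>\<^sup>+w. (\<Prod>j\<le>N. g j (scheme h j w)) \<partial>M)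
  = (NN x. ennreal (\<rho> x) * (g 0 x * chain_tail (split_kernel \<beta> \<sigma> b h) (%j. g (N - j)) N x))"
proof -
 let ?T = "chain_tail (split_kernel \<beta> \<sigma> b h) (%j. g (N - j))"
 have T[measurable]: "?T k : Borel" for k by (rule chain_tail_measurable[OF split_kernel_measurable[OF b_cont] g])
 have main: "(\<integral>\<^sup>+w. (\<Prod>j\<le>k. g j (scheme h j w)) * ?T (N - k) (scheme h k w) \<partial>M) = (\<integral>\<^sup>+w. g 0 (X 0 w) * ?T N (X 0 w) \<partial>M)"
  if "k <= N" for k using that
 proof (induction k)
  case (Suc k)
  define i where "i = N - Suc k"
  have i: "N - k = Suc i" "N - i = Suc k" using Suc.prems by (auto simp: i_def)
  let ?s = "real k * h" and ?t = "real (Suc k) * h"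
  have st: "0 <= ?s" "?s < ?t" "?t - ?s = h" using h by (auto simp: algebra_simps)
  define v where "v x = g (Suc k) x * ?T i x" for x
  have vm[measurable]: "v : Borel" unfolding v_def by measurable
  define Y where "Y w = (\<Prod>j\<le>k. g j (scheme h j w))" for w
  have Ym[measurable]: "Y : borel_measurable (F ?s)" unfolding Y_def
  proof (rule borel_measurable_prod_ennreal)
   fix j assume "j : {..k}"
   hence "0 <= real j * h" "real j * h <= ?s" using h by (auto intro: mult_right_mono)
   from F_measurable_mono[OF this scheme_adapted[OF h]]
   show "(%w. g j (scheme h j w)): borel_measurable (F ?s)" by (rule meas_comp) simp
  qed
  let ?S = "%x y. split_step (friction \<sigma>) b h x (noise \<beta> \<sigma> y)"
  have "(%z. v (?S (scheme h k (fst z)) (snd z))): borel_measurable (F ?s \<Otimes>\<^sub>M borel)"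
  proof (rule meas_comp[OF _ vm])
   have "(%z. (scheme h k (fst z), noise \<beta> \<sigma> (snd z))): measurable (F ?s \<Otimes>\<^sub>M borel) (borel \<Otimes>\<^sub>M borel)"
    using scheme_adapted[OF h, of k] by measurable
   from meas_comp[OF this split_step_measurable[OF b_cont]]
   show "(%z. ?S (scheme h k (fst z)) (snd z)): borel_measurable (F ?s \<Otimes>\<^sub>M borel)" by simp
  qed
  hence gm: "(%z. Y (fst z) * v (?S (scheme h k (fst z)) (snd z))): borel_measurable (F ?s \<Otimes>\<^sub>M borel)" by measurable
  have "(\<integral>\<^sup>+w. (\<Prod>j\<le>Suc k. g j (scheme h j w)) * ?T (N - Suc k) (scheme h (Suc k) w) \<partial>M)
   = (\<integral>\<^sup>+w. Y w * v (?S (scheme h k w) (B ?t w - B ?s w)) \<partial>M)"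
   by (simp add: Y_def v_def i_def[symmetric] scheme_Suc[symmetric] mult.assoc del: of_nat_Suc)
  also have "... = (\<integral>\<^sup>+w. (NN y. Y w * v (?S (scheme h k w) y) * ennreal (gauss (sqrt h) y)) \<partial>M)"
   using nn_increment[OF st(1,2) gm] unfolding st(3) by simp
  also have "... = (\<integral>\<^sup>+w. Y w * split_kernel \<beta> \<sigma> b h v (scheme h k w) \<partial>M)"
  proof (rule nn_integral_cong)
   fix w
   have "(%y. v (?S (scheme h k w) y)): Borel"
   proof (rule meas_comp[OF _ vm])
    have "(%y. (scheme h k w, noise \<beta> \<sigma> y)): measurable borel (borel \<Otimes>\<^sub>M borel)" by measurable
    from meas_comp[OF this split_step_measurable[OF b_cont]]
    show "?S (scheme h k w): Borel" by simp
   qed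
   thus "(NN y. Y w * v (?S (scheme h k w) y) * ennreal (gauss (sqrt h) y)) = Y w * split_kernel \<beta> \<sigma> b h v (scheme h k w)"
    unfolding split_kernel_def mult.assoc by (intro nn_integral_cmult) simp
  qed
  also have "... = (\<integral>\<^sup>+w. (\<Prod>j\<le>k. g j (scheme h j w)) * ?T (N - k) (scheme h k w) \<partial>M)"
   by (simp add: Y_def i v_def[abs_def])
  finally show ?case using Suc by simp
 qed simp
 have "(\<integral>\<^sup>+w. (\<Prod>j\<le>N. g j (scheme h j w)) \<partial>M) = (\<integral>\<^sup>+w. g 0 (X 0 w) * ?T N (X 0 w) \<partial>M)" using main[of N] by simp
 also have "... = (NN x. ennreal (\<rho> x) * (g 0 x * ?T N x))" by (rule nn_X0[where f="%x. g 0 x * ?T N x"]) simp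
 finally show ?thesis .
qed

end

section \<open>Finite-dimensional distributions from continuous functions\<close>

lemma borel_eq_sigma_closed: "sets (borel :: 'a::topological_space measure) = sets (sigma UNIV (Collect closed))"
proof -
 have "sigma_sets UNIV (Collect open) = sigma_sets (UNIV :: 'a set) (Collect closed)"
 proof (intro equalityI sigma_sets_mono subsetI)
  fix S :: "'a set"
  show "S : sigma_sets UNIV (Collect closed)" if "S : Collect open"
  proof -
   have "- S : Collect closed" using that by (simp add: closed_Compl)
   from sigma_sets.Compl[OF sigma_sets.Basic[OF this], of UNIV] show ?thesis by (simp add: Diff_eq)
  qed
  show "S : sigma_sets UNIV (Collect open)" if "S : Collect closed"
  proof -
   have "- S : Collect open" using that by (simp add: open_Compl)
   from sigma_sets.Compl[OF sigma_sets.Basic[OF this], of UNIV] show ?thesis by (simp add: Diff_eq)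
  qed
 qed
 thus ?thesis by (simp add: borel_def)
qed

lemma closed_indicator_approx: fixes A :: "'a::metric_space set" assumes "closed A" "A \<noteq> {}"
 defines "g \<equiv> %k x. max 0 (1 - real k * infdist x A)"
 shows "continuous_on UNIV (g k)" "0 <= g k x" "g k x <= 1" "(%k. g k x) ----> indicator A x"
proof -
 show "continuous_on UNIV (g k)" unfolding g_def by (intro continuous_intros)
 show "0 <= g k x" "g k x <= 1" by (simp_all add: g_def infdist_nonneg)
 show "(%k. g k x) ----> indicator A x"
 proof (cases "x : A")
  case False
  hence d: "infdist x A > 0" using assms(1,2) by (simp add: infdist_pos_not_in_closed)
  obtain N where "1 / infdist x A < real N" using reals_Archimedean2 by blast
  hence "g k x = 0" if "k \<ge> N" for k
  proof -
   have "1 <= real N * infdist x A" using \<open>1 / infdist x A < real N\<close> d by (simp add: field_simps)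
   also have "... <= real k * infdist x A" using that d by (intro mult_right_mono) auto
   finally show ?thesis by (simp add: g_def)
  qed
  thus ?thesis using False by (intro tendsto_eventually) (auto simp: eventually_sequentially)
 qed (simp add: g_def)
qed

text \<open>Boxes with closed sides generate the product space and are stable under intersection,
  and their indicators are limits of products of continuous functions. Such products are the
  functionals that pass to the limit along the scheme.\<close>

lemma (in prob_space) distr_PiM_eqI_continuous: fixes Y Y' :: "'i => 'a => 's::metric_space"
 assumes I: "finite I" and Y: "!!i. i : I ==> Y i : borel_measurable M" "!!i. i : I ==> Y' i : borel_measurable M"
  and eq: "!!f. (!!i. continuous_on UNIV (f i)) ==> (!!i x. 0 <= f i x) ==> (!!i x. f i x <= 1) ==>
   (\<integral>\<^sup>+y. ennreal (\<Prod>i\<in>I. f i (Y i y)) \<partial>M) = (\<integral>\<^sup>+y. ennreal (\<Prod>i\<in>I. f i (Y' i y)) \<partial>M)"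
 shows "distr M (Pi\<^sub>M I (%_. borel)) (%y. \<lambda>i\<in>I. Y i y) = distr M (Pi\<^sub>M I (%_. borel)) (%y. \<lambda>i\<in>I. Y' i y)"
proof -
 let ?P = "Pi\<^sub>M I (%_. borel :: 's measure)"
 let ?E = "{Pi\<^sub>E I A | A :: 'i => 's set. \<forall>i. closed (A i)}"
 have Ym: "(%y. \<lambda>i\<in>I. Y i y): measurable M ?P" "(%y. \<lambda>i\<in>I. Y' i y): measurable M ?P" by (intro measurable_restrict Y; simp)+
 have sets: "sets ?P = sigma_sets (\<Pi>\<^sub>E i\<in>I. UNIV) ?E"
 proof -
  have "sets ?P = sets (Pi\<^sub>M I (%_. sigma UNIV (Collect closed)))" by (rule sets_PiM_cong) (simp_all add: borel_eq_sigma_closed)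
  also have "... = sets (sigma (\<Pi>\<^sub>E i\<in>I. UNIV) {{f\<in>(\<Pi>\<^sub>E i\<in>I. UNIV). \<forall>i\<in>j. f i : A i} | A j. j : {I} \<and> A : j \<rightarrow> Collect closed})"
   by (rule sets_PiM_sigma) (auto intro!: exI[of _ "{UNIV}"] simp: I)
  also have "{{f\<in>(\<Pi>\<^sub>E i\<in>I. (UNIV :: 's set)). \<forall>i\<in>j. f i : A i} | A j. j : {I} \<and> A : j \<rightarrow> Collect closed} = ?E"
  proof (intro equalityI subsetI)
   fix x assume "x : {{f\<in>(\<Pi>\<^sub>E i\<in>I. (UNIV :: 's set)). \<forall>i\<in>j. f i : A i} | A j. j : {I} \<and> A : j \<rightarrow> Collect closed}"
   then obtain A :: "'i => 's set" where A: "x = {f\<in>(\<Pi>\<^sub>E i\<in>I. (UNIV :: 's set)). \<forall>i\<in>I. f i : A i}" "\<forall>i\<in>I. closed (A i)" by blast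
   hence "x = Pi\<^sub>E I (%i. if i : I then A i else UNIV)" by (auto simp: PiE_def Pi_def)
   thus "x : ?E" using A(2) by (intro CollectI exI[of _ "%i. if i : I then A i else UNIV"]) auto
  next
   fix x assume "x : ?E"
   then obtain A :: "'i => 's set" where A: "x = Pi\<^sub>E I A" "\<forall>i. closed (A i)" by auto
   hence "x = {f\<in>(\<Pi>\<^sub>E i\<in>I. (UNIV :: 's set)). \<forall>i\<in>I. f i : A i}" by (auto simp: PiE_def Pi_def)
   thus "x : {{f\<in>(\<Pi>\<^sub>E i\<in>I. (UNIV :: 's set)). \<forall>i\<in>j. f i : A i} | A j. j : {I} \<and> A : j \<rightarrow> Collect closed}" using A(2) by blast
  qed
  finally show ?thesis by (simp add: sets_measure_of_conv) (auto simp: PiE_def)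
 qed
 have em: "emeasure (distr M ?P (%y. \<lambda>i\<in>I. V i y)) (Pi\<^sub>E I A) = (\<integral>\<^sup>+y. ennreal (\<Prod>i\<in>I. indicator (A i) (V i y)) \<partial>M)"
  if V: "!!i. i : I ==> V i : borel_measurable M" and A: "!!i. closed (A i)" for V :: "'i => 'a => 's" and A
 proof -
  have Vm: "(%y. \<lambda>i\<in>I. V i y): measurable M ?P" by (intro measurable_restrict V)
  have AP: "Pi\<^sub>E I A : sets ?P" using I A by (intro sets_PiM_I_finite) auto
  have "emeasure (distr M ?P (%y. \<lambda>i\<in>I. V i y)) (Pi\<^sub>E I A) = (\<integral>\<^sup>+y. indicator (Pi\<^sub>E I A) (\<lambda>i\<in>I. V i y) \<partial>M)"
   using Vm AP by (subst nn_integral_distr[symmetric, where M'="?P"]) (simp_all)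
  also have "... = (\<integral>\<^sup>+y. ennreal (\<Prod>i\<in>I. indicator (A i) (V i y)) \<partial>M)"
  proof (rule nn_integral_cong)
   fix y
   show "indicator (Pi\<^sub>E I A) (\<lambda>i\<in>I. V i y) = ennreal (\<Prod>i\<in>I. indicator (A i) (V i y))"
   proof (cases "\<forall>i\<in>I. V i y : A i")
    case False
    hence "(\<Prod>i\<in>I. indicator (A i) (V i y) :: real) = 0" using I by (auto simp: prod_zero_iff indicator_def)
    thus ?thesis using False by (auto simp: PiE_iff)
   qed (auto simp: PiE_iff)
  qed
  finally show ?thesis .
 qed
 show ?thesis
 proof (rule measure_eqI_generator_eq[where E="?E" and \<Omega>="\<Pi>\<^sub>E i\<in>I. UNIV" and A="%_. \<Pi>\<^sub>E i\<in>I. UNIV"])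
  show "Int_stable ?E"
  proof (rule Int_stableI, elim CollectE exE conjE)
   fix a b :: "('i => 's) set" and A B assume "a = Pi\<^sub>E I A" "b = Pi\<^sub>E I B" "\<forall>i. closed (A i)" "\<forall>i. closed (B i)"
   thus "a \<inter> b : ?E" by (intro CollectI exI[of _ "%i. A i \<inter> B i"]) (auto simp: PiE_Int)
  qed
  fix S assume "S : ?E"
  then obtain A :: "'i => 's set" where S: "S = Pi\<^sub>E I A" and A: "!!i. closed (A i)" by auto
  show "emeasure (distr M ?P (%y. \<lambda>i\<in>I. Y i y)) S = emeasure (distr M ?P (%y. \<lambda>i\<in>I. Y' i y)) S"
  \<comment> \<open>The distance to the empty set is zero by convention, so the approximating
    functions would be identically one for an empty side; that case is settled apart.\<close>
  proof (cases "\<exists>i\<in>I. A i = {}")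
   case True
   hence "S = {}" unfolding S PiE_eq_empty_iff by blast
   thus ?thesis by simp
  next
   case False
   define A' where "A' i = (if i : I then A i else UNIV)" for i
   have A': "closed (A' i)" "A' i \<noteq> {}" for i using A False by (auto simp: A'_def)
   define g where "g i k x = max 0 (1 - real k * infdist x (A' i))" for i and k :: nat and x
   note g = closed_indicator_approx[OF A', folded g_def]
   have lim: "(%k. \<integral>\<^sup>+y. ennreal (\<Prod>i\<in>I. g i k (V i y)) \<partial>M) ----> (\<integral>\<^sup>+y. ennreal (\<Prod>i\<in>I. indicator (A i) (V i y)) \<partial>M)"
    if V: "!!i. i : I ==> V i : borel_measurable M" for V :: "'i => 'a => 's"
   proof (rule nn_integral_dominated_convergence[where w="%_. 1"])
    show "(%y. ennreal (\<Prod>i\<in>I. g i k (V i y))): borel_measurable M" for k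
    proof (intro meas_comp[OF borel_measurable_prod measurable_ennreal])
     fix i assume "i : I"
     show "(%y. g i k (V i y)): borel_measurable M" by (rule meas_comp[OF V[OF \<open>i : I\<close>] borel_contI[OF g(1)]])
    qed
    have "(%y. \<Prod>i\<in>I. indicator (A i) (V i y) :: real): borel_measurable M"
     using V A by (intro borel_measurable_prod meas_comp[OF V borel_measurable_indicator]) auto
    thus "(%y. ennreal (\<Prod>i\<in>I. indicator (A i) (V i y))): borel_measurable M" by simp
    show "AE y in M. ennreal (\<Prod>i\<in>I. g i k (V i y)) <= 1" for k by (intro AE_I2) (simp add: prod_le_1 g)
    have "(%k. \<Prod>i\<in>I. g i k (V i y)) ----> (\<Prod>i\<in>I. indicator (A' i) (V i y))" for y by (intro tendsto_prod g)
    thus "AE y in M. (%k. ennreal (\<Prod>i\<in>I. g i k (V i y))) ----> ennreal (\<Prod>i\<in>I. indicator (A i) (V i y))"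
     by (intro AE_I2 tendsto_ennrealI) (simp add: A'_def cong: prod.cong)
   qed (simp_all add: emeasure_space_1)
   have "(\<integral>\<^sup>+y. ennreal (\<Prod>i\<in>I. g i k (Y i y)) \<partial>M) = (\<integral>\<^sup>+y. ennreal (\<Prod>i\<in>I. g i k (Y' i y)) \<partial>M)" for k
    by (rule eq[of "%i. g i k"]) (rule g)+
   hence "(\<integral>\<^sup>+y. ennreal (\<Prod>i\<in>I. indicator (A i) (Y i y)) \<partial>M) = (\<integral>\<^sup>+y. ennreal (\<Prod>i\<in>I. indicator (A i) (Y' i y)) \<partial>M)"
    using LIMSEQ_unique[OF lim[of Y, OF Y(1)]] lim[of Y', OF Y(2)] by simp
   thus ?thesis unfolding S using em[of Y A] em[of Y' A] Y A by simp
  qed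
 next
  show "sets (distr M ?P (%y. \<lambda>i\<in>I. Y i y)) = sigma_sets (\<Pi>\<^sub>E i\<in>I. UNIV) ?E"
   "sets (distr M ?P (%y. \<lambda>i\<in>I. Y' i y)) = sigma_sets (\<Pi>\<^sub>E i\<in>I. UNIV) ?E" using sets by simp_all
  show "emeasure (distr M ?P (%y. \<lambda>i\<in>I. Y i y)) (\<Pi>\<^sub>E i\<in>I. UNIV) \<noteq> \<infinity>"
   using Ym(1) by (metis emeasure_space_1 ennreal_one_neq_top infinity_ennreal_def prob_space.emeasure_le_1 prob_space_distr top.extremum_unique)
 qed (auto intro!: exI[of _ "%_. UNIV"])
qed

context langevin_start
begin

lemma paths_AE:
 "AE w in M. continuous_on {0..} (%t. q t w) \<and> continuous_on {0..} (%t. p t w) \<and> continuous_on {0..} (%t. noise \<beta> \<sigma> (B t w)) \<and>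
  (\<forall>t\<ge>0. q t w = q 0 w + integral {0..t} (%s. p s w)) \<and>
  (\<forall>t\<ge>0. p t w = p 0 w + integral {0..t} (%s. b (q s w) - friction \<sigma> (p s w)) + noise \<beta> \<sigma> (B t w))"
 using q_continuous p_continuous B_continuous q_equation p_equation
proof eventually_elim
 case (elim w)
 have "continuous_on {0..} (%t. noise \<beta> \<sigma> (B t w))" by (rule bounded_linear.continuous_on[OF noise_linear elim(3)])
 moreover have int: "(%s. - (1/2) *R ((\<sigma> ** transpose \<sigma>) *v p s w) + b (q s w)) = (%s. b (q s w) - friction \<sigma> (p s w))"
  by (simp add: fun_eq_iff friction_def)
 ultimately show ?case using elim(1,2,4) elim(5)[unfolded int, folded noise_def] by blast
qed

lemma scheme_converges_AE: assumes T: "0 < T" shows "AE w in M. continuous_on {0..} (%t. X t w) \<and>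
  (\<forall>e>0. \<forall>\<^sub>F N in sequentially. \<forall>k\<le>N. norm (scheme (T / real N) k w - X (real k * (T / real N)) w) <= e)"
 using paths_AE
proof eventually_elim
 case (elim w)
 have sub: "{0..T} \<subseteq> {0..}" by auto
 from elim have el: "continuous_on {0..} (%t. q t w)" "continuous_on {0..} (%t. p t w)" "continuous_on {0..} (%t. noise \<beta> \<sigma> (B t w))"
  by blast+
 have eqs: "q t w = q 0 w + integral {0..t} (%s. p s w)"
  "p t w = p 0 w + integral {0..t} (%s. b (q s w) - friction \<sigma> (p s w)) + noise \<beta> \<sigma> (B t w)" if "t : {0..T}" for t
 proof -
  have "0 <= t" using that by simp
  with elim show "q t w = q 0 w + integral {0..t} (%s. p s w)"
   "p t w = p 0 w + integral {0..t} (%s. b (q s w) - friction \<sigma> (p s w)) + noise \<beta> \<sigma> (B t w)" by blast+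
 qed
 show ?case
 proof (intro conjI allI impI)
  show "continuous_on {0..} (%t. X t w)" unfolding X_def by (intro continuous_on_Pair el)
  fix e :: real assume "0 < e"
  show "\<forall>\<^sub>F N in sequentially. \<forall>k\<le>N. norm (scheme (T / real N) k w - X (real k * (T / real N)) w) <= e"
   unfolding scheme_def X_def by (rule splitting_path_converges[where q="%t. q t w" and p="%t. p t w",
    OF T el[THEN continuous_on_subset[OF _ sub]] friction_linear lip eqs \<open>0 < e\<close>])
 qed
qed

end

text \<open>Uniform closeness on the grid allows a grid index that varies with \<open>N\<close>;
  continuity of the limit path bridges the gap from the grid point to \<open>t\<close>.\<close>

lemma tendsto_scheme_at_time: fixes Y :: "real => 'a::real_normed_vector" assumes T: "0 < T" and Yc: "continuous_on {0..} Y"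
  and conv: "!!y. 0 < y ==> \<forall>\<^sub>F N in sequentially. \<forall>k\<le>N. norm (S N k - Y (real k * (T / real N))) <= y"
  and k: "!!N. k N <= N" "(%N. real (k N) * (T / real N)) ----> t" and t: "0 <= t" shows "(%N. S N (k N)) ----> Y t"
proof -
 have "(%N. Y (real (k N) * (T / real N))) ----> Y t"
  by (rule continuous_on_tendsto_compose[OF Yc k(2)]) (use t T in \<open>auto intro!: always_eventually\<close>)
 moreover have "(%N. S N (k N) - Y (real (k N) * (T / real N))) ----> 0"
 proof (rule tendstoI)
  fix e :: real assume "0 < e"
  have "\<forall>\<^sub>F N in sequentially. \<forall>k\<le>N. norm (S N k - Y (real k * (T / real N))) <= e / 2" by (rule conv) (use \<open>0 < e\<close> in simp)
  thus "\<forall>\<^sub>F N in sequentially. dist (S N (k N) - Y (real (k N) * (T / real N))) 0 < e"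
  proof eventually_elim
   case (elim N)
   from elim[rule_format, OF k(1)] \<open>0 < e\<close> show ?case by (simp add: dist_norm)
  qed
 qed
 ultimately have "(%N. Y (real (k N) * (T / real N)) + (S N (k N) - Y (real (k N) * (T / real N)))) ----> Y t + 0" by (rule tendsto_add)
 thus ?thesis by simp
qed

text \<open>\<open>k N\<close> is the last grid point not after \<open>t\<close>; the complementary
  index \<open>N - k N\<close> follows the time-reversed path.\<close>

lemma grid_index_tendsto: assumes T: "0 < T" and t: "0 <= t" "t <= T"
 defines "k \<equiv> %N::nat. nat \<lfloor>t * real N / T\<rfloor>"
 shows "k N <= N" "(%N. real (k N) * (T / real N)) ----> t" "(%N. real (N - k N) * (T / real N)) ----> T - t"
proof -
 have kN: "k N <= N" for N
 proof -
  have "t * real N / T <= real N" using T t by (simp add: field_simps mult_right_mono)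
  thus ?thesis unfolding k_def by linarith
 qed
 thus "k N <= N" .
 have bd: "t * real N / T - 1 <= real (k N)" "real (k N) <= t * real N / T" for N using T t by (auto simp: k_def le_nat_floor)
 have l1: "(%N. t - T / real N) ----> t - 0" by (intro tendsto_diff tendsto_const lim_const_over_n)
 show lim: "(%N. real (k N) * (T / real N)) ----> t"
 proof (rule tendsto_sandwich[OF _ _ _ tendsto_const])
  show "(%N. t - T / real N) ----> t" using l1 by simp
  show "\<forall>\<^sub>F N in sequentially. t - T / real N <= real (k N) * (T / real N)" using eventually_gt_at_top[of 0]
  proof eventually_elim
   case (elim N)
   have "(t * real N / T - 1) * (T / real N) <= real (k N) * (T / real N)" using bd(1)[of N] T by (intro mult_right_mono) auto
   moreover have "(t * real N / T - 1) * (T / real N) = t - T / real N" using elim T by (simp add: field_simps)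
   ultimately show ?case by simp
  qed
  show "\<forall>\<^sub>F N in sequentially. real (k N) * (T / real N) <= t" using eventually_gt_at_top[of 0]
  proof eventually_elim
   case (elim N)
   have "real (k N) * (T / real N) <= (t * real N / T) * (T / real N)" using bd(2)[of N] T by (intro mult_right_mono) auto
   thus ?case using elim T by simp
  qed
 qed
 have "(%N. T - real (k N) * (T / real N)) ----> T - t" by (intro tendsto_diff tendsto_const lim)
 moreover have "\<forall>\<^sub>F N in sequentially. real (N - k N) * (T / real N) = T - real (k N) * (T / real N)"
  using eventually_gt_at_top[of 0] by eventually_elim (simp add: of_nat_diff[OF kN] field_simps)
 ultimately show "(%N. real (N - k N) * (T / real N)) ----> T - t" by (simp add: tendsto_cong)
qed

section \<open>Reversibility of the Gibbs process\<close>

locale gibbs_langevin = langevin_start M F B \<beta> \<sigma> b q p \<rho> + gibbs_density \<beta> \<sigma> b \<rho> U R Z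
 for M :: "'w measure" and F :: "real => 'w measure" and B :: "real => 'w => real ^ 'n::finite"
  and \<beta> :: real and \<sigma> :: "real ^ 'n ^ 'n" and b :: "real ^ 'n => real ^ 'n"
  and q p :: "real => 'w => real ^ 'n" and \<rho> :: "'n phase => real" and U :: "real ^ 'n => real" and R :: "'n phase => real" and Z :: real
begin

lemma scheme_reversal: assumes r: "0 <= r" obtains C where "0 <= C"
  "!!h N g. 0 < h ==> h <= 1 ==> (!!j. g j : Borel) ==> (!!j x. r < norm x ==> g j x = 0) ==>
   (\<integral>\<^sup>+w. (\<Prod>j\<le>N. g j (scheme h j w)) \<partial>M)
   <= ennreal (exp (C * h * (1 + h * real N))) * (\<integral>\<^sup>+w. (\<Prod>j\<le>N. g (N - j) (flip (scheme h j w))) \<partial>M)"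
proof -
 obtain C where C: "0 <= C"
  "!!h N k. 0 < h ==> h <= 1 ==> (!!j. k j : Borel) ==> (!!j x. r < norm x ==> k j x = 0) ==>
   (NN x. ennreal (R x) * (k N x * chain_tail (split_kernel \<beta> \<sigma> b h) k N x)) <= ennreal (exp (C * h * (1 + h * real N))) *
    (NN x. ennreal (R x) * (k 0 (flip x) * chain_tail (split_kernel \<beta> \<sigma> b h) (%j x. k (N - j) (flip x)) N x))"
  by (rule splitting_chain_reversal[OF lip r]) blast
 show ?thesis
 proof (rule that[OF C(1)])
  fix h :: real and N :: nat and g :: "nat => 'n phase => ennreal"
  assume h: "0 < h" "h <= 1" and g: "!!j. g j : Borel" "!!j x. r < norm x ==> g j x = 0"
  have R: "(NN x. ennreal (\<rho> x) * f x) = (NN x. ennreal (R x) * f x)" for f :: "'n phase => ennreal"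
   by (rule nn_integral_cong_AE) (use rho_R in \<open>auto elim: eventually_mono\<close>)
  have "(\<integral>\<^sup>+w. (\<Prod>j\<le>N. g j (scheme h j w)) \<partial>M)
   = (NN x. ennreal (R x) * (g (N - N) x * chain_tail (split_kernel \<beta> \<sigma> b h) (%j. g (N - j)) N x))"
   by (simp add: nn_scheme[OF h(1) g(1)] R)
  also have "... <= ennreal (exp (C * h * (1 + h * real N))) *
    (NN x. ennreal (R x) * (g (N - 0) (flip x) * chain_tail (split_kernel \<beta> \<sigma> b h) (%j x. g (N - (N - j)) (flip x)) N x))"
   by (rule C(2)[OF h, of "%j. g (N - j)"]) (rule g; assumption)+
  also have "... = ennreal (exp (C * h * (1 + h * real N))) * (\<integral>\<^sup>+w. (\<Prod>j\<le>N. g (N - j) (flip (scheme h j w))) \<partial>M)"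
   using nn_scheme[OF h(1), of "%j x. g (N - j) (flip x)" N] meas_comp[OF flip_measurable g(1)] by (simp add: R)
  finally show "(\<integral>\<^sup>+w. (\<Prod>j\<le>N. g j (scheme h j w)) \<partial>M)
   <= ennreal (exp (C * h * (1 + h * real N))) * (\<integral>\<^sup>+w. (\<Prod>j\<le>N. g (N - j) (flip (scheme h j w))) \<partial>M)" .
 qed
qed

lemma scheme_measurable: "0 < h ==> scheme h k : borel_measurable M" by (rule F_measurable[OF _ scheme_adapted]) auto

text \<open>The cutoff keeps the scheme in a ball at every grid time, where reversal costs a factor
  \<open>exp (C * T * (1 + T) / N)\<close> that tends to one. On the reversed side the cutoff is
  dropped, which only increases the integral and leaves a bound independent of
  \<open>r\<close>.\<close>

lemma truncated_reversal_le: fixes f :: "real => 'n phase => real" assumes T: "0 < T" and I: "finite I" "I \<subseteq> {0..T}" and r: "0 <= r"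
  and f: "!!t. continuous_on UNIV (f t)" "!!t x. 0 <= f t x" "!!t x. f t x <= 1"
 defines "z \<equiv> %N t. nat \<lfloor>t * real N / T\<rfloor>"
 shows "liminf (%N. \<integral>\<^sup>+y. (\<Prod>j\<le>N. indicator (cball 0 r) (scheme (T / real N) j y)) * ennreal (\<Prod>t\<in>I. f t (scheme (T / real N) (z N t) y)) \<partial>M)
  <= (\<integral>\<^sup>+y. ennreal (\<Prod>t\<in>I. f t (flip (X (T - t) y))) \<partial>M)"
proof -
 have grid: "z N t <= N" "(%N. real (z N t) * (T / real N)) ----> t" "(%N. real (N - z N t) * (T / real N)) ----> T - t" if "0 <= t" "t <= T" for N t
  unfolding z_def by (rule grid_index_tendsto[OF T that])+
 have zN: "z N t <= N" "0 <= t" if "t : I" for t N using grid(1) I that by auto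
 obtain C where C: "0 <= C"
  "!!h N g. 0 < h ==> h <= 1 ==> (!!j. g j : Borel) ==> (!!j x. r < norm x ==> g j x = 0) ==>
   (\<integral>\<^sup>+y. (\<Prod>j\<le>N. g j (scheme h j y)) \<partial>M)
   <= ennreal (exp (C * h * (1 + h * real N))) * (\<integral>\<^sup>+y. (\<Prod>j\<le>N. g (N - j) (flip (scheme h j y))) \<partial>M)"
  by (rule scheme_reversal[OF r]) blast
 define D where "D N = (\<integral>\<^sup>+y. ennreal (\<Prod>t\<in>I. f t (flip (scheme (T / real N) (N - z N t) y))) \<partial>M)" for N
 let ?L = "\<integral>\<^sup>+y. ennreal (\<Prod>t\<in>I. f t (flip (X (T - t) y))) \<partial>M"
 have fc: "continuous_on UNIV (%x. f t (flip x))" for t by (rule cont_comp[OF f(1) linear_continuous_on[OF flip_bounded_linear]]) simp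
 have fm: "(%x. f t (flip x)): Borel" for t by (rule borel_contI[OF fc])
 have D: "(%N. D (Suc N)) ----> ?L" unfolding D_def
 proof (rule nn_integral_dominated_convergence[where w="%_. 1"])
  show "(%y. ennreal (\<Prod>t\<in>I. f t (flip (scheme (T / real (Suc N)) (Suc N - z (Suc N) t) y)))): borel_measurable M" for N
   using T by (intro meas_comp[OF borel_measurable_prod measurable_ennreal] meas_comp[OF scheme_measurable fm]) simp
  show "(%y. ennreal (\<Prod>t\<in>I. f t (flip (X (T - t) y)))): borel_measurable M"
   using I by (intro meas_comp[OF borel_measurable_prod measurable_ennreal] meas_comp[OF X_measurable fm]) auto
  show "AE y in M. ennreal (\<Prod>t\<in>I. f t (flip (scheme (T / real (Suc N)) (Suc N - z (Suc N) t) y))) <= 1" for N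
   by (intro AE_I2) (simp add: prod_le_1 f)
  show "AE y in M. (%N. ennreal (\<Prod>t\<in>I. f t (flip (scheme (T / real (Suc N)) (Suc N - z (Suc N) t) y))))
   ----> ennreal (\<Prod>t\<in>I. f t (flip (X (T - t) y)))" using scheme_converges_AE[OF T]
  proof eventually_elim
   case (elim y)
   have lim: "(%N. f t (flip (scheme (T / real N) (N - z N t) y))) ----> f t (flip (X (T - t) y))" if t: "t : I" for t
   proof (rule continuous_on_tendsto_compose[OF fc])
    show "(%N. scheme (T / real N) (N - z N t) y) ----> X (T - t) y"
    proof (rule tendsto_scheme_at_time[OF T, where Y="%t. X t y" and S="%N k. scheme (T / real N) k y" and k="%N. N - z N t"])
     show "(%N. real (N - z N t) * (T / real N)) ----> T - t" using grid(3)[of t] I t by auto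
    qed (use elim I t in auto)
   qed simp_all
   have "(%N. \<Prod>t\<in>I. f t (flip (scheme (T / real N) (N - z N t) y))) ----> (\<Prod>t\<in>I. f t (flip (X (T - t) y)))"
    by (rule tendsto_prod[OF lim])
   from tendsto_ennrealI[OF LIMSEQ_Suc[OF this]] show ?case .
  qed
 qed (simp_all add: emeasure_space_1)
 have le: "(\<integral>\<^sup>+y. (\<Prod>j\<le>N. indicator (cball 0 r) (scheme (T / real N) j y)) * ennreal (\<Prod>t\<in>I. f t (scheme (T / real N) (z N t) y)) \<partial>M)
  <= ennreal (exp (C * T * (1 + T) / real N)) * D N" if N: "real N \<ge> T" "N > 0" for N
 proof -
  \<comment> \<open>Several observation times may share a grid index; \<open>g j\<close> multiplies
    all of their functions.\<close>
  define g where "g j x = indicator (cball 0 r) x * (\<Prod>t\<in>{t\<in>I. z N t = j}. ennreal (f t x))" for j x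
  have hN: "0 < T / real N" "T / real N <= 1" "T / real N * real N = T" using T N by simp_all
  have grp: "(\<Prod>j\<le>N. \<Prod>t\<in>{t\<in>I. z N t = j}. ennreal (f t (Y j))) = ennreal (\<Prod>t\<in>I. f t (Y (z N t)))" for Y
  proof -
   have "(\<Prod>j\<le>N. \<Prod>t\<in>{t\<in>I. z N t = j}. ennreal (f t (Y j))) = (\<Prod>j\<le>N. \<Prod>t\<in>{t\<in>I. z N t = j}. ennreal (f t (Y (z N t))))"
    by (intro prod.cong refl) auto
   also have "... = (\<Prod>t\<in>I. ennreal (f t (Y (z N t))))" by (rule prod.group) (use I zN in auto)
   also have "... = ennreal (\<Prod>t\<in>I. f t (Y (z N t)))" by (rule prod_ennreal) (simp add: f)
   finally show ?thesis .
  qed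
  have "(\<integral>\<^sup>+y. (\<Prod>j\<le>N. indicator (cball 0 r) (scheme (T / real N) j y)) * ennreal (\<Prod>t\<in>I. f t (scheme (T / real N) (z N t) y)) \<partial>M)
   = (\<integral>\<^sup>+y. (\<Prod>j\<le>N. g j (scheme (T / real N) j y)) \<partial>M)" unfolding g_def prod.distrib grp ..
  also have "... <= ennreal (exp (C * (T / real N) * (1 + T / real N * real N))) * (\<integral>\<^sup>+y. (\<Prod>j\<le>N. g (N - j) (flip (scheme (T / real N) j y))) \<partial>M)"
  proof (rule C(2)[OF hN(1,2)])
   show "g j : Borel" for j
   proof -
    have "(%x. ennreal (f t x)): Borel" for t using borel_contI[OF f(1)[of t]] by simp
    thus ?thesis unfolding g_def by (intro borel_measurable_times_ennreal borel_measurable_prod_ennreal borel_measurable_indicator) auto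
   qed
   show "g j x = 0" if "r < norm x" for j x using that by (simp add: g_def indicator_def)
  qed
  also have "C * (T / real N) * (1 + T / real N * real N) = C * T * (1 + T) / real N" unfolding hN(3) by simp
  also have "ennreal (exp (C * T * (1 + T) / real N)) * (\<integral>\<^sup>+y. (\<Prod>j\<le>N. g (N - j) (flip (scheme (T / real N) j y))) \<partial>M)
   <= ennreal (exp (C * T * (1 + T) / real N)) * D N" unfolding D_def
  proof (intro mult_left_mono nn_integral_mono)
   fix y
   have "(\<Prod>j\<le>N. g (N - j) (flip (scheme (T / real N) j y))) = (\<Prod>j\<le>N. g (N - (N - j)) (flip (scheme (T / real N) (N - j) y)))"
    using prod.atLeastAtMost_rev[of "%j. g (N - j) (flip (scheme (T / real N) j y))" 0 N] by (simp add: atMost_atLeast0)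
   also have "... = (\<Prod>j\<le>N. g j (flip (scheme (T / real N) (N - j) y)))" by (intro prod.cong) auto
   also have "... <= (\<Prod>j\<le>N. \<Prod>t\<in>{t\<in>I. z N t = j}. ennreal (f t (flip (scheme (T / real N) (N - j) y))))"
    by (intro prod_mono_ennreal) (simp add: g_def indicator_def)
   also have "... = ennreal (\<Prod>t\<in>I. f t (flip (scheme (T / real N) (N - z N t) y)))" by (rule grp)
   finally show "(\<Prod>j\<le>N. g (N - j) (flip (scheme (T / real N) j y))) <= ennreal (\<Prod>t\<in>I. f t (flip (scheme (T / real N) (N - z N t) y)))" .
  qed simp
  finally show ?thesis .
 qed
 have "(%N. ennreal (exp (C * T * (1 + T) / real N)) * D N) ----> ennreal (exp 0) * ?L"
 proof (rule tendsto_mult_ennreal)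
  show "(%N. ennreal (exp (C * T * (1 + T) / real N))) ----> ennreal (exp 0)" by (intro tendsto_ennrealI tendsto_exp lim_const_over_n)
  show "D ----> ?L" using LIMSEQ_imp_Suc[OF D] .
 qed simp
 hence "liminf (%N. ennreal (exp (C * T * (1 + T) / real N)) * D N) = ?L" by (simp add: lim_imp_Liminf)
 moreover have "liminf (%N. \<integral>\<^sup>+y. (\<Prod>j\<le>N. indicator (cball 0 r) (scheme (T / real N) j y)) * ennreal (\<Prod>t\<in>I. f t (scheme (T / real N) (z N t) y)) \<partial>M)
  <= liminf (%N. ennreal (exp (C * T * (1 + T) / real N)) * D N)"
 proof (rule Liminf_mono)
  have "\<forall>\<^sub>F N in sequentially. real N \<ge> T" by real_asymp
  thus "\<forall>\<^sub>F N in sequentially. (\<integral>\<^sup>+y. (\<Prod>j\<le>N. indicator (cball 0 r) (scheme (T / real N) j y)) * ennreal (\<Prod>t\<in>I. f t (scheme (T / real N) (z N t) y)) \<partial>M)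
   <= ennreal (exp (C * T * (1 + T) / real N)) * D N" using eventually_gt_at_top[of 0] by eventually_elim (rule le)
 qed
 ultimately show ?thesis by simp
qed

end

context gibbs_langevin
begin

text \<open>Fatou's lemma is applied in \<open>N\<close> and in \<open>r\<close>: almost every path
  is bounded on the time interval, and for \<open>r\<close> beyond that bound the cutoff is
  eventually equal to one.\<close>

lemma reversal_le: fixes f :: "real => 'n phase => real" assumes T: "0 < T" and I: "finite I" "I \<subseteq> {0..T}"
  and f: "!!t. continuous_on UNIV (f t)" "!!t x. 0 <= f t x" "!!t x. f t x <= 1"
 shows "(\<integral>\<^sup>+w. ennreal (\<Prod>t\<in>I. f t (X t w)) \<partial>M) <= (\<integral>\<^sup>+w. ennreal (\<Prod>t\<in>I. f t (flip (X (T - t) w))) \<partial>M)"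
proof -
 define y where "y N t = nat \<lfloor>t * real N / T\<rfloor>" for N t
 let ?L = "\<integral>\<^sup>+w. ennreal (\<Prod>t\<in>I. f t (flip (X (T - t) w))) \<partial>M"
 have fm[measurable]: "f t : Borel" for t by (rule borel_contI[OF f(1)])
 \<comment> \<open>The value at \<open>N = 0\<close> is arbitrary; it avoids the step size
   \<open>T / 0\<close>, for which no measurability of the scheme is known.\<close>
 define A where "A r N w = (if N = 0 then 0 else
   (\<Prod>j\<le>N. indicator (cball 0 (real r)) (scheme (T / real N) j w)) * ennreal (\<Prod>t\<in>I. f t (scheme (T / real N) (y N t) w)))" for r N :: nat and w
 have Am: "A r N : borel_measurable M" for r N
 proof (cases "N = 0")
  case False
  hence "0 < T / real N" using T by simp
  note [measurable] = scheme_measurable[OF this]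
  have "(%w. ennreal (\<Prod>t\<in>I. f t (scheme (T / real N) (y N t) w))): borel_measurable M" by measurable
  moreover have "(%w. \<Prod>j\<le>N. indicator (cball 0 (real r)) (scheme (T / real N) j w) :: ennreal): borel_measurable M"
   by (intro borel_measurable_prod_ennreal meas_comp[OF scheme_measurable[OF \<open>0 < T / real N\<close>] borel_measurable_indicator]) simp
  ultimately show ?thesis using False unfolding A_def by simp
 qed (simp add: A_def[abs_def])
 have Lm: "(%w. liminf (%N. A r N w)): borel_measurable M" for r by (rule borel_measurable_liminf[OF Am])
 have "(\<integral>\<^sup>+w. ennreal (\<Prod>t\<in>I. f t (X t w)) \<partial>M) <= (\<integral>\<^sup>+w. liminf (%r. liminf (%N. A r N w)) \<partial>M)"
 proof (rule nn_integral_mono_AE)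
  show "AE w in M. ennreal (\<Prod>t\<in>I. f t (X t w)) <= liminf (%r. liminf (%N. A r N w))" using scheme_converges_AE[OF T]
  proof eventually_elim
   case (elim w)
   have lim: "(%N. f t (scheme (T / real N) (y N t) w)) ----> f t (X t w)" if t: "t : I" for t
   proof (rule continuous_on_tendsto_compose[OF f(1)])
    show "(%N. scheme (T / real N) (y N t) w) ----> X t w"
    proof (rule tendsto_scheme_at_time[OF T, where Y="%t. X t w" and S="%N k. scheme (T / real N) k w" and k="%N. y N t"])
     show "y N t <= N" for N unfolding y_def by (rule grid_index_tendsto(1)[OF T]) (use I t in auto)
     show "(%N. real (y N t) * (T / real N)) ----> t" unfolding y_def by (rule grid_index_tendsto(2)[OF T]) (use I t in auto)
    qed (use elim I t in auto)
   qed simp_all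
   have "continuous_on {0..T} (%t. X t w)" using elim by (auto intro: continuous_on_subset[of "{0..}"])
   hence "bounded ((%t. X t w) ` {0..T})" by (intro compact_imp_bounded compact_continuous_image compact_Icc)
   then obtain r0 where r0: "!!t. t : {0..T} ==> norm (X t w) <= r0" unfolding bounded_iff by blast
   have "\<forall>\<^sub>F r in sequentially. r0 + 1 <= real r" by real_asymp
   hence "\<forall>\<^sub>F r in sequentially. ennreal (\<Prod>t\<in>I. f t (X t w)) <= liminf (%N. A r N w)"
   proof eventually_elim
    case r: (elim r)
    from elim have "\<forall>\<^sub>F N in sequentially. \<forall>k\<le>N. norm (scheme (T / real N) k w - X (real k * (T / real N)) w) <= 1"
     using zero_less_one by blast
    hence "\<forall>\<^sub>F N in sequentially. A r N w = ennreal (\<Prod>t\<in>I. f t (scheme (T / real N) (y N t) w))"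
     using eventually_gt_at_top[of 0]
    proof eventually_elim
     case (elim N)
     have "scheme (T / real N) k w : cball 0 (real r)" if "k <= N" for k
     proof -
      have "real k * (T / real N) <= real N * (T / real N)" using that T by (intro mult_right_mono) auto
      hence "real k * (T / real N): {0..T}" using T elim by simp
      from r0[OF this] elim(1)[rule_format, OF that] r
       norm_triangle_ineq[of "scheme (T / real N) k w - X (real k * (T / real N)) w" "X (real k * (T / real N)) w"]
      show ?thesis by simp
     qed
     thus ?case using elim by (simp add: A_def)
    qed
    moreover have "(%N. ennreal (\<Prod>t\<in>I. f t (scheme (T / real N) (y N t) w))) ----> ennreal (\<Prod>t\<in>I. f t (X t w))"
     by (intro tendsto_ennrealI tendsto_prod lim)
    ultimately have "(%N. A r N w) ----> ennreal (\<Prod>t\<in>I. f t (X t w))" by (simp add: tendsto_cong)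
    from lim_imp_Liminf[OF _ this] show ?case by simp
   qed
   thus ?case by (rule Liminf_bounded)
  qed
 qed
 also have "... <= liminf (%r. \<integral>\<^sup>+w. liminf (%N. A r N w) \<partial>M)" by (rule nn_integral_liminf[OF Lm])
 also have "... <= liminf (%r::nat. ?L)"
 proof (intro Liminf_mono always_eventually allI)
  fix r :: nat
  have "(\<integral>\<^sup>+w. liminf (%N. A r N w) \<partial>M) <= liminf (%N. \<integral>\<^sup>+w. A r N w \<partial>M)" by (rule nn_integral_liminf[OF Am])
  also have "... = liminf (%N. \<integral>\<^sup>+w. (\<Prod>j\<le>N. indicator (cball 0 (real r)) (scheme (T / real N) j w)) * ennreal (\<Prod>t\<in>I. f t (scheme (T / real N) (y N t) w)) \<partial>M)"
   by (rule Liminf_eq, rule eventually_mono[OF eventually_gt_at_top[of 0]]) (simp add: A_def)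
  also have "... <= ?L" unfolding y_def by (rule truncated_reversal_le[OF T I _ f]) simp
  finally show "(\<integral>\<^sup>+w. liminf (%N. A r N w) \<partial>M) <= ?L" .
 qed
 also have "... = ?L" by (simp add: Liminf_const)
 finally show ?thesis .
qed

text \<open>Reversal is an involution, so the inequality for the reversed times and flipped
  functions is the opposite inequality.\<close>

lemma reversal_eq: fixes f :: "real => 'n phase => real" assumes T: "0 < T" and I: "finite I" "I \<subseteq> {0..T}"
  and f: "!!t. continuous_on UNIV (f t)" "!!t x. 0 <= f t x" "!!t x. f t x <= 1"
 shows "(\<integral>\<^sup>+w. ennreal (\<Prod>t\<in>I. f t (X t w)) \<partial>M) = (\<integral>\<^sup>+w. ennreal (\<Prod>t\<in>I. f t (flip (X (T - t) w))) \<partial>M)"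
proof (rule antisym)
 have inj: "inj_on ((-) T) I" by (auto simp: inj_on_def)
 have "(\<integral>\<^sup>+w. ennreal (\<Prod>t\<in>(-) T ` I. f (T - t) (flip (X t w))) \<partial>M)
  <= (\<integral>\<^sup>+w. ennreal (\<Prod>t\<in>(-) T ` I. f (T - t) (flip (flip (X (T - t) w)))) \<partial>M)"
  by (rule reversal_le[OF T, where f="%t x. f (T - t) (flip x)"])
   (use I in \<open>auto intro!: f cont_comp[OF f(1) linear_continuous_on[OF flip_bounded_linear]]\<close>)
 thus "(\<integral>\<^sup>+w. ennreal (\<Prod>t\<in>I. f t (flip (X (T - t) w))) \<partial>M) <= (\<integral>\<^sup>+w. ennreal (\<Prod>t\<in>I. f t (X t w)) \<partial>M)"
  by (simp add: prod.reindex[OF inj])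
qed (rule reversal_le[OF assms])

lemma reversible: "reversible_process M (%t w. (q t w, p t w))"
proof -
 have Xeq: "(%t w. (q t w, p t w)) = X" by (simp add: X_def fun_eq_iff)
 have tr: "time_reversal T X = (%t w. flip (X (T - t) w))" for T by (simp add: time_reversal_def flip_def fun_eq_iff)
 show ?thesis unfolding Xeq reversible_process_def stationary_process_def same_fdd_def tr
 proof (intro conjI allI impI)
  fix h :: real and I :: "real set" assume h: "0 <= h" and I: "finite I" "I \<subseteq> {0..}"
  show "distr M (Pi\<^sub>M I (%_. borel)) (%w. \<lambda>t\<in>I. X (t + h) w) = distr M (Pi\<^sub>M I (%_. borel)) (%w. \<lambda>t\<in>I. X t w)"
  proof (rule distr_PiM_eqI_continuous[OF I(1)])
   fix f :: "real => 'n phase => real"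
   assume f: "!!t. continuous_on UNIV (f t)" "!!t x. 0 <= f t x" "!!t x. f t x <= 1"
   \<comment> \<open>Reversal over length \<open>S + h\<close> sends \<open>t + h\<close> to
     \<open>S - t\<close>, and so does reversal over length \<open>S\<close> with \<open>t\<close>;
     comparing the two gives shift invariance. The inserted 1 keeps the horizon positive.\<close>
   define S where "S = Max (insert 1 I)"
   have S: "0 < S" "!!t. t : I ==> 0 <= t \<and> t <= S" using I by (auto simp: S_def intro: less_le_trans[OF zero_less_one])
   have inj: "inj_on (%t. t + h) I" by (auto simp: inj_on_def)
   have "(\<integral>\<^sup>+w. ennreal (\<Prod>t\<in>(%t. t + h) ` I. f (t - h) (X t w)) \<partial>M)
    = (\<integral>\<^sup>+w. ennreal (\<Prod>t\<in>(%t. t + h) ` I. f (t - h) (flip (X (S + h - t) w))) \<partial>M)"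
    by (rule reversal_eq[where f="%t. f (t - h)"]) (use I h S f in \<open>auto simp: add_pos_nonneg\<close>)
   hence "(\<integral>\<^sup>+w. ennreal (\<Prod>t\<in>I. f t (X (t + h) w)) \<partial>M) = (\<integral>\<^sup>+w. ennreal (\<Prod>t\<in>I. f t (flip (X (S - t) w))) \<partial>M)"
    by (simp add: prod.reindex[OF inj])
   also have "... = (\<integral>\<^sup>+w. ennreal (\<Prod>t\<in>I. f t (X t w)) \<partial>M)"
    by (rule reversal_eq[OF S(1) I(1) _ f, symmetric]) (use S in auto)
   finally show "(\<integral>\<^sup>+w. ennreal (\<Prod>t\<in>I. f t (X (t + h) w)) \<partial>M) = (\<integral>\<^sup>+w. ennreal (\<Prod>t\<in>I. f t (X t w)) \<partial>M)" .
  qed (use I h in auto)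
 next
  fix T :: real and I :: "real set" assume T: "0 < T" and I: "finite I" "I \<subseteq> {0..T}"
  show "distr M (Pi\<^sub>M I (%_. borel)) (%w. \<lambda>t\<in>I. flip (X (T - t) w)) = distr M (Pi\<^sub>M I (%_. borel)) (%w. \<lambda>t\<in>I. X t w)"
   by (rule distr_PiM_eqI_continuous[OF I(1) _ _ reversal_eq[OF T I, symmetric]])
    (use I in \<open>auto intro!: meas_comp[OF X_measurable flip_measurable] X_measurable\<close>)
 qed
qed

end

section \<open>Small-time behaviour\<close>

lemma dd_Basis: assumes "smooth f" shows "dd v f x = (\<Sum>i\<in>Basis. (v \<bullet> i) * dd i f x)"
proof -
 have "dd (\<Sum>i\<in>Basis. (v \<bullet> i) *R i) f x = (\<Sum>i\<in>Basis. (v \<bullet> i) * dd i f x)"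
  by (simp add: dd_sum_dir[OF assms] dd_scaleR_dir[OF assms])
 thus ?thesis by (simp only: euclidean_representation)
qed

lemma tendsto_dd: assumes f: "smooth f" and "v ----> v0" "x ----> x0" shows "(%n. dd (v n) f (x n)) ----> dd v0 f x0"
proof -
 have c: "(%n. dd i f (x n)) ----> dd i f x0" for i by (rule continuous_on_tendsto_compose[OF smooth_cont[OF smooth_dd[OF f], of UNIV] assms(3)]) auto
 show ?thesis unfolding dd_Basis[OF f, of "v _"] dd_Basis[OF f, of v0] by (intro tendsto_sum tendsto_mult tendsto_inner assms tendsto_const c)
qed

lemma dd_bound: assumes f: "test_function f" obtains L where "0 <= L" "!!v x. \<bar>dd v f x\<bar> <= L * norm v"
proof -
 have "\<exists>B. \<forall>x. \<bar>dd i f x\<bar> <= B" for i using tf_bounded[OF tf_dd[OF f, of i]] by metis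
 then obtain B where B: "!!i x. \<bar>dd i f x\<bar> <= B i" by metis
 have B0: "0 <= B i" for i using B[of i 0] by simp
 have "\<bar>dd v f x\<bar> <= (\<Sum>i\<in>Basis. B i) * norm v" for v x
 proof -
  have "\<bar>dd v f x\<bar> <= (\<Sum>i\<in>Basis. \<bar>(v \<bullet> i) * dd i f x\<bar>)"
   unfolding dd_Basis[OF tf_smooth[OF f], of v x] by (rule sum_abs)
  also have "... <= (\<Sum>i\<in>Basis. norm v * B i)" by (rule sum_mono) (auto simp: abs_mult intro!: mult_mono B Basis_le_norm)
  finally show ?thesis by (simp add: sum_distrib_left mult.commute)
 qed
 thus ?thesis using that[of "\<Sum>i\<in>Basis. B i"] B0 by (simp add: sum_nonneg)
qed

lemma mvt_dd: assumes f: "smooth f" obtains y where "0 < y" "y < 1" "f (x + v) - f x = dd v f (x + y *R v)"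
proof -
 have "\<exists>y>0. y < 1 \<and> f (x + 1 *R v) - f (x + 0 *R v) = (1 - 0) * dd v f (x + y *R v)"
  by (rule MVT2[where f="%s. f (x + s *R v)"]) (auto intro: smooth_DERIV_line[OF f])
 thus ?thesis using that by auto
qed

lemma taylor2_dd: assumes f: "smooth f"
 obtains y where "\<bar>y\<bar> <= \<bar>s\<bar>" "f (x + s *R v) = f x + s * dd v f x + s^2 / 2 * dd v (dd v f) (x + y *R v)"
proof -
 define D where "D m s = (if m = 0 then f (x + s *R v) else if m = 1 then dd v f (x + s *R v) else dd v (dd v f) (x + s *R v))" for m :: nat and s
 have "\<exists>t. \<bar>t\<bar> <= \<bar>s\<bar> \<and> f (x + s *R v) = (\<Sum>m<2. D m 0 / fact m * s ^ m) + D 2 t / fact 2 * s ^ 2"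
 proof (rule Maclaurin_bi_le)
  show "D 0 = (%s. f (x + s *R v))" by (simp add: D_def fun_eq_iff)
  have "DERIV (D m) t :> D (Suc m) t" if "m < 2" for m t
  proof -
   have "m = 0 \<or> m = 1" using that by auto
   thus ?thesis using smooth_DERIV_line[OF f, of x v t] smooth_DERIV_line[OF smooth_dd[OF f, of v], of x v t] by (auto simp: D_def[abs_def])
  qed
  thus "\<forall>m t. m < 2 \<and> \<bar>t\<bar> <= \<bar>s\<bar> \<longrightarrow> DERIV (D m) t :> D (Suc m) t" by blast
 qed
 then obtain t where "\<bar>t\<bar> <= \<bar>s\<bar>" "f (x + s *R v) = (\<Sum>m<2. D m 0 / fact m * s ^ m) + D 2 t / fact 2 * s ^ 2" by blast
 thus ?thesis by (intro that[of t]) (simp_all add: D_def numeral_2_eq_2 power2_eq_square)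
qed

lemma second_dd_bound: assumes f: "test_function f" obtains C where "0 <= C" "!!v x. \<bar>dd v (dd v f) x\<bar> <= C * (norm v)^2"
proof -
 note sm = tf_smooth[OF f]
 have "\<exists>L\<ge>0. \<forall>v x. \<bar>dd v (dd i f) x\<bar> <= L * norm v" for i by (rule dd_bound[OF tf_dd[OF f, of i]]) blast
 then obtain L where L: "!!i. 0 <= L i" "!!i v x. \<bar>dd v (dd i f) x\<bar> <= L i * norm v" by metis
 have "\<bar>dd v (dd v f) x\<bar> <= (\<Sum>i\<in>Basis. L i) * (norm v)^2" for v x
 proof -
  have "dd v f = (%x. \<Sum>i\<in>Basis. (v \<bullet> i) * dd i f x)" using dd_Basis[OF sm] by blast
  hence "dd v (dd v f) x = (\<Sum>i\<in>Basis. (v \<bullet> i) * dd v (dd i f) x)" by (simp add: dd_sum_fun smooth_dd sm)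
  also have "\<bar>...\<bar> <= (\<Sum>i\<in>Basis. \<bar>(v \<bullet> i) * dd v (dd i f) x\<bar>)" by (rule sum_abs)
  also have "... <= (\<Sum>i\<in>Basis. norm v * (L i * norm v))" by (rule sum_mono) (auto simp: abs_mult intro!: mult_mono L Basis_le_norm)
  finally show ?thesis by (simp add: sum_distrib_left sum_distrib_right power2_eq_square mult_ac)
 qed
 thus ?thesis using that[of "\<Sum>i\<in>Basis. L i"] L(1) by (simp add: sum_nonneg)
qed

text \<open>The first-order Taylor term is odd, so only the second-order one survives averaging.\<close>

lemma gauss_average_second_order: fixes f :: "'a::euclidean_space => real" and u :: "'b::euclidean_space => 'a"
 assumes f: "test_function f" and u: "bounded_linear u"
 defines "\<Phi> \<equiv> %s x. (LBINT y. gauss s y * (f (x + u y) - f x)) / s^2" obtains C where "!!s x. 0 < s ==> \<bar>\<Phi> s x\<bar> <= C"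
  "!!s x. s ----> 0 ==> (!!n. 0 < s n) ==> (%n. \<Phi> (s n) x) ----> 1/2 * (\<Sum>k\<in>Basis. dd (u k) (dd (u k) f) x)"
proof -
 note sm = tf_smooth[OF f]
 have fm[measurable]: "f : Borel" by (rule tf_measurable[OF f])
 have um[measurable]: "u : Borel" by (rule borel_contI[OF linear_continuous_on[OF u]])
 obtain C where C: "0 <= C" "!!v x. \<bar>dd v (dd v f) x\<bar> <= C * (norm v)^2" by (rule second_dd_bound[OF f]) blast
 obtain g where g: "0 < g" "!!y. norm (u y) <= norm y * g" using bounded_linear.pos_bounded[OF u] by blast
 have lin: "linear u" by (rule bounded_linear.linear[OF u])
 define e where "e = u"
 have du: "dd (u y) h x = (\<Sum>k\<in>Basis. (y \<bullet> k) * dd (e k) h x)" if "smooth h" for h y x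
 proof -
  have "u y = (\<Sum>k\<in>Basis. (y \<bullet> k) *R e k)"
   using linear_sum[OF lin, of "%k. (y \<bullet> k) *R k" Basis] by (simp add: euclidean_representation linear_scale[OF lin] e_def)
  thus ?thesis by (simp add: dd_sum_dir[OF that] dd_scaleR_dir[OF that])
 qed
 have int1: "integrable lborel (%y::'b. gauss 1 y * (y \<bullet> k))" for k
 proof (rule int_bound[OF integrable_mult_right[OF int_gauss_norm_power[of 1], of "norm k"]])
  show "AE y::'b in lborel. norm (gauss 1 y * (y \<bullet> k)) <= norm (norm k * (gauss 1 y * norm y ^ 1))"
  proof (rule AE_I2)
   fix y :: 'b
   have "gauss 1 y * \<bar>y \<bullet> k\<bar> <= gauss 1 y * (norm y * norm k)" by (intro mult_left_mono Cauchy_Schwarz_ineq2 gauss_nonneg)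
   thus "norm (gauss 1 y * (y \<bullet> k)) <= norm (norm k * (gauss 1 y * norm y ^ 1))" by (simp add: abs_mult gauss_nonneg mult_ac)
  qed
 qed simp
 have int2: "integrable lborel (%y::'b. gauss 1 y * ((y \<bullet> k) * (y \<bullet> j)))" if "k : Basis" "j : Basis" for k j
 proof (rule int_bound[OF int_gauss_norm_power[of 2]])
  show "AE y::'b in lborel. norm (gauss 1 y * ((y \<bullet> k) * (y \<bullet> j))) <= norm (gauss 1 y * norm y ^ 2)"
  proof (rule AE_I2)
   fix y :: 'b
   have "\<bar>y \<bullet> k\<bar> * \<bar>y \<bullet> j\<bar> <= norm y * norm y" by (intro mult_mono Basis_le_norm that) auto
   thus "norm (gauss 1 y * ((y \<bullet> k) * (y \<bullet> j))) <= norm (gauss 1 y * norm y ^ 2)"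
    by (simp add: abs_mult gauss_nonneg mult_left_mono power2_eq_square)
  qed
 qed simp
 have first: "(LBINT y. gauss 1 y * dd (u y) f x) = 0" "integrable lborel (%y. gauss 1 y * dd (u y) f x)" for x
 proof -
  have "(%y. gauss 1 y * dd (u y) f x) = (%y. \<Sum>k\<in>Basis. (gauss 1 y * (y \<bullet> k)) * dd (e k) f x)"
   by (simp add: fun_eq_iff du[OF sm] sum_distrib_left mult_ac)
  thus "integrable lborel (%y. gauss 1 y * dd (u y) f x)" by (simp only:) (intro int_sum integrable_mult_left int1)
  have m: "(%y. gauss 1 y * dd (u y) f x): Borel" using borel_intI[OF \<open>integrable lborel (%y. gauss 1 y * dd (u y) f x)\<close>] by simp
  have "dd (u (- y)) f x = - dd (u y) f x" for y by (simp add: du[OF sm] sum_negf)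
  thus "(LBINT y. gauss 1 y * dd (u y) f x) = 0" using integral_uminus_arg[OF m] by (simp add: gauss_uminus)
 qed
 have second: "(LBINT y. gauss 1 y * (1/2 * dd (u y) (dd (u y) f) x)) = 1/2 * (\<Sum>k\<in>Basis. dd (e k) (dd (e k) f) x)" for x
 proof -
  have "dd (u y) (dd (u y) f) x = (\<Sum>k\<in>Basis. \<Sum>j\<in>Basis. ((y \<bullet> k) * (y \<bullet> j)) * dd (e j) (dd (e k) f) x)" for y
  proof -
   have "dd (u y) f = (%x. \<Sum>k\<in>Basis. (y \<bullet> k) * dd (e k) f x)" using du[OF sm] by blast
   hence "dd (u y) (dd (u y) f) x = (\<Sum>k\<in>Basis. (y \<bullet> k) * dd (u y) (dd (e k) f) x)" by (simp add: dd_sum_fun smooth_dd sm)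
   thus ?thesis by (simp add: du[OF smooth_dd[OF sm]] sum_distrib_left mult_ac)
  qed
  hence "(%y. gauss 1 y * (1/2 * dd (u y) (dd (u y) f) x)) = (%y. \<Sum>k\<in>Basis. \<Sum>j\<in>Basis. (gauss 1 y * ((y \<bullet> k) * (y \<bullet> j))) * (1/2 * dd (e j) (dd (e k) f) x))"
   by (simp add: fun_eq_iff sum_distrib_left mult_ac)
  hence "(LBINT y. gauss 1 y * (1/2 * dd (u y) (dd (u y) f) x))
   = (\<Sum>k\<in>Basis. \<Sum>j\<in>Basis. (LBINT y. (gauss 1 y * ((y \<bullet> k) * (y \<bullet> j))) * (1/2 * dd (e j) (dd (e k) f) x)))"
   by (simp only:) (subst lint_sum, intro int_sum integrable_mult_left int2, assumption+,
    intro sum.cong refl lint_sum integrable_mult_left int2)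
  also have "... = (\<Sum>k\<in>Basis. \<Sum>j\<in>Basis. (if k = j then 1 else 0) * (1/2 * dd (e j) (dd (e k) f) x))"
   by (intro sum.cong refl) (simp add: integral_gauss_second_moment)
  also have "... = (\<Sum>k\<in>Basis. 1/2 * dd (e k) (dd (e k) f) x)"
  proof (intro sum.cong refl)
   fix k :: 'b assume k: "k : Basis"
   have "(\<Sum>j\<in>Basis. (if k = j then 1 else 0) * (1/2 * dd (e j) (dd (e k) f) x))
    = (\<Sum>j\<in>Basis. if k = j then 1/2 * dd (e j) (dd (e k) f) x else 0)" by (intro sum.cong) auto
   also have "... = 1/2 * dd (e k) (dd (e k) f) x" using k by (subst sum.delta') auto
   finally show "(\<Sum>j\<in>Basis. (if k = j then 1 else 0) * (1/2 * dd (e j) (dd (e k) f) x)) = 1/2 * dd (e k) (dd (e k) f) x" .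
  qed
  finally show ?thesis by (simp add: sum_distrib_left)
 qed
 \<comment> \<open>The Taylor remainder after removal of the odd term, scaled by \<open>s^2\<close>;
   it is bounded by a multiple of \<open>(norm y)^2\<close> uniformly in \<open>s\<close> and
   \<open>x\<close>.\<close>
 define r where "r s x y = (f (x + s *R u y) - f x - s * dd (u y) f x) / s^2" for s x y
 have r_bound: "\<bar>r s x y\<bar> <= (C * g^2 / 2) * norm y ^ 2" if "0 < s" for s x y
 proof -
  obtain z where z: "f (x + s *R u y) = f x + s * dd (u y) f x + s^2 / 2 * dd (u y) (dd (u y) f) (x + z *R u y)"
   by (rule taylor2_dd[OF sm, of s x "u y"]) blast
  have "\<bar>r s x y\<bar> = \<bar>dd (u y) (dd (u y) f) (x + z *R u y)\<bar> / 2" using that by (simp add: r_def z)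
  also have "... <= C * (norm (u y))^2 / 2" using C(2) by (intro divide_right_mono) auto
  also have "... <= C * (norm y * g)^2 / 2" using C(1) g(2) by (intro divide_right_mono mult_left_mono power_mono) auto
  finally show ?thesis by (simp add: power_mult_distrib mult_ac)
 qed
 have rm: "(%y. gauss 1 y * r s x y): Borel" for s x
 proof -
  have "(%y. dd (u y) f x): Borel" unfolding du[OF sm] by measurable
  thus ?thesis unfolding r_def by measurable
 qed
 have ib: "integrable lborel (%y::'b. gauss 1 y * ((C * g^2 / 2) * norm y ^ 2))"
  using integrable_mult_right[OF int_gauss_norm_power[of 2, where 'a='b], of "C * g^2 / 2"] by (simp add: mult_ac)
 have rb: "norm (gauss 1 y * r s x y) <= gauss 1 y * ((C * g^2 / 2) * norm y ^ 2)" if "0 < s" for s x y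
  using mult_left_mono[OF r_bound[OF that] gauss_nonneg] by (simp only: real_norm_def abs_mult abs_of_nonneg[OF gauss_nonneg])
 have ri: "integrable lborel (%y. gauss 1 y * r s x y)" if "0 < s" for s x
  by (rule int_bound[OF ib]) (use rm order.trans[OF rb[OF that] abs_ge_self] in auto)
 have \<Phi>: "\<Phi> s x = (LBINT y. gauss 1 y * r s x y)" if s: "0 < s" for s x
 proof -
  have "(LBINT y. gauss s y * (f (x + u y) - f x)) = (LBINT y. gauss 1 y * (f (x + u (s *R y)) - f x))"
   by (rule integral_gauss_scale[OF s]) measurable
  also have "... = (LBINT y. s^2 * (gauss 1 y * r s x y) + s * (gauss 1 y * dd (u y) f x))"
   using s by (intro lint_cong) (simp_all add: r_def linear_scale[OF lin] field_simps)
  also have "... = s^2 * (LBINT y. gauss 1 y * r s x y)" by (simp add: lint_add ri[OF s] first)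
  finally show ?thesis using s by (simp add: \<Phi>_def)
 qed
 show ?thesis
 proof (rule that)
  show "\<bar>\<Phi> s x\<bar> <= (LBINT y. gauss 1 (y::'b) * ((C * g^2 / 2) * norm y ^ 2))" if "0 < s" for s x
  proof -
   have "\<bar>\<Phi> s x\<bar> <= (LBINT y. norm (gauss 1 y * r s x y))"
    unfolding \<Phi>[OF that] using Bochner_Integration.integral_norm_bound[of lborel "%y. gauss 1 y * r s x y"] by simp
   also have "... <= (LBINT y. gauss 1 (y::'b) * ((C * g^2 / 2) * norm y ^ 2))"
    by (rule Bochner_Integration.integral_mono[OF integrable_norm[OF ri[OF that]] ib rb[OF that]])
   finally show ?thesis .
  qed
  fix s :: "nat => real" and x assume s0: "s ----> 0" and s: "!!n. 0 < s n"
  have "(%n. LBINT y. gauss 1 y * r (s n) x y) ----> (LBINT y. gauss 1 y * (1/2 * dd (u y) (dd (u y) f) x))"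
  proof (rule int_dct[OF _ _ ib])
   show "(%y. gauss 1 y * r (s n) x y): borel_measurable lborel" for n using rm by simp
   show "AE y in lborel. norm (gauss 1 y * r (s n) x y) <= gauss 1 y * ((C * g^2 / 2) * norm y ^ 2)" for n using rb[OF s] by simp
   have lim: "(%n. r (s n) x y) ----> 1/2 * dd (u y) (dd (u y) f) x" for y
   proof -
    have "\<exists>z. \<bar>z\<bar> <= \<bar>s n\<bar> \<and> f (x + s n *R u y) = f x + s n * dd (u y) f x + (s n)^2 / 2 * dd (u y) (dd (u y) f) (x + z *R u y)" for n
     by (rule taylor2_dd[OF sm, of "s n" x "u y"]) blast
    then obtain z where z: "!!n. \<bar>z n\<bar> <= \<bar>s n\<bar>"
     "!!n. f (x + s n *R u y) = f x + s n * dd (u y) f x + (s n)^2 / 2 * dd (u y) (dd (u y) f) (x + z n *R u y)" by metis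
    have eq: "r (s n) x y = 1/2 * dd (u y) (dd (u y) f) (x + z n *R u y)" for n using s[of n] by (simp add: r_def z(2))
    have "z ----> 0" by (rule tendsto_rabs_zero_cancel, rule tendsto_sandwich[OF _ _ tendsto_const tendsto_rabs_zero[OF s0]]) (auto simp: z(1))
    hence "(%n. x + z n *R u y) ----> x + 0 *R u y" by (intro tendsto_intros)
    hence "(%n. 1/2 * dd (u y) (dd (u y) f) (x + z n *R u y)) ----> 1/2 * dd (u y) (dd (u y) f) (x + 0 *R u y)"
     by (intro tendsto_mult tendsto_const tendsto_dd smooth_dd sm)
    thus ?thesis unfolding eq by simp
   qed
   thus "AE y in lborel. (%n. gauss 1 y * r (s n) x y) ----> gauss 1 y * (1/2 * dd (u y) (dd (u y) f) x)" by (intro AE_I2 tendsto_mult tendsto_const)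
   have "(%y. 1/2 * dd (u y) (dd (u y) f) x): Borel"
    by (rule borel_measurable_LIMSEQ_real[OF lim]) (use rm[of "s _" x] in \<open>simp add: r_def du[OF sm]\<close>)
   thus "(%y. gauss 1 y * (1/2 * dd (u y) (dd (u y) f) x)): borel_measurable lborel" by measurable
  qed
  thus "(%n. \<Phi> (s n) x) ----> 1/2 * (\<Sum>k\<in>Basis. dd (u k) (dd (u k) f) x)" unfolding second by (simp add: \<Phi>[OF s] e_def)
 qed
qed

section \<open>Tail bounds for the Brownian path over short times\<close>

context brownian_motion
begin

text \<open>The fourth moment gives order \<open>(t - s)^2\<close>, which stays negligible after
  division by the time step; the second moment would give order \<open>t - s\<close> only.\<close>

lemma prob_increment_gt: assumes s: "0 <= s" "s < t" and a: "0 < a"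
 shows "prob {w : space M. a < norm (B t w - B s w)} <= (LBINT y. gauss 1 (y :: real ^ 'n) * norm y ^ 4) * (t - s)^2 / a ^ 4"
proof -
 define r where "r = sqrt (t - s)"
 have r: "0 < r" "r ^ 4 = (t - s)^2" using s real_sqrt_pow2[of "t - s"] by (simp_all add: r_def power4_eq_xxxx power2_eq_square)
 let ?I = "%y::real ^ 'n. indicator {y. a < norm y} y :: real"
 have Im[measurable]: "?I : Borel" by measurable
 have D[measurable]: "(%w. B t w - B s w): borel_measurable M" using B_measurable[of s] B_measurable[of t] s by simp
 have ig: "integrable lborel (%y. gauss r y * ?I y)" by (rule int_mult_bounded[OF int_gauss[OF r(1)], where B=1]) (auto simp: indicator_def)
 have "ennreal (prob {w : space M. a < norm (B t w - B s w)}) = emeasure M {w : space M. a < norm (B t w - B s w)}" by (simp add: emeasure_eq_measure)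
 also have "... = (\<integral>\<^sup>+w. ennreal (?I (B t w - B s w)) \<partial>M)"
 proof -
  have "{w : space M. a < norm (B t w - B s w)} : sets M" by measurable
  hence "emeasure M {w : space M. a < norm (B t w - B s w)} = (\<integral>\<^sup>+w. indicator {w : space M. a < norm (B t w - B s w)} w \<partial>M)"
   by (rule nn_integral_indicator[symmetric])
  also have "... = (\<integral>\<^sup>+w. ennreal (?I (B t w - B s w)) \<partial>M)" by (intro nn_integral_cong) (simp add: indicator_def)
  finally show ?thesis .
 qed
 also have "... = (\<integral>\<^sup>+w. (NN y. ennreal (?I y) * ennreal (gauss r y)) \<partial>M)"
  using nn_increment[OF s, of "%z. ennreal (?I (snd z))"] unfolding r_def by simp
 also have "... = (NN y. ennreal (gauss r y * ?I y))" by (simp add: emeasure_space_1 ennreal_mult gauss_nonneg mult.commute)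
 also have "... = ennreal (LBINT y. gauss r y * ?I y)" by (rule nn_integral_eq_integral[OF ig]) (simp add: gauss_nonneg)
 also have "(LBINT y. gauss r y * ?I y) = (LBINT y. gauss 1 y * ?I (r *R y))" by (rule integral_gauss_scale[OF r(1)]) simp
 also have "... <= (LBINT y. (r ^ 4 / a ^ 4) * (gauss 1 (y :: real ^ 'n) * norm y ^ 4))"
 proof (rule Bochner_Integration.integral_mono)
  show "integrable lborel (%y. gauss 1 y * ?I (r *R y))" by (rule int_mult_bounded[OF int_gauss, where B=1]) (auto simp: indicator_def)
  show "integrable lborel (%y. (r ^ 4 / a ^ 4) * (gauss 1 (y :: real ^ 'n) * norm y ^ 4))" by (intro integrable_mult_right int_gauss_norm_power)
  fix y :: "real ^ 'n"
  have "?I (r *R y) <= (r * norm y) ^ 4 / a ^ 4"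
  proof (cases "a < norm (r *R y)")
   case True
   hence "a ^ 4 <= (r * norm y) ^ 4" using a r by (intro power_mono) auto
   thus ?thesis using True a by (simp add: field_simps)
  qed simp
  from mult_left_mono[OF this gauss_nonneg] show "gauss 1 y * ?I (r *R y) <= (r ^ 4 / a ^ 4) * (gauss 1 y * norm y ^ 4)"
   by (simp add: power_mult_distrib mult_ac)
 qed
 also have "... = (LBINT y. gauss 1 (y :: real ^ 'n) * norm y ^ 4) * (t - s)^2 / a ^ 4" by (simp add: r(2))
 finally have "ennreal (prob {w : space M. a < norm (B t w - B s w)}) <= ennreal ((LBINT y. gauss 1 (y :: real ^ 'n) * norm y ^ 4) * (t - s)^2 / a ^ 4)"
  by (simp add: ennreal_leI)
 thus ?thesis by (subst (asm) ennreal_le_iff) (auto intro!: divide_nonneg_nonneg mult_nonneg_nonneg Bochner_Integration.integral_nonneg simp: gauss_nonneg)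
qed

text \<open>Ottaviani's inequality, by decomposition at the first time the walk leaves the large ball.\<close>

lemma ottaviani: assumes t: "0 < t" and a: "0 < a" and N: "0 < N"
  and half: "!!s. 0 <= s ==> s < t ==> prob {y : space M. a < norm (B t y - B s y)} <= 1/2"
 shows "prob {y : space M. \<exists>k\<le>N. 2 * a < norm (B (real k * (t / real N)) y - B 0 y)} <= 2 * prob {y : space M. a < norm (B t y - B 0 y)}"
proof -
 define h where "h = t / real N"
 have h: "0 < h" "real N * h = t" using t N by (simp_all add: h_def)
 have kh: "0 <= real k * h" "k <= N ==> real k * h <= t" for k using h mult_right_mono[of "real k" "real N" h] by simp_all
 define S where "S k y = norm (B (real k * h) y - B 0 y)" for k y
 define A where "A k = {y : space M. 2 * a < S k y \<and> (\<forall>j<k. S j y <= 2 * a)}" for k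
 have SF: "S j : borel_measurable (F (real k * h))" if "j <= k" for j k
 proof -
  have "real j * h <= real k * h" using that h by (intro mult_right_mono) auto
  from F_measurable_mono[OF kh(1) this B_adapted[OF kh(1)]] F_measurable_mono[OF order_refl kh(1) B_adapted[OF order_refl]]
  show ?thesis unfolding S_def by simp
 qed
 have AF: "A k : sets (F (real k * h))" for k
 proof -
  note [measurable] = SF[of _ k]
  have "A k = {y : space (F (real k * h)). 2 * a < S k y \<and> (\<forall>j\<in>{..<k}. S j y <= 2 * a)}"
   using F_sets(2)[OF kh(1)] by (auto simp: A_def)
  also have "... : sets (F (real k * h))"
   by (intro sets.sets_Collect_conj sets.sets_Collect_finite_All borel_measurable_less borel_measurable_le SF) auto
  finally show ?thesis .
 qed
 have AM: "A k : sets M" for k using AF F_sets(1)[OF kh(1)] by blast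
 have disj: "disjoint_family_on A {..N}" unfolding disjoint_family_on_def A_def by (auto simp: not_less) (metis linorder_neqE_nat not_less)
 have Dm[measurable]: "(%y. B t y - B s y): borel_measurable M" if "0 <= s" for s using B_measurable[OF that] B_measurable[of t] t by simp
 define G where "G = {y : space M. a < norm (B t y - B 0 y)}"
 have Gm: "G : sets M" unfolding G_def using Dm[of 0] by measurable
 have step: "prob (A k) <= 2 * prob (A k \<inter> G)" if k: "k <= N" for k
 proof -
  let ?D = "%y. B t y - B (real k * h) y"
  \<comment> \<open>Once the walk has left the ball of radius \<open>2 * a\<close>, a remaining
    increment of size at most \<open>a\<close> keeps its endpoint outside the ball of radius
    \<open>a\<close>; that increment is independent of the exit.\<close>
  define C where "C = {y : space M. norm (?D y) <= a}"
  have Cm: "C : sets M" unfolding C_def using Dm[OF kh(1)] by measurable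
  have Ceq: "C = ?D -` cball 0 a \<inter> space M" by (auto simp: C_def)
  have ind: "prob (A k \<inter> C) = prob (A k) * prob C"
   using B_indep[OF kh(1) kh(2)[OF k]] AF[of k] unfolding Ceq by (intro indep_setD) (auto simp: in_vimage_algebra)
  have pC: "1/2 <= prob C"
  proof -
   have "prob {y : space M. a < norm (?D y)} <= 1/2"
   proof (cases "real k * h < t")
    case False
    hence "real k * h = t" using kh(2)[OF k] by simp
    thus ?thesis using a by simp
   qed (rule half[OF kh(1)])
   moreover have "{y : space M. a < norm (?D y)} = space M - C" by (auto simp: C_def)
   ultimately show ?thesis using prob_compl[OF Cm] by simp
  qed
  have "A k \<inter> C \<subseteq> A k \<inter> G"
  proof
   fix y assume w: "y : A k \<inter> C"
   have "norm (B (real k * h) y - B 0 y) <= norm (B t y - B 0 y) + norm (?D y)" using norm_triangle_ineq4[of "B t y - B 0 y" "?D y"] by simp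
   thus "y : A k \<inter> G" using w by (auto simp: A_def S_def C_def G_def)
  qed
  hence "prob (A k \<inter> C) <= prob (A k \<inter> G)" using AM Gm by (intro finite_measure_mono) auto
  moreover have "prob (A k) * (1/2) <= prob (A k) * prob C" using pC by (intro mult_left_mono) auto
  ultimately show ?thesis using ind by simp
 qed
 have "{y : space M. \<exists>k\<le>N. 2 * a < S k y} \<subseteq> (\<Union>k\<le>N. A k)"
 proof
  fix y assume w: "y : {y : space M. \<exists>k\<le>N. 2 * a < S k y}"
  then obtain k where k: "k <= N" "2 * a < S k y" by auto
  define m where "m = (LEAST k. 2 * a < S k y)"
  have "2 * a < S m y" unfolding m_def by (rule LeastI[of _ k]) (rule k)
  moreover have "m <= k" unfolding m_def by (rule Least_le) (rule k)
  moreover have "S j y <= 2 * a" if "j < m" for j using not_less_Least[of j "%k. 2 * a < S k y"] that by (simp add: m_def)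
  ultimately show "y : (\<Union>k\<le>N. A k)" using w k by (auto simp: A_def)
 qed
 hence "prob {y : space M. \<exists>k\<le>N. 2 * a < S k y} <= prob (\<Union>k\<le>N. A k)" using AM by (intro finite_measure_mono) auto
 also have "... = (\<Sum>k\<le>N. prob (A k))" by (rule finite_measure_finite_Union) (use AM disj in auto)
 also have "... <= (\<Sum>k\<le>N. 2 * prob (A k \<inter> G))" by (rule sum_mono) (use step in auto)
 also have "... = 2 * prob (\<Union>k\<le>N. A k \<inter> G)"
 proof -
  have "prob (\<Union>k\<le>N. A k \<inter> G) = (\<Sum>k\<le>N. prob (A k \<inter> G))"
   by (rule finite_measure_finite_Union) (use AM Gm disj in \<open>auto simp: disjoint_family_on_def\<close>)
  thus ?thesis by (simp add: sum_distrib_left)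
 qed
 also have "prob (\<Union>k\<le>N. A k \<inter> G) <= prob G" using Gm by (intro finite_measure_mono) auto
 finally show ?thesis by (simp add: S_def G_def h_def)
qed

text \<open>Dyadic grids are nested, so the event is a countable increasing union to which the
  maximal inequality passes; continuity recovers the times off the grids.\<close>

definition excursion :: "real => 'w set" where
 "excursion t = {w : space M. \<exists>n. \<exists>k\<le>2 ^ n. 1 < norm (B (real k * (t / 2 ^ n)) w - B 0 w)}"

lemma grid_event: "0 < t ==> {w : space M. \<exists>k\<le>(N::nat). c < norm (B (real k * (t / real N)) w - B 0 w)} : sets M"
proof -
 assume t: "0 < t"
 have [measurable]: "B (real k * (t / real N)): borel_measurable M" "B 0 : borel_measurable M" for k using t by (auto intro!: B_measurable)
 have "{w : space M. \<exists>k\<in>{..N}. c < norm (B (real k * (t / real N)) w - B 0 w)} : sets M" by measurable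
 thus ?thesis by (simp only: Bex_def atMost_iff)
qed

lemma excursion_bound: obtains C t0 where "0 < t0" "!!t. 0 < t ==> t <= t0 ==> prob (excursion t) <= C * t^2"
proof -
 \<comment> \<open>The factor 16 is the fourth power of the inverse of the level 1/2.\<close>
 define K where "K = (LBINT y. gauss 1 (y :: real ^ 'n) * norm y ^ 4) * 16"
 have K: "0 <= K" by (auto simp: K_def gauss_nonneg intro!: Bochner_Integration.integral_nonneg)
 have inc: "prob {w : space M. 1/2 < norm (B t w - B s w)} <= K * (t - s)^2" if "0 <= s" "s < t" for s t
  using prob_increment_gt[OF that, of "1/2"] by (simp add: K_def power_one_over)
 \<comment> \<open>Small enough that \<open>K * t0 <= 1/2\<close> and
   \<open>(t - s)^2 <= t0\<close>: every increment then exceeds 1/2 with probability at most 1/2, as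
   \<open>ottaviani\<close> demands.\<close>
 define t0 where "t0 = min 1 (1 / (2 * (K + 1)))"
 have t0: "0 < t0" "t0 <= 1" "K * t0 <= 1/2"
 proof -
  show "0 < t0" "t0 <= 1" using K by (auto simp: t0_def)
  have "K * t0 <= K * (1 / (2 * (K + 1)))" using K by (intro mult_left_mono) (auto simp: t0_def)
  also have "... <= 1/2" using K by (simp add: field_simps)
  finally show "K * t0 <= 1/2" .
 qed
 show ?thesis
 proof (rule that[OF t0(1), of "2 * K"])
  fix t :: real assume t: "0 < t" "t <= t0"
  define E where "E n = {w : space M. \<exists>k\<le>2 ^ n. 1 < norm (B (real k * (t / 2 ^ n)) w - B 0 w)}" for n :: nat
  have Em: "E n : sets M" for n using grid_event[OF t(1), of "2 ^ n" 1] unfolding E_def of_nat_power of_nat_numeral .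
  have bound: "prob (E n) <= 2 * K * t^2" for n
  proof -
   have "prob {w : space M. \<exists>k\<le>2 ^ n. 2 * (1/2) < norm (B (real k * (t / real (2 ^ n))) w - B 0 w)}
    <= 2 * prob {w : space M. 1/2 < norm (B t w - B 0 w)}"
   proof (rule ottaviani[OF t(1)])
    fix s assume s: "0 <= s" "s < t"
    have "(t - s)^2 <= t0 * 1" unfolding power2_eq_square using s t t0 by (intro mult_mono) auto
    hence "K * (t - s)^2 <= K * t0" using K by (intro mult_left_mono) auto
    thus "prob {w : space M. 1/2 < norm (B t w - B s w)} <= 1/2" using inc[OF s] t0 by simp
   qed simp_all
   also have "... <= 2 * (K * t^2)" using inc[of 0 t] t by simp
   finally show ?thesis by (simp add: E_def)
  qed
  have "incseq E"
  proof (rule incseq_SucI)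
   fix n show "E n \<subseteq> E (Suc n)"
   proof
    fix w assume "w : E n"
    then obtain k where "w : space M" "k <= 2 ^ n" "1 < norm (B (real k * (t / 2 ^ n)) w - B 0 w)" by (auto simp: E_def)
    thus "w : E (Suc n)" unfolding E_def by (intro CollectI conjI exI[of _ "2 * k"]) auto
   qed
  qed
  hence "(%n. prob (E n)) ----> prob (\<Union>n. E n)" using Em by (intro finite_Lim_measure_incseq) auto
  hence "prob (\<Union>n. E n) <= 2 * K * t^2" by (rule LIMSEQ_le_const2) (use bound in auto)
  moreover have "(\<Union>n. E n) = excursion t" by (auto simp: E_def excursion_def)
  ultimately show "prob (excursion t) <= 2 * K * t^2" by simp
 qed
qed

lemma excursion_measurable: "0 < t ==> excursion t : sets M"
proof -
 assume t: "0 < t"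
 have "excursion t = (\<Union>n. {w : space M. \<exists>k\<le>2 ^ n. 1 < norm (B (real k * (t / real (2 ^ n))) w - B 0 w)})"
  by (auto simp: excursion_def)
 also have "... : sets M" by (intro sets.countable_UN image_subsetI grid_event[OF t])
 finally show ?thesis .
qed

text \<open>Indices rounded down on the dyadic grids converge to \<open>s\<close>, so the bound on
  the grids extends by continuity of the path.\<close>

lemma not_excursion: assumes "w : space M" "w \<notin> excursion t" "0 < t" "continuous_on {0..} (%t. B t w)" "0 <= s" "s <= t"
 shows "norm (B s w - B 0 w) <= 1"
proof -
 define k where "k N = nat \<lfloor>s * real N / t\<rfloor>" for N
 have k: "k N <= N" "(%N. real (k N) * (t / real N)) ----> s" for N unfolding k_def by (rule grid_index_tendsto[OF assms(3,5,6)])+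
 have "strict_mono (%n::nat. 2 ^ n :: nat)" by (simp add: strict_mono_def)
 from LIMSEQ_subseq_LIMSEQ[OF k(2) this] have "(%n. real (k (2 ^ n)) * (t / 2 ^ n)) ----> s" by (simp add: comp_def)
 hence "(%n. B (real (k (2 ^ n)) * (t / 2 ^ n)) w) ----> B s w" by (rule continuous_on_tendsto_compose[OF assms(4)]) (use assms in auto)
 hence "(%n. norm (B (real (k (2 ^ n)) * (t / 2 ^ n)) w - B 0 w)) ----> norm (B s w - B 0 w)" by (intro tendsto_norm tendsto_diff tendsto_const)
 thus ?thesis
 proof (rule LIMSEQ_le_const2)
  show "\<exists>N. \<forall>n\<ge>N. norm (B (real (k (2 ^ n)) * (t / 2 ^ n)) w - B 0 w) <= 1"
   using assms(1,2) k(1) unfolding excursion_def by (auto simp: not_less)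
 qed
qed

end

text \<open>A first-exit argument: while position and momentum stay in the enlarged balls, both
  integrals grow at rate at most \<open>C\<close>, and \<open>C * t < 1\<close> rules out a first
  time at which the margin is used up.\<close>

lemma short_time_confinement: fixes b G :: "'a::euclidean_space => 'a"
 assumes b: "continuous_on UNIV b" and G: "bounded_linear G" and r: "0 <= r" "0 <= c"
 obtains t0 C where "0 < t0" "!!q p W t. 0 < t ==> t <= t0 ==> continuous_on {0..t} q ==> continuous_on {0..t} p ==>
   norm (q 0) <= r ==> norm (p 0) <= r ==> (!!s. s : {0..t} ==> norm (W s) <= c) ==>
   (!!s. s : {0..t} ==> q s = q 0 + integral {0..s} p) ==>
   (!!s. s : {0..t} ==> p s = p 0 + integral {0..s} (%s. b (q s) - G (p s)) + W s) ==>
   norm (integral {0..t} p) <= C * t \<and> norm (integral {0..t} (%s. b (q s) - G (p s))) <= C * t"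
proof -
 define P where "P = r + c + 1"
 have "bounded ((%z. b (fst z) - G (snd z)) ` (cball 0 (r + 1) \<times> cball 0 P))"
  by (intro compact_imp_bounded compact_continuous_image compact_Times compact_cball continuous_on_diff
   cont_comp[OF b] cont_comp[OF linear_continuous_on[OF G, of UNIV]] continuous_on_fst continuous_on_snd continuous_on_id) auto
 then obtain C0 where C0: "!!x y. norm x <= r + 1 ==> norm y <= P ==> norm (b x - G y) <= C0" unfolding bounded_iff by force
 define C where "C = max (max C0 P) 1"
 have C: "1 <= C" "P <= C" "C0 <= C" by (auto simp: C_def)
 define t0 where "t0 = 1 / (2 * C)"
 have t0: "0 < t0" using C by (simp add: t0_def)
 show ?thesis
 proof (rule that[OF t0, of C])
  fix q p W :: "real => 'a" and t
  assume t: "0 < t" "t <= t0" and qc: "continuous_on {0..t} q" and pc: "continuous_on {0..t} p"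
   and q0: "norm (q 0) <= r" and p0: "norm (p 0) <= r" and W: "!!s. s : {0..t} ==> norm (W s) <= c"
   and qe: "!!s. s : {0..t} ==> q s = q 0 + integral {0..s} p" and pe: "!!s. s : {0..t} ==> p s = p 0 + integral {0..s} (%s. b (q s) - G (p s)) + W s"
  have Ct: "C * t < 1"
  proof -
   have "C * t <= C * t0" using t C by (intro mult_left_mono) auto
   thus ?thesis using C by (simp add: t0_def)
  qed
  have fc: "continuous_on {0..t} (%s. b (q s) - G (p s))"
   by (intro continuous_on_diff cont_comp[OF b qc] cont_comp[OF linear_continuous_on[OF G, of UNIV] pc]) auto
  have Ib: "norm (integral {0..s} p) <= C * s \<and> norm (integral {0..s} (%s. b (q s) - G (p s))) <= C * s"
   if s: "s : {0..t}" and in_ball: "!!u. u : {0..s} ==> norm (q u) <= r + 1 \<and> norm (p u) <= P" for s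
  proof -
   have sub: "{0..s} \<subseteq> {0..t}" using s by auto
   have "norm (integral {0..s} p) <= C * (s - 0)"
    by (rule integral_bound) (use s in_ball C continuous_on_subset[OF pc sub] in \<open>auto intro: order.trans\<close>)
   moreover have "norm (integral {0..s} (%s. b (q s) - G (p s))) <= C * (s - 0)"
    by (rule integral_bound) (use s in_ball C C0 continuous_on_subset[OF fc sub] in \<open>auto intro: order.trans\<close>)
   ultimately show ?thesis by simp
  qed
  \<comment> \<open>The larger share of the margins used by position and momentum; the bound
    \<open>c\<close> on the noise is charged to the momentum, so the exit threshold is one for
    both.\<close>
  define n where "n s = max (norm (q s) - r) (norm (p s) - r - c)" for s
  have nc: "continuous_on {0..t} n" unfolding n_def by (intro continuous_intros qc pc)
  have n1: "n s <= 1 \<longleftrightarrow> norm (q s) <= r + 1 \<and> norm (p s) <= P" for s by (auto simp: n_def P_def)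
  have all: "n s < 1" if s: "s : {0..t}" for s
  proof (rule ccontr)
   assume "\<not> n s < 1"
   \<comment> \<open>Its least element \<open>w\<close> is the first exit time, attained because
     \<open>Z\<close> is compact.\<close>
   define Z where "Z = {u : {0..s}. 1 <= n u}"
   have "closed Z" unfolding Z_def by (intro continuous_on_closed_Collect_le[OF continuous_on_const continuous_on_subset[OF nc]]) (use s in auto)
   moreover have "bounded Z" by (rule bounded_subset[of "{0..s}"]) (auto simp: Z_def)
   ultimately have "compact Z" by (simp add: compact_eq_bounded_closed)
   moreover have "s : Z" using s \<open>\<not> n s < 1\<close> by (auto simp: Z_def)
   ultimately obtain w where w: "w : Z" "!!u. u : Z ==> w <= u" using compact_attains_inf[of Z] by blast
   have wt: "w : {0..t}" "1 <= n w" "w <= s" using w(1) s by (auto simp: Z_def)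
   have before: "n u < 1" if "u : {0..<w}" for u using w(2)[of u] that wt by (force simp: Z_def)
   have n0: "n 0 < 1" using q0 p0 r by (simp add: n_def)
   hence w0: "0 < w" using wt by (cases "w = 0") auto
   have "n w <= 1"
   proof -
    have "closure {0..<w} \<subseteq> {u : {0..t}. n u <= 1}"
    proof (rule closure_minimal)
     show "closed {u : {0..t}. n u <= 1}" by (rule continuous_on_closed_Collect_le[OF nc continuous_on_const]) simp
    qed (use before wt in \<open>auto intro: less_imp_le\<close>)
    moreover have "w : closure {0..<w}" using w0 by simp
    ultimately show ?thesis by blast
   qed
   with before have "norm (q u) <= r + 1 \<and> norm (p u) <= P" if "u : {0..w}" for u
    unfolding n1[symmetric] using that by (cases "u = w") (auto intro: less_imp_le)
   from Ib[OF wt(1) this] have I: "norm (integral {0..w} p) <= C * w" "norm (integral {0..w} (%s. b (q s) - G (p s))) <= C * w" by auto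
   have "C * w <= C * t" using wt C by (intro mult_left_mono) auto
   hence Cw: "C * w < 1" using Ct by simp
   have "norm (q w) < r + 1" unfolding qe[OF wt(1)] using norm_triangle_ineq[of "q 0" "integral {0..w} p"] I q0 Cw by linarith
   moreover have "norm (p w) < r + c + 1" unfolding pe[OF wt(1)] using norm_triangle_ineq[of "p 0 + integral {0..w} (%s. b (q s) - G (p s))" "W w"]
     norm_triangle_ineq[of "p 0" "integral {0..w} (%s. b (q s) - G (p s))"] I p0 Cw W[OF wt(1)] by linarith
   ultimately have "n w < 1" by (simp add: n_def)
   thus False using wt by simp
  qed
  hence "norm (q u) <= r + 1 \<and> norm (p u) <= P" if "u : {0..t}" for u using that unfolding n1[symmetric] by (simp add: less_imp_le)
  from Ib[OF _ this] t show "norm (integral {0..t} p) <= C * t \<and> norm (integral {0..t} (%s. b (q s) - G (p s))) <= C * t" by simp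
 qed
qed

lemma average_tendsto: fixes h :: "real => 'a::euclidean_space" assumes c: "continuous_on {0..} h" and d: "d ----> 0" "!!n::nat. 0 < d n"
 shows "(%n. (1 / d n) *R integral {0..d n} h) ----> h 0"
proof (rule tendstoI)
 fix e :: real assume e: "0 < e"
 obtain y where y: "0 < y" "!!s. s : {0..} ==> dist s 0 < y ==> dist (h s) (h 0) < e / 2"
  using c[unfolded continuous_on_iff, rule_format, of 0 "e / 2"] e by auto
 have "\<forall>\<^sub>F n in sequentially. d n < y" by (rule order_tendstoD(2)[OF d(1) y(1)])
 thus "\<forall>\<^sub>F n in sequentially. dist ((1 / d n) *R integral {0..d n} h) (h 0) < e"
 proof eventually_elim
  case (elim n)
  have "norm ((d n - 0) *R h 0 - integral {0..d n} h) <= (d n - 0) * (e / 2)"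
  proof (rule integral_const_approx)
   show "norm (h s - h 0) <= e / 2" if "s : {0..d n}" for s using y(2)[of s] that elim by (simp add: dist_norm)
  qed (use d(2)[of n] in \<open>auto intro: continuous_on_subset[OF c]\<close>)
  hence "norm ((1 / d n) *R (d n *R h 0 - integral {0..d n} h)) <= (1 / d n) * (d n * (e / 2))"
   using d(2)[of n] by (simp only: norm_scaleR) (simp add: field_simps)
  hence "norm (h 0 - (1 / d n) *R integral {0..d n} h) <= e / 2" using d(2)[of n] by (simp add: scaleR_diff_right)
  thus ?case using e by (simp add: dist_norm norm_minus_commute)
 qed
qed

section \<open>Small increments split into noise and drift\<close>

context langevin_start
begin

lemma bounded_integrable: "h : borel_measurable M ==> (!!w. w : space M ==> \<bar>h w\<bar> <= K) ==> integrable M h" for h :: "'w => real"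
 by (rule integrable_const_bound[where B=K]) auto

lemma integral_X0: fixes h :: "'n phase => real" assumes [measurable]: "h : Borel" shows "(LINT w|M. h (X 0 w)) = (LBINT x. \<rho> x * h x)"
proof -
 have "(LINT w|M. h (X 0 w)) = (LINT x|distr M borel (X 0). h x)" by (rule integral_distr[symmetric]) simp_all
 also have "... = (LBINT x. \<rho> x * h x)" unfolding X0_distr using rho_pos by (subst integral_density) (auto intro!: AE_I2 less_imp_le)
 finally show ?thesis .
qed

text \<open>The initial state and the increment have as joint law the product of
  \<open>\<rho>\<close> and a Gaussian; boundedness of \<open>h\<close> permits Fubini.\<close>

lemma integral_X0_increment: fixes h :: "'n phase \<times> (real ^ 'n) => real"
 assumes t: "0 < t" and h[measurable]: "h : Borel" and K: "!!z. \<bar>h z\<bar> <= K"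
 shows "(LINT w|M. h (X 0 w, B t w - B 0 w)) = (LBINT x. \<rho> x * (LBINT y. gauss (sqrt t) y * h (x, y)))"
proof -
 define G where "G z = \<rho> (fst z) * gauss (sqrt t) (snd z)" for z :: "'n phase \<times> (real ^ 'n)"
 have Gi: "integrable lborel G" unfolding G_def by (rule int_tensor[OF rho_int int_gauss]) (use t in simp)
 have G0: "0 <= G z" for z using rho_pos[of "fst z"] by (simp add: G_def gauss_nonneg)
 have Gm[measurable]: "G : Borel" using borel_intI[OF Gi] by simp
 have D[measurable]: "(%w. B t w - B 0 w): borel_measurable M" using B_measurable[of 0] B_measurable[of t] t by simp
 have Zm: "(%w. (X 0 w, B t w - B 0 w)): borel_measurable M" by (intro borel_measurable_Pair X_measurable D) simp
 have law: "distr M borel (%w. (X 0 w, B t w - B 0 w)) = density lborel (%z. ennreal (G z))"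
 proof (rule measure_eqI)
  fix A assume "A : sets (distr M borel (%w. (X 0 w, B t w - B 0 w)))"
  hence A: "A : sets borel" by simp
  let ?i = "%z. indicator A z :: ennreal"
  have im: "?i : Borel" using A by simp
  have im': "(%z. ?i (X 0 (fst z), snd z)): borel_measurable (F 0 \<Otimes>\<^sub>M borel)"
   by (rule meas_comp[OF borel_measurable_Pair[OF meas_comp[OF measurable_fst X_adapted] measurable_snd] im]) simp
  have inner: "(%x. (NN y. ?i (x, y) * ennreal (gauss (sqrt t) y))): Borel"
  proof (rule lborel.borel_measurable_nn_integral)
   have "?i : borel_measurable (borel \<Otimes>\<^sub>M borel)" using im by (simp only: borel_prod)
   thus "(%(x, y). ?i (x, y) * ennreal (gauss (sqrt t) y)): borel_measurable (borel \<Otimes>\<^sub>M lborel)"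
    by (simp add: case_prod_unfold cong: measurable_cong_sets)
  qed
  have "emeasure (distr M borel (%w. (X 0 w, B t w - B 0 w))) A = (\<integral>\<^sup>+z. ?i z \<partial>distr M borel (%w. (X 0 w, B t w - B 0 w)))"
   using A by simp
  also have "... = (\<integral>\<^sup>+w. ?i (X 0 w, B t w - B 0 w) \<partial>M)" by (rule nn_integral_distr[OF Zm]) (use im in simp)
  also have "... = (\<integral>\<^sup>+w. (NN y. ?i (X 0 w, y) * ennreal (gauss (sqrt t) y)) \<partial>M)"
   using nn_increment[OF order_refl t im'] by simp
  also have "... = (NN x. ennreal (\<rho> x) * (NN y. ?i (x, y) * ennreal (gauss (sqrt t) y)))" by (rule nn_X0[OF inner])
  also have "... = (NN x. (NN y. ennreal (G (x, y)) * ?i (x, y)))"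
  proof (rule nn_integral_cong)
   fix x
   have "(%y. ?i (x, y)): Borel" by (rule meas_comp[OF borel_measurable_Pair im]) simp_all
   thus "ennreal (\<rho> x) * (NN y. ?i (x, y) * ennreal (gauss (sqrt t) y)) = (NN y. ennreal (G (x, y)) * ?i (x, y))"
    using less_imp_le[OF rho_pos[of x]]
    by (subst nn_integral_cmult[symmetric]) (auto simp: G_def ennreal_mult gauss_nonneg mult_ac intro!: nn_integral_cong)
  qed
  also have "... = (NN z. ennreal (G z) * ?i z)" by (rule nn_lborel_fst(1)) (use im in simp)
  also have "... = emeasure (density lborel (%z. ennreal (G z))) A" using A by (simp add: emeasure_density)
  finally show "emeasure (distr M borel (%w. (X 0 w, B t w - B 0 w))) A = emeasure (density lborel (%z. ennreal (G z))) A" .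
 qed simp
 have "(LINT w|M. h (X 0 w, B t w - B 0 w)) = (LINT z|distr M borel (%w. (X 0 w, B t w - B 0 w)). h z)"
  by (rule integral_distr[symmetric, OF Zm]) simp
 also have "... = (LBINT z. G z * h z)" unfolding law using G0 by (subst integral_density) auto
 also have "... = (LBINT x. LBINT y. G (x, y) * h (x, y))" by (rule lborel_fubini(1)[symmetric, OF int_mult_bounded[OF Gi _ K]]) simp
 also have "... = (LBINT x. \<rho> x * (LBINT y. gauss (sqrt t) y * h (x, y)))" by (simp add: G_def mult.assoc)
 finally show ?thesis .
qed

text \<open>The initial state moved by the noise alone. As an intermediate point it separates the
  increment of \<open>f\<close> into a Gaussian average and a displacement by the drift, which need
  different arguments.\<close>

definition kick :: "real => 'w => 'n phase" where
 "kick t w = X 0 w + (0, noise \<beta> \<sigma> (B t w - B 0 w))"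

lemma kick_measurable: "0 < t ==> kick t : borel_measurable M"
proof -
 assume t: "0 < t"
 have "(%w. B t w - B 0 w): borel_measurable M" using B_measurable[of 0] B_measurable[of t] t by simp
 hence "(%w. noise \<beta> \<sigma> (B t w - B 0 w)): borel_measurable M" by (rule meas_comp[OF _ noise_measurable])
 thus ?thesis unfolding kick_def[abs_def] by (intro borel_measurable_add borel_measurable_Pair X_measurable) simp_all
qed

text \<open>The noise over time \<open>d n\<close> has deviation \<open>sqrt (d n)\<close>, so
  division by \<open>d n\<close> is the scaling of \<open>gauss_average_second_order\<close>. The
  bound there is uniform in \<open>x\<close>, so a multiple of \<open>\<rho>\<close>
  dominates.\<close>

lemma noise_limit: assumes f: "test_function f" and g: "test_function g" and d: "d ----> 0" "!!n::nat. 0 < d n"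
 shows "(%n. (LINT h|M. g (X 0 h) * (f (kick (d n) h) - f (X 0 h))) / d n)
  ----> (LBINT x. \<rho> x * (g x * (1/2 * (\<Sum>k\<in>UNIV. 1/\<beta> * dd (0, column k \<sigma>) (dd (0, column k \<sigma>) f) x))))"
proof -
 note sm = tf_smooth[OF f]
 note [measurable] = tf_measurable[OF f] tf_measurable[OF g]
 define u where "u m = (0 :: real ^ 'n, noise \<beta> \<sigma> m)" for m
 have ul: "bounded_linear u" unfolding u_def[abs_def] by (intro bounded_linear_Pair bounded_linear_zero noise_linear)
 define \<Phi> where "\<Phi> s x = (LBINT m. gauss s m * (f (x + u m) - f x)) / s^2" for s x
 obtain C where C: "!!s x. 0 < s ==> \<bar>\<Phi> s x\<bar> <= C"
  "!!s x. s ----> 0 ==> (!!n. 0 < s n) ==> (%n. \<Phi> (s n) x) ----> 1/2 * (\<Sum>k\<in>Basis. dd (u k) (dd (u k) f) x)"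
  using gauss_average_second_order[OF f ul] unfolding \<Phi>_def by blast
 obtain Kf where Kf: "0 < Kf" "!!x. \<bar>f x\<bar> <= Kf" using tf_bounded[OF f] by blast
 obtain Kg where Kg: "0 < Kg" "!!x. \<bar>g x\<bar> <= Kg" using tf_bounded[OF g] by blast
 have sd: "(%n. sqrt (d n)) ----> 0" "!!n. 0 < sqrt (d n)" using tendsto_real_sqrt[OF d(1)] d(2) by simp_all
 have xu: "(%z. fst z + u (snd z)): Borel"
 proof (rule borel_contI)
  show "continuous_on UNIV (%z. fst z + u (snd z))"
   by (intro continuous_on_add continuous_on_fst continuous_on_id cont_comp[OF linear_continuous_on[OF ul, of UNIV] continuous_on_snd[OF continuous_on_id]]) simp
 qed
 have hm: "(%z. g (fst z) * (f (fst z + u (snd z)) - f (fst z))): Borel"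
  by (intro borel_measurable_times borel_measurable_diff meas_comp[OF xu] meas_comp[OF borel_fst]
   tf_measurable f g)
 have eq: "(LINT h|M. g (X 0 h) * (f (kick (d n) h) - f (X 0 h))) / d n = (LBINT x. \<rho> x * (g x * \<Phi> (sqrt (d n)) x))" for n
 proof -
  have "(LINT h|M. g (X 0 h) * (f (kick (d n) h) - f (X 0 h))) = (LBINT x. \<rho> x * (LBINT m. gauss (sqrt (d n)) m * (g x * (f (x + u m) - f x))))"
   using integral_X0_increment[OF d(2) hm, of "Kg * (2 * Kf)" n]
  proof -
   have "\<bar>g x * (f y - f z)\<bar> <= Kg * (2 * Kf)" for x y z
    unfolding abs_mult using Kg(2)[of x] Kf(2)[of y] Kf(2)[of z] Kg(1) by (intro mult_mono) linarith+
   thus ?thesis using integral_X0_increment[OF d(2) hm, of "Kg * (2 * Kf)" n] by (simp add: kick_def u_def)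
  qed
  also have "... = (LBINT x. d n * (\<rho> x * (g x * \<Phi> (sqrt (d n)) x)))"
  proof (rule lint_cong[OF refl])
   fix x
   have "(LBINT m. gauss (sqrt (d n)) m * (g x * (f (x + u m) - f x))) = g x * (LBINT m. gauss (sqrt (d n)) m * (f (x + u m) - f x))"
    by (simp add: mult.left_commute[of _ "g x"])
   thus "\<rho> x * (LBINT m. gauss (sqrt (d n)) m * (g x * (f (x + u m) - f x))) = d n * (\<rho> x * (g x * \<Phi> (sqrt (d n)) x))"
    using d(2)[of n] by (simp add: \<Phi>_def)
  qed
  finally show ?thesis using d(2)[of n] by simp
 qed
 have lim: "(%n. LBINT x. \<rho> x * (g x * \<Phi> (sqrt (d n)) x)) ----> (LBINT x. \<rho> x * (g x * (1/2 * (\<Sum>k\<in>Basis. dd (u k) (dd (u k) f) x))))"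
 proof (rule int_dct[where w="%x. (Kg * C) * \<rho> x"])
  show "integrable lborel (%x. (Kg * C) * \<rho> x)" using rho_int by simp
  show "(%x. \<rho> x * (g x * \<Phi> (sqrt (d n)) x)): borel_measurable lborel" for n
  proof -
   have "(%z. gauss (sqrt (d n)) (snd z) * (f (fst z + u (snd z)) - f (fst z))): Borel"
    by (intro borel_measurable_times borel_measurable_diff meas_comp[OF xu] meas_comp[OF borel_fst]
     meas_comp[OF borel_snd] tf_measurable f gauss_measurable)
   hence "(%z. gauss (sqrt (d n)) (snd z) * (f (fst z + u (snd z)) - f (fst z))): borel_measurable (borel \<Otimes>\<^sub>M borel)"
    by (simp only: borel_prod)
   hence "(%z. gauss (sqrt (d n)) (snd z) * (f (fst z + u (snd z)) - f (fst z))): borel_measurable (borel \<Otimes>\<^sub>M lborel)"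
    by (simp cong: measurable_cong_sets)
   hence "(%x. LBINT m. gauss (sqrt (d n)) m * (f (x + u m) - f x)): Borel"
    by (intro lborel.borel_measurable_lebesgue_integral) (simp add: case_prod_unfold)
   thus ?thesis unfolding \<Phi>_def by simp
  qed
  have "(%x. \<Sum>k\<in>Basis. dd (u k) (dd (u k) f) x): Borel" by (intro borel_measurable_sum tf_measurable tf_dd f)
  thus "(%x. \<rho> x * (g x * (1/2 * (\<Sum>k\<in>Basis. dd (u k) (dd (u k) f) x)))): borel_measurable lborel" by measurable
  show "AE x in lborel. (%n. \<rho> x * (g x * \<Phi> (sqrt (d n)) x)) ----> \<rho> x * (g x * (1/2 * (\<Sum>k\<in>Basis. dd (u k) (dd (u k) f) x)))"
   by (intro AE_I2 tendsto_mult tendsto_const C(2)[OF sd])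
  show "AE x in lborel. norm (\<rho> x * (g x * \<Phi> (sqrt (d n)) x)) <= (Kg * C) * \<rho> x" for n
  proof (rule AE_I2)
   fix x
   have "\<bar>g x\<bar> * \<bar>\<Phi> (sqrt (d n)) x\<bar> <= Kg * C" using Kg C(1)[OF sd(2)] by (intro mult_mono) auto
   from mult_left_mono[OF this less_imp_le[OF rho_pos[of x]]] show "norm (\<rho> x * (g x * \<Phi> (sqrt (d n)) x)) <= (Kg * C) * \<rho> x"
    using rho_pos[of x] by (simp add: abs_mult mult_ac)
  qed
 qed
 have u_axis: "(\<Sum>k\<in>Basis. dd (u k) (dd (u k) f) x) = (\<Sum>k\<in>UNIV. 1/\<beta> * dd (0, column k \<sigma>) (dd (0, column k \<sigma>) f) x)" for x
 proof -
  have ux: "u (axis k 1) = (1 / sqrt \<beta>) *R (0, column k \<sigma>)" for k by (simp add: u_def noise_def matrix_vector_mult_basis)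
  have d2: "dd (c *R v) (dd (c *R v) f) x = (c * c) * dd v (dd v f) x" for c and v :: "'n phase"
  proof -
   have "dd (c *R v) f = (%x. c * dd v f x)" using dd_scaleR_dir[OF sm] by blast
   hence "dd (c *R v) (dd (c *R v) f) x = c * dd (c *R v) (dd v f) x"
    using dd_sum_fun[of "{()}" "%_. dd v f" "c *R v" "%_. c" x] smooth_dd[OF sm] by simp
   thus ?thesis by (simp add: dd_scaleR_dir[OF smooth_dd[OF sm]])
  qed
  have Bs: "(Basis :: (real ^ 'n) set) = (%i. axis i 1) ` UNIV" by (auto simp: Basis_vec_def)
  have "inj (%i. axis i (1::real) :: real ^ 'n)" by (auto simp: inj_on_def axis_eq_axis)
  hence "(\<Sum>k\<in>Basis. dd (u k) (dd (u k) f) x) = (\<Sum>i\<in>UNIV. dd (u (axis i 1)) (dd (u (axis i 1)) f) x)"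
   unfolding Bs by (subst sum.reindex) (simp_all add: comp_def)
  also have "... = (\<Sum>k\<in>UNIV. 1/\<beta> * dd (0, column k \<sigma>) (dd (0, column k \<sigma>) f) x)" unfolding ux d2 using beta by simp
  finally show ?thesis .
 qed
 show ?thesis unfolding eq using lim unfolding u_axis .
qed

end

context langevin_start
begin

definition drift :: "'n phase => 'n phase" where
 "drift x = (snd x, b (fst x) - friction \<sigma> (snd x))"

text \<open>Only initial states in the support of \<open>g\<close> count. Without an excursion the
  drift displaces them by at most a multiple of \<open>t\<close>, so the quotient is bounded and
  dominated convergence applies. With an excursion the quotient is of order \<open>1 / t\<close>,
  but the probability is of order \<open>t^2\<close>.\<close>

lemma drift_limit: assumes f: "test_function f" and g: "test_function g"
 obtains t1 where "0 < t1" "!!d. d ----> 0 ==> (!!n::nat. 0 < d n \<and> d n <= t1) ==>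
  (%n. (LINT y|M. g (X 0 y) * (f (X (d n) y) - f (kick (d n) y))) / d n)
   ----> (LBINT x. \<rho> x * (g x * dd (drift x) f x))"
proof -
 note sm = tf_smooth[OF f]
 have fm[measurable]: "f : Borel" and gm[measurable]: "g : Borel" by (rule tf_measurable[OF f] tf_measurable[OF g])+
 obtain r where r: "0 < r" "!!x. r < norm x ==> g x = 0" using tf_support_cball[OF g] by blast
 obtain Kf where Kf: "0 < Kf" "!!x. \<bar>f x\<bar> <= Kf" using tf_bounded[OF f] by blast
 obtain Kg where Kg: "0 < Kg" "!!x. \<bar>g x\<bar> <= Kg" using tf_bounded[OF g] by blast
 obtain L where L: "0 <= L" "!!v x. \<bar>dd v f x\<bar> <= L * norm v" using dd_bound[OF f] by blast
 obtain c where c: "0 < c" "!!z. norm (noise \<beta> \<sigma> z) <= norm z * c" using bounded_linear.pos_bounded[OF noise_linear] by blast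
 obtain t2 C where t2: "0 < t2" and conf: "!!q p W t. 0 < t ==> t <= t2 ==> continuous_on {0..t} q ==> continuous_on {0..t} p ==>
   norm (q 0) <= r ==> norm (p 0) <= r ==> (!!s. s : {0..t} ==> norm (W s) <= c) ==>
   (!!s. s : {0..t} ==> q s = q 0 + integral {0..s} p) ==>
   (!!s. s : {0..t} ==> p s = p 0 + integral {0..s} (%s. b (q s) - friction \<sigma> (p s)) + W s) ==>
   norm (integral {0..t} p) <= C * t \<and> norm (integral {0..t} (%s. b (q s) - friction \<sigma> (p s))) <= C * t"
  by (rule short_time_confinement[OF b_cont friction_linear[of \<sigma>] less_imp_le[OF r(1)] less_imp_le[OF c(1)]]) blast
 obtain t3 C3 where t3: "0 < t3" and exc: "!!t. 0 < t ==> t <= t3 ==> prob (excursion t) <= C3 * t^2" by (rule excursion_bound) blast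
 define V where "V t y = (integral {0..t} (%s. p s y), integral {0..t} (%s. b (q s y) - friction \<sigma> (p s y)))" for t y
 define D where "D t y = g (X 0 y) * (f (X t y) - f (kick t y)) / t" for t y
 have dc: "continuous_on UNIV (%x. dd (drift x) f x)"
 proof -
  have e: "dd (drift x) f x = (\<Sum>i\<in>Basis. (drift x \<bullet> i) * dd i f x)" for x by (rule dd_Basis[OF sm])
  show ?thesis unfolding e unfolding drift_def
  by (intro continuous_on_sum continuous_on_mult continuous_on_inner continuous_on_Pair continuous_on_diff continuous_on_const
   continuous_on_snd continuous_on_id cont_comp[OF b_cont continuous_on_fst[OF continuous_on_id]]
   cont_comp[OF linear_continuous_on[OF friction_linear, of UNIV] continuous_on_snd[OF continuous_on_id]]
   smooth_cont[OF smooth_dd[OF sm]]) simp_all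
 qed
 have dm[measurable]: "(%x. dd (drift x) f x): Borel" by (rule borel_contI[OF dc])
 have AEpath: "AE y in M. B 0 y = 0 \<and> continuous_on {0..} (%t. B t y) \<and> continuous_on {0..} (%t. q t y) \<and> continuous_on {0..} (%t. p t y) \<and>
  (\<forall>t\<ge>0. q t y = q 0 y + integral {0..t} (%s. p s y)) \<and>
  (\<forall>t\<ge>0. p t y = p 0 y + integral {0..t} (%s. b (q s y) - friction \<sigma> (p s y)) + noise \<beta> \<sigma> (B t y - B 0 y))"
  using B_zero B_continuous paths_AE
 proof eventually_elim
  case (elim y)
  show ?case unfolding elim(1) diff_zero by (rule conjI[OF refl conjI[OF elim(2)]]) (use elim(3) in blast)
 qed
 have Dm: "D t : borel_measurable M" if "0 < t" for t
  unfolding D_def using meas_comp[OF kick_measurable[OF that] fm] meas_comp[OF X_measurable fm, of t]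
   meas_comp[OF X_measurable gm, of 0] that by (intro borel_measurable_divide borel_measurable_times borel_measurable_diff) auto
 have D_bound: "\<bar>D t y\<bar> <= Kg * (2 * Kf) / t" if "0 < t" for t y
 proof -
  have "\<bar>g (X 0 y) * (f (X t y) - f (kick t y))\<bar> <= Kg * (2 * Kf)"
   unfolding abs_mult using Kg Kf(2)[of "X t y"] Kf(2)[of "kick t y"] by (intro mult_mono) auto
  thus ?thesis using that by (simp add: D_def divide_right_mono)
 qed
 show ?thesis
 proof (rule that[of "min t2 t3"])
  show "0 < min t2 t3" using t2 t3 by simp
  fix d :: "nat => real" assume d0: "d ----> 0" and d': "!!n. 0 < d n \<and> d n <= min t2 t3"
  have d: "0 < d n" "d n <= t2" "d n <= t3" for n using d'[of n] by auto
  define I where "I n y = (indicator (excursion (d n)) y :: real)" for n y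
  have Im[measurable]: "I n : borel_measurable M" for n unfolding I_def using excursion_measurable[OF d(1)] by simp
  have Din: "integrable M (%y. D (d n) y * (1 - I n y))" "integrable M (%y. D (d n) y * I n y)" for n
  proof -
   have "\<bar>D (d n) y * (1 - I n y)\<bar> <= Kg * (2 * Kf) / d n" "\<bar>D (d n) y * I n y\<bar> <= Kg * (2 * Kf) / d n" for y
    using D_bound[OF d(1)[of n], of y] Kg Kf d(1)[of n] by (auto simp: I_def indicator_def)
   thus "integrable M (%y. D (d n) y * (1 - I n y))" "integrable M (%y. D (d n) y * I n y)"
    using Dm[OF d(1)[of n]] by (auto intro!: bounded_integrable)
  qed
  have "(%n. LINT y|M. D (d n) y * (1 - I n y)) ----> (LINT y|M. g (X 0 y) * dd (drift (X 0 y)) f (X 0 y))"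
  proof (rule int_dct[where w="%_. Kg * (L * (2 * \<bar>C\<bar>))"])
   show "(%y. D (d n) y * (1 - I n y)): borel_measurable M" for n using borel_intI[OF Din(1)] .
   show "(%y. g (X 0 y) * dd (drift (X 0 y)) f (X 0 y)): borel_measurable M"
    by (intro borel_measurable_times meas_comp[OF X_measurable gm] meas_comp[OF X_measurable dm]) simp_all
   show "AE y in M. norm (D (d n) y * (1 - I n y)) <= Kg * (L * (2 * \<bar>C\<bar>))" for n using AEpath AE_space
   proof eventually_elim
    case (elim y)
    from elim(1) have el: "continuous_on {0..} (%t. B t y)" "continuous_on {0..} (%t. q t y)" "continuous_on {0..} (%t. p t y)" by blast+
    have qpe: "q t y = q 0 y + integral {0..t} (%s. p s y)"
     "p t y = p 0 y + integral {0..t} (%s. b (q s y) - friction \<sigma> (p s y)) + noise \<beta> \<sigma> (B t y - B 0 y)" if "t : {0..d n}" for t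
    proof -
     have "0 <= t" using that by simp
     with elim(1) show "q t y = q 0 y + integral {0..t} (%s. p s y)"
      "p t y = p 0 y + integral {0..t} (%s. b (q s y) - friction \<sigma> (p s y)) + noise \<beta> \<sigma> (B t y - B 0 y)" by blast+
    qed
    note sp = elim(2)
    have sub: "{0..d n} \<subseteq> {0..}" by auto
    have "norm (integral {0..d n} (%s. p s y)) <= C * d n \<and> norm (integral {0..d n} (%s. b (q s y) - friction \<sigma> (p s y))) <= C * d n"
     if ne: "y \<notin> excursion (d n)" and X0: "norm (X 0 y) <= r"
    proof (rule conf[OF d(1,2) el(2,3)[THEN continuous_on_subset[OF _ sub]] _ _ _ qpe])
     show "norm (q 0 y) <= r" "norm (p 0 y) <= r" using X0 norm_fst_le[of "q 0 y" "p 0 y"] norm_snd_le[of "p 0 y" "q 0 y"] by (simp_all add: X_def)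
     show "norm (noise \<beta> \<sigma> (B s y - B 0 y)) <= c" if "s : {0..d n}" for s
     proof -
      have "norm (B s y - B 0 y) <= 1" by (rule not_excursion[OF sp ne d(1) el(1)]) (use that in auto)
      hence "norm (B s y - B 0 y) * c <= 1 * c" using c(1) by (intro mult_right_mono) auto
      with c(2)[of "B s y - B 0 y"] show ?thesis by simp
     qed
    qed
    hence VC: "norm (V (d n) y) <= 2 * C * d n" if "y \<notin> excursion (d n)" "norm (X 0 y) <= r"
     using that norm_Pair_le[of "integral {0..d n} (%s. p s y)" "integral {0..d n} (%s. b (q s y) - friction \<sigma> (p s y))"]
     unfolding V_def by linarith
    have XV: "X (d n) y = kick (d n) y + V (d n) y" using qpe[of "d n"] d(1)[of n] by (simp add: X_def kick_def V_def)
    show ?case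
    proof (cases "y : excursion (d n) \<or> r < norm (X 0 y)")
     case True
     hence "D (d n) y * (1 - I n y) = 0" using r(2)[of "X 0 y"] by (auto simp: I_def D_def)
     thus ?thesis using Kg(1) L(1) by (simp only: norm_zero) simp
    next
     case False
     obtain h where h: "f (X (d n) y) - f (kick (d n) y) = dd (V (d n) y) f (kick (d n) y + h *R V (d n) y)"
      unfolding XV by (rule mvt_dd[OF sm]) blast
     have "\<bar>f (X (d n) y) - f (kick (d n) y)\<bar> <= L * norm (V (d n) y)" unfolding h by (rule L(2))
     also have "... <= L * (2 * \<bar>C\<bar> * d n)"
     proof -
      have "2 * C * d n <= 2 * \<bar>C\<bar> * d n" using d(1)[of n] by (intro mult_right_mono) auto
      thus ?thesis using VC False L(1) by (intro mult_left_mono) auto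
     qed
     finally have "\<bar>g (X 0 y)\<bar> * \<bar>f (X (d n) y) - f (kick (d n) y)\<bar> <= Kg * (L * (2 * \<bar>C\<bar> * d n))"
      using Kg by (intro mult_mono) auto
     hence "\<bar>g (X 0 y) * (f (X (d n) y) - f (kick (d n) y))\<bar> / d n <= Kg * (L * (2 * \<bar>C\<bar>))"
      using d(1)[of n] by (simp only: abs_mult[symmetric] pos_divide_le_eq mult_ac)
     thus ?thesis using False d(1)[of n] by (simp add: D_def I_def)
    qed
   qed
   show "AE y in M. (%n. D (d n) y * (1 - I n y)) ----> g (X 0 y) * dd (drift (X 0 y)) f (X 0 y)" using AEpath
   proof eventually_elim
    case (elim y)
    hence el: "continuous_on {0..} (%t. B t y)" "continuous_on {0..} (%t. q t y)" "continuous_on {0..} (%t. p t y)"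
     and qe: "!!t. 0 <= t ==> q t y = q 0 y + integral {0..t} (%s. p s y)"
     and pe: "!!t. 0 <= t ==> p t y = p 0 y + integral {0..t} (%s. b (q s y) - friction \<sigma> (p s y)) + noise \<beta> \<sigma> (B t y - B 0 y)"
     by blast+
    obtain u where u: "0 < u" "!!s. s : {0..} ==> dist s 0 < u ==> dist (B s y) (B 0 y) < 1"
     using el(1)[unfolded continuous_on_iff, rule_format, of 0 1] by auto
    have "\<forall>\<^sub>F n in sequentially. d n < u" by (rule order_tendstoD(2)[OF d0 u(1)])
    hence I0: "\<forall>\<^sub>F n in sequentially. 1 - I n y = 1"
    proof eventually_elim
     case (elim n)
     have "y \<notin> excursion (d n)"
     proof
      assume "y : excursion (d n)"
      then obtain m k where k: "k <= 2 ^ m" "1 < norm (B (real k * (d n / 2 ^ m)) y - B 0 y)" by (auto simp: excursion_def)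
      have "real k <= 2 ^ m" using k(1) by (metis of_nat_le_iff of_nat_numeral of_nat_power)
      hence "real k * (d n / 2 ^ m) <= 2 ^ m * (d n / 2 ^ m)" using d(1)[of n] by (intro mult_right_mono) auto
      hence "real k * (d n / 2 ^ m) < u" using elim by simp
      with u(2)[of "real k * (d n / 2 ^ m)"] k(2) d(1)[of n] show False by (simp add: dist_norm)
     qed
     thus ?case by (simp add: I_def)
    qed
    have fc: "continuous_on {0..} (%s. b (q s y) - friction \<sigma> (p s y))"
     by (intro continuous_on_diff cont_comp[OF b_cont el(2)] cont_comp[OF linear_continuous_on[OF friction_linear, of UNIV] el(3)]) auto
    have Vlim: "(%n. (1 / d n) *R V (d n) y) ----> drift (X 0 y)"
     using tendsto_Pair[OF average_tendsto[OF el(3) d0 d(1)] average_tendsto[OF fc d0 d(1)]] by (simp add: V_def drift_def X_def)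
    have Blim: "(%n. B (d n) y) ----> B 0 y"
     by (rule continuous_on_tendsto_compose[OF el(1) d0]) (use d(1) in \<open>auto intro!: always_eventually less_imp_le\<close>)
    have klim: "(%n. kick (d n) y) ----> X 0 y"
    proof -
     have "(%n. noise \<beta> \<sigma> (B (d n) y - B 0 y)) ----> noise \<beta> \<sigma> (B 0 y - B 0 y)"
      by (rule bounded_linear.tendsto[OF noise_linear]) (intro tendsto_diff Blim tendsto_const)
     hence "(%n. X 0 y + (0, noise \<beta> \<sigma> (B (d n) y - B 0 y))) ----> X 0 y + (0, noise \<beta> \<sigma> (B 0 y - B 0 y))"
      by (intro tendsto_add tendsto_Pair tendsto_const)
     thus ?thesis by (simp add: kick_def noise_def flip: zero_prod_def)
    qed
    have XV: "X (d n) y = kick (d n) y + V (d n) y" for n using qe[of "d n"] pe[of "d n"] d(1)[of n] by (simp add: X_def kick_def V_def)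
    have "\<exists>h. 0 < h \<and> h < 1 \<and> f (X (d n) y) - f (kick (d n) y) = dd (V (d n) y) f (kick (d n) y + h *R V (d n) y)" for n
     unfolding XV by (rule mvt_dd[OF sm]) blast
    then obtain h where h: "!!n. 0 < h n \<and> h n < 1" "!!n. f (X (d n) y) - f (kick (d n) y) = dd (V (d n) y) f (kick (d n) y + h n *R V (d n) y)"
     by metis
    \<comment> \<open>Linearity in the direction moves the factor \<open>1 / d n\<close> inside, so
      that the direction becomes the time-averaged drift, which converges.\<close>
    have quot: "(f (X (d n) y) - f (kick (d n) y)) / d n = dd ((1 / d n) *R V (d n) y) f (kick (d n) y + (h n * d n) *R ((1 / d n) *R V (d n) y))" for n
     unfolding h(2) dd_scaleR_dir[OF sm] using d(1)[of n] by simp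
    have "(%n. h n * d n) ----> 0"
     by (rule tendsto_sandwich[OF _ _ tendsto_const d0]) (use h(1) d(1) in \<open>auto intro!: always_eventually mult_left_le_one_le less_imp_le\<close>)
    hence "(%n. kick (d n) y + (h n * d n) *R ((1 / d n) *R V (d n) y)) ----> X 0 y + 0 *R drift (X 0 y)"
     by (intro tendsto_add klim tendsto_scaleR Vlim)
    hence "(%n. (f (X (d n) y) - f (kick (d n) y)) / d n) ----> dd (drift (X 0 y)) f (X 0 y)" unfolding quot by (intro tendsto_dd[OF sm Vlim]) simp
    hence "(%n. g (X 0 y) * ((f (X (d n) y) - f (kick (d n) y)) / d n) * (1 - I n y)) ----> g (X 0 y) * dd (drift (X 0 y)) f (X 0 y) * 1"
     by (intro tendsto_mult[OF tendsto_mult[OF tendsto_const] tendsto_eventually[OF I0]])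
    thus ?case by (simp add: D_def)
   qed
  qed simp
  moreover have "(%n. LINT y|M. D (d n) y * I n y) ----> 0"
  proof (rule Lim_null_comparison)
   show "(%n. Kg * (2 * Kf) * C3 * d n) ----> 0" using tendsto_mult_right_zero[OF d0] .
   show "\<forall>\<^sub>F n in sequentially. norm (LINT y|M. D (d n) y * I n y) <= Kg * (2 * Kf) * C3 * d n"
   proof (intro always_eventually allI)
    fix n
    have "norm (LINT y|M. D (d n) y * I n y) <= (LINT y|M. norm (D (d n) y * I n y))" by (rule Bochner_Integration.integral_norm_bound)
    also have "... <= (LINT y|M. (Kg * (2 * Kf) / d n) * I n y)"
    proof (rule Bochner_Integration.integral_mono[OF integrable_norm[OF Din(2)]])
     show "integrable M (%y. (Kg * (2 * Kf) / d n) * I n y)"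
      by (intro integrable_mult_right bounded_integrable[where K=1] Im) (auto simp: I_def indicator_def)
     show "norm (D (d n) y * I n y) <= (Kg * (2 * Kf) / d n) * I n y" for y using D_bound[OF d(1)[of n], of y] by (auto simp: I_def indicator_def)
    qed
    also have "... = (Kg * (2 * Kf) / d n) * prob (excursion (d n))"
     using sets.sets_into_space[OF excursion_measurable[OF d(1)[of n]]] by (simp add: I_def[abs_def] Int_absorb2)
    also have "... <= (Kg * (2 * Kf) / d n) * (C3 * (d n)^2)" using exc[OF d(1,3)] Kg Kf d(1)[of n] by (intro mult_left_mono) auto
    also have "... = Kg * (2 * Kf) * C3 * d n" using d(1)[of n] by (simp add: power2_eq_square)
    finally show "norm (LINT y|M. D (d n) y * I n y) <= Kg * (2 * Kf) * C3 * d n" .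
   qed
  qed
  ultimately have "(%n. (LINT y|M. D (d n) y * (1 - I n y)) + (LINT y|M. D (d n) y * I n y)) ----> (LINT y|M. g (X 0 y) * dd (drift (X 0 y)) f (X 0 y)) + 0"
   by (rule tendsto_add)
  moreover have "(LINT y|M. D (d n) y * (1 - I n y)) + (LINT y|M. D (d n) y * I n y) = (LINT y|M. g (X 0 y) * (f (X (d n) y) - f (kick (d n) y))) / d n" for n
   unfolding lint_add[OF Din, symmetric] by (simp add: D_def algebra_simps flip: add_divide_distrib)
  moreover have "(LINT y|M. g (X 0 y) * dd (drift (X 0 y)) f (X 0 y)) = (LBINT x. \<rho> x * (g x * dd (drift x) f x))"
   by (rule integral_X0) measurable
  ultimately show "(%n. (LINT y|M. g (X 0 y) * (f (X (d n) y) - f (kick (d n) y))) / d n)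
   ----> (LBINT x. \<rho> x * (g x * dd (drift x) f x))" by simp
 qed
qed

lemma generator_drift: assumes f: "smooth f"
 shows "generator \<beta> \<sigma> b f x = dd (drift x) f x + 1/2 * (\<Sum>k\<in>UNIV. 1/\<beta> * dd (0, column k \<sigma>) (dd (0, column k \<sigma>) f) x)"
proof -
 have "(0 :: real ^ 'n, - friction \<sigma> (snd x)) = (\<Sum>k\<in>UNIV. (- (1/2) * (column k \<sigma> \<bullet> snd x)) *R (0, column k \<sigma>))"
  by (simp add: prod_eq_iff fst_sum snd_sum friction_def diffusion_matrix_mult scaleR_sum_right sum_negf)
 hence "dd (0, - friction \<sigma> (snd x)) f x = (\<Sum>k\<in>UNIV. (- (1/2) * (column k \<sigma> \<bullet> snd x)) * dd (0, column k \<sigma>) f x)"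
  by (simp only: dd_sum_dir[OF f] dd_scaleR_dir[OF f])
 moreover have "dd (drift x) f x = dd (snd x, b (fst x)) f x + dd (0, - friction \<sigma> (snd x)) f x"
  by (simp add: dd_add_dir[OF f, symmetric] drift_def)
 ultimately show ?thesis by (simp add: generator_eq[OF f] diffusion_def sum_subtractf sum_distrib_left sum_negf algebra_simps)
qed

text \<open>Inserting \<open>kick\<close> splits the increment into the two parts already treated;
  the bound \<open>t1\<close> on the times comes from the drift part.\<close>

lemma generator_limit: assumes f: "test_function f" and g: "test_function g"
 obtains t1 where "0 < t1" "!!d. d ----> 0 ==> (!!n::nat. 0 < d n \<and> d n <= t1) ==>
  (%n. (LINT w|M. g (X 0 w) * (f (X (d n) w) - f (X 0 w))) / d n)
   ----> (LBINT x. \<rho> x * (g x * generator \<beta> \<sigma> b f x))"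
proof -
 note sm = tf_smooth[OF f]
 have fm: "f : Borel" and gm: "g : Borel" by (rule tf_measurable[OF f] tf_measurable[OF g])+
 obtain Kf where Kf: "0 < Kf" "!!x. \<bar>f x\<bar> <= Kf" using tf_bounded[OF f] by blast
 obtain Kg where Kg: "0 < Kg" "!!x. \<bar>g x\<bar> <= Kg" using tf_bounded[OF g] by blast
 obtain t1 where t1: "0 < t1" "!!d. d ----> 0 ==> (!!n::nat. 0 < d n \<and> d n <= t1) ==>
  (%n. (LINT w|M. g (X 0 w) * (f (X (d n) w) - f (kick (d n) w))) / d n)
   ----> (LBINT x. \<rho> x * (g x * dd (drift x) f x))" using drift_limit[OF f g] by blast
 define N where "N x = 1/2 * (\<Sum>k\<in>UNIV. 1/\<beta> * dd (0, column k \<sigma>) (dd (0, column k \<sigma>) f) x)" for x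
 obtain K where K: "compact K" "!!x. x \<notin> K ==> g x = 0" using tf_support[OF g] by blast
 have gc: "continuous_on UNIV g" by (rule smooth_cont[OF tf_smooth[OF g]])
 have Nc: "continuous_on UNIV N" unfolding N_def[abs_def] by (intro continuous_on_mult continuous_on_sum continuous_on_const smooth_cont smooth_dd sm)
 have bi: "integrable lborel (%x. \<rho> x * (g x * h x))" if h: "continuous_on UNIV h" for h
 proof -
  have c: "continuous_on UNIV (%x. g x * h x)" by (intro continuous_on_mult gc h)
  obtain B where "!!x. \<bar>g x * h x\<bar> <= B" by (rule compact_support_bounded[OF c K(1)]) (simp add: K(2), blast)
  thus ?thesis using borel_contI[OF c] by (intro int_mult_bounded[OF rho_int]) auto
 qed
 have dc: "continuous_on UNIV (%x. dd (drift x) f x)"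
 proof -
  have e: "(%x. dd (drift x) f x) = (%x. transport (%q. b q) f x + (\<Sum>k\<in>UNIV. (- (1/2) * (column k \<sigma> \<bullet> snd x)) * dd (0, column k \<sigma>) f x))"
   using generator_drift[OF sm] generator_split[OF sm] by (simp add: fun_eq_iff diffusion_def sum_subtractf sum_distrib_left sum_negf algebra_simps)
  show ?thesis unfolding e
   by (intro continuous_on_add continuous_on_sum continuous_on_mult continuous_on_const continuous_on_inner continuous_on_snd continuous_on_id
    transport_continuous[OF sm] b_cont smooth_cont smooth_dd sm)
 qed
 have bnd: "\<bar>g x * (f y - f z)\<bar> <= Kg * (2 * Kf)" for x y z
  unfolding abs_mult using Kg(2)[of x] Kf(2)[of y] Kf(2)[of z] Kg(1) by (intro mult_mono) linarith+
 show ?thesis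
 proof (rule that[OF t1(1)])
  fix d :: "nat => real" assume d: "d ----> 0" "!!n. 0 < d n \<and> d n <= t1"
  have dp: "0 < d n" for n using d(2) by blast
  have m: "(%w. f (X (d n) w)): borel_measurable M" "(%w. f (X 0 w)): borel_measurable M" "(%w. g (X 0 w)): borel_measurable M"
   "(%w. f (kick (d n) w)): borel_measurable M" for n using dp[of n] by (auto intro!: meas_comp[OF _ fm] meas_comp[OF _ gm] kick_measurable)
  have E: "(LINT w|M. g (X 0 w) * (f (X (d n) w) - f (kick (d n) w))) + (LINT w|M. g (X 0 w) * (f (kick (d n) w) - f (X 0 w)))
   = (LINT w|M. g (X 0 w) * (f (X (d n) w) - f (X 0 w)))" for n
  proof -
   have "integrable M (%w. g (X 0 w) * (f (X (d n) w) - f (kick (d n) w)))" "integrable M (%w. g (X 0 w) * (f (kick (d n) w) - f (X 0 w)))"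
    by (rule bounded_integrable[OF _ bnd], intro borel_measurable_times borel_measurable_diff m)+
   from lint_add[OF this, symmetric] show ?thesis by (simp add: algebra_simps)
  qed
  have "(LINT w|M. g (X 0 w) * (f (X (d n) w) - f (X 0 w))) / d n
   = (LINT w|M. g (X 0 w) * (f (X (d n) w) - f (kick (d n) w))) / d n + (LINT w|M. g (X 0 w) * (f (kick (d n) w) - f (X 0 w))) / d n" for n
   unfolding E[symmetric] by (rule add_divide_distrib)
  moreover have "(LBINT x. \<rho> x * (g x * generator \<beta> \<sigma> b f x)) = (LBINT x. \<rho> x * (g x * dd (drift x) f x)) + (LBINT x. \<rho> x * (g x * N x))"
   unfolding lint_add[OF bi[OF dc] bi[OF Nc], symmetric] by (simp add: generator_drift[OF sm] N_def algebra_simps)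
  ultimately show "(%n. (LINT w|M. g (X 0 w) * (f (X (d n) w) - f (X 0 w))) / d n) ----> (LBINT x. \<rho> x * (g x * generator \<beta> \<sigma> b f x))"
   using tendsto_add[OF t1(2)[OF d] noise_limit[OF f g d(1) dp]] by (simp add: N_def)
 qed
qed

end

section \<open>From reversibility to duality for the generator\<close>

lemma tf_flip: fixes f :: "'a::euclidean_space \<times> 'b::euclidean_space => real" assumes "test_function f" shows "test_function (%x. f (flip x))"
proof -
 obtain r where r: "!!x. r < norm x ==> f x = 0" using tf_support_cball[OF assms] by blast
 show ?thesis by (rule tf_I[OF smooth_flip[OF tf_smooth[OF assms]] compact_cball[of 0 r]]) (simp add: r norm_prod_def)
qed

text \<open>The choice \<open>s = t\<close> is allowed and compares one-dimensional
  marginals.\<close>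

lemma same_fdd_integral: fixes Y Y' :: "real => 'w => 's::{second_countable_topology}" and h :: "'s \<times> 's => real"
 assumes eq: "same_fdd M J Y Y'" and st: "s : J" "t : J" and Y: "!!t. t : J ==> Y t : borel_measurable M" "!!t. t : J ==> Y' t : borel_measurable M"
  and h: "h : Borel" shows "(LINT y|M. h (Y s y, Y t y)) = (LINT y|M. h (Y' s y, Y' t y))"
proof -
 let ?P = "Pi\<^sub>M {s, t} (%_. borel :: 's measure)"
 have hm: "(%w. h (w s, w t)): borel_measurable ?P" by (rule meas_comp[OF borel_measurable_Pair h]; rule measurable_component_singleton) simp_all
 have e: "(LINT y|M. h (V s y, V t y)) = (LINT w|distr M ?P (%y. \<lambda>t\<in>{s, t}. V t y). h (w s, w t))"
  if V: "!!t. t : J ==> V t : borel_measurable M" for V :: "real => 'w => 's"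
 proof -
  have "(%y. \<lambda>t\<in>{s, t}. V t y): measurable M ?P" using V st by (intro measurable_restrict) auto
  from integral_distr[OF this hm] show ?thesis by simp
 qed
 have "distr M ?P (%y. \<lambda>t\<in>{s, t}. Y t y) = distr M ?P (%y. \<lambda>t\<in>{s, t}. Y' t y)" using eq st unfolding same_fdd_def by simp
 thus ?thesis using e[of Y, OF Y(1)] e[of Y', OF Y(2)] by simp
qed

context langevin_start
begin

text \<open>Reversal over \<open>[0, t]\<close> exchanges the two states in
  \<open>E (g (X 0) * f (X t))\<close> up to \<open>flip\<close>, and the term
  \<open>E (g (X 0) * f (X 0))\<close> is unchanged because the initial law is even. So the two
  increments agree for every \<open>t\<close>, and dividing by \<open>t\<close> gives the identity
  between the generators.\<close>

lemma reversible_duality: assumes rev: "reversible_process M (%t w. (q t w, p t w))"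
 shows "even_in_p \<rho>" "test_function f ==> test_function g ==> (LBINT x. \<rho> x * (g x * generator \<beta> \<sigma> b f x)) = (LBINT x. \<rho> x * (generator \<beta> \<sigma> b (%x. g (flip x)) x * f (flip x)))"
proof -
 have Xeq: "(%t w. (q t w, p t w)) = X" by (simp add: X_def fun_eq_iff)
 have tr: "time_reversal T X = (%t w. flip (X (T - t) w))" for T by (simp add: time_reversal_def flip_def fun_eq_iff)
 have stat: "same_fdd M {0..} (%t. X (t + h)) X" if "0 <= h" for h using rev that unfolding Xeq reversible_process_def stationary_process_def by blast
 have revT: "same_fdd M {0..T} (%t w. flip (X (T - t) w)) X" if "0 < T" for T using rev that unfolding Xeq reversible_process_def tr by blast
 have fX: "(%w. flip (X t w)): borel_measurable M" if "0 <= t" for t by (rule meas_comp[OF X_measurable[OF that] flip_measurable])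
 have rev2: "(LINT w|M. h (flip (X t w), flip (X 0 w))) = (LINT w|M. h (X 0 w, X t w))"
  if "0 < t" "h : Borel" for h :: "'n phase \<times> 'n phase => real" and t using same_fdd_integral[OF revT[OF that(1)], of 0 t h] that fX by simp
 have even_law: "(LINT w|M. k (flip (X 0 w))) = (LINT w|M. k (X 0 w))" if k[measurable]: "k : Borel" for k :: "'n phase => real"
 proof -
  have kf: "(%z::'n phase \<times> 'n phase. k (fst z)): Borel" "(%z::'n phase \<times> 'n phase. k (flip (fst z))): Borel"
   by (rule meas_comp[OF borel_fst k])
    (rule meas_comp[OF meas_comp[OF borel_fst flip_measurable] k])
  \<comment> \<open>Any positive horizon would do: stationarity moves the state to time 1, and
    reversal over that length brings it back flipped.\<close>
  have "(LINT w|M. k (flip (X 0 w))) = (LINT w|M. k (flip (X 1 w)))" using same_fdd_integral[OF stat[of 1] _ _ _ _ kf(2), of 0 0] by simp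
  also have "... = (LINT w|M. k (X 0 w))" using rev2[OF zero_less_one kf(1)] by simp
  finally show ?thesis .
 qed
 have "AE x in lborel. \<rho> (flip x) - \<rho> x = 0"
 proof (rule AE_eq_0_test)
  have fi: "integrable lborel (%x. \<rho> (flip x))"
  proof -
   have "integrable (distr lborel borel flip) \<rho>" unfolding lborel_distr_flip by (rule rho_int)
   thus ?thesis by (subst (asm) integrable_distr_eq) simp_all
  qed
  thus "integrable lborel (%x. \<rho> (flip x) - \<rho> x)" using rho_int by simp
  fix G :: "'n phase => real" assume G: "test_function G"
  have Gm[measurable]: "G : Borel" by (rule tf_measurable[OF G])
  have "(LBINT x. \<rho> (flip x) * G x) = (LBINT x. \<rho> (flip (flip x)) * G (flip x))"
   by (rule integral_flip[symmetric, where f="%x. \<rho> (flip x) * G x"]) simp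
  also have "... = (LINT w|M. G (flip (X 0 w)))" by (simp add: integral_X0[where h="%x. G (flip x)"])
  also have "... = (LBINT x. \<rho> x * G x)" unfolding even_law[OF Gm] by (rule integral_X0[OF Gm])
  finally show "(LBINT x. (\<rho> (flip x) - \<rho> x) * G x) = 0"
   by (simp add: left_diff_distrib lint_diff int_mult_test[OF fi G] int_mult_test[OF rho_int G])
 qed
 thus "even_in_p \<rho>" unfolding even_in_p_flip by eventually_elim simp
 show "(LBINT x. \<rho> x * (g x * generator \<beta> \<sigma> b f x)) = (LBINT x. \<rho> x * (generator \<beta> \<sigma> b (%x. g (flip x)) x * f (flip x)))"
  if tg: "test_function g" "test_function f"
 proof -
  have tr: "test_function (%x. g (flip x))" "test_function (%x. f (flip x))" by (intro tf_flip tg)+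
  note [measurable] = tf_measurable[OF tg(1)] tf_measurable[OF tg(2)]
  obtain ta where ta: "0 < ta" "!!d. d ----> 0 ==> (!!n::nat. 0 < d n \<and> d n <= ta) ==>
   (%n. (LINT w|M. g (X 0 w) * (f (X (d n) w) - f (X 0 w))) / d n) ----> (LBINT x. \<rho> x * (g x * generator \<beta> \<sigma> b f x))"
   by (rule generator_limit[OF tg(2) tg(1)]) blast
  obtain tb where tb: "0 < tb" "!!d. d ----> 0 ==> (!!n::nat. 0 < d n \<and> d n <= tb) ==>
   (%n. (LINT w|M. f (flip (X 0 w)) * (g (flip (X (d n) w)) - g (flip (X 0 w)))) / d n)
    ----> (LBINT x. \<rho> x * (f (flip x) * generator \<beta> \<sigma> b (%x. g (flip x)) x))" by (rule generator_limit[OF tr(1) tr(2)]) blast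
  define d where "d n = min ta tb / real (Suc n)" for n
  have d: "d ----> 0" unfolding d_def using LIMSEQ_Suc[OF lim_const_over_n[of "min ta tb"]] .
  have db: "0 < d n \<and> d n <= min ta tb" for n
  proof -
   have "min ta tb / real (Suc n) <= min ta tb / 1" using ta(1) tb(1) by (intro divide_left_mono) auto
   thus ?thesis using ta(1) tb(1) by (simp add: d_def)
  qed
  have "(LINT w|M. g (X 0 w) * (f (X (d n) w) - f (X 0 w))) = (LINT w|M. f (flip (X 0 w)) * (g (flip (X (d n) w)) - g (flip (X 0 w))))" for n
  proof -
   have dn: "0 < d n" using db by blast
   have int: "integrable M (%w. g (Y w) * f (Y' w))" if [measurable]: "Y : borel_measurable M" "Y' : borel_measurable M" for Y Y'
   proof -
    obtain Kf where Kf: "0 < Kf" "!!x. \<bar>f x\<bar> <= Kf" using tf_bounded[OF tg(2)] by blast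
    obtain Kg where Kg: "0 < Kg" "!!x. \<bar>g x\<bar> <= Kg" using tf_bounded[OF tg(1)] by blast
    show ?thesis
    proof (rule bounded_integrable)
     show "\<bar>g (Y w) * f (Y' w)\<bar> <= Kg * Kf" for w unfolding abs_mult using Kf Kg by (intro mult_mono) auto
    qed measurable
   qed
   have Xm: "X 0 : borel_measurable M" "X (d n): borel_measurable M" "(%w. flip (X 0 w)): borel_measurable M" "(%w. flip (X (d n) w)): borel_measurable M"
    using dn fX by auto
   have hm: "(%z. g (fst z) * f (snd z)): Borel" by (intro borel_measurable_times meas_comp[OF borel_fst] meas_comp[OF borel_snd]) measurable
   have 1: "(LINT w|M. g (X 0 w) * f (X (d n) w)) = (LINT w|M. g (flip (X (d n) w)) * f (flip (X 0 w)))" using rev2[OF dn hm] by simp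
   have 2: "(LINT w|M. g (X 0 w) * f (X 0 w)) = (LINT w|M. g (flip (X 0 w)) * f (flip (X 0 w)))" using even_law[of "%x. g x * f x"] by simp
   have "(LINT w|M. g (X 0 w) * (f (X (d n) w) - f (X 0 w))) = (LINT w|M. g (X 0 w) * f (X (d n) w)) - (LINT w|M. g (X 0 w) * f (X 0 w))"
    unfolding right_diff_distrib by (intro lint_diff int Xm)
   also have "... = (LINT w|M. g (flip (X (d n) w)) * f (flip (X 0 w)) - g (flip (X 0 w)) * f (flip (X 0 w)))"
    unfolding 1 2 by (intro lint_diff[symmetric] int Xm)
   finally show ?thesis by (simp add: algebra_simps)
  qed
  with ta(2)[OF d] tb(2)[OF d] db
  have "(LBINT x. \<rho> x * (g x * generator \<beta> \<sigma> b f x)) = (LBINT x. \<rho> x * (f (flip x) * generator \<beta> \<sigma> b (%x. g (flip x)) x))"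
   by (intro LIMSEQ_unique) auto
  thus ?thesis by (simp add: mult.commute)
 qed
qed

lemma reversible_imp_symmetry: assumes "reversible_process M (%t w. (q t w, p t w))" shows "symmetry_condition \<beta> \<sigma> b \<rho>"
 unfolding symmetry_condition_eq by (intro conjI allI impI reversible_duality[OF assms] tf_tensor')

text \<open>Stationarity is tested with arbitrary functions on phase space, whereas the symmetry
  condition speaks of products only. The duality for general functions is therefore used directly,
  with a radial plateau.\<close>

lemma reversible_imp_stationary: assumes "reversible_process M (%t w. (q t w, p t w))" shows "stationary_density \<beta> \<sigma> b \<rho>"
 unfolding stationary_density_iff
proof (intro allI impI)
 fix f :: "'n phase => real" assume f: "test_function f"
 obtain r where r: "0 < r" "!!x. r < norm x ==> f x = 0" using tf_support_cball[OF f] by blast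
 obtain z :: "'n phase => real" where z: "test_function z" "!!x. norm x <= r + 1 ==> z x = 1" "!!x y. norm x = norm y ==> z x = z y"
  using plateau_function[of "r + 1"] r(1) by (metis add_pos_pos zero_less_one)
 show "(LBINT x. \<rho> x * generator \<beta> \<sigma> b f x) = 0"
  by (rule duality_imp_zero_integral[OF f r(2) z(1,2) z(3)[OF norm_flip] reversible_duality(2)[OF assms f z(1)]])
qed

end

theorem theorem2p2: fixes M :: "'w measure" and F :: "real \<Rightarrow> 'w measure"
    and B q p :: "real \<Rightarrow> 'w \<Rightarrow> real ^ 'n::finite"
    and \<beta> :: real and \<sigma> :: "real ^ 'n ^ 'n" and b :: "real ^ 'n \<Rightarrow> real ^ 'n"
    and \<rho>\<^sub>0 :: "(real ^ 'n) \<times> (real ^ 'n) \<Rightarrow> real" assumes beta_pos: "\<beta> > 0" and nonsingular: "invertible \<sigma>"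
    and locally_lipschitz:
      "\<forall>n::nat. n > 0 \<longrightarrow> (\<exists>K>0. \<forall>x y. norm x \<le> real n \<longrightarrow> norm y \<le> real n \<longrightarrow>
         norm (b x - b y) \<le> K * norm (x - y))" and growth: "\<exists>C>0. \<forall>x. x \<bullet> b x \<le> C * (1 + (norm x)\<^sup>2)"
    and solution: "langevin_solution M F B \<beta> \<sigma> b q p"
    and initial_density: "distributed M lborel (\<lambda>\<omega>. (q 0 \<omega>, p 0 \<omega>)) (\<lambda>x. ennreal (\<rho>\<^sub>0 x))"
    and density_pos: "\<forall>x. \<rho>\<^sub>0 x > 0"
  shows "(reversible_process M (\<lambda>t \<omega>. (q t \<omega>, p t \<omega>)) \<longleftrightarrow> symmetry_condition \<beta> \<sigma> b \<rho>\<^sub>0) \<and>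
    (symmetry_condition \<beta> \<sigma> b \<rho>\<^sub>0 \<longleftrightarrow> potential_condition \<beta> b \<rho>\<^sub>0) \<and>
    (potential_condition \<beta> b \<rho>\<^sub>0 \<longleftrightarrow> even_in_p \<rho>\<^sub>0 \<and> stationary_density \<beta> \<sigma> b \<rho>\<^sub>0) \<and>
    (even_in_p \<rho>\<^sub>0 \<and> stationary_density \<beta> \<sigma> b \<rho>\<^sub>0 \<longleftrightarrow>
      separable_density \<rho>\<^sub>0 \<and> stationary_density \<beta> \<sigma> b \<rho>\<^sub>0)"
proof -
 interpret S: langevin_solution M F B \<beta> \<sigma> b q p by (rule solution)
 have lip: "\<exists>K>0. \<forall>x y. norm x <= r \<longrightarrow> norm y <= r \<longrightarrow> norm (b x - b y) <= K * norm (x - y)" for r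
 proof -
  obtain n :: nat where n: "max r 0 < real n" using reals_Archimedean2 by blast
  hence "n > 0" by (simp add: less_max_iff_disj)
  then obtain K where "K > 0" "!!x y. norm x <= real n ==> norm y <= real n ==> norm (b x - b y) <= K * norm (x - y)" using locally_lipschitz by blast
  thus ?thesis using n by (intro exI[of _ K]) auto
 qed
 have bc: "continuous_on UNIV b" unfolding continuous_on_iff
 proof (intro ballI allI impI)
  fix x :: "real ^ 'n" and e :: real assume e: "0 < e"
  obtain K where K: "K > 0" "!!y z. norm y <= norm x + 1 ==> norm z <= norm x + 1 ==> norm (b y - b z) <= K * norm (y - z)"
   using lip[of "norm x + 1"] by auto
  show "\<exists>d>0. \<forall>y\<in>UNIV. dist y x < d \<longrightarrow> dist (b y) (b x) < e"
  proof (intro exI[of _ "min 1 (e / K)"] conjI ballI impI)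
   fix y assume y: "dist y x < min 1 (e / K)"
   have "norm y <= norm x + 1" using y norm_triangle_ineq[of x "y - x"] by (simp add: dist_norm)
   from K(2)[OF this, of x] have "dist (b y) (b x) <= K * dist y x" by (simp add: dist_norm)
   also have "... < e" using y K(1) by (simp add: field_simps)
   finally show "dist (b y) (b x) < e" .
  qed (use e K in simp)
 qed
 \<comment> \<open>\<open>distributed\<close> yields measurability of
   \<open>ennreal (\<rho>\<^sub>0 x)\<close> only; positivity lets \<open>enn2real\<close> recover
   the density itself.\<close>
 have rm: "\<rho>\<^sub>0 : Borel"
 proof -
  have "(%x. enn2real (ennreal (\<rho>\<^sub>0 x))): Borel" using distributed_borel_measurable[OF initial_density] by simp
  thus ?thesis using density_pos by (simp add: less_imp_le)
 qed
 have "prob_space (density lborel (%x. ennreal (\<rho>\<^sub>0 x)))" unfolding distributed_distr_eq_density[OF initial_density, symmetric]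
  by (rule S.prob_space_distr[OF distributed_measurable[OF initial_density]])
 hence nn: "(NN x. ennreal (\<rho>\<^sub>0 x)) = 1" using prob_space.emeasure_space_1 rm by (fastforce simp: emeasure_density)
 have r0: "!!x. 0 <= \<rho>\<^sub>0 x" by (rule less_imp_le[OF spec[OF density_pos]])
 have ri: "integrable lborel \<rho>\<^sub>0" using nn rm r0 by (intro integrableI_nonneg) simp_all
 have r1: "(LBINT x. \<rho>\<^sub>0 x) = 1" using nn rm r0 by (subst integral_eq_nn_integral) simp_all
 interpret D: langevin_start M F B \<beta> \<sigma> b q p \<rho>\<^sub>0
  by unfold_locales (use beta_pos nonsingular bc density_pos ri r1 lip initial_density in auto)
 have pot: "reversible_process M (%t w. (q t w, p t w)) \<and> separable_density \<rho>\<^sub>0" if P: "potential_condition \<beta> b \<rho>\<^sub>0"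
 proof -
  obtain U R Z where "gibbs_density \<beta> \<sigma> b \<rho>\<^sub>0 U R Z" by (rule D.potential_imp_gibbs[OF P])
  then interpret G: gibbs_density \<beta> \<sigma> b \<rho>\<^sub>0 U R Z .
  interpret L: gibbs_langevin M F B \<beta> \<sigma> b q p \<rho>\<^sub>0 U R Z ..
  show ?thesis using L.reversible G.gibbs_separable by blast
 qed
 have sym: "potential_condition \<beta> b \<rho>\<^sub>0" if "symmetry_condition \<beta> \<sigma> b \<rho>\<^sub>0"
  by (rule D.weak_even_imp_potential[OF _ D.symmetry_imp_weakly[OF that]]) (use that in \<open>simp add: symmetry_condition_def\<close>)
 have ev: "potential_condition \<beta> b \<rho>\<^sub>0" if "even_in_p \<rho>\<^sub>0" "stationary_density \<beta> \<sigma> b \<rho>\<^sub>0"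
  by (rule D.weak_even_imp_potential[OF that(1) D.stationary_imp_weakly[OF that(2)]])
 have sep: "even_in_p \<rho>\<^sub>0" if "separable_density \<rho>\<^sub>0" "stationary_density \<beta> \<sigma> b \<rho>\<^sub>0"
  by (rule D.separable_stationary_even[OF that(1) D.stationary_imp_weakly[OF that(2)]])
 \<comment> \<open>Each condition leads to the potential condition, separability by way of evenness.
   From there reversibility and separability follow, and reversibility gives symmetry, evenness and
   stationarity, which closes all equivalences.\<close>
 show ?thesis using pot sym ev sep D.reversible_imp_symmetry D.reversible_imp_stationary D.reversible_duality(1) by blast
qed

end
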